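(* The Gray tensor product functors $\otimes_a:\widehat{\Theta_2}^{\,a}\to\widehat{\Theta_2}$ ($a\in\mathbb N$) form part of a normal lax monoidal structure on $\widehat{\Theta_2}$.
   Context: **Lax monoidal structure.** A lax monoidal structure on a category $\mathcal C$ consists of functors $\odot_a:\mathcal C^a\to\mathcal C$ for each $a\in\mathbb N$, a natural transformation $\iota:\mathrm{id}_{\mathcal C}\to\odot_1$, and natural transformations $\mu_{b_1,\dots,b_a}:\odot_a(\odot_{b_1},\dots,\odot_{b_a})\to\odot_{b_1+\dots+b_a}$ for all $a,b_1,\dots,b_a\in\mathbb N$, such that: (1) $\mu_a\circ\iota_{\odot_a}=\mathrm{id}_{\odot_a}$ (where $\iota_{\odot_a}:\odot_a\to\odot_1(\odot_a)$); (2) $\mu_{1,\dots,1}\circ\odot_a(\iota,\dots,\iota)=\mathrm{id}_{\odot_a}$; (3) for all $a$, $b_1,\dots,b_a$ and $c_{uv}$ ($1\le u\le a$, $1\le v\le b_u$), the two composites $$\odot_a\bigl(\odot_{b_1}(\odot_{c_{11}},\dots,\odot_{c_{1b_1}}),\dots,\odot_{b_a}(\odot_{c_{a1}},\dots,\odot_{c_{ab_a}})\bigr)\to\odot_{c_{11}+\dots+c_{ab_a}}$$ agree: $\mu_{b_1,\dots,b_a}$ (into $\odot_{b_1+\dots+b_a}(\odot_{c_{11}},\dots,\odot_{c_{ab_a}})$) followed by $\mu_{c_{11},\dots,c_{ab_a}}$; and $\odot_a(\mu_{c_{11},\dots,c_{1b_1}},\dots,\mu_{c_{a1},\dots,c_{ab_a}})$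 followed by $\mu_{c_{11}+\dots+c_{1b_1},\dots,c_{a1}+\dots+c_{ab_a}}$. It is normal if $\iota$ is invertible. **$\Theta_2$.** Let $\mathbf{2Cat}$ be the category of small strict 2-categories and strict 2-functors, and $[q]=\{0<\dots<q\}$. For $n,q_1,\dots,q_n\in\mathbb N$, $[n;\mathbf q]=[n;q_1,\dots,q_n]$ is the 2-category with objects $0,\dots,n$, hom-categories $\hom(k,\ell)=[q_{k+1}]\times\cdots\times[q_\ell]$ for $k\le\ell$ (terminal for $k=\ell$) and empty for $k>\ell$, composition being concatenation of tuples. $\Theta_2\subset\mathbf{2Cat}$ is the full subcategory on these; $[0]$ is the case $n=0$. $\widehat{\Theta_2}=[\Theta_2^{\mathrm{op}},\mathbf{Set}]$, $\Theta_2[n;\mathbf q]$ denotes the representable, and $N:\mathbf{2Cat}\to\widehat{\Theta_2}$ is the nerve $(N\mathcal A)_\theta=\mathbf{2Cat}(\theta,\mathcal A)$. **Gray tensor product.** The lax Gray tensor product $\mathcal A\boxtimes\mathcal B$ of 2-categories has objects $\mathrm{ob}\mathcal A\times\mathrm{ob}\mathcal B$; its 1-cells are generated by $(f,y):(x,y)\to(x',y)$ and $(x,g):(x,y)\to(x,y')$ (for $f:x\to x'$ in $\mathcal A$, $g:y\to y'$ in $\mathcal B$), functorially in each variable; its 2-cells are generated by $(\alpha,y)$, $(x,\beta)$ for 2-cells $\alpha,\beta$ (respecting horizontal and vertical composition in $\mathcal A$ and $\mathcal B$) and $\gamma_{f,g}:(f,y')(x,g)\Rightarrow(x',g)(f,y)$,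 subject to naturality of $\gamma_{f,g}$ in $f$ and $g$ with respect to 2-cells, $\gamma_{f,g}$ being an identity when $f$ or $g$ is, and compatibility of $\gamma$ with composition of 1-cells in each variable (by pasting). It is part of a monoidal structure on $\mathbf{2Cat}$, and $\boxtimes_a$ is the corresponding $a$-ary tensor product. $\otimes_a:\widehat{\Theta_2}^{\,a}\to\widehat{\Theta_2}$ is the functor, cocontinuous in each variable, extending $(\theta_1,\dots,\theta_a)\mapsto N(\boxtimes_a(\theta_1,\dots,\theta_a))$ on $\Theta_2^a$, with the choices $\otimes_0=\Theta_2[0]$ and $\otimes_1=\mathrm{id}$. *)

theory Defs
  imports Main "HOL-Library.FuncSet" "HOL-Library.Countable_Set"
begin

section \<open>Categories, functors, colimits\<close>

record ('o, 'a) cat =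
  Obj :: "'o set"
  Arr :: "'a set"
  Dom :: "'a \<Rightarrow> 'o"
  Cod :: "'a \<Rightarrow> 'o"
  Id :: "'o \<Rightarrow> 'a"
  Comp :: "'a \<Rightarrow> 'a \<Rightarrow> 'a"  \<comment> \<open>\<open>Comp C g f\<close> is \<open>g\<close> after \<open>f\<close>\<close>

definition Hom :: "('o, 'a) cat \<Rightarrow> 'o \<Rightarrow> 'o \<Rightarrow> 'a set" where
  "Hom C x y = {f \<in> Arr C. Dom C f = x \<and> Cod C f = y}"

locale category =
  fixes C :: "('o, 'a) cat"
  assumes dom_cod: "f \<in> Arr C \<Longrightarrow> Dom C f \<in> Obj C \<and> Cod C f \<in> Obj C"
    and id_hom: "x \<in> Obj C \<Longrightarrow> Id C x \<in> Hom C x x"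
    and comp_hom: "f \<in> Hom C x y \<Longrightarrow> g \<in> Hom C y z \<Longrightarrow> Comp C g f \<in> Hom C x z"
    and comp_id: "f \<in> Arr C \<Longrightarrow> Comp C f (Id C (Dom C f)) = f"
    and id_comp: "f \<in> Arr C \<Longrightarrow> Comp C (Id C (Cod C f)) f = f"
    and comp_assoc: "f \<in> Hom C w x \<Longrightarrow> g \<in> Hom C x y \<Longrightarrow> h \<in> Hom C y z \<Longrightarrow>
      Comp C h (Comp C g f) = Comp C (Comp C h g) f"

locale cat_functor =
  fixes C :: "('o, 'a) cat" and D :: "('p, 'b) cat"
    and Fo :: "'o \<Rightarrow> 'p" and Fa :: "'a \<Rightarrow> 'b"
  assumes obj: "x \<in> Obj C \<Longrightarrow> Fo x \<in> Obj D"
    and hom: "f \<in> Hom C x y \<Longrightarrow> Fa f \<in> Hom D (Fo x) (Fo y)"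
    and id: "x \<in> Obj C \<Longrightarrow> Fa (Id C x) = Id D (Fo x)"
    and comp: "f \<in> Hom C x y \<Longrightarrow> g \<in> Hom C y z \<Longrightarrow> Fa (Comp C g f) = Comp D (Fa g) (Fa f)"

definition is_iso :: "('o, 'a) cat \<Rightarrow> 'a \<Rightarrow> bool" where
  "is_iso C f \<longleftrightarrow> f \<in> Arr C \<and> (\<exists>g \<in> Hom C (Cod C f) (Dom C f).
     Comp C g f = Id C (Dom C f) \<and> Comp C f g = Id C (Cod C f))"

definition full_subcat :: "('o, 'a) cat \<Rightarrow> 'o set \<Rightarrow> ('o, 'a) cat" where
  "full_subcat C S = C\<lparr>Obj := Obj C \<inter> S, Arr := {f \<in> Arr C. Dom C f \<in> S \<and> Cod C f \<in> S}\<rparr>"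

definition pow_cat :: "('o, 'a) cat \<Rightarrow> nat \<Rightarrow> ('o list, 'a list) cat" where
  "pow_cat C n = \<lparr>
     Obj = {xs. length xs = n \<and> set xs \<subseteq> Obj C},
     Arr = {fs. length fs = n \<and> set fs \<subseteq> Arr C},
     Dom = map (Dom C), Cod = map (Cod C), Id = map (Id C), Comp = map2 (Comp C)\<rparr>"

definition is_cocone :: "('i, 'j) cat \<Rightarrow> ('o, 'a) cat \<Rightarrow> ('i \<Rightarrow> 'o) \<Rightarrow> ('j \<Rightarrow> 'a) \<Rightarrow>
    'o \<Rightarrow> ('i \<Rightarrow> 'a) \<Rightarrow> bool" where
  "is_cocone J C Do Da z l \<longleftrightarrow>
     z \<in> Obj C \<and> (\<forall>j \<in> Obj J. l j \<in> Hom C (Do j) z) \<and>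
     (\<forall>u \<in> Arr J. Comp C (l (Cod J u)) (Da u) = l (Dom J u))"

definition is_colimit :: "('i, 'j) cat \<Rightarrow> ('o, 'a) cat \<Rightarrow> ('i \<Rightarrow> 'o) \<Rightarrow> ('j \<Rightarrow> 'a) \<Rightarrow>
    'o \<Rightarrow> ('i \<Rightarrow> 'a) \<Rightarrow> bool" where
  "is_colimit J C Do Da z l \<longleftrightarrow> is_cocone J C Do Da z l \<and>
     (\<forall>w m. is_cocone J C Do Da w m \<longrightarrow>
       (\<exists>!h. h \<in> Hom C z w \<and> (\<forall>j \<in> Obj J. Comp C h (l j) = m j)))"

text \<open>Smallness is relative to a type \<open>'u\<close>: the indexing categories are those whose objects and
  arrows are elements of \<open>'u\<close>.\<close>

definition cocontinuous :: "'u itself \<Rightarrow> ('o, 'a) cat \<Rightarrow> ('p, 'b) cat \<Rightarrow>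
    ('o \<Rightarrow> 'p) \<Rightarrow> ('a \<Rightarrow> 'b) \<Rightarrow> bool" where
  "cocontinuous U C D Fo Fa \<longleftrightarrow>
     (\<forall>(J :: ('u, 'u) cat) Do Da z l.
        category J \<longrightarrow> cat_functor J C Do Da \<longrightarrow> is_colimit J C Do Da z l \<longrightarrow>
        is_colimit J D (Fo \<circ> Do) (Fa \<circ> Da) (Fo z) (Fa \<circ> l))"


section \<open>Lax monoidal structures\<close>

text \<open>The functors of all arities are given together as a map \<open>To\<close> on lists of objects and a map
  \<open>Ta\<close> on lists of arrows. The component of \<open>\<mu>\<^bsub>b\<^sub>1,\<dots>,b\<^sub>a\<^esub>\<close> at a family of
  objects is indexed by a list of lists, of lengths \<open>b\<^sub>1,\<dots>,b\<^sub>a\<close>.\<close>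

locale lax_monoidal = category C
  for C :: "('o, 'a) cat" +
  fixes To :: "'o list \<Rightarrow> 'o" and Ta :: "'a list \<Rightarrow> 'a"
    and \<iota> :: "'o \<Rightarrow> 'a" and \<mu> :: "'o list list \<Rightarrow> 'a"
  assumes tensor_functor: "cat_functor (pow_cat C n) C To Ta"
    and unit_hom: "X \<in> Obj C \<Longrightarrow> \<iota> X \<in> Hom C X (To [X])"
    and unit_natural: "f \<in> Arr C \<Longrightarrow> Comp C (\<iota> (Cod C f)) f = Comp C (Ta [f]) (\<iota> (Dom C f))"
    and mult_hom: "set (concat Xss) \<subseteq> Obj C \<Longrightarrow>
      \<mu> Xss \<in> Hom C (To (map To Xss)) (To (concat Xss))"
    and mult_natural: "set (concat fss) \<subseteq> Arr C \<Longrightarrow>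
      Comp C (\<mu> (map (map (Cod C)) fss)) (Ta (map Ta fss)) =
      Comp C (Ta (concat fss)) (\<mu> (map (map (Dom C)) fss))"
    and left_unit: "set Xs \<subseteq> Obj C \<Longrightarrow> Comp C (\<mu> [Xs]) (\<iota> (To Xs)) = Id C (To Xs)"
    and right_unit: "set Xs \<subseteq> Obj C \<Longrightarrow>
      Comp C (\<mu> (map (\<lambda>X. [X]) Xs)) (Ta (map \<iota> Xs)) = Id C (To Xs)"
    and mult_assoc: "set (concat (concat Xsss)) \<subseteq> Obj C \<Longrightarrow>
      Comp C (\<mu> (concat Xsss)) (\<mu> (map (map To) Xsss)) =
      Comp C (\<mu> (map concat Xsss)) (Ta (map \<mu> Xsss))"

locale normal_lax_monoidal = lax_monoidal +
  assumes unit_iso: "X \<in> Obj C \<Longrightarrow> is_iso C (\<iota> X)"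


section \<open>Presheaves\<close>

record ('o, 'a, 'x) psh =
  At :: "'o \<Rightarrow> 'x set"
  Act :: "'a \<Rightarrow> 'x \<Rightarrow> 'x"

locale presheaf =
  fixes C :: "('o, 'a) cat" and X :: "('o, 'a, 'x) psh"
  assumes act: "f \<in> Hom C c d \<Longrightarrow> x \<in> At X d \<Longrightarrow> Act X f x \<in> At X c"
    and act_id: "c \<in> Obj C \<Longrightarrow> x \<in> At X c \<Longrightarrow> Act X (Id C c) x = x"
    and act_comp: "f \<in> Hom C c d \<Longrightarrow> g \<in> Hom C d e \<Longrightarrow> x \<in> At X e \<Longrightarrow>
      Act X (Comp C g f) x = Act X f (Act X g x)"

locale psh_nat =
  fixes C :: "('o, 'a) cat" and X :: "('o, 'a, 'x) psh" and Y :: "('o, 'a, 'y) psh"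
    and \<eta> :: "'o \<Rightarrow> 'x \<Rightarrow> 'y"
  assumes map_at: "c \<in> Obj C \<Longrightarrow> x \<in> At X c \<Longrightarrow> \<eta> c x \<in> At Y c"
    and natural: "f \<in> Hom C c d \<Longrightarrow> x \<in> At X d \<Longrightarrow> \<eta> c (Act X f x) = Act Y f (\<eta> d x)"

locale psh_iso = psh_nat +
  assumes bij: "c \<in> Obj C \<Longrightarrow> bij_betw (\<eta> c) (At X c) (At Y c)"

record ('o, 'a, 'x) psh_arr =
  Src :: "('o, 'a, 'x) psh"
  Tgt :: "('o, 'a, 'x) psh"
  Map :: "'o \<Rightarrow> 'x \<Rightarrow> 'x"

definition mk_psh_arr :: "('o, 'a) cat \<Rightarrow> ('o, 'a, 'x) psh \<Rightarrow> ('o, 'a, 'x) psh \<Rightarrow>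
    ('o \<Rightarrow> 'x \<Rightarrow> 'x) \<Rightarrow> ('o, 'a, 'x) psh_arr" where
  "mk_psh_arr C X Y \<eta> = \<lparr>Src = X, Tgt = Y, Map = (\<lambda>c \<in> Obj C. restrict (\<eta> c) (At X c))\<rparr>"

definition Psh :: "('o, 'a) cat \<Rightarrow> (('o, 'a, 'x) psh, ('o, 'a, 'x) psh_arr) cat" where
  "Psh C = \<lparr>
     Obj = {X. presheaf C X},
     Arr = {mk_psh_arr C X Y \<eta> | X Y \<eta>. presheaf C X \<and> presheaf C Y \<and> psh_nat C X Y \<eta>},
     Dom = Src, Cod = Tgt,
     Id = (\<lambda>X. mk_psh_arr C X X (\<lambda>c x. x)),
     Comp = (\<lambda>\<beta> \<alpha>. mk_psh_arr C (Src \<alpha>) (Tgt \<beta>) (\<lambda>c x. Map \<beta> c (Map \<alpha> c x)))\<rparr>"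

text \<open>Hom-sets are sets of arrows, not of elements of \<open>'u\<close>. To regard a representable as a presheaf
  with values in sets of elements of \<open>'u\<close>, its values are renamed along chosen injections into
  \<open>'u\<close>; these exist whenever the values are countable and \<open>'u\<close> is infinite.\<close>

definition psh_code :: "('o, 'a, 'x) psh \<Rightarrow> 'o \<Rightarrow> 'x \<Rightarrow> 'u" where
  "psh_code X c = (SOME e. inj_on e (At X c))"

definition psh_decode :: "('o, 'a, 'x) psh \<Rightarrow> 'o \<Rightarrow> 'u \<Rightarrow> 'x" where
  "psh_decode X c = inv_into (At X c) (psh_code X c)"

definition psh_copy :: "('o, 'a) cat \<Rightarrow> ('o, 'a, 'x) psh \<Rightarrow> ('o, 'a, 'u) psh" where
  "psh_copy C X = \<lparr>
     At = (\<lambda>c. psh_code X c ` At X c),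
     Act = (\<lambda>f u. psh_code X (Dom C f) (Act X f (psh_decode X (Cod C f) u)))\<rparr>"

definition representable :: "('o, 'a) cat \<Rightarrow> 'o \<Rightarrow> ('o, 'a, 'a) psh" where
  "representable C c = \<lparr>At = (\<lambda>d. Hom C d c), Act = (\<lambda>f h. Comp C h f)\<rparr>"

definition yoneda :: "('o, 'a) cat \<Rightarrow> 'o \<Rightarrow> ('o, 'a, 'u) psh" where
  "yoneda C c = psh_copy C (representable C c)"

definition yoneda_arr :: "('o, 'a) cat \<Rightarrow> 'a \<Rightarrow> ('o, 'a, 'u) psh_arr" where
  "yoneda_arr C f = mk_psh_arr C (yoneda C (Dom C f)) (yoneda C (Cod C f))
     (\<lambda>d u. psh_code (representable C (Cod C f)) d
              (Comp C f (psh_decode (representable C (Dom C f)) d u)))"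


section \<open>Strict 2-categories\<close>

text \<open>The three sets of cells are subsets of one type; they need not be disjoint.\<close>

record 'c two_cat =
  Cell0 :: "'c set"
  Cell1 :: "'c set"
  Cell2 :: "'c set"
  src1 :: "'c \<Rightarrow> 'c"
  tgt1 :: "'c \<Rightarrow> 'c"
  id1 :: "'c \<Rightarrow> 'c"
  comp1 :: "'c \<Rightarrow> 'c \<Rightarrow> 'c"
  src2 :: "'c \<Rightarrow> 'c"
  tgt2 :: "'c \<Rightarrow> 'c"
  id2 :: "'c \<Rightarrow> 'c"
  vcomp :: "'c \<Rightarrow> 'c \<Rightarrow> 'c"
  hcomp :: "'c \<Rightarrow> 'c \<Rightarrow> 'c"

definition cat1 :: "'c two_cat \<Rightarrow> ('c, 'c) cat" where
  "cat1 A = \<lparr>Obj = Cell0 A, Arr = Cell1 A, Dom = src1 A, Cod = tgt1 A, Id = id1 A, Comp = comp1 A\<rparr>"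

definition vcat :: "'c two_cat \<Rightarrow> ('c, 'c) cat" where
  "vcat A = \<lparr>Obj = Cell1 A, Arr = Cell2 A, Dom = src2 A, Cod = tgt2 A, Id = id2 A, Comp = vcomp A\<rparr>"

definition hcat :: "'c two_cat \<Rightarrow> ('c, 'c) cat" where
  "hcat A = \<lparr>Obj = Cell0 A, Arr = Cell2 A, Dom = src1 A \<circ> src2 A, Cod = tgt1 A \<circ> src2 A,
     Id = id2 A \<circ> id1 A, Comp = hcomp A\<rparr>"

locale two_category =
  fixes A :: "'c two_cat"
  assumes cat1: "category (cat1 A)"
    and vcat: "category (vcat A)"
    and hcat: "category (hcat A)"
    and globular: "\<alpha> \<in> Cell2 A \<Longrightarrow>
      src1 A (src2 A \<alpha>) = src1 A (tgt2 A \<alpha>) \<and> tgt1 A (src2 A \<alpha>) = tgt1 A (tgt2 A \<alpha>)"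
    and hcomp_src_tgt: "\<alpha> \<in> Hom (hcat A) x y \<Longrightarrow> \<beta> \<in> Hom (hcat A) y z \<Longrightarrow>
      src2 A (hcomp A \<beta> \<alpha>) = comp1 A (src2 A \<beta>) (src2 A \<alpha>) \<and>
      tgt2 A (hcomp A \<beta> \<alpha>) = comp1 A (tgt2 A \<beta>) (tgt2 A \<alpha>)"
    and hcomp_id2: "f \<in> Hom (cat1 A) x y \<Longrightarrow> g \<in> Hom (cat1 A) y z \<Longrightarrow>
      hcomp A (id2 A g) (id2 A f) = id2 A (comp1 A g f)"
    and interchange: "\<alpha> \<in> Hom (vcat A) f f' \<Longrightarrow> \<alpha>' \<in> Hom (vcat A) f' f'' \<Longrightarrow>
      \<beta> \<in> Hom (vcat A) g g' \<Longrightarrow> \<beta>' \<in> Hom (vcat A) g' g'' \<Longrightarrow> tgt1 A f = src1 A g \<Longrightarrow>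
      hcomp A (vcomp A \<beta>' \<beta>) (vcomp A \<alpha>' \<alpha>) = vcomp A (hcomp A \<beta>' \<alpha>') (hcomp A \<beta> \<alpha>)"

record ('c, 'd) two_fun =
  TSrc :: "'c two_cat"
  TTgt :: "'d two_cat"
  Fun0 :: "'c \<Rightarrow> 'd"
  Fun1 :: "'c \<Rightarrow> 'd"
  Fun2 :: "'c \<Rightarrow> 'd"

definition mk_two_fun :: "'c two_cat \<Rightarrow> 'd two_cat \<Rightarrow> ('c \<Rightarrow> 'd) \<Rightarrow> ('c \<Rightarrow> 'd) \<Rightarrow> ('c \<Rightarrow> 'd) \<Rightarrow>
    ('c, 'd) two_fun" where
  "mk_two_fun A B F0 F1 F2 = \<lparr>TSrc = A, TTgt = B,
     Fun0 = restrict F0 (Cell0 A), Fun1 = restrict F1 (Cell1 A), Fun2 = restrict F2 (Cell2 A)\<rparr>"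

definition two_functor :: "'c two_cat \<Rightarrow> 'd two_cat \<Rightarrow> ('c \<Rightarrow> 'd) \<Rightarrow> ('c \<Rightarrow> 'd) \<Rightarrow> ('c \<Rightarrow> 'd) \<Rightarrow> bool"
  where "two_functor A B F0 F1 F2 \<longleftrightarrow>
     cat_functor (cat1 A) (cat1 B) F0 F1 \<and>
     cat_functor (vcat A) (vcat B) F1 F2 \<and>
     cat_functor (hcat A) (hcat B) F0 F2"

definition TwoCat :: "('c two_cat, ('c, 'c) two_fun) cat" where
  "TwoCat = \<lparr>
     Obj = {A. two_category A},
     Arr = {mk_two_fun A B F0 F1 F2 | A B F0 F1 F2.
              two_category A \<and> two_category B \<and> two_functor A B F0 F1 F2},
     Dom = TSrc, Cod = TTgt,
     Id = (\<lambda>A. mk_two_fun A A (\<lambda>x. x) (\<lambda>x. x) (\<lambda>x. x)),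
     Comp = (\<lambda>G F. mk_two_fun (TSrc F) (TTgt G)
               (Fun0 G \<circ> Fun0 F) (Fun1 G \<circ> Fun1 F) (Fun2 G \<circ> Fun2 F))\<rparr>"

text \<open>Every 2-category relevant below has countably many cells. So that iterated tensor products
  stay in one type, each is replaced by an isomorphic copy whose cells are natural numbers.\<close>

definition cells :: "'c two_cat \<Rightarrow> 'c set" where
  "cells A = Cell0 A \<union> Cell1 A \<union> Cell2 A"

definition encode :: "'c two_cat \<Rightarrow> 'c \<Rightarrow> nat" where
  "encode A = to_nat_on (cells A)"

definition decode :: "'c two_cat \<Rightarrow> nat \<Rightarrow> 'c" where
  "decode A = inv_into (cells A) (encode A)"

definition nat_copy :: "'c two_cat \<Rightarrow> nat two_cat" where
  "nat_copy A = \<lparr>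
     Cell0 = encode A ` Cell0 A, Cell1 = encode A ` Cell1 A, Cell2 = encode A ` Cell2 A,
     src1 = encode A \<circ> src1 A \<circ> decode A, tgt1 = encode A \<circ> tgt1 A \<circ> decode A,
     id1 = encode A \<circ> id1 A \<circ> decode A,
     comp1 = (\<lambda>g f. encode A (comp1 A (decode A g) (decode A f))),
     src2 = encode A \<circ> src2 A \<circ> decode A, tgt2 = encode A \<circ> tgt2 A \<circ> decode A,
     id2 = encode A \<circ> id2 A \<circ> decode A,
     vcomp = (\<lambda>\<beta> \<alpha>. encode A (vcomp A (decode A \<beta>) (decode A \<alpha>))),
     hcomp = (\<lambda>\<beta> \<alpha>. encode A (hcomp A (decode A \<beta>) (decode A \<alpha>)))\<rparr>"

definition nat_copy_fun :: "('c, 'd) two_fun \<Rightarrow> (nat, nat) two_fun" where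
  "nat_copy_fun F = (let A = TSrc F; B = TTgt F in
     mk_two_fun (nat_copy A) (nat_copy B)
       (encode B \<circ> Fun0 F \<circ> decode A)
       (encode B \<circ> Fun1 F \<circ> decode A)
       (encode B \<circ> Fun2 F \<circ> decode A))"


section \<open>The category \<open>\<Theta>\<^sub>2\<close> and the nerve\<close>

text \<open>For a list \<open>q\<close> of length \<open>n\<close>, the 2-category \<open>[n; q]\<close>, where \<open>q ! k\<close> is \<open>q\<^sub>k\<^sub>+\<^sub>1\<close>. An object
  of \<open>hom(k, l)\<close> is a list of length \<open>l - k\<close>, so that \<open>l\<close> need not be recorded. There is
  a unique 2-cell from \<open>is\<close> to \<open>js\<close> when \<open>is \<le> js\<close> componentwise.\<close>

datatype theta_cell = Th0 nat | Th1 nat "nat list" | Th2 nat "nat list" "nat list"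

definition theta_hom :: "nat list \<Rightarrow> nat \<Rightarrow> nat list set" where
  "theta_hom q k = {is. k + length is \<le> length q \<and> (\<forall>j < length is. is ! j \<le> q ! (k + j))}"

fun th_src1 where "th_src1 (Th1 k is) = Th0 k"
fun th_tgt1 where "th_tgt1 (Th1 k is) = Th0 (k + length is)"
fun th_id1 where "th_id1 (Th0 k) = Th1 k []"
fun th_comp1 where "th_comp1 (Th1 l js) (Th1 k is) = Th1 k (is @ js)"
fun th_src2 where "th_src2 (Th2 k is js) = Th1 k is"
fun th_tgt2 where "th_tgt2 (Th2 k is js) = Th1 k js"
fun th_id2 where "th_id2 (Th1 k is) = Th2 k is is"
fun th_vcomp where "th_vcomp (Th2 _ js ks) (Th2 k is _) = Th2 k is ks"
fun th_hcomp where "th_hcomp (Th2 l is' js') (Th2 k is js) = Th2 k (is @ is') (js @ js')"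

definition theta_cat :: "nat list \<Rightarrow> theta_cell two_cat" where
  "theta_cat q = \<lparr>
     Cell0 = {Th0 k | k. k \<le> length q},
     Cell1 = {Th1 k is | k is. is \<in> theta_hom q k},
     Cell2 = {Th2 k is js | k is js.
                is \<in> theta_hom q k \<and> js \<in> theta_hom q k \<and> list_all2 (\<le>) is js},
     src1 = th_src1, tgt1 = th_tgt1, id1 = th_id1, comp1 = th_comp1,
     src2 = th_src2, tgt2 = th_tgt2, id2 = th_id2, vcomp = th_vcomp, hcomp = th_hcomp\<rparr>"

definition theta :: "nat list \<Rightarrow> nat two_cat" where
  "theta q = nat_copy (theta_cat q)"

definition Theta2 :: "(nat two_cat, (nat, nat) two_fun) cat" where
  "Theta2 = full_subcat TwoCat (range theta)"

definition nerve :: "nat two_cat \<Rightarrow> (nat two_cat, (nat, nat) two_fun, (nat, nat) two_fun) psh" where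
  "nerve A = \<lparr>At = (\<lambda>\<theta>. Hom TwoCat \<theta> A), Act = (\<lambda>f h. Comp TwoCat h f)\<rparr>"


section \<open>The lax Gray tensor product of 2-categories\<close>

text \<open>Cells are classes of formal composites of the generators \<open>L1 f y = (f, y)\<close>,
  \<open>R1 x g = (x, g)\<close>, \<open>L2 \<alpha> y = (\<alpha>, y)\<close>, \<open>R2 x \<beta> = (x, \<beta>)\<close> and
  \<open>Gam f g = \<gamma>\<^bsub>f,g\<^esub>\<close>, modulo \<open>geq1\<close> and \<open>geq2\<close>. Formal 2-cells are vertically
  composable when their boundaries agree up to \<open>geq1\<close>.\<close>

datatype ('c, 'd) gterm1 =
  I1 "'c \<times> 'd"
| L1 'c 'd
| R1 'c 'd
| C1 "('c, 'd) gterm1" "('c, 'd) gterm1"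

fun gsrc1 :: "'c two_cat \<Rightarrow> 'd two_cat \<Rightarrow> ('c, 'd) gterm1 \<Rightarrow> 'c \<times> 'd" where
  "gsrc1 A B (I1 p) = p"
| "gsrc1 A B (L1 f y) = (src1 A f, y)"
| "gsrc1 A B (R1 x g) = (x, src1 B g)"
| "gsrc1 A B (C1 t s) = gsrc1 A B s"

fun gtgt1 :: "'c two_cat \<Rightarrow> 'd two_cat \<Rightarrow> ('c, 'd) gterm1 \<Rightarrow> 'c \<times> 'd" where
  "gtgt1 A B (I1 p) = p"
| "gtgt1 A B (L1 f y) = (tgt1 A f, y)"
| "gtgt1 A B (R1 x g) = (x, tgt1 B g)"
| "gtgt1 A B (C1 t s) = gtgt1 A B t"

fun gwf1 :: "'c two_cat \<Rightarrow> 'd two_cat \<Rightarrow> ('c, 'd) gterm1 \<Rightarrow> bool" where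
  "gwf1 A B (I1 p) \<longleftrightarrow> p \<in> Cell0 A \<times> Cell0 B"
| "gwf1 A B (L1 f y) \<longleftrightarrow> f \<in> Cell1 A \<and> y \<in> Cell0 B"
| "gwf1 A B (R1 x g) \<longleftrightarrow> x \<in> Cell0 A \<and> g \<in> Cell1 B"
| "gwf1 A B (C1 t s) \<longleftrightarrow> gwf1 A B t \<and> gwf1 A B s \<and> gsrc1 A B t = gtgt1 A B s"

inductive geq1 :: "'c two_cat \<Rightarrow> 'd two_cat \<Rightarrow> ('c, 'd) gterm1 \<Rightarrow> ('c, 'd) gterm1 \<Rightarrow> bool"
  for A :: "'c two_cat" and B :: "'d two_cat" where
  refl: "gwf1 A B s \<Longrightarrow> geq1 A B s s"
| sym: "geq1 A B s t \<Longrightarrow> geq1 A B t s"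
| trans: "geq1 A B r s \<Longrightarrow> geq1 A B s t \<Longrightarrow> geq1 A B r t"
| cong: "geq1 A B t t' \<Longrightarrow> geq1 A B s s' \<Longrightarrow> gsrc1 A B t = gtgt1 A B s \<Longrightarrow>
    geq1 A B (C1 t s) (C1 t' s')"
| unit_l: "gwf1 A B s \<Longrightarrow> geq1 A B (C1 (I1 (gtgt1 A B s)) s) s"
| unit_r: "gwf1 A B s \<Longrightarrow> geq1 A B (C1 s (I1 (gsrc1 A B s))) s"
| assoc: "gwf1 A B (C1 t (C1 s r)) \<Longrightarrow> geq1 A B (C1 t (C1 s r)) (C1 (C1 t s) r)"
| L_id: "x \<in> Cell0 A \<Longrightarrow> y \<in> Cell0 B \<Longrightarrow> geq1 A B (L1 (id1 A x) y) (I1 (x, y))"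
| R_id: "x \<in> Cell0 A \<Longrightarrow> y \<in> Cell0 B \<Longrightarrow> geq1 A B (R1 x (id1 B y)) (I1 (x, y))"
| L_comp: "f \<in> Hom (cat1 A) x x' \<Longrightarrow> f' \<in> Hom (cat1 A) x' x'' \<Longrightarrow> y \<in> Cell0 B \<Longrightarrow>
    geq1 A B (L1 (comp1 A f' f) y) (C1 (L1 f' y) (L1 f y))"
| R_comp: "x \<in> Cell0 A \<Longrightarrow> g \<in> Hom (cat1 B) y y' \<Longrightarrow> g' \<in> Hom (cat1 B) y' y'' \<Longrightarrow>
    geq1 A B (R1 x (comp1 B g' g)) (C1 (R1 x g') (R1 x g))"

datatype ('c, 'd) gterm2 =
  I2 "('c, 'd) gterm1"
| L2 'c 'd
| R2 'c 'd
| Gam 'c 'd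
| V2 "('c, 'd) gterm2" "('c, 'd) gterm2"
| H2 "('c, 'd) gterm2" "('c, 'd) gterm2"

fun gsrc2 :: "'c two_cat \<Rightarrow> 'd two_cat \<Rightarrow> ('c, 'd) gterm2 \<Rightarrow> ('c, 'd) gterm1" where
  "gsrc2 A B (I2 s) = s"
| "gsrc2 A B (L2 \<alpha> y) = L1 (src2 A \<alpha>) y"
| "gsrc2 A B (R2 x \<beta>) = R1 x (src2 B \<beta>)"
| "gsrc2 A B (Gam f g) = C1 (L1 f (tgt1 B g)) (R1 (src1 A f) g)"
| "gsrc2 A B (V2 b a) = gsrc2 A B a"
| "gsrc2 A B (H2 b a) = C1 (gsrc2 A B b) (gsrc2 A B a)"

fun gtgt2 :: "'c two_cat \<Rightarrow> 'd two_cat \<Rightarrow> ('c, 'd) gterm2 \<Rightarrow> ('c, 'd) gterm1" where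
  "gtgt2 A B (I2 s) = s"
| "gtgt2 A B (L2 \<alpha> y) = L1 (tgt2 A \<alpha>) y"
| "gtgt2 A B (R2 x \<beta>) = R1 x (tgt2 B \<beta>)"
| "gtgt2 A B (Gam f g) = C1 (R1 (tgt1 A f) g) (L1 f (src1 B g))"
| "gtgt2 A B (V2 b a) = gtgt2 A B b"
| "gtgt2 A B (H2 b a) = C1 (gtgt2 A B b) (gtgt2 A B a)"

fun gwf2 :: "'c two_cat \<Rightarrow> 'd two_cat \<Rightarrow> ('c, 'd) gterm2 \<Rightarrow> bool" where
  "gwf2 A B (I2 s) \<longleftrightarrow> gwf1 A B s"
| "gwf2 A B (L2 \<alpha> y) \<longleftrightarrow> \<alpha> \<in> Cell2 A \<and> y \<in> Cell0 B"
| "gwf2 A B (R2 x \<beta>) \<longleftrightarrow> x \<in> Cell0 A \<and> \<beta> \<in> Cell2 B"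
| "gwf2 A B (Gam f g) \<longleftrightarrow> f \<in> Cell1 A \<and> g \<in> Cell1 B"
| "gwf2 A B (V2 b a) \<longleftrightarrow> gwf2 A B b \<and> gwf2 A B a \<and> geq1 A B (gsrc2 A B b) (gtgt2 A B a)"
| "gwf2 A B (H2 b a) \<longleftrightarrow> gwf2 A B b \<and> gwf2 A B a \<and>
     gsrc1 A B (gsrc2 A B b) = gtgt1 A B (gsrc2 A B a)"

inductive geq2 :: "'c two_cat \<Rightarrow> 'd two_cat \<Rightarrow> ('c, 'd) gterm2 \<Rightarrow> ('c, 'd) gterm2 \<Rightarrow> bool"
  for A :: "'c two_cat" and B :: "'d two_cat" where
  refl: "gwf2 A B a \<Longrightarrow> geq2 A B a a"
| sym: "geq2 A B a b \<Longrightarrow> geq2 A B b a"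
| trans: "geq2 A B a b \<Longrightarrow> geq2 A B b c \<Longrightarrow> geq2 A B a c"
| I_cong: "geq1 A B s t \<Longrightarrow> geq2 A B (I2 s) (I2 t)"
| V_cong: "geq2 A B b b' \<Longrightarrow> geq2 A B a a' \<Longrightarrow> gwf2 A B (V2 b a) \<Longrightarrow>
    geq2 A B (V2 b a) (V2 b' a')"
| H_cong: "geq2 A B b b' \<Longrightarrow> geq2 A B a a' \<Longrightarrow> gwf2 A B (H2 b a) \<Longrightarrow>
    geq2 A B (H2 b a) (H2 b' a')"
| V_unit_l: "gwf2 A B a \<Longrightarrow> geq2 A B (V2 (I2 (gtgt2 A B a)) a) a"
| V_unit_r: "gwf2 A B a \<Longrightarrow> geq2 A B (V2 a (I2 (gsrc2 A B a))) a"
| V_assoc: "gwf2 A B (V2 c (V2 b a)) \<Longrightarrow> geq2 A B (V2 c (V2 b a)) (V2 (V2 c b) a)"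
| H_unit_l: "gwf2 A B a \<Longrightarrow> geq2 A B (H2 (I2 (I1 (gtgt1 A B (gsrc2 A B a)))) a) a"
| H_unit_r: "gwf2 A B a \<Longrightarrow> geq2 A B (H2 a (I2 (I1 (gsrc1 A B (gsrc2 A B a))))) a"
| H_assoc: "gwf2 A B (H2 c (H2 b a)) \<Longrightarrow> geq2 A B (H2 c (H2 b a)) (H2 (H2 c b) a)"
| H_id: "gwf1 A B (C1 t s) \<Longrightarrow> geq2 A B (H2 (I2 t) (I2 s)) (I2 (C1 t s))"
| interchange: "gwf2 A B (H2 (V2 b' b) (V2 a' a)) \<Longrightarrow>
    geq2 A B (H2 (V2 b' b) (V2 a' a)) (V2 (H2 b' a') (H2 b a))"
| L_id2: "f \<in> Cell1 A \<Longrightarrow> y \<in> Cell0 B \<Longrightarrow> geq2 A B (L2 (id2 A f) y) (I2 (L1 f y))"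
| L_vcomp: "\<alpha> \<in> Hom (vcat A) f f' \<Longrightarrow> \<alpha>' \<in> Hom (vcat A) f' f'' \<Longrightarrow> y \<in> Cell0 B \<Longrightarrow>
    geq2 A B (L2 (vcomp A \<alpha>' \<alpha>) y) (V2 (L2 \<alpha>' y) (L2 \<alpha> y))"
| L_hcomp: "\<alpha> \<in> Hom (hcat A) x x' \<Longrightarrow> \<alpha>' \<in> Hom (hcat A) x' x'' \<Longrightarrow> y \<in> Cell0 B \<Longrightarrow>
    geq2 A B (L2 (hcomp A \<alpha>' \<alpha>) y) (H2 (L2 \<alpha>' y) (L2 \<alpha> y))"
| R_id2: "x \<in> Cell0 A \<Longrightarrow> g \<in> Cell1 B \<Longrightarrow> geq2 A B (R2 x (id2 B g)) (I2 (R1 x g))"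
| R_vcomp: "x \<in> Cell0 A \<Longrightarrow> \<beta> \<in> Hom (vcat B) g g' \<Longrightarrow> \<beta>' \<in> Hom (vcat B) g' g'' \<Longrightarrow>
    geq2 A B (R2 x (vcomp B \<beta>' \<beta>)) (V2 (R2 x \<beta>') (R2 x \<beta>))"
| R_hcomp: "x \<in> Cell0 A \<Longrightarrow> \<beta> \<in> Hom (hcat B) y y' \<Longrightarrow> \<beta>' \<in> Hom (hcat B) y' y'' \<Longrightarrow>
    geq2 A B (R2 x (hcomp B \<beta>' \<beta>)) (H2 (R2 x \<beta>') (R2 x \<beta>))"
| Gam_natural_l: "\<alpha> \<in> Hom (vcat A) f f' \<Longrightarrow> f \<in> Hom (cat1 A) x x' \<Longrightarrow> g \<in> Hom (cat1 B) y y' \<Longrightarrow>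
    geq2 A B (V2 (Gam f' g) (H2 (L2 \<alpha> y') (I2 (R1 x g))))
             (V2 (H2 (I2 (R1 x' g)) (L2 \<alpha> y)) (Gam f g))"
| Gam_natural_r: "f \<in> Hom (cat1 A) x x' \<Longrightarrow> \<beta> \<in> Hom (vcat B) g g' \<Longrightarrow> g \<in> Hom (cat1 B) y y' \<Longrightarrow>
    geq2 A B (V2 (Gam f g') (H2 (I2 (L1 f y')) (R2 x \<beta>)))
             (V2 (H2 (R2 x' \<beta>) (I2 (L1 f y))) (Gam f g))"
| Gam_id_l: "x \<in> Cell0 A \<Longrightarrow> g \<in> Cell1 B \<Longrightarrow> geq2 A B (Gam (id1 A x) g) (I2 (R1 x g))"
| Gam_id_r: "f \<in> Cell1 A \<Longrightarrow> y \<in> Cell0 B \<Longrightarrow> geq2 A B (Gam f (id1 B y)) (I2 (L1 f y))"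
| Gam_comp_l: "f \<in> Hom (cat1 A) x x' \<Longrightarrow> f' \<in> Hom (cat1 A) x' x'' \<Longrightarrow> g \<in> Hom (cat1 B) y y' \<Longrightarrow>
    geq2 A B (Gam (comp1 A f' f) g)
      (V2 (H2 (Gam f' g) (I2 (L1 f y))) (H2 (I2 (L1 f' y')) (Gam f g)))"
| Gam_comp_r: "f \<in> Hom (cat1 A) x x' \<Longrightarrow> g \<in> Hom (cat1 B) y y' \<Longrightarrow> g' \<in> Hom (cat1 B) y' y'' \<Longrightarrow>
    geq2 A B (Gam f (comp1 B g' g))
      (V2 (H2 (I2 (R1 x' g')) (Gam f g)) (H2 (Gam f g') (I2 (R1 x g))))"

datatype ('c, 'd) gcell =
  G0 "'c \<times> 'd"
| G1 (cls1: "('c, 'd) gterm1 set")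
| G2 (cls2: "('c, 'd) gterm2 set")

definition class1 :: "'c two_cat \<Rightarrow> 'd two_cat \<Rightarrow> ('c, 'd) gterm1 \<Rightarrow> ('c, 'd) gcell" where
  "class1 A B t = G1 {s. geq1 A B t s}"

definition class2 :: "'c two_cat \<Rightarrow> 'd two_cat \<Rightarrow> ('c, 'd) gterm2 \<Rightarrow> ('c, 'd) gcell" where
  "class2 A B a = G2 {b. geq2 A B a b}"

definition rep1 :: "('c, 'd) gcell \<Rightarrow> ('c, 'd) gterm1" where
  "rep1 c = (SOME t. t \<in> cls1 c)"

definition rep2 :: "('c, 'd) gcell \<Rightarrow> ('c, 'd) gterm2" where
  "rep2 c = (SOME a. a \<in> cls2 c)"

definition gray :: "'c two_cat \<Rightarrow> 'd two_cat \<Rightarrow> ('c, 'd) gcell two_cat" where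
  "gray A B = \<lparr>
     Cell0 = G0 ` (Cell0 A \<times> Cell0 B),
     Cell1 = class1 A B ` {t. gwf1 A B t},
     Cell2 = class2 A B ` {a. gwf2 A B a},
     src1 = (\<lambda>c. G0 (gsrc1 A B (rep1 c))),
     tgt1 = (\<lambda>c. G0 (gtgt1 A B (rep1 c))),
     id1 = (\<lambda>c. case c of G0 p \<Rightarrow> class1 A B (I1 p)),
     comp1 = (\<lambda>d c. class1 A B (C1 (rep1 d) (rep1 c))),
     src2 = (\<lambda>c. class1 A B (gsrc2 A B (rep2 c))),
     tgt2 = (\<lambda>c. class1 A B (gtgt2 A B (rep2 c))),
     id2 = (\<lambda>c. class2 A B (I2 (rep1 c))),
     vcomp = (\<lambda>d c. class2 A B (V2 (rep2 d) (rep2 c))),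
     hcomp = (\<lambda>d c. class2 A B (H2 (rep2 d) (rep2 c)))\<rparr>"

fun gmap1 :: "('c, 'c') two_fun \<Rightarrow> ('d, 'd') two_fun \<Rightarrow> ('c, 'd) gterm1 \<Rightarrow> ('c', 'd') gterm1" where
  "gmap1 F G (I1 p) = I1 (Fun0 F (fst p), Fun0 G (snd p))"
| "gmap1 F G (L1 f y) = L1 (Fun1 F f) (Fun0 G y)"
| "gmap1 F G (R1 x g) = R1 (Fun0 F x) (Fun1 G g)"
| "gmap1 F G (C1 t s) = C1 (gmap1 F G t) (gmap1 F G s)"

fun gmap2 :: "('c, 'c') two_fun \<Rightarrow> ('d, 'd') two_fun \<Rightarrow> ('c, 'd) gterm2 \<Rightarrow> ('c', 'd') gterm2" where
  "gmap2 F G (I2 s) = I2 (gmap1 F G s)"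
| "gmap2 F G (L2 \<alpha> y) = L2 (Fun2 F \<alpha>) (Fun0 G y)"
| "gmap2 F G (R2 x \<beta>) = R2 (Fun0 F x) (Fun2 G \<beta>)"
| "gmap2 F G (Gam f g) = Gam (Fun1 F f) (Fun1 G g)"
| "gmap2 F G (V2 b a) = V2 (gmap2 F G b) (gmap2 F G a)"
| "gmap2 F G (H2 b a) = H2 (gmap2 F G b) (gmap2 F G a)"

definition gray_fun :: "('c, 'c') two_fun \<Rightarrow> ('d, 'd') two_fun \<Rightarrow>
    (('c, 'd) gcell, ('c', 'd') gcell) two_fun" where
  "gray_fun F G = mk_two_fun (gray (TSrc F) (TSrc G)) (gray (TTgt F) (TTgt G))
     (\<lambda>c. case c of G0 p \<Rightarrow> G0 (Fun0 F (fst p), Fun0 G (snd p)))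
     (\<lambda>c. class1 (TTgt F) (TTgt G) (gmap1 F G (rep1 c)))
     (\<lambda>c. class2 (TTgt F) (TTgt G) (gmap2 F G (rep2 c)))"

text \<open>The \<open>a\<close>-ary tensor product, bracketed to the right; \<open>theta []\<close> is the unit \<open>[0]\<close>.\<close>

fun gray_list :: "nat two_cat list \<Rightarrow> nat two_cat" where
  "gray_list [] = theta []"
| "gray_list [A] = A"
| "gray_list (A # B # As) = nat_copy (gray A (gray_list (B # As)))"

fun gray_list_fun :: "(nat, nat) two_fun list \<Rightarrow> (nat, nat) two_fun" where
  "gray_list_fun [] = Id TwoCat (theta [])"
| "gray_list_fun [F] = F"
| "gray_list_fun (F # G # Fs) = nat_copy_fun (gray_fun F (gray_list_fun (G # Fs)))"


section \<open>The Gray tensor product of presheaves on \<open>\<Theta>\<^sub>2\<close>\<close>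

type_synonym 'u theta_psh = "(nat two_cat, (nat, nat) two_fun, 'u) psh"
type_synonym 'u theta_psh_arr = "(nat two_cat, (nat, nat) two_fun, 'u) psh_arr"

text \<open>The defining property of the family \<open>\<otimes>\<^sub>a\<close>, which determines it up to unique isomorphism
  compatible with \<open>\<kappa>\<close>. Here \<open>\<kappa>\<close> is the isomorphism
  \<open>N(\<boxtimes>\<^sub>a(\<theta>\<^sub>1,\<dots>,\<theta>\<^sub>a)) \<cong> \<otimes>\<^sub>a(\<Theta>\<^sub>2[\<theta>\<^sub>1],\<dots>,\<Theta>\<^sub>2[\<theta>\<^sub>a])\<close>, natural in the \<open>\<theta>\<^sub>i\<close>.\<close>

locale gray_tensor_functors =
  fixes To :: "'u theta_psh list \<Rightarrow> 'u theta_psh"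
    and Ta :: "'u theta_psh_arr list \<Rightarrow> 'u theta_psh_arr"
  assumes tensor_functor: "cat_functor (pow_cat (Psh Theta2) n) (Psh Theta2) To Ta"
    and tensor_cocontinuous: "set Xs \<subseteq> Obj (Psh Theta2) \<Longrightarrow> i < length Xs \<Longrightarrow>
      cocontinuous TYPE('u) (Psh Theta2) (Psh Theta2)
        (\<lambda>X. To (Xs[i := X])) (\<lambda>f. Ta ((map (Id (Psh Theta2)) Xs)[i := f]))"
    and tensor_extends: "\<exists>\<kappa>.
      (\<forall>\<theta>s. set \<theta>s \<subseteq> Obj Theta2 \<longrightarrow>
         psh_iso Theta2 (nerve (gray_list \<theta>s)) (To (map (yoneda Theta2) \<theta>s)) (\<kappa> \<theta>s)) \<and>
      (\<forall>fs \<zeta> h. set fs \<subseteq> Arr Theta2 \<longrightarrow> \<zeta> \<in> Obj Theta2 \<longrightarrow>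
         h \<in> Hom TwoCat \<zeta> (gray_list (map TSrc fs)) \<longrightarrow>
         Map (Ta (map (yoneda_arr Theta2) fs)) \<zeta> (\<kappa> (map TSrc fs) \<zeta> h) =
         \<kappa> (map TTgt fs) \<zeta> (Comp TwoCat (gray_list_fun fs) h))"
    and tensor_0: "To [] = yoneda Theta2 (theta [])"
    and tensor_1: "X \<in> Obj (Psh Theta2) \<Longrightarrow> To [X] = X"
      "f \<in> Arr (Psh Theta2) \<Longrightarrow> Ta [f] = f"

end

theory Submission
  imports Defs
begin

text \<open>The multiplication of the lax structure comes from the associativity of the Gray tensor product
  \<open>\<boxtimes>\<close> of 2-categories. An element of \<open>\<otimes>\<^sub>a(X\<^sub>1,\<dots>,X\<^sub>a)\<close> at \<open>\<zeta>\<close> is presented by elements \<open>x\<^sub>i\<close> of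
  \<open>X\<^sub>i\<close> at objects \<open>\<theta>\<^sub>i\<close>, that is, by maps from representables to \<open>X\<^sub>i\<close>, together with a
  2-functor \<open>h : \<zeta> \<rightarrow> \<theta>\<^sub>1 \<boxtimes> \<dots> \<boxtimes> \<theta>\<^sub>a\<close>, an element of the nerve from which \<open>\<otimes>\<^sub>a\<close> is extended. Every
  element has such a presentation (\<open>pure_surj\<close>), usually several, and a map out of
  \<open>\<otimes>\<^sub>a(X\<^sub>1,\<dots>,X\<^sub>a)\<close> is a function of presentations that is natural in \<open>\<zeta>\<close> and invariant under
  moving an arrow of \<open>\<Theta>\<^sub>2\<close> between the \<open>x\<^sub>i\<close> and \<open>h\<close> (\<open>To_extend\<close>). Both facts rest on one
  property of functors of several variables that are cocontinuous in each (\<open>extend_family\<close>): as every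
  presheaf is a colimit of representables, maps out of their values are compatible families of maps
  out of their values at representables.

  An element of \<open>\<otimes>\<^sub>a(\<otimes>\<^bsub>b\<^sub>1\<^esub>(\<dots>),\<dots>)\<close> is thus presented by 2-functors \<open>h : \<zeta> \<rightarrow> \<boxtimes>\<^sub>i \<eta>\<^sub>i\<close> and
  \<open>k\<^sub>i : \<eta>\<^sub>i \<rightarrow> \<boxtimes>\<^sub>j \<theta>\<^sub>i\<^sub>j\<close> and by elements \<open>x\<^sub>i\<^sub>j\<close> at \<open>\<theta>\<^sub>i\<^sub>j\<close>. The multiplication sends it to the element
  presented by all the \<open>x\<^sub>i\<^sub>j\<close> and by the composite of \<open>h\<close>, the tensor product of the \<open>k\<^sub>i\<close>, and the
  associativity isomorphism that flattens \<open>\<boxtimes>\<^sub>i \<boxtimes>\<^sub>j \<theta>\<^sub>i\<^sub>j\<close> (\<open>Map_mult\<close>). It exists because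
  \<open>extend_family\<close> also applies to composites of the functors \<open>\<otimes>\<close>. On presentations the axioms become
  the naturality, the unit laws and the associativity of flattening: \<open>flat_natural\<close>,
  \<open>flat_single\<close>, \<open>flat_singles\<close> and \<open>flat_flat\<close>. The unit is an identity because \<open>\<otimes>\<^sub>1\<close> is the
  identity functor, so the structure is normal.

  The laws of flattening hold in every monoidal category. That the Gray tensor product is monoidal is
  derived from its presentation by generators and relations. A 2-functor out of \<open>A \<boxtimes> B\<close> is determined
  by its values on generators, so the pentagon and its companions are checked there. The associator
  needs interchange cells for every 1-cell of \<open>A \<boxtimes> B\<close>, not only for the generating ones: an object
  or 1-cell of the third factor gives a 2-functor or a lax transformation on \<open>A \<boxtimes> B\<close>, and the latter
  is extended from generators by pasting (\<open>lax_extension\<close>).\<close>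

section \<open>Working with strict 2-categories\<close>

lemma Hom_iff: "f \<in> Hom C x y \<longleftrightarrow> f \<in> Arr C \<and> Dom C f = x \<and> Cod C f = y"
  by (auto simp: Hom_def)

lemma in_Hom_cat1: "f \<in> Hom (cat1 A) x y \<longleftrightarrow> f \<in> Cell1 A \<and> src1 A f = x \<and> tgt1 A f = y"
  by (auto simp: Hom_def cat1_def)

lemma in_Hom_vcat: "\<alpha> \<in> Hom (vcat A) f g \<longleftrightarrow> \<alpha> \<in> Cell2 A \<and> src2 A \<alpha> = f \<and> tgt2 A \<alpha> = g"
  by (auto simp: Hom_def vcat_def)

lemma in_Hom_hcat: "\<alpha> \<in> Hom (hcat A) x y \<longleftrightarrow>
    \<alpha> \<in> Cell2 A \<and> src1 A (src2 A \<alpha>) = x \<and> tgt1 A (src2 A \<alpha>) = y"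
  by (auto simp: Hom_def hcat_def)

lemma cell_cat_fields:
  "Obj (cat1 A) = Cell0 A" "Arr (cat1 A) = Cell1 A" "Dom (cat1 A) = src1 A" "Cod (cat1 A) = tgt1 A"
  "Id (cat1 A) = id1 A" "Comp (cat1 A) = comp1 A"
  "Obj (vcat A) = Cell1 A" "Arr (vcat A) = Cell2 A" "Dom (vcat A) = src2 A" "Cod (vcat A) = tgt2 A"
  "Id (vcat A) = id2 A" "Comp (vcat A) = vcomp A"
  "Obj (hcat A) = Cell0 A" "Arr (hcat A) = Cell2 A" "Dom (hcat A) = src1 A \<circ> src2 A"
  "Cod (hcat A) = tgt1 A \<circ> src2 A" "Id (hcat A) = id2 A \<circ> id1 A" "Comp (hcat A) = hcomp A"
  by (simp_all add: cat1_def vcat_def hcat_def)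

lemmas in_Hom_cells = in_Hom_cat1 in_Hom_vcat in_Hom_hcat

text \<open>The axioms with the composability conditions spelled out as equations between sources and targets, the form that simplification can use.\<close>

lemma two_categoryI:
  assumes st1: "\<And>f. f \<in> Cell1 A ==> src1 A f \<in> Cell0 A \<and> tgt1 A f \<in> Cell0 A"
    and i1: "\<And>x. x \<in> Cell0 A ==> id1 A x \<in> Cell1 A \<and> src1 A (id1 A x) = x \<and> tgt1 A (id1 A x) = x"
    and c1: "\<And>f g. f \<in> Cell1 A ==> g \<in> Cell1 A ==> tgt1 A f = src1 A g ==>
      comp1 A g f \<in> Cell1 A \<and> src1 A (comp1 A g f) = src1 A f \<and> tgt1 A (comp1 A g f) = tgt1 A g"
    and u1: "\<And>f. f \<in> Cell1 A ==>
      comp1 A f (id1 A (src1 A f)) = f \<and> comp1 A (id1 A (tgt1 A f)) f = f"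
    and a1: "\<And>f g h. f \<in> Cell1 A ==> g \<in> Cell1 A ==> h \<in> Cell1 A ==>
      tgt1 A f = src1 A g ==> tgt1 A g = src1 A h ==>
      comp1 A h (comp1 A g f) = comp1 A (comp1 A h g) f"
    and st2: "\<And>\<alpha>. \<alpha> \<in> Cell2 A ==> src2 A \<alpha> \<in> Cell1 A \<and> tgt2 A \<alpha> \<in> Cell1 A \<and>
      src1 A (tgt2 A \<alpha>) = src1 A (src2 A \<alpha>) \<and> tgt1 A (tgt2 A \<alpha>) = tgt1 A (src2 A \<alpha>)"
    and i2: "\<And>f. f \<in> Cell1 A ==> id2 A f \<in> Cell2 A \<and> src2 A (id2 A f) = f \<and> tgt2 A (id2 A f) = f"
    and cv: "\<And>\<alpha> \<beta>. \<alpha> \<in> Cell2 A ==> \<beta> \<in> Cell2 A ==> tgt2 A \<alpha> = src2 A \<beta> ==>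
      vcomp A \<beta> \<alpha> \<in> Cell2 A \<and> src2 A (vcomp A \<beta> \<alpha>) = src2 A \<alpha> \<and> tgt2 A (vcomp A \<beta> \<alpha>) = tgt2 A \<beta>"
    and uv: "\<And>\<alpha>. \<alpha> \<in> Cell2 A ==>
      vcomp A \<alpha> (id2 A (src2 A \<alpha>)) = \<alpha> \<and> vcomp A (id2 A (tgt2 A \<alpha>)) \<alpha> = \<alpha>"
    and av: "\<And>\<alpha> \<beta> \<gamma>. \<alpha> \<in> Cell2 A ==> \<beta> \<in> Cell2 A ==> \<gamma> \<in> Cell2 A ==>
      tgt2 A \<alpha> = src2 A \<beta> ==> tgt2 A \<beta> = src2 A \<gamma> ==>
      vcomp A \<gamma> (vcomp A \<beta> \<alpha>) = vcomp A (vcomp A \<gamma> \<beta>) \<alpha>"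
    and ch: "\<And>\<alpha> \<beta>. \<alpha> \<in> Cell2 A ==> \<beta> \<in> Cell2 A ==> tgt1 A (src2 A \<alpha>) = src1 A (src2 A \<beta>) ==>
      hcomp A \<beta> \<alpha> \<in> Cell2 A \<and> src2 A (hcomp A \<beta> \<alpha>) = comp1 A (src2 A \<beta>) (src2 A \<alpha>) \<and>
      tgt2 A (hcomp A \<beta> \<alpha>) = comp1 A (tgt2 A \<beta>) (tgt2 A \<alpha>)"
    and uh: "\<And>\<alpha>. \<alpha> \<in> Cell2 A ==>
      hcomp A \<alpha> (id2 A (id1 A (src1 A (src2 A \<alpha>)))) = \<alpha> \<and>
      hcomp A (id2 A (id1 A (tgt1 A (src2 A \<alpha>)))) \<alpha> = \<alpha>"
    and ah: "\<And>\<alpha> \<beta> \<gamma>. \<alpha> \<in> Cell2 A ==> \<beta> \<in> Cell2 A ==> \<gamma> \<in> Cell2 A ==>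
      tgt1 A (src2 A \<alpha>) = src1 A (src2 A \<beta>) ==> tgt1 A (src2 A \<beta>) = src1 A (src2 A \<gamma>) ==>
      hcomp A \<gamma> (hcomp A \<beta> \<alpha>) = hcomp A (hcomp A \<gamma> \<beta>) \<alpha>"
    and ih: "\<And>f g. f \<in> Cell1 A ==> g \<in> Cell1 A ==> tgt1 A f = src1 A g ==>
      hcomp A (id2 A g) (id2 A f) = id2 A (comp1 A g f)"
    and ic: "\<And>\<alpha> \<alpha>' \<beta> \<beta>'. \<alpha> \<in> Cell2 A ==> \<alpha>' \<in> Cell2 A ==> \<beta> \<in> Cell2 A ==> \<beta>' \<in> Cell2 A ==>
      tgt2 A \<alpha> = src2 A \<alpha>' ==> tgt2 A \<beta> = src2 A \<beta>' ==> tgt1 A (src2 A \<alpha>) = src1 A (src2 A \<beta>) ==>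
      tgt1 A (src2 A \<alpha>') = src1 A (src2 A \<beta>') ==>
      hcomp A (vcomp A \<beta>' \<beta>) (vcomp A \<alpha>' \<alpha>) = vcomp A (hcomp A \<beta>' \<alpha>') (hcomp A \<beta> \<alpha>)"
  shows "two_category A"
proof (rule two_category.intro)
  show "category (cat1 A)"
    by (rule category.intro) (auto simp: in_Hom_cells cell_cat_fields st1 i1 c1 u1 a1)
  show "category (vcat A)"
    by (rule category.intro) (auto simp: in_Hom_cells cell_cat_fields st2 i2 cv uv av)
  show "category (hcat A)"
    by (rule category.intro) (auto simp: in_Hom_cells cell_cat_fields st1 i1 i2 c1 st2 ch uh ah)
  show "\<And>\<alpha>. \<alpha> \<in> Cell2 A ==>
      src1 A (src2 A \<alpha>) = src1 A (tgt2 A \<alpha>) \<and> tgt1 A (src2 A \<alpha>) = tgt1 A (tgt2 A \<alpha>)"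
    using st2 by auto
  show "hcomp A (vcomp A \<beta>' \<beta>) (vcomp A \<alpha>' \<alpha>) = vcomp A (hcomp A \<beta>' \<alpha>') (hcomp A \<beta> \<alpha>)"
    if "\<alpha> \<in> Hom (vcat A) f f'" "\<alpha>' \<in> Hom (vcat A) f' f''" "\<beta> \<in> Hom (vcat A) g g'"
      "\<beta>' \<in> Hom (vcat A) g' g''" "tgt1 A f = src1 A g" for \<alpha> \<alpha>' \<beta> \<beta>' f f' f'' g g' g''
    using that st2[of \<alpha>] st2[of \<beta>] by (intro ic) (auto simp: in_Hom_cells)
qed (use ch ih in \<open>auto simp: in_Hom_cells\<close>)

context
  fixes A :: "'c two_cat" assumes A: "two_category A"
begin

interpretation two_category A by (rule A)
interpretation c1: category "cat1 A" by (rule cat1)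
interpretation cv: category "vcat A" by (rule vcat)
interpretation ch: category "hcat A" by (rule hcat)

lemma two_cat_1:
  "f \<in> Cell1 A ==> src1 A f \<in> Cell0 A"
  "f \<in> Cell1 A ==> tgt1 A f \<in> Cell0 A"
  "x \<in> Cell0 A ==> id1 A x \<in> Cell1 A"
  "x \<in> Cell0 A ==> src1 A (id1 A x) = x"
  "x \<in> Cell0 A ==> tgt1 A (id1 A x) = x"
  "f \<in> Cell1 A ==> g \<in> Cell1 A ==> tgt1 A f = src1 A g ==> comp1 A g f \<in> Cell1 A"
  "f \<in> Cell1 A ==> g \<in> Cell1 A ==> tgt1 A f = src1 A g ==> src1 A (comp1 A g f) = src1 A f"
  "f \<in> Cell1 A ==> g \<in> Cell1 A ==> tgt1 A f = src1 A g ==> tgt1 A (comp1 A g f) = tgt1 A g"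
  "f \<in> Cell1 A ==> src1 A f = x ==> comp1 A f (id1 A x) = f"
  "f \<in> Cell1 A ==> tgt1 A f = x ==> comp1 A (id1 A x) f = f"
  "f \<in> Cell1 A ==> g \<in> Cell1 A ==> h \<in> Cell1 A ==> tgt1 A f = src1 A g ==> tgt1 A g = src1 A h ==>
      comp1 A (comp1 A h g) f = comp1 A h (comp1 A g f)"
  using c1.dom_cod c1.id_hom c1.comp_hom c1.comp_id c1.id_comp c1.comp_assoc
  by (auto simp: in_Hom_cells cell_cat_fields)

lemma two_cat_v:
  "\<alpha> \<in> Cell2 A ==> src2 A \<alpha> \<in> Cell1 A"
  "\<alpha> \<in> Cell2 A ==> tgt2 A \<alpha> \<in> Cell1 A"
  "\<alpha> \<in> Cell2 A ==> src1 A (tgt2 A \<alpha>) = src1 A (src2 A \<alpha>)"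
  "\<alpha> \<in> Cell2 A ==> tgt1 A (tgt2 A \<alpha>) = tgt1 A (src2 A \<alpha>)"
  "f \<in> Cell1 A ==> id2 A f \<in> Cell2 A"
  "f \<in> Cell1 A ==> src2 A (id2 A f) = f"
  "f \<in> Cell1 A ==> tgt2 A (id2 A f) = f"
  "\<alpha> \<in> Cell2 A ==> \<beta> \<in> Cell2 A ==> tgt2 A \<alpha> = src2 A \<beta> ==> vcomp A \<beta> \<alpha> \<in> Cell2 A"
  "\<alpha> \<in> Cell2 A ==> \<beta> \<in> Cell2 A ==> tgt2 A \<alpha> = src2 A \<beta> ==> src2 A (vcomp A \<beta> \<alpha>) = src2 A \<alpha>"
  "\<alpha> \<in> Cell2 A ==> \<beta> \<in> Cell2 A ==> tgt2 A \<alpha> = src2 A \<beta> ==> tgt2 A (vcomp A \<beta> \<alpha>) = tgt2 A \<beta>"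
  "\<alpha> \<in> Cell2 A ==> src2 A \<alpha> = f ==> vcomp A \<alpha> (id2 A f) = \<alpha>"
  "\<alpha> \<in> Cell2 A ==> tgt2 A \<alpha> = f ==> vcomp A (id2 A f) \<alpha> = \<alpha>"
  "\<alpha> \<in> Cell2 A ==> \<beta> \<in> Cell2 A ==> \<gamma> \<in> Cell2 A ==> tgt2 A \<alpha> = src2 A \<beta> ==> tgt2 A \<beta> = src2 A \<gamma> ==>
      vcomp A (vcomp A \<gamma> \<beta>) \<alpha> = vcomp A \<gamma> (vcomp A \<beta> \<alpha>)"
  using cv.dom_cod cv.id_hom cv.comp_hom cv.comp_id cv.id_comp cv.comp_assoc globular
  by (auto simp: in_Hom_cells cell_cat_fields)

lemma two_cat_h:
  "\<alpha> \<in> Cell2 A ==> \<beta> \<in> Cell2 A ==> tgt1 A (src2 A \<alpha>) = src1 A (src2 A \<beta>) ==> hcomp A \<beta> \<alpha> \<in> Cell2 A"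
  "\<alpha> \<in> Cell2 A ==> \<beta> \<in> Cell2 A ==> tgt1 A (src2 A \<alpha>) = src1 A (src2 A \<beta>) ==>
    src2 A (hcomp A \<beta> \<alpha>) = comp1 A (src2 A \<beta>) (src2 A \<alpha>)"
  "\<alpha> \<in> Cell2 A ==> \<beta> \<in> Cell2 A ==> tgt1 A (src2 A \<alpha>) = src1 A (src2 A \<beta>) ==>
    tgt2 A (hcomp A \<beta> \<alpha>) = comp1 A (tgt2 A \<beta>) (tgt2 A \<alpha>)"
  "\<alpha> \<in> Cell2 A ==> src1 A (src2 A \<alpha>) = x ==> hcomp A \<alpha> (id2 A (id1 A x)) = \<alpha>"
  "\<alpha> \<in> Cell2 A ==> tgt1 A (src2 A \<alpha>) = x ==> hcomp A (id2 A (id1 A x)) \<alpha> = \<alpha>"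
  "\<alpha> \<in> Cell2 A ==> \<beta> \<in> Cell2 A ==> \<gamma> \<in> Cell2 A ==>
      tgt1 A (src2 A \<alpha>) = src1 A (src2 A \<beta>) ==> tgt1 A (src2 A \<beta>) = src1 A (src2 A \<gamma>) ==>
      hcomp A (hcomp A \<gamma> \<beta>) \<alpha> = hcomp A \<gamma> (hcomp A \<beta> \<alpha>)"
  "f \<in> Cell1 A ==> g \<in> Cell1 A ==> tgt1 A f = src1 A g ==>
      hcomp A (id2 A g) (id2 A f) = id2 A (comp1 A g f)"
  using ch.dom_cod ch.id_hom ch.comp_hom ch.comp_id ch.id_comp ch.comp_assoc hcomp_id2 hcomp_src_tgt
  by (auto simp: in_Hom_cells cell_cat_fields)

lemma interchange_cells:
  "\<alpha> \<in> Cell2 A ==> \<alpha>' \<in> Cell2 A ==> \<beta> \<in> Cell2 A ==> \<beta>' \<in> Cell2 A ==>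
      tgt2 A \<alpha> = src2 A \<alpha>' ==> tgt2 A \<beta> = src2 A \<beta>' ==> tgt1 A (src2 A \<alpha>) = src1 A (src2 A \<beta>) ==>
      hcomp A (vcomp A \<beta>' \<beta>) (vcomp A \<alpha>' \<alpha>) = vcomp A (hcomp A \<beta>' \<alpha>') (hcomp A \<beta> \<alpha>)"
  by (rule interchange) (auto simp: in_Hom_cells)

text \<open>Together with the previous three lemmas, the next one rewrites every pasting diagram to a
  vertical composite of whiskered cells.\<close>

lemma whisker:
  "f \<in> Cell1 A ==> \<alpha> \<in> Cell2 A ==> \<beta> \<in> Cell2 A ==> tgt2 A \<alpha> = src2 A \<beta> ==>
    tgt1 A (src2 A \<alpha>) = src1 A f ==>
    hcomp A (id2 A f) (vcomp A \<beta> \<alpha>) = vcomp A (hcomp A (id2 A f) \<beta>) (hcomp A (id2 A f) \<alpha>)"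
  "f \<in> Cell1 A ==> \<alpha> \<in> Cell2 A ==> \<beta> \<in> Cell2 A ==> tgt2 A \<alpha> = src2 A \<beta> ==>
    tgt1 A f = src1 A (src2 A \<alpha>) ==>
    hcomp A (vcomp A \<beta> \<alpha>) (id2 A f) = vcomp A (hcomp A \<beta> (id2 A f)) (hcomp A \<alpha> (id2 A f))"
  "f \<in> Cell1 A ==> g \<in> Cell1 A ==> \<alpha> \<in> Cell2 A ==> tgt1 A (src2 A \<alpha>) = src1 A f ==>
    tgt1 A f = src1 A g ==>
    hcomp A (id2 A g) (hcomp A (id2 A f) \<alpha>) = hcomp A (id2 A (comp1 A g f)) \<alpha>"
  subgoal
    using interchange_cells[of \<alpha> \<beta> "id2 A f" "id2 A f"] by (simp add: two_cat_v)
  subgoal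
    using interchange_cells[of "id2 A f" "id2 A f" \<alpha> \<beta>] by (simp add: two_cat_v)
  subgoal by (simp add: two_cat_v two_cat_h two_cat_1 flip: two_cat_h(6,7))
  done

lemma exchange:
  assumes "\<alpha> \<in> Cell2 A" "\<beta> \<in> Cell2 A" "tgt1 A (src2 A \<alpha>) = src1 A (src2 A \<beta>)"
  shows "vcomp A (hcomp A \<beta> (id2 A (tgt2 A \<alpha>))) (hcomp A (id2 A (src2 A \<beta>)) \<alpha>) =
    vcomp A (hcomp A (id2 A (tgt2 A \<beta>)) \<alpha>) (hcomp A \<beta> (id2 A (src2 A \<alpha>)))"
  using interchange_cells[of \<alpha> "id2 A (tgt2 A \<alpha>)" "id2 A (src2 A \<beta>)" \<beta>]
    interchange_cells[of "id2 A (src2 A \<alpha>)" \<alpha> \<beta> "id2 A (tgt2 A \<beta>)"] assms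
  by (simp add: two_cat_v)

end

lemmas two_cat_ops = two_cat_1 two_cat_v two_cat_h
lemmas two_cat = two_cat_1 two_cat_v two_cat_h whisker

subsection \<open>The category of strict 2-categories\<close>

lemma two_functorI:
  assumes "\<And>x. x \<in> Cell0 A ==> F0 x \<in> Cell0 B"
    and "\<And>f. f \<in> Cell1 A ==> F1 f \<in> Cell1 B \<and> src1 B (F1 f) = F0 (src1 A f) \<and> tgt1 B (F1 f) = F0 (tgt1 A f)"
    and "\<And>\<alpha>. \<alpha> \<in> Cell2 A ==> F2 \<alpha> \<in> Cell2 B \<and> src2 B (F2 \<alpha>) = F1 (src2 A \<alpha>) \<and> tgt2 B (F2 \<alpha>) = F1 (tgt2 A \<alpha>)"
    and "\<And>x. x \<in> Cell0 A ==> F1 (id1 A x) = id1 B (F0 x)"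
    and "\<And>f g. f \<in> Cell1 A ==> g \<in> Cell1 A ==> tgt1 A f = src1 A g ==>
      F1 (comp1 A g f) = comp1 B (F1 g) (F1 f)"
    and "\<And>f. f \<in> Cell1 A ==> F2 (id2 A f) = id2 B (F1 f)"
    and "\<And>\<alpha> \<beta>. \<alpha> \<in> Cell2 A ==> \<beta> \<in> Cell2 A ==> tgt2 A \<alpha> = src2 A \<beta> ==>
      F2 (vcomp A \<beta> \<alpha>) = vcomp B (F2 \<beta>) (F2 \<alpha>)"
    and "\<And>\<alpha> \<beta>. \<alpha> \<in> Cell2 A ==> \<beta> \<in> Cell2 A ==> tgt1 A (src2 A \<alpha>) = src1 A (src2 A \<beta>) ==>
      F2 (hcomp A \<beta> \<alpha>) = hcomp B (F2 \<beta>) (F2 \<alpha>)"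
    and "two_category A" "two_category B"
  shows "two_functor A B F0 F1 F2"
  unfolding two_functor_def cat_functor_def in_Hom_cells
  using assms(1-8) two_cat_1[OF assms(9)] two_cat_v[OF assms(9)]
  by (auto simp: cell_cat_fields)

lemma TwoCat_Hom_iff: "F \<in> Hom TwoCat A B \<longleftrightarrow> F \<in> Arr TwoCat \<and> TSrc F = A \<and> TTgt F = B"
  by (simp add: Hom_iff TwoCat_def)

lemma TwoCat_Dom_Cod [simp]: "Dom TwoCat = TSrc" "Cod TwoCat = TTgt"
  by (simp_all add: TwoCat_def)

lemma TwoCat_Obj [simp]: "A \<in> Obj TwoCat \<longleftrightarrow> two_category A"
  by (simp add: TwoCat_def)

lemma two_functor_cong:
  assumes "\<And>x. x \<in> Cell0 A ==> F0 x = K0 x" "\<And>x. x \<in> Cell1 A ==> F1 x = K1 x"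
    "\<And>x. x \<in> Cell2 A ==> F2 x = K2 x" "two_category A" "two_functor A B F0 F1 F2"
  shows "two_functor A B K0 K1 K2"
  using assms(5) unfolding two_functor_def cat_functor_def in_Hom_cells
  using two_cat_ops[OF assms(4)] assms(1-3)
  by (auto simp: cell_cat_fields)

lemma TwoCat_Arr_iff: "F \<in> Arr TwoCat \<longleftrightarrow> (two_category (TSrc F) \<and> two_category (TTgt F) \<and>
    two_functor (TSrc F) (TTgt F) (Fun0 F) (Fun1 F) (Fun2 F) \<and>
    Fun0 F \<in> extensional (Cell0 (TSrc F)) \<and> Fun1 F \<in> extensional (Cell1 (TSrc F)) \<and>
    Fun2 F \<in> extensional (Cell2 (TSrc F)))" (is "?l \<longleftrightarrow> ?r")
proof
  assume ?l then obtain A B F0 F1 F2 where F: "F = mk_two_fun A B F0 F1 F2"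
    "two_category A" "two_category B" "two_functor A B F0 F1 F2" by (auto simp: TwoCat_def)
  have "two_functor A B (restrict F0 (Cell0 A)) (restrict F1 (Cell1 A)) (restrict F2 (Cell2 A))"
    by (rule two_functor_cong[OF _ _ _ F(2,4)]) auto
  then show ?r using F by (simp add: mk_two_fun_def)
next
  assume r: ?r
  then have "F = mk_two_fun (TSrc F) (TTgt F) (Fun0 F) (Fun1 F) (Fun2 F)"
    by (cases F) (auto simp: mk_two_fun_def extensional_restrict)
  then show ?l using r unfolding TwoCat_def by force
qed

lemma Arr_TwoCat_ends:
  assumes "F \<in> Arr TwoCat"
  shows "two_category (TSrc F)" "two_category (TTgt F)"
  using assms by (auto simp: TwoCat_Arr_iff)

lemma two_fun_app:
  assumes "F \<in> Arr TwoCat" "TTgt F = B"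
  shows
    "x \<in> Cell0 (TSrc F) ==> Fun0 F x \<in> Cell0 B"
    "f \<in> Cell1 (TSrc F) ==> Fun1 F f \<in> Cell1 B"
    "f \<in> Cell1 (TSrc F) ==> src1 B (Fun1 F f) = Fun0 F (src1 (TSrc F) f)"
    "f \<in> Cell1 (TSrc F) ==> tgt1 B (Fun1 F f) = Fun0 F (tgt1 (TSrc F) f)"
    "\<alpha> \<in> Cell2 (TSrc F) ==> Fun2 F \<alpha> \<in> Cell2 B"
    "\<alpha> \<in> Cell2 (TSrc F) ==> src2 B (Fun2 F \<alpha>) = Fun1 F (src2 (TSrc F) \<alpha>)"
    "\<alpha> \<in> Cell2 (TSrc F) ==> tgt2 B (Fun2 F \<alpha>) = Fun1 F (tgt2 (TSrc F) \<alpha>)"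
  using assms by (auto simp: TwoCat_Arr_iff two_functor_def cat_functor_def in_Hom_cells cell_cat_fields)

lemma two_fun_ops:
  assumes "F \<in> Arr TwoCat" "TSrc F = A"
  shows
    "x \<in> Cell0 A ==> Fun1 F (id1 A x) = id1 (TTgt F) (Fun0 F x)"
    "f \<in> Cell1 A ==> g \<in> Cell1 A ==> tgt1 A f = src1 A g ==>
      Fun1 F (comp1 A g f) = comp1 (TTgt F) (Fun1 F g) (Fun1 F f)"
    "f \<in> Cell1 A ==> Fun2 F (id2 A f) = id2 (TTgt F) (Fun1 F f)"
    "\<alpha> \<in> Cell2 A ==> \<beta> \<in> Cell2 A ==> tgt2 A \<alpha> = src2 A \<beta> ==>
      Fun2 F (vcomp A \<beta> \<alpha>) = vcomp (TTgt F) (Fun2 F \<beta>) (Fun2 F \<alpha>)"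
    "\<alpha> \<in> Cell2 A ==> \<beta> \<in> Cell2 A ==> tgt1 A (src2 A \<alpha>) = src1 A (src2 A \<beta>) ==>
      Fun2 F (hcomp A \<beta> \<alpha>) = hcomp (TTgt F) (Fun2 F \<beta>) (Fun2 F \<alpha>)"
  using assms by (auto simp: TwoCat_Arr_iff two_functor_def cat_functor_def in_Hom_cells cell_cat_fields)

lemmas two_fun = two_fun_app two_fun_ops

lemma mk_two_fun_app [simp]:
  "TSrc (mk_two_fun A B F0 F1 F2) = A" "TTgt (mk_two_fun A B F0 F1 F2) = B"
  "x \<in> Cell0 A ==> Fun0 (mk_two_fun A B F0 F1 F2) x = F0 x"
  "f \<in> Cell1 A ==> Fun1 (mk_two_fun A B F0 F1 F2) f = F1 f"
  "\<alpha> \<in> Cell2 A ==> Fun2 (mk_two_fun A B F0 F1 F2) \<alpha> = F2 \<alpha>"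
  by (simp_all add: mk_two_fun_def)

lemma mk_two_fun_Arr: "two_category A ==> two_category B ==> two_functor A B F0 F1 F2 ==>
    mk_two_fun A B F0 F1 F2 \<in> Arr TwoCat"
  unfolding TwoCat_def by simp blast

lemma two_fun_eqI:
  assumes "F \<in> Arr TwoCat" "G \<in> Arr TwoCat" "TSrc F = TSrc G" "TTgt F = TTgt G"
    and "\<And>x. x \<in> Cell0 (TSrc F) ==> Fun0 F x = Fun0 G x"
    and "\<And>x. x \<in> Cell1 (TSrc F) ==> Fun1 F x = Fun1 G x"
    and "\<And>x. x \<in> Cell2 (TSrc F) ==> Fun2 F x = Fun2 G x"
  shows "F = G"
proof -
  have "Fun0 F = Fun0 G" "Fun1 F = Fun1 G" "Fun2 F = Fun2 G"
    using assms by (auto simp: TwoCat_Arr_iff intro!: extensionalityI)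
  then show ?thesis using assms(3,4) by (cases F; cases G) auto
qed

lemma two_fun_id:
  "two_category A ==> Id TwoCat A \<in> Arr TwoCat" "TSrc (Id TwoCat A) = A" "TTgt (Id TwoCat A) = A"
  "x \<in> Cell0 A ==> Fun0 (Id TwoCat A) x = x"
  "f \<in> Cell1 A ==> Fun1 (Id TwoCat A) f = f"
  "\<alpha> \<in> Cell2 A ==> Fun2 (Id TwoCat A) \<alpha> = \<alpha>"
proof -
  assume "two_category A"
  then have "two_functor A A (\<lambda>x. x) (\<lambda>x. x) (\<lambda>x. x)" by (intro two_functorI) auto
  then show "Id TwoCat A \<in> Arr TwoCat" using \<open>two_category A\<close> unfolding TwoCat_def by simp blast
qed (simp_all add: TwoCat_def)

lemma two_fun_comp:
  "F \<in> Arr TwoCat ==> G \<in> Arr TwoCat ==> TTgt F = TSrc G ==> Comp TwoCat G F \<in> Arr TwoCat"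
  "TSrc (Comp TwoCat G F) = TSrc F" "TTgt (Comp TwoCat G F) = TTgt G"
  "x \<in> Cell0 (TSrc F) ==> Fun0 (Comp TwoCat G F) x = Fun0 G (Fun0 F x)"
  "f \<in> Cell1 (TSrc F) ==> Fun1 (Comp TwoCat G F) f = Fun1 G (Fun1 F f)"
  "\<alpha> \<in> Cell2 (TSrc F) ==> Fun2 (Comp TwoCat G F) \<alpha> = Fun2 G (Fun2 F \<alpha>)"
proof -
  assume a: "F \<in> Arr TwoCat" "G \<in> Arr TwoCat" "TTgt F = TSrc G"
  note e = Arr_TwoCat_ends[OF a(1)] Arr_TwoCat_ends[OF a(2)]
  have "two_functor (TSrc F) (TTgt G) (Fun0 G \<circ> Fun0 F) (Fun1 G \<circ> Fun1 F) (Fun2 G \<circ> Fun2 F)"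
    by (rule two_functorI) (use a e in \<open>simp_all add: two_fun two_cat_1 two_cat_v\<close>)
  then have "mk_two_fun (TSrc F) (TTgt G) (Fun0 G \<circ> Fun0 F) (Fun1 G \<circ> Fun1 F) (Fun2 G \<circ> Fun2 F) \<in> Arr TwoCat"
    using e by (auto intro: mk_two_fun_Arr)
  then show "Comp TwoCat G F \<in> Arr TwoCat" by (simp add: TwoCat_def)
qed (simp_all add: TwoCat_def)

lemma category_TwoCat: "category TwoCat"
proof (rule category.intro, goal_cases)
  case (1 f) then show ?case by (simp add: Arr_TwoCat_ends)
next
  case (2 x) then show ?case by (simp add: Hom_iff two_fun_id)
next
  case (3 f x y g z) then show ?case by (simp add: Hom_iff two_fun_comp)
next
  case (4 f) then show ?case
    by (intro two_fun_eqI) (auto simp: two_fun_id two_fun_comp Arr_TwoCat_ends)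
next
  case (5 f) then show ?case
    by (intro two_fun_eqI) (auto simp: two_fun_id two_fun_comp Arr_TwoCat_ends two_fun)
next
  case (6 f w x g y h z) then show ?case
    by (intro two_fun_eqI) (auto simp: two_fun_comp two_fun Hom_iff)
qed

subsection \<open>Copies with cells in the natural numbers\<close>

context
  fixes A :: "'c two_cat" assumes A: "two_category A" and cA: "countable (cells A)"
begin

lemma decode_encode: "c \<in> cells A ==> decode A (encode A c) = c"
  unfolding decode_def encode_def using cA inj_on_to_nat_on inv_into_f_f by metis

lemma encode_eq: "c \<in> cells A ==> d \<in> cells A ==> encode A c = encode A d \<longleftrightarrow> c = d"
  using decode_encode by metis

lemma in_cells: "c \<in> Cell0 A ==> c \<in> cells A" "c \<in> Cell1 A ==> c \<in> cells A"
  "c \<in> Cell2 A ==> c \<in> cells A"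
  by (auto simp: cells_def)

lemma nat_copy_cells: "Cell0 (nat_copy A) = encode A ` Cell0 A" "Cell1 (nat_copy A) = encode A ` Cell1 A"
  "Cell2 (nat_copy A) = encode A ` Cell2 A"
  by (simp_all add: nat_copy_def)

lemma nat_copy_ops:
  "c \<in> cells A ==> src1 (nat_copy A) (encode A c) = encode A (src1 A c)"
  "c \<in> cells A ==> tgt1 (nat_copy A) (encode A c) = encode A (tgt1 A c)"
  "c \<in> cells A ==> id1 (nat_copy A) (encode A c) = encode A (id1 A c)"
  "c \<in> cells A ==> d \<in> cells A ==> comp1 (nat_copy A) (encode A d) (encode A c) = encode A (comp1 A d c)"
  "c \<in> cells A ==> src2 (nat_copy A) (encode A c) = encode A (src2 A c)"
  "c \<in> cells A ==> tgt2 (nat_copy A) (encode A c) = encode A (tgt2 A c)"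
  "c \<in> cells A ==> id2 (nat_copy A) (encode A c) = encode A (id2 A c)"
  "c \<in> cells A ==> d \<in> cells A ==> vcomp (nat_copy A) (encode A d) (encode A c) = encode A (vcomp A d c)"
  "c \<in> cells A ==> d \<in> cells A ==> hcomp (nat_copy A) (encode A d) (encode A c) = encode A (hcomp A d c)"
  by (simp_all add: nat_copy_def decode_encode)

lemma two_category_nat_copy: "two_category (nat_copy A)"
  by (rule two_categoryI)
    (auto simp: nat_copy_cells nat_copy_ops in_cells encode_eq two_cat[OF A] interchange_cells[OF A])

end

subsection \<open>The objects of \<open>\<Theta>\<^sub>2\<close>\<close>

lemma theta_hom_append:
  "is @ js \<in> theta_hom q k \<longleftrightarrow> is \<in> theta_hom q k \<and> js \<in> theta_hom q (k + length is)"
proof -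
  have "(\<forall>j < length is + length js. (is @ js) ! j \<le> q ! (k + j)) \<longleftrightarrow>
    (\<forall>j < length is. is ! j \<le> q ! (k + j)) \<and> (\<forall>j < length js. js ! j \<le> q ! (k + length is + j))"
    (is "?l \<longleftrightarrow> ?r")
  proof
    assume l: ?l
    have "js ! j \<le> q ! (k + length is + j)" if "j < length js" for j
      using l[rule_format, of "length is + j"] that by (simp add: nth_append add.assoc)
    moreover have "is ! j \<le> q ! (k + j)" if "j < length is" for j
      using l[rule_format, of j] that by (simp add: nth_append)
    ultimately show ?r by blast
  next
    assume r: ?r
    show ?l
    proof (intro allI impI)
      fix j assume "j < length is + length js"
      then show "(is @ js) ! j \<le> q ! (k + j)"
        using r[THEN conjunct1, rule_format, of j] r[THEN conjunct2, rule_format, of "j - length is"]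
        by (auto simp: nth_append split: if_splits)
    qed
  qed
  then show ?thesis by (auto simp: theta_hom_def)
qed

lemma two_category_theta_cat: "two_category (theta_cat q)"
proof -
  have nil: "[] \<in> theta_hom q k \<longleftrightarrow> k \<le> length q" for k by (simp add: theta_hom_def)
  have le: "k + length is \<le> length q" "k \<le> length q" if "is \<in> theta_hom q k" for k "is"
    using that by (auto simp: theta_hom_def)
  have len: "ks \<in> theta_hom q (k + length js)"
    if "list_all2 (\<le>) is js" "ks \<in> theta_hom q (k + length is)" for k "is" js ks
    using that by (simp add: list_all2_lengthD)
  show ?thesis
    by (rule two_categoryI)
      (auto simp: theta_cat_def theta_hom_append list.rel_refl nil le
        intro: list_all2_trans[OF order_trans] list_all2_appendI len dest: list_all2_lengthD)
qed

lemma finite_theta_hom: "finite (theta_hom q k)"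
proof (rule finite_subset)
  show "theta_hom q k \<subseteq> {is. set is \<subseteq> {..Max (set q)} \<and> length is \<le> length q}"
  proof
    fix "is" assume a: "is \<in> theta_hom q k"
    have "is ! j \<le> Max (set q)" if "j < length is" for j
    proof -
      have "is ! j \<le> q ! (k + j)" "k + j < length q" using a that by (auto simp: theta_hom_def)
      then show ?thesis by (meson List.finite_set Max_ge nth_mem order_trans)
    qed
    then show "is \<in> {is. set is \<subseteq> {..Max (set q)} \<and> length is \<le> length q}"
      using a by (auto simp: theta_hom_def in_set_conv_nth)
  qed
qed (simp add: finite_lists_length_le)

section \<open>The Gray tensor product of two 2-categories\<close>

context
  fixes A :: "'c two_cat" and B :: "'d two_cat"
  assumes A: "two_category A" and B: "two_category B"
begin

lemma gwf1_ends: "gwf1 A B t ==> gsrc1 A B t \<in> Cell0 A \<times> Cell0 B \<and> gtgt1 A B t \<in> Cell0 A \<times> Cell0 B"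
  by (induction t) (auto simp: two_cat_1[OF A] two_cat_1[OF B])

lemma geq1_ends:
  "geq1 A B s t ==> gwf1 A B s \<and> gwf1 A B t \<and> gsrc1 A B s = gsrc1 A B t \<and> gtgt1 A B s = gtgt1 A B t"
  by (induction rule: geq1.induct) (use gwf1_ends in \<open>auto simp: in_Hom_cells two_cat_1[OF A] two_cat_1[OF B]\<close>)

lemma gwf2_ends: "gwf2 A B a ==> gwf1 A B (gsrc2 A B a) \<and> gwf1 A B (gtgt2 A B a) \<and>
    gsrc1 A B (gtgt2 A B a) = gsrc1 A B (gsrc2 A B a) \<and> gtgt1 A B (gtgt2 A B a) = gtgt1 A B (gsrc2 A B a)"
proof (induction a)
  case (V2 b a) then show ?case using geq1_ends[of "gsrc2 A B b" "gtgt2 A B a"] by auto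
qed (auto simp: two_cat_1[OF A] two_cat_1[OF B] two_cat_v[OF A] two_cat_v[OF B])

lemma geq1_assoc': "gwf1 A B (C1 t (C1 s r)) ==> geq1 A B (C1 (C1 t s) r) (C1 t (C1 s r))"
  by (rule geq1.sym, rule geq1.assoc)

lemma geq1_cong_l: "geq1 A B t t' ==> gwf1 A B s ==> gsrc1 A B t = gtgt1 A B s ==>
    geq1 A B (C1 t s) (C1 t' s)"
  by (intro geq1.cong geq1.refl)

lemma geq1_cong_r: "geq1 A B s s' ==> gwf1 A B t ==> gsrc1 A B t = gtgt1 A B s ==>
    geq1 A B (C1 t s) (C1 t s')"
  by (intro geq1.cong geq1.refl)

text \<open>Sources and targets are thus defined on classes of terms. The relations for \<open>\<gamma>\<close> are the cases with content: both sides of each must be parallel up to associativity and units of 1-cells.\<close>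

lemma geq2_ends:
  "geq2 A B a b ==> gwf2 A B a \<and> gwf2 A B b \<and>
    geq1 A B (gsrc2 A B a) (gsrc2 A B b) \<and> geq1 A B (gtgt2 A B a) (gtgt2 A B b)"
proof (induction rule: geq2.induct)
  case (refl a) then show ?case using gwf2_ends by (auto intro: geq1.refl)
next
  case (sym a b) then show ?case by (auto intro: geq1.sym)
next
  case (trans a b c) then show ?case by (auto intro: geq1.trans)
next
  case (I_cong s t) then show ?case using geq1_ends by auto
next
  case (V_cong b b' a a') then show ?case by (auto intro: geq1.sym geq1.trans)
next
  case (H_cong b b' a a')
  then show ?case
    using gwf2_ends[of b] gwf2_ends[of a] geq1_ends[of "gsrc2 A B b" "gsrc2 A B b'"]
      geq1_ends[of "gsrc2 A B a" "gsrc2 A B a'"]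
    by (auto intro: geq1.cong)
next
  case (V_unit_l a) then show ?case using gwf2_ends[of a] by (auto intro: geq1.refl)
next
  case (V_unit_r a) then show ?case using gwf2_ends[of a] by (auto intro: geq1.refl)
next
  case (V_assoc c b a) then show ?case
    using gwf2_ends[of a] gwf2_ends[of b] gwf2_ends[of c] by (auto intro: geq1.refl)
next
  case (H_unit_l a) then show ?case
    using gwf2_ends[of a] gwf1_ends[of "gsrc2 A B a"] geq1.unit_l[of A B "gsrc2 A B a"]
      geq1.unit_l[of A B "gtgt2 A B a"] by auto
next
  case (H_unit_r a) then show ?case
    using gwf2_ends[of a] gwf1_ends[of "gsrc2 A B a"] geq1.unit_r[of A B "gsrc2 A B a"]
      geq1.unit_r[of A B "gtgt2 A B a"] by auto
next
  case (H_assoc c b a) then show ?case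
    using gwf2_ends[of a] gwf2_ends[of b] gwf2_ends[of c] by (auto intro: geq1.assoc)
next
  case (H_id t s) then show ?case by (auto intro: geq1.refl)
next
  case (interchange b' b a' a)
  have "gsrc1 A B (gsrc2 A B b') = gtgt1 A B (gsrc2 A B a')"
    using interchange gwf2_ends[of b] gwf2_ends[of a]
      geq1_ends[of "gsrc2 A B b'" "gtgt2 A B b"] geq1_ends[of "gsrc2 A B a'" "gtgt2 A B a"] by auto
  then show ?case
    using interchange gwf2_ends[of a] gwf2_ends[of b] gwf2_ends[of a'] gwf2_ends[of b']
    by (auto intro!: geq1.refl geq1.cong)
next
  case (L_vcomp \<alpha> f f' \<alpha>' f'' y)
  then show ?case using two_cat_v[OF A] by (auto simp: in_Hom_cells intro!: geq1.refl)
next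
  case (R_vcomp x \<alpha> f f' \<alpha>' f'')
  then show ?case using two_cat_v[OF B] by (auto simp: in_Hom_cells intro!: geq1.refl)
next
  case (L_hcomp \<alpha> x x' \<alpha>' x'' y)
  then show ?case
    using two_cat_v(3,4)[OF A, of \<alpha>] two_cat_v(3,4)[OF A, of \<alpha>']
    by (auto simp: in_Hom_cells two_cat_v[OF A] two_cat_h[OF A] intro!: geq1.L_comp)
next
  case (R_hcomp x \<alpha> y y' \<alpha>' y'')
  then show ?case
    using two_cat_v(3,4)[OF B, of \<alpha>] two_cat_v(3,4)[OF B, of \<alpha>']
    by (auto simp: in_Hom_cells two_cat_v[OF B] two_cat_h[OF B] intro!: geq1.R_comp)
next
  case (Gam_natural_l \<alpha> f f' x x' g y y')
  then have "src1 A f' = x" "tgt1 A f' = x'" "f \<in> Cell1 A" "f' \<in> Cell1 A"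
    using two_cat_v[OF A, of \<alpha>] by (auto simp: in_Hom_cells)
  with Gam_natural_l show ?case
    by (auto simp add: in_Hom_cells two_cat_1[OF A] two_cat_1[OF B] geq1.refl)
next
  case (Gam_natural_r f x x' \<beta> g g' y y')
  then have "src1 B g' = y" "tgt1 B g' = y'" "g' \<in> Cell1 B"
    using two_cat_v[OF B, of \<beta>] by (auto simp: in_Hom_cells)
  with Gam_natural_r show ?case
    by (auto simp: in_Hom_cells two_cat_1[OF A] two_cat_1[OF B] geq1.refl)
next
  case (Gam_id_l x g)
  have "geq1 A B (C1 (L1 (id1 A x) (tgt1 B g)) (R1 x g)) (R1 x g)"
    by (rule geq1.trans[OF geq1_cong_l[OF geq1.L_id]], use Gam_id_l in \<open>auto simp: two_cat_1[OF A] two_cat_1[OF B]\<close>)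
      (use geq1.unit_l[of A B "R1 x g"] Gam_id_l in simp)
  moreover have "geq1 A B (C1 (R1 x g) (L1 (id1 A x) (src1 B g))) (R1 x g)"
    by (rule geq1.trans[OF geq1_cong_r[OF geq1.L_id]], use Gam_id_l in \<open>auto simp: two_cat_1[OF A] two_cat_1[OF B]\<close>)
      (use geq1.unit_r[of A B "R1 x g"] Gam_id_l in simp)
  ultimately show ?case using Gam_id_l by (simp add: two_cat_1[OF A] two_cat_1[OF B])
next
  case (Gam_id_r f y)
  have "geq1 A B (C1 (L1 f y) (R1 (src1 A f) (id1 B y))) (L1 f y)"
    by (rule geq1.trans[OF geq1_cong_r[OF geq1.R_id]], use Gam_id_r in \<open>auto simp: two_cat_1[OF A] two_cat_1[OF B]\<close>)
      (use geq1.unit_r[of A B "L1 f y"] Gam_id_r in simp)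
  moreover have "geq1 A B (C1 (R1 (tgt1 A f) (id1 B y)) (L1 f y)) (L1 f y)"
    by (rule geq1.trans[OF geq1_cong_l[OF geq1.R_id]], use Gam_id_r in \<open>auto simp: two_cat_1[OF A] two_cat_1[OF B]\<close>)
      (use geq1.unit_l[of A B "L1 f y"] Gam_id_r in simp)
  ultimately show ?case using Gam_id_r by (simp add: two_cat_1[OF A] two_cat_1[OF B])
next
  case (Gam_comp_l f x x' f' x'' g y y')
  have w: "gwf1 A B (C1 (L1 f' y') (C1 (L1 f y') (R1 x g)))"
    "gwf1 A B (C1 (L1 f' y') (C1 (R1 x' g) (L1 f y)))"
    "gwf1 A B (C1 (R1 x'' g) (C1 (L1 f' y) (L1 f y)))"
    using Gam_comp_l by (auto simp: in_Hom_cells two_cat_1[OF A] two_cat_1[OF B])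
  have "geq1 A B (C1 (L1 (comp1 A f' f) y') (R1 x g)) (C1 (L1 f' y') (C1 (L1 f y') (R1 x g)))"
    by (rule geq1.trans[OF geq1_cong_l[OF geq1.L_comp]])
      (use Gam_comp_l geq1_assoc'[OF w(1)] in \<open>auto simp: in_Hom_cells two_cat_1[OF A] two_cat_1[OF B]\<close>)
  moreover have "geq1 A B (C1 (R1 x'' g) (L1 (comp1 A f' f) y)) (C1 (C1 (R1 x'' g) (L1 f' y)) (L1 f y))"
    by (rule geq1.trans[OF geq1_cong_r[OF geq1.L_comp]])
      (use Gam_comp_l geq1.assoc[OF w(3)] in \<open>auto simp: in_Hom_cells two_cat_1[OF A] two_cat_1[OF B]\<close>)
  ultimately show ?case using Gam_comp_l geq1_assoc'[OF w(2)]
    by (auto simp: in_Hom_cells two_cat_1[OF A] two_cat_1[OF B])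
next
  case (Gam_comp_r f x x' g y y' g' y'')
  have w: "gwf1 A B (C1 (L1 f y'') (C1 (R1 x g') (R1 x g)))"
    "gwf1 A B (C1 (R1 x' g') (C1 (L1 f y') (R1 x g)))"
    "gwf1 A B (C1 (R1 x' g') (C1 (R1 x' g) (L1 f y)))"
    using Gam_comp_r by (auto simp: in_Hom_cells two_cat_1[OF A] two_cat_1[OF B])
  have "geq1 A B (C1 (L1 f y'') (R1 x (comp1 B g' g))) (C1 (C1 (L1 f y'') (R1 x g')) (R1 x g))"
    by (rule geq1.trans[OF geq1_cong_r[OF geq1.R_comp]])
      (use Gam_comp_r geq1.assoc[OF w(1)] in \<open>auto simp: in_Hom_cells two_cat_1[OF A] two_cat_1[OF B]\<close>)
  moreover have "geq1 A B (C1 (R1 x' (comp1 B g' g)) (L1 f y)) (C1 (R1 x' g') (C1 (R1 x' g) (L1 f y)))"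
    by (rule geq1.trans[OF geq1_cong_l[OF geq1.R_comp]])
      (use Gam_comp_r geq1_assoc'[OF w(3)] in \<open>auto simp: in_Hom_cells two_cat_1[OF A] two_cat_1[OF B]\<close>)
  ultimately show ?case using Gam_comp_r geq1.assoc[OF w(2)]
    by (auto simp: in_Hom_cells two_cat_1[OF A] two_cat_1[OF B])
qed (auto simp: two_cat_1[OF A] two_cat_1[OF B] two_cat_v[OF A] two_cat_v[OF B] intro!: geq1.refl)

lemma class1_eq: "gwf1 A B t ==> gwf1 A B s ==> class1 A B t = class1 A B s \<longleftrightarrow> geq1 A B t s"
  unfolding class1_def using geq1.refl geq1.sym geq1.trans by blast

lemma class2_eq: "gwf2 A B a ==> gwf2 A B b ==> class2 A B a = class2 A B b \<longleftrightarrow> geq2 A B a b"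
  unfolding class2_def using geq2.refl geq2.sym geq2.trans by blast

lemma class_eqI:
  "geq1 A B t s ==> class1 A B s = class1 A B t" "geq2 A B a b ==> class2 A B b = class2 A B a"
  subgoal using geq1_ends[of t s] class1_eq[of t s] by simp
  subgoal using geq2_ends[of a b] class2_eq[of a b] by simp
  done

lemma rep1: "gwf1 A B t ==> geq1 A B t (rep1 (class1 A B t))"
  unfolding rep1_def class1_def using someI[of "geq1 A B t" t] by (simp add: geq1.refl)

lemma rep2: "gwf2 A B a ==> geq2 A B a (rep2 (class2 A B a))"
  unfolding rep2_def class2_def using someI[of "geq2 A B a" a] by (simp add: geq2.refl)

lemma gray_cells:
  "Cell0 (gray A B) = G0 ` (Cell0 A \<times> Cell0 B)"
  "Cell1 (gray A B) = class1 A B ` {t. gwf1 A B t}"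
  "Cell2 (gray A B) = class2 A B ` {a. gwf2 A B a}"
  by (simp_all add: gray_def)

lemma gray_ops:
  "gwf1 A B t ==> src1 (gray A B) (class1 A B t) = G0 (gsrc1 A B t)"
  "gwf1 A B t ==> tgt1 (gray A B) (class1 A B t) = G0 (gtgt1 A B t)"
  "id1 (gray A B) (G0 p) = class1 A B (I1 p)"
  "gwf1 A B (C1 t s) ==> comp1 (gray A B) (class1 A B t) (class1 A B s) = class1 A B (C1 t s)"
  "gwf2 A B a ==> src2 (gray A B) (class2 A B a) = class1 A B (gsrc2 A B a)"
  "gwf2 A B a ==> tgt2 (gray A B) (class2 A B a) = class1 A B (gtgt2 A B a)"
  "gwf1 A B t ==> id2 (gray A B) (class1 A B t) = class2 A B (I2 t)"
  "gwf2 A B (V2 b a) ==> vcomp (gray A B) (class2 A B b) (class2 A B a) = class2 A B (V2 b a)"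
  "gwf2 A B (H2 b a) ==> hcomp (gray A B) (class2 A B b) (class2 A B a) = class2 A B (H2 b a)"
proof -
  show "gwf1 A B t ==> src1 (gray A B) (class1 A B t) = G0 (gsrc1 A B t)"
    "gwf1 A B t ==> tgt1 (gray A B) (class1 A B t) = G0 (gtgt1 A B t)"
    using geq1_ends[OF rep1] by (auto simp: gray_def)
  show "id1 (gray A B) (G0 p) = class1 A B (I1 p)" by (simp add: gray_def)
  assume w: "gwf1 A B (C1 t s)"
  then have "geq1 A B (C1 t s) (C1 (rep1 (class1 A B t)) (rep1 (class1 A B s)))"
    by (auto intro!: geq1.cong rep1)
  then show "comp1 (gray A B) (class1 A B t) (class1 A B s) = class1 A B (C1 t s)"
    by (simp add: gray_def class_eqI)
next
  assume w: "gwf2 A B a"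
  note g = geq2_ends[OF rep2[OF w]]
  show "src2 (gray A B) (class2 A B a) = class1 A B (gsrc2 A B a)"
    "tgt2 (gray A B) (class2 A B a) = class1 A B (gtgt2 A B a)"
    using g by (simp_all add: gray_def class_eqI)
next
  assume w: "gwf1 A B t"
  have "geq2 A B (I2 t) (I2 (rep1 (class1 A B t)))" by (intro geq2.I_cong rep1 w)
  then show "id2 (gray A B) (class1 A B t) = class2 A B (I2 t)"
    by (simp add: gray_def class_eqI)
next
  assume w: "gwf2 A B (V2 b a)"
  then have "geq2 A B (V2 b a) (V2 (rep2 (class2 A B b)) (rep2 (class2 A B a)))"
    by (auto intro!: geq2.V_cong rep2)
  then show "vcomp (gray A B) (class2 A B b) (class2 A B a) = class2 A B (V2 b a)"
    by (simp add: gray_def class_eqI)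
next
  assume w: "gwf2 A B (H2 b a)"
  then have "geq2 A B (H2 b a) (H2 (rep2 (class2 A B b)) (rep2 (class2 A B a)))"
    by (auto intro!: geq2.H_cong rep2)
  then show "hcomp (gray A B) (class2 A B b) (class2 A B a) = class2 A B (H2 b a)"
    by (simp add: gray_def class_eqI)
qed

text \<open>All laws are relations between terms, except that composability of two classes has to be transported to their chosen representatives.\<close>

lemma two_category_gray: "two_category (gray A B)"
proof -
  have V: "gwf2 A B (V2 b a) \<longleftrightarrow> gwf2 A B b \<and> gwf2 A B a \<and>
      class1 A B (gtgt2 A B a) = class1 A B (gsrc2 A B b)" for a b
    using gwf2_ends class1_eq geq1.sym by auto
  have w2: "gwf1 A B (gsrc2 A B a)" "gwf1 A B (gtgt2 A B a)"
    "gsrc1 A B (gtgt2 A B a) = gsrc1 A B (gsrc2 A B a)"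
    "gtgt1 A B (gtgt2 A B a) = gtgt1 A B (gsrc2 A B a)" if "gwf2 A B a" for a
    using gwf2_ends that by auto
  have s: "gsrc1 A B s = gsrc1 A B t" "gtgt1 A B s = gtgt1 A B t" if "class1 A B s = class1 A B t"
    "gwf1 A B s" "gwf1 A B t" for s t using that class1_eq geq1_ends by auto
  note eq = class1_eq[THEN iffD2] class2_eq[THEN iffD2]
  note simps = gray_cells gray_ops w2
  show ?thesis
  proof (rule two_categoryI)
    fix f assume "f \<in> Cell1 (gray A B)"
    then obtain t where t: "f = class1 A B t" "gwf1 A B t" by (auto simp: simps)
    show "src1 (gray A B) f \<in> Cell0 (gray A B) \<and> tgt1 (gray A B) f \<in> Cell0 (gray A B)"
      using t gwf1_ends[of t] by (auto simp: simps)
    show "comp1 (gray A B) f (id1 (gray A B) (src1 (gray A B) f)) = f \<and>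
      comp1 (gray A B) (id1 (gray A B) (tgt1 (gray A B) f)) f = f"
      using t gwf1_ends[of t] geq1.unit_l[of A B t] geq1.unit_r[of A B t] by (auto simp: simps class1_eq)
    show "id2 (gray A B) f \<in> Cell2 (gray A B) \<and> src2 (gray A B) (id2 (gray A B) f) = f \<and>
        tgt2 (gray A B) (id2 (gray A B) f) = f"
      using t by (auto simp: simps)
    fix g assume "g \<in> Cell1 (gray A B)" and fg: "tgt1 (gray A B) f = src1 (gray A B) g"
    then obtain s where s: "g = class1 A B s" "gwf1 A B s" by (auto simp: simps)
    then have w: "gwf1 A B (C1 s t)" using t fg by (auto simp: simps)
    then show "comp1 (gray A B) g f \<in> Cell1 (gray A B) \<and>
        src1 (gray A B) (comp1 (gray A B) g f) = src1 (gray A B) f \<and>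
        tgt1 (gray A B) (comp1 (gray A B) g f) = tgt1 (gray A B) g"
      using s t by (auto simp: simps simp del: gwf1.simps)
    show "hcomp (gray A B) (id2 (gray A B) g) (id2 (gray A B) f) = id2 (gray A B) (comp1 (gray A B) g f)"
      using s t w geq2.H_id[OF w] geq2_ends by (auto simp: simps class2_eq)
    fix h assume "h \<in> Cell1 (gray A B)" and gh: "tgt1 (gray A B) g = src1 (gray A B) h"
    then obtain r where r: "h = class1 A B r" "gwf1 A B r" by (auto simp: simps)
    then have w: "gwf1 A B (C1 r (C1 s t))" using s t fg gh by (auto simp: simps)
    show "comp1 (gray A B) h (comp1 (gray A B) g f) = comp1 (gray A B) (comp1 (gray A B) h g) f"
      using r s t w geq1.assoc[OF w] by (auto simp: simps class1_eq)
  next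
    fix x assume "x \<in> Cell0 (gray A B)"
    then show "id1 (gray A B) x \<in> Cell1 (gray A B) \<and> src1 (gray A B) (id1 (gray A B) x) = x \<and>
        tgt1 (gray A B) (id1 (gray A B) x) = x"
      by (auto simp: simps)
  next
    fix \<alpha> assume "\<alpha> \<in> Cell2 (gray A B)"
    then obtain a where a: "\<alpha> = class2 A B a" "gwf2 A B a" by (auto simp: simps)
    show "src2 (gray A B) \<alpha> \<in> Cell1 (gray A B) \<and> tgt2 (gray A B) \<alpha> \<in> Cell1 (gray A B) \<and>
         src1 (gray A B) (tgt2 (gray A B) \<alpha>) = src1 (gray A B) (src2 (gray A B) \<alpha>) \<and>
         tgt1 (gray A B) (tgt2 (gray A B) \<alpha>) = tgt1 (gray A B) (src2 (gray A B) \<alpha>)"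
      using a by (auto simp: simps)
    show "vcomp (gray A B) \<alpha> (id2 (gray A B) (src2 (gray A B) \<alpha>)) = \<alpha> \<and>
      vcomp (gray A B) (id2 (gray A B) (tgt2 (gray A B) \<alpha>)) \<alpha> = \<alpha>"
      using a w2[OF a(2)] geq2.V_unit_l[OF a(2)] geq2.V_unit_r[OF a(2)]
        geq2_ends[OF geq2.V_unit_l[OF a(2)]] geq2_ends[OF geq2.V_unit_r[OF a(2)]]
      by (simp add: gray_ops class2_eq del: gwf2.simps)
    show "hcomp (gray A B) \<alpha> (id2 (gray A B) (id1 (gray A B) (src1 (gray A B) (src2 (gray A B) \<alpha>)))) = \<alpha> \<and>
      hcomp (gray A B) (id2 (gray A B) (id1 (gray A B) (tgt1 (gray A B) (src2 (gray A B) \<alpha>)))) \<alpha> = \<alpha>"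
      using a w2[OF a(2)] gwf1_ends[OF w2(1)[OF a(2)]] geq2.H_unit_l[OF a(2)] geq2.H_unit_r[OF a(2)]
        geq2_ends[OF geq2.H_unit_l[OF a(2)]] geq2_ends[OF geq2.H_unit_r[OF a(2)]]
      by (simp add: gray_ops class2_eq del: gwf2.simps)
    fix \<beta> assume "\<beta> \<in> Cell2 (gray A B)"
    then obtain b where b: "\<beta> = class2 A B b" "gwf2 A B b" by (auto simp: simps)
    {
      assume "tgt2 (gray A B) \<alpha> = src2 (gray A B) \<beta>"
      then have w: "gwf2 A B (V2 b a)" using a b unfolding V by (simp add: simps)
      show "vcomp (gray A B) \<beta> \<alpha> \<in> Cell2 (gray A B) \<and> src2 (gray A B) (vcomp (gray A B) \<beta> \<alpha>) = src2 (gray A B) \<alpha> \<and>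
         tgt2 (gray A B) (vcomp (gray A B) \<beta> \<alpha>) = tgt2 (gray A B) \<beta>"
        using a b w gray_ops(5)[OF w] gray_ops(6)[OF w] by (simp add: gray_ops gray_cells del: gwf2.simps)
      fix \<gamma> assume "\<gamma> \<in> Cell2 (gray A B)"
      then obtain c where c: "\<gamma> = class2 A B c" "gwf2 A B c" by (auto simp: simps)
      assume "tgt2 (gray A B) \<beta> = src2 (gray A B) \<gamma>"
      then have w': "gwf2 A B (V2 c b)" using c b unfolding V by (simp add: simps)
      with w have w'': "gwf2 A B (V2 c (V2 b a))" by simp
      show "vcomp (gray A B) \<gamma> (vcomp (gray A B) \<beta> \<alpha>) = vcomp (gray A B) (vcomp (gray A B) \<gamma> \<beta>) \<alpha>"
        using a b c w w' w'' geq2.V_assoc[OF w''] geq2_ends[OF geq2.V_assoc[OF w'']]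
        by (simp add: gray_ops class2_eq del: gwf2.simps)
    }
    assume ab: "tgt1 (gray A B) (src2 (gray A B) \<alpha>) = src1 (gray A B) (src2 (gray A B) \<beta>)"
    then have w: "gwf2 A B (H2 b a)" using a b by (simp add: simps)
    show "hcomp (gray A B) \<beta> \<alpha> \<in> Cell2 (gray A B) \<and>
        src2 (gray A B) (hcomp (gray A B) \<beta> \<alpha>) = comp1 (gray A B) (src2 (gray A B) \<beta>) (src2 (gray A B) \<alpha>) \<and>
        tgt2 (gray A B) (hcomp (gray A B) \<beta> \<alpha>) = comp1 (gray A B) (tgt2 (gray A B) \<beta>) (tgt2 (gray A B) \<alpha>)"
      using a b w gray_ops(5)[OF w] gray_ops(6)[OF w] w2[OF a(2)] w2[OF b(2)] by (simp add: simps)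
    {
      fix \<gamma> assume "\<gamma> \<in> Cell2 (gray A B)"
      then obtain c where c: "\<gamma> = class2 A B c" "gwf2 A B c" by (auto simp: simps)
      assume "tgt1 (gray A B) (src2 (gray A B) \<beta>) = src1 (gray A B) (src2 (gray A B) \<gamma>)"
      then have w'': "gwf2 A B (H2 c (H2 b a))" using a b c ab by (simp add: simps)
      show "hcomp (gray A B) \<gamma> (hcomp (gray A B) \<beta> \<alpha>) = hcomp (gray A B) (hcomp (gray A B) \<gamma> \<beta>) \<alpha>"
        using a b c w'' geq2.H_assoc[OF w''] geq2_ends[OF geq2.H_assoc[OF w'']]
        by (simp add: gray_ops class2_eq)
    }
    fix \<alpha>' assume "\<alpha>' \<in> Cell2 (gray A B)"
    then obtain a' where a': "\<alpha>' = class2 A B a'" "gwf2 A B a'" by (auto simp: simps)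
    fix \<beta>' assume "\<beta>' \<in> Cell2 (gray A B)"
    then obtain b' where b': "\<beta>' = class2 A B b'" "gwf2 A B b'" by (auto simp: simps)
    assume "tgt2 (gray A B) \<alpha> = src2 (gray A B) \<alpha>'" "tgt2 (gray A B) \<beta> = src2 (gray A B) \<beta>'"
      "tgt1 (gray A B) (src2 (gray A B) \<alpha>') = src1 (gray A B) (src2 (gray A B) \<beta>')"
    then have wa: "gwf2 A B (V2 a' a)" and wb: "gwf2 A B (V2 b' b)" and w': "gwf2 A B (H2 b' a')"
      using a b a' b' unfolding V by (simp_all add: simps)
    have w'': "gwf2 A B (H2 (V2 b' b) (V2 a' a))" using wa wb w by simp
    show "hcomp (gray A B) (vcomp (gray A B) \<beta>' \<beta>) (vcomp (gray A B) \<alpha>' \<alpha>) =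
        vcomp (gray A B) (hcomp (gray A B) \<beta>' \<alpha>') (hcomp (gray A B) \<beta> \<alpha>)"
      using a b a' b' wa wb w w' w'' geq2.interchange[OF w''] geq2_ends[OF geq2.interchange[OF w'']]
      by (simp add: gray_ops class2_eq del: gwf2.simps)
  qed
qed

end

instance gterm1 :: (countable, countable) countable by countable_datatype
instance gterm2 :: (countable, countable) countable by countable_datatype

lemma countable_gray: "countable (cells (gray A B))"
  for A :: "'c::countable two_cat" and B :: "'d::countable two_cat"
proof (rule countable_subset)
  show "cells (gray A B) \<subseteq> range G0 \<union> range (class1 A B) \<union> range (class2 A B)"
    by (auto simp: cells_def gray_def)
qed simp

section \<open>The tensor product on 2-categories with cells in the natural numbers\<close>

definition tens :: "nat two_cat \<Rightarrow> nat two_cat \<Rightarrow> nat two_cat" where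
  "tens A B = nat_copy (gray A B)"

definition tens0 :: "nat two_cat \<Rightarrow> nat two_cat \<Rightarrow> nat \<Rightarrow> nat \<Rightarrow> nat" where
  "tens0 A B x y = encode (gray A B) (G0 (x, y))"

definition tens1 :: "nat two_cat \<Rightarrow> nat two_cat \<Rightarrow> (nat, nat) gterm1 \<Rightarrow> nat" where
  "tens1 A B t = encode (gray A B) (class1 A B t)"

definition tens2 :: "nat two_cat \<Rightarrow> nat two_cat \<Rightarrow> (nat, nat) gterm2 \<Rightarrow> nat" where
  "tens2 A B a = encode (gray A B) (class2 A B a)"

context
  fixes A B :: "nat two_cat"
  assumes A: "two_category A" and B: "two_category B"
begin

lemma tens_two_cat: "two_category (tens A B)"
  unfolding tens_def by (intro two_category_nat_copy two_category_gray A B countable_gray)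

lemma tens_cells:
  "Cell0 (tens A B) = (\<lambda>(x, y). tens0 A B x y) ` (Cell0 A \<times> Cell0 B)"
  "Cell1 (tens A B) = tens1 A B ` {t. gwf1 A B t}"
  "Cell2 (tens A B) = tens2 A B ` {a. gwf2 A B a}"
  by (auto simp: tens_def nat_copy_cells[OF two_category_gray[OF A B] countable_gray] gray_cells[OF A B] image_image tens0_def tens1_def
      tens2_def split_beta)

lemma in_tens_cells:
  "x \<in> Cell0 A ==> y \<in> Cell0 B ==> tens0 A B x y \<in> Cell0 (tens A B)"
  "gwf1 A B t ==> tens1 A B t \<in> Cell1 (tens A B)"
  "gwf2 A B a ==> tens2 A B a \<in> Cell2 (tens A B)"
  unfolding tens_cells by auto

private lemma in_gray: "x \<in> Cell0 A ==> y \<in> Cell0 B ==> G0 (x, y) \<in> cells (gray A B)"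
  "gwf1 A B t ==> class1 A B t \<in> cells (gray A B)"
  "gwf2 A B a ==> class2 A B a \<in> cells (gray A B)"
  by (auto simp: cells_def gray_cells[OF A B])

private lemmas copy = nat_copy_ops[OF two_category_gray[OF A B] countable_gray] gray_ops[OF A B] in_gray

lemma tens_eq:
  "gwf1 A B t ==> gwf1 A B s ==> tens1 A B t = tens1 A B s \<longleftrightarrow> geq1 A B t s"
  "gwf2 A B a ==> gwf2 A B b ==> tens2 A B a = tens2 A B b \<longleftrightarrow> geq2 A B a b"
  using class1_eq[OF A B] class2_eq[OF A B]
  by (auto simp: tens1_def tens2_def encode_eq[OF two_category_gray[OF A B] countable_gray] in_gray)

lemma tens_decode:
  "x \<in> Cell0 A ==> y \<in> Cell0 B ==> decode (gray A B) (tens0 A B x y) = G0 (x, y)"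
  "gwf1 A B t ==> decode (gray A B) (tens1 A B t) = class1 A B t"
  "gwf2 A B a ==> decode (gray A B) (tens2 A B a) = class2 A B a"
  by (auto simp: tens0_def tens1_def tens2_def decode_encode[OF two_category_gray[OF A B] countable_gray] in_gray)

lemma tens_ops:
  "gwf1 A B t ==> src1 (tens A B) (tens1 A B t) = case_prod (tens0 A B) (gsrc1 A B t)"
  "gwf1 A B t ==> tgt1 (tens A B) (tens1 A B t) = case_prod (tens0 A B) (gtgt1 A B t)"
  "x \<in> Cell0 A ==> y \<in> Cell0 B ==> id1 (tens A B) (tens0 A B x y) = tens1 A B (I1 (x, y))"
  "gwf1 A B (C1 t s) ==> comp1 (tens A B) (tens1 A B t) (tens1 A B s) = tens1 A B (C1 t s)"
  "gwf2 A B a ==> src2 (tens A B) (tens2 A B a) = tens1 A B (gsrc2 A B a)"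
  "gwf2 A B a ==> tgt2 (tens A B) (tens2 A B a) = tens1 A B (gtgt2 A B a)"
  "gwf1 A B t ==> id2 (tens A B) (tens1 A B t) = tens2 A B (I2 t)"
  "gwf2 A B (V2 b a) ==> vcomp (tens A B) (tens2 A B b) (tens2 A B a) = tens2 A B (V2 b a)"
  "gwf2 A B (H2 b a) ==> hcomp (tens A B) (tens2 A B b) (tens2 A B a) = tens2 A B (H2 b a)"
  unfolding tens_def tens0_def tens1_def tens2_def by (simp_all add: copy split_beta)

end

text \<open>The generators of the tensor product, assembled into the universal bifunctor.\<close>

definition insl :: "nat two_cat \<Rightarrow> nat two_cat \<Rightarrow> nat \<Rightarrow> (nat, nat) two_fun" where
  "insl A B y = mk_two_fun A (tens A B) (\<lambda>x. tens0 A B x y) (\<lambda>f. tens1 A B (L1 f y)) (\<lambda>\<alpha>. tens2 A B (L2 \<alpha> y))"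

definition insr :: "nat two_cat \<Rightarrow> nat two_cat \<Rightarrow> nat \<Rightarrow> (nat, nat) two_fun" where
  "insr A B x = mk_two_fun B (tens A B) (\<lambda>y. tens0 A B x y) (\<lambda>g. tens1 A B (R1 x g)) (\<lambda>\<beta>. tens2 A B (R2 x \<beta>))"

definition gam :: "nat two_cat \<Rightarrow> nat two_cat \<Rightarrow> nat \<Rightarrow> nat \<Rightarrow> nat" where
  "gam A B f g = tens2 A B (Gam f g)"

text \<open>The data of a 2-functor out of a tensor product: 2-functors in each variable separately, and
  interchange cells subject to the defining relations of the Gray tensor product.\<close>

locale gray_bifunctor =
  fixes A B D :: "nat two_cat" and l r :: "nat \<Rightarrow> (nat, nat) two_fun" and gm :: "nat \<Rightarrow> nat \<Rightarrow> nat"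
  assumes A: "two_category A" and B: "two_category B"
    and l: "y \<in> Cell0 B ==> l y \<in> Hom TwoCat A D"
    and r: "x \<in> Cell0 A ==> r x \<in> Hom TwoCat B D"
    and D: "two_category D"
    and lr: "x \<in> Cell0 A ==> y \<in> Cell0 B ==> Fun0 (r x) y = Fun0 (l y) x"
    and gm: "f \<in> Cell1 A ==> g \<in> Cell1 B ==> gm f g \<in> Cell2 D"
      "f \<in> Cell1 A ==> g \<in> Cell1 B ==>
        src2 D (gm f g) = comp1 D (Fun1 (l (tgt1 B g)) f) (Fun1 (r (src1 A f)) g)"
      "f \<in> Cell1 A ==> g \<in> Cell1 B ==>
        tgt2 D (gm f g) = comp1 D (Fun1 (r (tgt1 A f)) g) (Fun1 (l (src1 B g)) f)"
    and gm_natural_l: "\<alpha> \<in> Cell2 A ==> g \<in> Cell1 B ==>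
        vcomp D (gm (tgt2 A \<alpha>) g)
          (hcomp D (Fun2 (l (tgt1 B g)) \<alpha>) (id2 D (Fun1 (r (src1 A (src2 A \<alpha>))) g))) =
        vcomp D (hcomp D (id2 D (Fun1 (r (tgt1 A (src2 A \<alpha>))) g)) (Fun2 (l (src1 B g)) \<alpha>))
          (gm (src2 A \<alpha>) g)"
    and gm_natural_r: "f \<in> Cell1 A ==> \<beta> \<in> Cell2 B ==>
        vcomp D (gm f (tgt2 B \<beta>))
          (hcomp D (id2 D (Fun1 (l (tgt1 B (src2 B \<beta>))) f)) (Fun2 (r (src1 A f)) \<beta>)) =
        vcomp D (hcomp D (Fun2 (r (tgt1 A f)) \<beta>) (id2 D (Fun1 (l (src1 B (src2 B \<beta>))) f)))
          (gm f (src2 B \<beta>))"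
    and gm_id_l: "x \<in> Cell0 A ==> g \<in> Cell1 B ==> gm (id1 A x) g = id2 D (Fun1 (r x) g)"
    and gm_id_r: "f \<in> Cell1 A ==> y \<in> Cell0 B ==> gm f (id1 B y) = id2 D (Fun1 (l y) f)"
    and gm_comp_l: "f \<in> Cell1 A ==> f' \<in> Cell1 A ==> tgt1 A f = src1 A f' ==> g \<in> Cell1 B ==>
        gm (comp1 A f' f) g =
        vcomp D (hcomp D (gm f' g) (id2 D (Fun1 (l (src1 B g)) f)))
          (hcomp D (id2 D (Fun1 (l (tgt1 B g)) f')) (gm f g))"
    and gm_comp_r: "f \<in> Cell1 A ==> g \<in> Cell1 B ==> g' \<in> Cell1 B ==> tgt1 B g = src1 B g' ==>
        gm f (comp1 B g' g) =
        vcomp D (hcomp D (id2 D (Fun1 (r (tgt1 A f)) g')) (gm f g))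
          (hcomp D (gm f g') (id2 D (Fun1 (r (src1 A f)) g)))"
begin

lemma l_app: "y \<in> Cell0 B ==> l y \<in> Arr TwoCat" "y \<in> Cell0 B ==> TSrc (l y) = A"
  "y \<in> Cell0 B ==> TTgt (l y) = D"
  using l by (auto simp: TwoCat_Hom_iff)

lemma r_app: "x \<in> Cell0 A ==> r x \<in> Arr TwoCat" "x \<in> Cell0 A ==> TSrc (r x) = B"
  "x \<in> Cell0 A ==> TTgt (r x) = D"
  using r by (auto simp: TwoCat_Hom_iff)

text \<open>A bifunctor evaluates terms in its codomain; as it respects all the relations, evaluation descends to a 2-functor on the tensor product.\<close>

fun ev1 :: "(nat, nat) gterm1 \<Rightarrow> nat" where
  "ev1 (I1 p) = id1 D (Fun0 (l (snd p)) (fst p))"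
| "ev1 (L1 f y) = Fun1 (l y) f"
| "ev1 (R1 x g) = Fun1 (r x) g"
| "ev1 (C1 t s) = comp1 D (ev1 t) (ev1 s)"

fun ev2 :: "(nat, nat) gterm2 \<Rightarrow> nat" where
  "ev2 (I2 s) = id2 D (ev1 s)"
| "ev2 (L2 \<alpha> y) = Fun2 (l y) \<alpha>"
| "ev2 (R2 x \<beta>) = Fun2 (r x) \<beta>"
| "ev2 (Gam f g) = gm f g"
| "ev2 (V2 b a) = vcomp D (ev2 b) (ev2 a)"
| "ev2 (H2 b a) = hcomp D (ev2 b) (ev2 a)"

lemmas simps = l_app r_app lr two_fun two_cat_1[OF A] two_cat_1[OF B] two_cat_v[OF A] two_cat_v[OF B]
  two_cat_h[OF A] two_cat_h[OF B] two_cat_ops[OF D] in_Hom_cells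

lemma ev1_ends: "gwf1 A B t ==> ev1 t \<in> Cell1 D \<and>
    src1 D (ev1 t) = Fun0 (l (snd (gsrc1 A B t))) (fst (gsrc1 A B t)) \<and>
    tgt1 D (ev1 t) = Fun0 (l (snd (gtgt1 A B t))) (fst (gtgt1 A B t))"
  by (induction t) (auto simp: simps)

lemma ev1_geq1: "geq1 A B s t ==> ev1 s = ev1 t"
proof (induction rule: geq1.induct)
  case (unit_l s) then show ?case using ev1_ends[of s] by (simp add: simps)
next
  case (unit_r s) then show ?case using ev1_ends[of s] by (simp add: simps)
next
  case (assoc t s r) then show ?case using ev1_ends[of s] ev1_ends[of t] ev1_ends[of r]
    by (auto simp: simps)
qed (auto simp: simps)

lemma ev2_ends: "gwf2 A B a ==> ev2 a \<in> Cell2 D \<and> src2 D (ev2 a) = ev1 (gsrc2 A B a) \<and>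
    tgt2 D (ev2 a) = ev1 (gtgt2 A B a)"
proof (induction a)
  case (I2 s) then show ?case using ev1_ends[of s] by (simp add: simps)
next
  case (V2 b a) then show ?case using ev1_geq1 by (auto simp: simps)
next
  case (H2 b a)
  then show ?case using ev1_ends gwf2_ends[OF A B] by (auto simp: simps)
next
  case (Gam f g) then show ?case by (auto simp: gm)
qed (auto simp: simps)

lemma ev2_geq2: "geq2 A B a b ==> ev2 a = ev2 b"
proof (induction rule: geq2.induct)
  case (I_cong s t) then show ?case using ev1_geq1 by auto
next
  case (V_unit_l a) then show ?case using ev2_ends[of a] by (simp add: simps)
next
  case (V_unit_r a) then show ?case using ev2_ends[of a] by (simp add: simps)
next
  case (V_assoc c b a) then show ?case
    using ev2_ends[of a] ev2_ends[of b] ev2_ends[of c] ev1_geq1[of "gsrc2 A B b" "gtgt2 A B a"]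
      ev1_geq1[of "gsrc2 A B c" "gtgt2 A B b"] by (simp add: simps)
next
  case (H_unit_l a) then show ?case
    using ev2_ends[of a] gwf2_ends[OF A B, of a] gwf1_ends[OF A B, of "gsrc2 A B a"] ev1_ends[of "gsrc2 A B a"]
    by (auto simp: simps)
next
  case (H_unit_r a) then show ?case
    using ev2_ends[of a] gwf2_ends[OF A B, of a] gwf1_ends[OF A B, of "gsrc2 A B a"] ev1_ends[of "gsrc2 A B a"]
    by (auto simp: simps)
next
  case (H_assoc c b a) then show ?case
    using ev2_ends[of a] gwf2_ends[OF A B, of a] ev1_ends[of "gsrc2 A B a"]
      ev2_ends[of b] gwf2_ends[OF A B, of b] ev1_ends[of "gsrc2 A B b"]
      ev2_ends[of c] gwf2_ends[OF A B, of c] ev1_ends[of "gsrc2 A B c"]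
    by (simp add: simps)
next
  case (H_id t s) then show ?case using ev1_ends[of s] ev1_ends[of t] by (simp add: simps)
next
  case (interchange b' b a' a)
  then show ?case
    using ev2_ends[of a] gwf2_ends[OF A B, of a] ev1_ends[of "gsrc2 A B a"]
      ev2_ends[of b] gwf2_ends[OF A B, of b] ev1_ends[of "gsrc2 A B b"]
      ev2_ends[of a'] ev2_ends[of b'] ev1_geq1[of "gsrc2 A B b'" "gtgt2 A B b"]
      ev1_geq1[of "gsrc2 A B a'" "gtgt2 A B a"]
    by (simp add: interchange_cells[OF D])
next
  case Gam_natural_l then show ?case using gm_natural_l by (auto simp: in_Hom_cells)
next
  case Gam_natural_r then show ?case using gm_natural_r by (auto simp: in_Hom_cells)
next
  case Gam_comp_l then show ?case using gm_comp_l by (auto simp: in_Hom_cells)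
next
  case Gam_comp_r then show ?case using gm_comp_r by (auto simp: in_Hom_cells)
qed (auto simp: simps gm_id_l gm_id_r)

definition extension :: "(nat, nat) two_fun" where
  "extension = mk_two_fun (tens A B) D
     (\<lambda>c. case decode (gray A B) c of G0 p \<Rightarrow> Fun0 (l (snd p)) (fst p))
     (\<lambda>c. ev1 (rep1 (decode (gray A B) c)))
     (\<lambda>c. ev2 (rep2 (decode (gray A B) c)))"

lemma extension_app:
  "x \<in> Cell0 A ==> y \<in> Cell0 B ==> Fun0 extension (tens0 A B x y) = Fun0 (l y) x"
  "gwf1 A B t ==> Fun1 extension (tens1 A B t) = ev1 t"
  "gwf2 A B a ==> Fun2 extension (tens2 A B a) = ev2 a"
  unfolding extension_def
  using ev1_geq1[OF rep1[OF A B]] ev2_geq2[OF rep2[OF A B]]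
  by (simp_all add: in_tens_cells[OF A B] tens_decode[OF A B])

lemma extension_Hom: "extension \<in> Hom TwoCat (tens A B) D"
proof -
  note T = tens_ops[OF A B] in_tens_cells[OF A B]
  have *: "two_functor (tens A B) D (Fun0 extension) (Fun1 extension) (Fun2 extension)"
  proof (rule two_functorI[OF _ _ _ _ _ _ _ _ tens_two_cat[OF A B] D])
    fix x assume "x \<in> Cell0 (tens A B)"
    then obtain a b where x: "x = tens0 A B a b" "a \<in> Cell0 A" "b \<in> Cell0 B"
      by (auto simp: tens_cells[OF A B])
    then show "Fun0 extension x \<in> Cell0 D" by (simp add: extension_app simps)
    show "Fun1 extension (id1 (tens A B) x) = id1 D (Fun0 extension x)"
      using x by (simp add: T extension_app)
  next
    fix f assume "f \<in> Cell1 (tens A B)"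
    then obtain t where t: "f = tens1 A B t" "gwf1 A B t" by (auto simp: tens_cells[OF A B])
    then show "Fun1 extension f \<in> Cell1 D \<and> src1 D (Fun1 extension f) = Fun0 extension (src1 (tens A B) f) \<and>
        tgt1 D (Fun1 extension f) = Fun0 extension (tgt1 (tens A B) f)"
      using ev1_ends[of t] gwf1_ends[OF A B t(2)] by (auto simp: T extension_app)
    show "Fun2 extension (id2 (tens A B) f) = id2 D (Fun1 extension f)"
      using t by (simp add: T extension_app)
    fix g assume "g \<in> Cell1 (tens A B)" and fg: "tgt1 (tens A B) f = src1 (tens A B) g"
    then obtain s where s: "g = tens1 A B s" "gwf1 A B s" by (auto simp: tens_cells[OF A B])
    have "gwf1 A B (C1 s t)"
      using s t fg gwf1_ends[OF A B t(2)] gwf1_ends[OF A B s(2)]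
      by (auto simp: T dest!: arg_cong[of _ _ "decode (gray A B)"] simp: tens_decode[OF A B])
    then show "Fun1 extension (comp1 (tens A B) g f) = comp1 D (Fun1 extension g) (Fun1 extension f)"
      using s t by (simp add: T extension_app del: gwf1.simps)
  next
    fix \<alpha> assume "\<alpha> \<in> Cell2 (tens A B)"
    then obtain a where a: "\<alpha> = tens2 A B a" "gwf2 A B a" by (auto simp: tens_cells[OF A B])
    note wa = gwf2_ends[OF A B a(2)]
    then show "Fun2 extension \<alpha> \<in> Cell2 D \<and> src2 D (Fun2 extension \<alpha>) = Fun1 extension (src2 (tens A B) \<alpha>) \<and>
        tgt2 D (Fun2 extension \<alpha>) = Fun1 extension (tgt2 (tens A B) \<alpha>)"
      using ev2_ends[of a] a by (auto simp: T extension_app)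
    fix \<beta> assume "\<beta> \<in> Cell2 (tens A B)"
    then obtain b where b: "\<beta> = tens2 A B b" "gwf2 A B b" by (auto simp: tens_cells[OF A B])
    note wb = gwf2_ends[OF A B b(2)]
    {
      assume "tgt2 (tens A B) \<alpha> = src2 (tens A B) \<beta>"
      then have "gwf2 A B (V2 b a)"
        using a b wa wb by (auto simp: T tens_eq[OF A B] intro: geq1.sym)
      then show "Fun2 extension (vcomp (tens A B) \<beta> \<alpha>) = vcomp D (Fun2 extension \<beta>) (Fun2 extension \<alpha>)"
        using a b by (simp add: T extension_app del: gwf2.simps)
    next
      assume "tgt1 (tens A B) (src2 (tens A B) \<alpha>) = src1 (tens A B) (src2 (tens A B) \<beta>)"
      then have "gwf2 A B (H2 b a)"
        using a b wa wb gwf1_ends[OF A B, of "gsrc2 A B a"] gwf1_ends[OF A B, of "gsrc2 A B b"]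
        by (auto simp: T dest!: arg_cong[of _ _ "decode (gray A B)"] simp: tens_decode[OF A B])
      then show "Fun2 extension (hcomp (tens A B) \<beta> \<alpha>) = hcomp D (Fun2 extension \<beta>) (Fun2 extension \<alpha>)"
        using a b by (simp add: T extension_app del: gwf2.simps)
    }
  qed
  have "extension = mk_two_fun (tens A B) D (Fun0 extension) (Fun1 extension) (Fun2 extension)"
    by (simp add: extension_def mk_two_fun_def)
  then have "extension \<in> Arr TwoCat"
    using mk_two_fun_Arr[OF tens_two_cat[OF A B] D *] by simp
  then show ?thesis by (simp add: TwoCat_Hom_iff extension_def)
qed

end

context
  fixes A B :: "nat two_cat"
  assumes A: "two_category A" and B: "two_category B"
begin

private lemmas tens_cells_ops = tens_ops[OF A B] in_tens_cells[OF A B]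

private lemmas Hom_geq = geq1.L_comp[unfolded in_Hom_cells] geq2.L_vcomp[unfolded in_Hom_cells]
  geq2.L_hcomp[unfolded in_Hom_cells] geq1.R_comp[unfolded in_Hom_cells]
  geq2.R_vcomp[unfolded in_Hom_cells] geq2.R_hcomp[unfolded in_Hom_cells]

lemma insl_Hom: "y \<in> Cell0 B ==> insl A B y \<in> Hom TwoCat A (tens A B)"
  unfolding insl_def TwoCat_Hom_iff mk_two_fun_app
  apply (intro conjI refl mk_two_fun_Arr A tens_two_cat B two_functorI)
  by (auto simp: tens_cells_ops two_cat_ops[OF A] tens_eq[OF A B] geq1.refl
      intro: geq1.L_id geq2.L_id2 Hom_geq)

lemma insr_Hom: "x \<in> Cell0 A ==> insr A B x \<in> Hom TwoCat B (tens A B)"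
  unfolding insr_def TwoCat_Hom_iff mk_two_fun_app
  apply (intro conjI refl mk_two_fun_Arr B tens_two_cat A two_functorI)
  by (auto simp: tens_cells_ops two_cat_ops[OF B] tens_eq[OF A B] geq1.refl
      intro: geq1.R_id geq2.R_id2 Hom_geq)

lemma ins_app:
  "y \<in> Cell0 B ==> insl A B y \<in> Arr TwoCat" "TSrc (insl A B y) = A" "TTgt (insl A B y) = tens A B"
  "x \<in> Cell0 A ==> insr A B x \<in> Arr TwoCat" "TSrc (insr A B x) = B" "TTgt (insr A B x) = tens A B"
  "x \<in> Cell0 A ==> Fun0 (insl A B y) x = tens0 A B x y"
  "y \<in> Cell0 B ==> Fun0 (insr A B x) y = tens0 A B x y"
  using insl_Hom insr_Hom by (auto simp: TwoCat_Hom_iff insl_def insr_def)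

lemma tens_generators:
  "f \<in> Cell1 A ==> tens1 A B (L1 f y) = Fun1 (insl A B y) f"
  "g \<in> Cell1 B ==> tens1 A B (R1 x g) = Fun1 (insr A B x) g"
  "\<alpha> \<in> Cell2 A ==> tens2 A B (L2 \<alpha> y) = Fun2 (insl A B y) \<alpha>"
  "\<beta> \<in> Cell2 B ==> tens2 A B (R2 x \<beta>) = Fun2 (insr A B x) \<beta>"
  "tens2 A B (Gam f g) = gam A B f g"
  by (simp_all add: insl_def insr_def gam_def)

text \<open>The universal bifunctor: it holds by the relations imposed on \<open>\<gamma>\<close>.\<close>

lemma gray_bifunctor_tens: "gray_bifunctor A B (tens A B) (insl A B) (insr A B) (gam A B)"
proof -
  note S = two_cat_1[OF A] two_cat_1[OF B] two_cat_v[OF A] two_cat_v[OF B] in_Hom_cells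
  have g: "tens2 A B a = tens2 A B b" if "geq2 A B a b" for a b
    using that geq2_ends[OF A B] tens_eq(2)[OF A B] by blast
  have u1: "Fun1 (insl A B y) f = tens1 A B (L1 f y)" if "f \<in> Cell1 A" for f y
    by (simp add: that tens_generators)
  have u2: "Fun1 (insr A B x) f = tens1 A B (R1 x f)" if "f \<in> Cell1 B" for f x
    by (simp add: that tens_generators)
  have u3: "Fun2 (insl A B y) f = tens2 A B (L2 f y)" if "f \<in> Cell2 A" for f y
    by (simp add: that tens_generators)
  have u4: "Fun2 (insr A B x) f = tens2 A B (R2 x f)" if "f \<in> Cell2 B" for f x
    by (simp add: that tens_generators)
  note u = u1 u2 u3 u4 gam_def
  have V: "vcomp (tens A B) (tens2 A B b) (tens2 A B a) = tens2 A B (V2 b a)"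
    if "geq2 A B (V2 b a) c \<or> geq2 A B c (V2 b a)" for a b c
    using that geq2_ends[OF A B] by (intro tens_cells_ops) blast
  have H: "hcomp (tens A B) (tens2 A B b) (tens2 A B a) = tens2 A B (H2 b a)"
    if "gwf2 A B (H2 b a)" for a b
    using that by (intro tens_cells_ops)
  show ?thesis
  proof (rule gray_bifunctor.intro, goal_cases)
    case (10 \<alpha> g)
    note e = geq2.Gam_natural_l[of \<alpha> A "src2 A \<alpha>" "tgt2 A \<alpha>" "src1 A (src2 A \<alpha>)" "tgt1 A (src2 A \<alpha>)" g B
        "src1 B g" "tgt1 B g"]
    have e: "geq2 A B (V2 (Gam (tgt2 A \<alpha>) g) (H2 (L2 \<alpha> (tgt1 B g)) (I2 (R1 (src1 A (src2 A \<alpha>)) g))))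
       (V2 (H2 (I2 (R1 (tgt1 A (src2 A \<alpha>)) g)) (L2 \<alpha> (src1 B g))) (Gam (src2 A \<alpha>) g))"
      by (rule e) (use 10 in \<open>auto simp: S\<close>)
    show ?case using 10 g[OF e] V[of _ _ _, OF disjI1[OF e]] V[of _ _ _, OF disjI2[OF e]]
        geq2_ends[OF A B e]
      by (simp add: u tens_cells_ops S H)
  next
    case (11 f \<beta>)
    note e = geq2.Gam_natural_r[of f A "src1 A f" "tgt1 A f" \<beta> B "src2 B \<beta>" "tgt2 B \<beta>"
        "src1 B (src2 B \<beta>)" "tgt1 B (src2 B \<beta>)"]
    have e: "geq2 A B (V2 (Gam f (tgt2 B \<beta>)) (H2 (I2 (L1 f (tgt1 B (src2 B \<beta>)))) (R2 (src1 A f) \<beta>)))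
       (V2 (H2 (R2 (tgt1 A f) \<beta>) (I2 (L1 f (src1 B (src2 B \<beta>))))) (Gam f (src2 B \<beta>)))"
      by (rule e) (use 11 in \<open>auto simp: S\<close>)
    show ?case using 11 g[OF e] V[of _ _ _, OF disjI1[OF e]] V[of _ _ _, OF disjI2[OF e]]
        geq2_ends[OF A B e]
      by (simp add: u tens_cells_ops S H)
  next
    case (14 f f' g)
    note e = geq2.Gam_comp_l[of f A "src1 A f" "tgt1 A f" f' "tgt1 A f'" g B "src1 B g" "tgt1 B g"]
    have e: "geq2 A B (Gam (comp1 A f' f) g) (V2 (H2 (Gam f' g) (I2 (L1 f (src1 B g))))
        (H2 (I2 (L1 f' (tgt1 B g))) (Gam f g)))"
      by (rule e) (use 14 in \<open>auto simp: S\<close>)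
    show ?case using 14 g[OF e] V[of _ _ _, OF disjI2[OF e]] geq2_ends[OF A B e]
      by (simp add: u tens_cells_ops S H)
  next
    case (15 f g g')
    note e = geq2.Gam_comp_r[of f A "src1 A f" "tgt1 A f" g B "src1 B g" "tgt1 B g" g' "tgt1 B g'"]
    have e: "geq2 A B (Gam f (comp1 B g' g)) (V2 (H2 (I2 (R1 (tgt1 A f) g')) (Gam f g))
        (H2 (Gam f g') (I2 (R1 (src1 A f) g))))"
      by (rule e) (use 15 in \<open>auto simp: S\<close>)
    show ?case using 15 g[OF e] V[of _ _ _, OF disjI2[OF e]] geq2_ends[OF A B e]
      by (simp add: u tens_cells_ops S H)
  next
    case (12 x g) then show ?case by (simp add: u tens_cells_ops g[OF geq2.Gam_id_l])
  next
    case (13 f y) then show ?case by (simp add: u tens_cells_ops g[OF geq2.Gam_id_r])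
  qed (auto simp: A B ins_app tens_two_cat[OF A B] insl_Hom insr_Hom u tens_cells_ops S)
qed

text \<open>Induction on cells, in place of induction on the terms that represent them.\<close>

lemma tens_induct1 [consumes 1, case_names L R comp]:
  assumes "c \<in> Cell1 (tens A B)"
    and "\<And>f y. f \<in> Cell1 A ==> y \<in> Cell0 B ==> P (Fun1 (insl A B y) f)"
    and "\<And>x g. x \<in> Cell0 A ==> g \<in> Cell1 B ==> P (Fun1 (insr A B x) g)"
    and "\<And>s t. s \<in> Cell1 (tens A B) ==> t \<in> Cell1 (tens A B) ==>
      tgt1 (tens A B) s = src1 (tens A B) t ==> P s ==> P t ==> P (comp1 (tens A B) t s)"
  shows "P c"
proof -
  have "P (tens1 A B t)" if "gwf1 A B t" for t
    using that
  proof (induction t)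
    case (I1 p)
    have "tens1 A B (L1 (id1 A (fst p)) (snd p)) = tens1 A B (I1 p)"
      using I1 geq1.L_id[of "fst p" A "snd p" B] by (auto simp: tens_eq[OF A B] two_cat_1[OF A])
    then show ?case
      using assms(2)[of "id1 A (fst p)" "snd p"] I1 by (auto simp: two_cat_1[OF A] tens_generators)
  next
    case (C1 t s)
    then have "P (comp1 (tens A B) (tens1 A B t) (tens1 A B s))"
      by (intro assms(4)) (auto simp: tens_cells_ops)
    then show ?case using tens_cells_ops(4)[OF C1.prems] by simp
  qed (use assms(2,3) in \<open>auto simp: tens_generators\<close>)
  then show ?thesis using assms(1) by (auto simp: tens_cells[OF A B])
qed

lemma tens_induct2 [consumes 1, case_names id L R gam V H]:
  assumes "c \<in> Cell2 (tens A B)"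
    and "\<And>s. s \<in> Cell1 (tens A B) ==> P (id2 (tens A B) s)"
    and "\<And>\<alpha> y. \<alpha> \<in> Cell2 A ==> y \<in> Cell0 B ==> P (Fun2 (insl A B y) \<alpha>)"
    and "\<And>x \<beta>. x \<in> Cell0 A ==> \<beta> \<in> Cell2 B ==> P (Fun2 (insr A B x) \<beta>)"
    and "\<And>f g. f \<in> Cell1 A ==> g \<in> Cell1 B ==> P (gam A B f g)"
    and "\<And>a b. a \<in> Cell2 (tens A B) ==> b \<in> Cell2 (tens A B) ==>
      tgt2 (tens A B) a = src2 (tens A B) b ==> P a ==> P b ==> P (vcomp (tens A B) b a)"
    and "\<And>a b. a \<in> Cell2 (tens A B) ==> b \<in> Cell2 (tens A B) ==>
      tgt1 (tens A B) (src2 (tens A B) a) = src1 (tens A B) (src2 (tens A B) b) ==>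
      P a ==> P b ==> P (hcomp (tens A B) b a)"
  shows "P c"
proof -
  have "P (tens2 A B t)" if "gwf2 A B t" for t
    using that
  proof (induction t)
    case (I2 s) then show ?case using assms(2)[of "tens1 A B s"] by (auto simp: tens_cells_ops)
  next
    case (V2 b a)
    then have "P (vcomp (tens A B) (tens2 A B b) (tens2 A B a))"
      using gwf2_ends[OF A B, of a] gwf2_ends[OF A B, of b]
      by (intro assms(6)) (auto simp: tens_cells_ops tens_eq[OF A B] intro: geq1.sym)
    then show ?case using tens_cells_ops(8)[OF V2.prems] by simp
  next
    case (H2 b a)
    then have "P (hcomp (tens A B) (tens2 A B b) (tens2 A B a))"
      using gwf2_ends[OF A B, of a] gwf2_ends[OF A B, of b]
      by (intro assms(7)) (auto simp: tens_cells_ops)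
    then show ?case using tens_cells_ops(9)[OF H2.prems] by simp
  qed (use assms(3-5) in \<open>auto simp: tens_generators\<close>)
  then show ?thesis using assms(1) by (auto simp: tens_cells[OF A B])
qed

text \<open>The uniqueness half of the universal property.\<close>

lemma tens_fun_eqI:
  assumes "F \<in> Arr TwoCat" "G \<in> Arr TwoCat" "TSrc F = tens A B" "TSrc G = tens A B" "TTgt F = TTgt G"
    and l: "\<And>y. y \<in> Cell0 B ==> Comp TwoCat F (insl A B y) = Comp TwoCat G (insl A B y)"
    and r: "\<And>x. x \<in> Cell0 A ==> Comp TwoCat F (insr A B x) = Comp TwoCat G (insr A B x)"
    and g: "\<And>f g. f \<in> Cell1 A ==> g \<in> Cell1 B ==> Fun2 F (gam A B f g) = Fun2 G (gam A B f g)"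
  shows "F = G"
proof (rule two_fun_eqI)
  have L: "x \<in> Cell0 A ==> Fun0 F (tens0 A B x y) = Fun0 G (tens0 A B x y)"
    "f \<in> Cell1 A ==> Fun1 F (Fun1 (insl A B y) f) = Fun1 G (Fun1 (insl A B y) f)"
    "\<alpha> \<in> Cell2 A ==> Fun2 F (Fun2 (insl A B y) \<alpha>) = Fun2 G (Fun2 (insl A B y) \<alpha>)"
    if "y \<in> Cell0 B" for x y f \<alpha>
    using that arg_cong[OF l[OF that], of "\<lambda>F. Fun0 F x"] arg_cong[OF l[OF that], of "\<lambda>F. Fun1 F f"]
      arg_cong[OF l[OF that], of "\<lambda>F. Fun2 F \<alpha>"]
    by (simp_all add: two_fun_comp ins_app)
  have R: "f \<in> Cell1 B ==> Fun1 F (Fun1 (insr A B x) f) = Fun1 G (Fun1 (insr A B x) f)"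
    "\<alpha> \<in> Cell2 B ==> Fun2 F (Fun2 (insr A B x) \<alpha>) = Fun2 G (Fun2 (insr A B x) \<alpha>)"
    if "x \<in> Cell0 A" for x f \<alpha>
    using that arg_cong[OF r[OF that], of "\<lambda>F. Fun1 F f"] arg_cong[OF r[OF that], of "\<lambda>F. Fun2 F \<alpha>"]
    by (simp_all add: two_fun_comp ins_app)
  show "Fun0 F x = Fun0 G x" if "x \<in> Cell0 (TSrc F)" for x
    using that L assms(3) by (auto simp: tens_cells[OF A B])
  show *: "Fun1 F x = Fun1 G x" if "x \<in> Cell1 (TSrc F)" for x
    using that unfolding assms(3)
    by (induction x rule: tens_induct1) (use assms(1-5) L R in \<open>auto simp: two_fun\<close>)
  show "Fun2 F x = Fun2 G x" if "x \<in> Cell2 (TSrc F)" for x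
    using that unfolding assms(3)
    by (induction x rule: tens_induct2) (use assms(1-5) L R g * in \<open>auto simp: two_fun\<close>)
qed (use assms in auto)

end

locale tens_pair =
  fixes A B :: "nat two_cat"
  assumes "two_category A" "two_category B"
begin

sublocale gray_bifunctor A B "tens A B" "insl A B" "insr A B" "gam A B"
  by (rule gray_bifunctor_tens) (use tens_pair_axioms in \<open>auto simp: tens_pair_def\<close>)

end

context gray_bifunctor
begin

lemma extension:
  "extension \<in> Arr TwoCat" "TSrc extension = tens A B" "TTgt extension = D"
  "x \<in> Cell0 A ==> y \<in> Cell0 B ==> Fun0 extension (tens0 A B x y) = Fun0 (l y) x"
  "f \<in> Cell1 A ==> y \<in> Cell0 B ==> Fun1 extension (Fun1 (insl A B y) f) = Fun1 (l y) f"
  "x \<in> Cell0 A ==> g \<in> Cell1 B ==> Fun1 extension (Fun1 (insr A B x) g) = Fun1 (r x) g"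
  "\<alpha> \<in> Cell2 A ==> y \<in> Cell0 B ==> Fun2 extension (Fun2 (insl A B y) \<alpha>) = Fun2 (l y) \<alpha>"
  "x \<in> Cell0 A ==> \<beta> \<in> Cell2 B ==> Fun2 extension (Fun2 (insr A B x) \<beta>) = Fun2 (r x) \<beta>"
  "f \<in> Cell1 A ==> g \<in> Cell1 B ==> Fun2 extension (gam A B f g) = gm f g"
  using extension_Hom extension_app
  by (auto simp: TwoCat_Hom_iff extension_app simp flip: tens_generators[OF A B])

end

subsection \<open>Functoriality\<close>

definition tens_fun :: "(nat, nat) two_fun \<Rightarrow> (nat, nat) two_fun \<Rightarrow> (nat, nat) two_fun" where
  "tens_fun F G = nat_copy_fun (gray_fun F G)"

lemma tens_fun_ends: "TSrc (tens_fun F G) = tens (TSrc F) (TSrc G)" "TTgt (tens_fun F G) = tens (TTgt F) (TTgt G)"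
  by (simp_all add: tens_fun_def nat_copy_fun_def gray_fun_def Let_def tens_def)

context
  fixes F G :: "(nat, nat) two_fun" and A B A' B' assumes F: "F \<in> Arr TwoCat" and G: "G \<in> Arr TwoCat"
    and ends: "TSrc F = A" "TTgt F = A'" "TSrc G = B" "TTgt G = B'"
begin

private lemma cats: "two_category A" "two_category B" "two_category A'" "two_category B'"
  using Arr_TwoCat_ends F G ends by auto

lemma gray_bifunctor_tens_fun:
  "gray_bifunctor A B (tens A' B') (\<lambda>y. Comp TwoCat (insl A' B' (Fun0 G y)) F)
     (\<lambda>x. Comp TwoCat (insr A' B' (Fun0 F x)) G) (\<lambda>f g. gam A' B' (Fun1 F f) (Fun1 G g))"
proof -
  note A = cats(1) and B = cats(2) and A' = cats(3) and B' = cats(4)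
  interpret u: gray_bifunctor A' B' "tens A' B'" "insl A' B'" "insr A' B'" "gam A' B'"
    by (rule gray_bifunctor_tens[OF A' B'])
  have app: "x \<in> Cell0 A ==> Fun0 F x \<in> Cell0 A'" "y \<in> Cell0 B ==> Fun0 G y \<in> Cell0 B'"
    "f \<in> Cell1 A ==> Fun1 F f \<in> Cell1 A'" "g \<in> Cell1 B ==> Fun1 G g \<in> Cell1 B'"
    "\<alpha> \<in> Cell2 A ==> Fun2 F \<alpha> \<in> Cell2 A'" "\<beta> \<in> Cell2 B ==> Fun2 G \<beta> \<in> Cell2 B'" for x y f g \<alpha> \<beta>
    using F G ends by (auto simp: two_fun)
  note S = two_cat_1[OF A] two_cat_1[OF B] two_cat_v[OF A] two_cat_v[OF B] F G ends app
    two_fun_comp ins_app[OF A' B'] TwoCat_Hom_iff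
  have push: "Fun1 F (src2 A \<alpha>) = src2 A' (Fun2 F \<alpha>)" "Fun1 F (tgt2 A \<alpha>) = tgt2 A' (Fun2 F \<alpha>)"
    "Fun0 F (src1 A f) = src1 A' (Fun1 F f)" "Fun0 F (tgt1 A f) = tgt1 A' (Fun1 F f)"
    if "\<alpha> \<in> Cell2 A" "f \<in> Cell1 A" for f \<alpha> using that F ends by (auto simp: two_fun)
  have push': "Fun1 G (src2 B \<alpha>) = src2 B' (Fun2 G \<alpha>)" "Fun1 G (tgt2 B \<alpha>) = tgt2 B' (Fun2 G \<alpha>)"
    "Fun0 G (src1 B f) = src1 B' (Fun1 G f)" "Fun0 G (tgt1 B f) = tgt1 B' (Fun1 G f)"
    if "\<alpha> \<in> Cell2 B" "f \<in> Cell1 B" for f \<alpha> using that G ends by (auto simp: two_fun)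
  show ?thesis
  proof (rule gray_bifunctor.intro, goal_cases)
    case (10 \<alpha> g) then show ?case using u.gm_natural_l[of "Fun2 F \<alpha>" "Fun1 G g"]
      by (simp add: S two_fun)
  next
    case (11 f \<beta>) then show ?case using u.gm_natural_r[of "Fun1 F f" "Fun2 G \<beta>"]
      by (simp add: S two_fun)
  next
    case (12 x g) then show ?case using u.gm_id_l[of "Fun0 F x" "Fun1 G g"]
      by (simp add: S two_fun)
  next
    case (13 f y) then show ?case using u.gm_id_r[of "Fun1 F f" "Fun0 G y"]
      by (simp add: S two_fun)
  next
    case (14 f f' g) then show ?case using u.gm_comp_l[of "Fun1 F f" "Fun1 F f'" "Fun1 G g"]
      by (simp add: S two_fun)
  next
    case (15 f g g') then show ?case using u.gm_comp_r[of "Fun1 F f" "Fun1 G g" "Fun1 G g'"]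
      by (simp add: S two_fun)
  qed (auto simp: A B tens_two_cat[OF A' B'] S two_fun u.gm)
qed

text \<open>The given action on arrows is recognised as the 2-functor induced by a bifunctor, so that all that follows can use the universal property in place of terms.\<close>

lemma tens_fun_extension: "tens_fun F G =
  gray_bifunctor.extension A B (tens A' B') (\<lambda>y. Comp TwoCat (insl A' B' (Fun0 G y)) F)
     (\<lambda>x. Comp TwoCat (insr A' B' (Fun0 F x)) G) (\<lambda>f g. gam A' B' (Fun1 F f) (Fun1 G g))"
  (is "_ = gray_bifunctor.extension _ _ _ ?l ?r ?g")
proof -
  note A = cats(1) and B = cats(2) and A' = cats(3) and B' = cats(4)
  interpret e: gray_bifunctor A B "tens A' B'" ?l ?r ?g by (rule gray_bifunctor_tens_fun)
  have app: "x \<in> Cell0 A ==> Fun0 F x \<in> Cell0 A'" "y \<in> Cell0 B ==> Fun0 G y \<in> Cell0 B'"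
    "f \<in> Cell1 A ==> Fun1 F f \<in> Cell1 A'" "g \<in> Cell1 B ==> Fun1 G g \<in> Cell1 B'"
    "\<alpha> \<in> Cell2 A ==> Fun2 F \<alpha> \<in> Cell2 A'" "\<beta> \<in> Cell2 B ==> Fun2 G \<beta> \<in> Cell2 B'" for x y f g \<alpha> \<beta>
    using F G ends by (auto simp: two_fun)
  note S = two_cat_1[OF A] two_cat_1[OF B] two_cat_v[OF A] two_cat_v[OF B] F G ends app
    two_fun_comp ins_app[OF A' B']
  have m0: "gsrc1 A' B' (gmap1 F G t) = map_prod (Fun0 F) (Fun0 G) (gsrc1 A B t)"
    "gtgt1 A' B' (gmap1 F G t) = map_prod (Fun0 F) (Fun0 G) (gtgt1 A B t)" if "gwf1 A B t" for t
    using that by (induction t) (auto simp: S two_fun)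
  have m1: "gwf1 A' B' (gmap1 F G t) \<and> e.ev1 t = tens1 A' B' (gmap1 F G t)" if "gwf1 A B t" for t
    using that
  proof (induction t)
    case (C1 t s)
    then have w: "gwf1 A' B' (C1 (gmap1 F G t) (gmap1 F G s))" by (simp add: m0)
    show ?case using C1 w tens_ops(4)[OF A' B' w] by simp
  qed (auto simp: S tens_ops[OF A' B'] tens_generators[OF A' B'])
  have eq1: "geq1 A' B' (gmap1 F G s) (gmap1 F G t)" if "geq1 A B s t" for s t
    using e.ev1_geq1[OF that] geq1_ends[OF A B that] m1 tens_eq(1)[OF A' B'] by auto
  have m2s: "gsrc2 A' B' (gmap2 F G a) = gmap1 F G (gsrc2 A B a)"
    "gtgt2 A' B' (gmap2 F G a) = gmap1 F G (gtgt2 A B a)" if "gwf2 A B a" for a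
    using that by (induction a) (auto simp: S two_fun)
  have m2: "gwf2 A' B' (gmap2 F G a) \<and> e.ev2 a = tens2 A' B' (gmap2 F G a)" if "gwf2 A B a" for a
    using that
  proof (induction a)
    case (V2 b a)
    then have w: "gwf2 A' B' (V2 (gmap2 F G b) (gmap2 F G a))" by (simp add: m2s eq1)
    show ?case using V2 w tens_ops(8)[OF A' B' w] by simp
  next
    case (H2 b a)
    then have w: "gwf2 A' B' (H2 (gmap2 F G b) (gmap2 F G a))"
      using gwf2_ends[OF A B] by (simp add: m2s m0)
    show ?case using H2 w tens_ops(9)[OF A' B' w] by simp
  qed (auto simp: S m1 tens_ops[OF A' B'] tens_generators[OF A' B'])
  have eq2: "geq2 A' B' (gmap2 F G a) (gmap2 F G b)" if "geq2 A B a b" for a b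
    using e.ev2_geq2[OF that] geq2_ends[OF A B that] m2 tens_eq(2)[OF A' B'] by auto
  have enc: "encode (gray A' B') (class1 A' B' (gmap1 F G (rep1 (class1 A B t)))) = e.ev1 t"
    if "gwf1 A B t" for t
    using m1[OF that] class_eqI(1)[OF A' B' eq1[OF rep1[OF A B that]]] by (simp add: tens1_def)
  have enc2: "encode (gray A' B') (class2 A' B' (gmap2 F G (rep2 (class2 A B a)))) = e.ev2 a"
    if "gwf2 A B a" for a
    using m2[OF that] class_eqI(2)[OF A' B' eq2[OF rep2[OF A B that]]] by (simp add: tens2_def)
  note D = tens_decode[OF A B] gray_cells[OF A B] e.extension_app
  have c: "e.ev1 s = e.ev1 t" if "class1 A B t = class1 A B s" "gwf1 A B t" "gwf1 A B s" for s t
    using e.ev1_geq1[of t s] class1_eq[OF A B that(2,3)] that(1) by simp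
  have c2: "e.ev2 a = e.ev2 b" if "class2 A B b = class2 A B a" "gwf2 A B b" "gwf2 A B a" for a b
    using e.ev2_geq2[of b a] class2_eq[OF A B that(2,3)] that(1) by simp
  have r: "tens_fun F G = mk_two_fun (tens A B) (tens A' B') (Fun0 e.extension) (Fun1 e.extension) (Fun2 e.extension)"
    unfolding tens_fun_def nat_copy_fun_def gray_fun_def Let_def mk_two_fun_app ends tens_def[symmetric]
    unfolding mk_two_fun_def two_fun.simps
    by (rule two_fun.equality; simp; rule restrict_ext)
      (auto simp: tens_cells[OF A B] D enc enc2 S tens0_def[of A' B'] intro: c c2)
  also have "\<dots> = e.extension" by (simp add: e.extension_def mk_two_fun_def)
  finally show ?thesis .
qed

lemma tens_fun:
  "tens_fun F G \<in> Arr TwoCat"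
  "x \<in> Cell0 A ==> y \<in> Cell0 B ==> Fun0 (tens_fun F G) (tens0 A B x y) = tens0 A' B' (Fun0 F x) (Fun0 G y)"
  "f \<in> Cell1 A ==> y \<in> Cell0 B ==>
    Fun1 (tens_fun F G) (Fun1 (insl A B y) f) = Fun1 (insl A' B' (Fun0 G y)) (Fun1 F f)"
  "x \<in> Cell0 A ==> g \<in> Cell1 B ==>
    Fun1 (tens_fun F G) (Fun1 (insr A B x) g) = Fun1 (insr A' B' (Fun0 F x)) (Fun1 G g)"
  "\<alpha> \<in> Cell2 A ==> y \<in> Cell0 B ==>
    Fun2 (tens_fun F G) (Fun2 (insl A B y) \<alpha>) = Fun2 (insl A' B' (Fun0 G y)) (Fun2 F \<alpha>)"
  "x \<in> Cell0 A ==> \<beta> \<in> Cell2 B ==>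
    Fun2 (tens_fun F G) (Fun2 (insr A B x) \<beta>) = Fun2 (insr A' B' (Fun0 F x)) (Fun2 G \<beta>)"
  "f \<in> Cell1 A ==> g \<in> Cell1 B ==> Fun2 (tens_fun F G) (gam A B f g) = gam A' B' (Fun1 F f) (Fun1 G g)"
  unfolding tens_fun_extension
  using gray_bifunctor.extension[OF gray_bifunctor_tens_fun]
  by (simp_all add: two_fun_comp ends two_fun F G ins_app[OF cats(3,4)])

end

section \<open>Pasting squares\<close>

text \<open>A 2-cell \<open>\<sigma> : v k \<Rightarrow> k' u\<close>, drawn with vertical edges \<open>k\<close>, \<open>k'\<close> and horizontal edges \<open>u\<close>,
  \<open>v\<close>. The orientation is that of \<open>\<gamma>\<^bsub>f,g\<^esub>\<close>, which has vertical edges \<open>(x,g)\<close>, \<open>(x',g)\<close> and horizontal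
  edges \<open>(f,y)\<close>, \<open>(f,y')\<close>.\<close>

definition square :: "'c two_cat \<Rightarrow> 'c \<Rightarrow> 'c \<Rightarrow> 'c \<Rightarrow> 'c \<Rightarrow> 'c \<Rightarrow> bool" where
  "square D k k' u v \<sigma> \<longleftrightarrow> k \<in> Cell1 D \<and> k' \<in> Cell1 D \<and> u \<in> Cell1 D \<and> v \<in> Cell1 D \<and> \<sigma> \<in> Cell2 D \<and>
     src1 D u = src1 D k \<and> src1 D v = tgt1 D k \<and> src1 D k' = tgt1 D u \<and> tgt1 D k' = tgt1 D v \<and>
     src2 D \<sigma> = comp1 D v k \<and> tgt2 D \<sigma> = comp1 D k' u"

definition hpaste :: "'c two_cat \<Rightarrow> 'c \<Rightarrow> 'c \<Rightarrow> 'c \<Rightarrow> 'c \<Rightarrow> 'c" where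
  "hpaste D v' u \<sigma>' \<sigma> = vcomp D (hcomp D \<sigma>' (id2 D u)) (hcomp D (id2 D v') \<sigma>)"

definition vpaste :: "'c two_cat \<Rightarrow> 'c \<Rightarrow> 'c \<Rightarrow> 'c \<Rightarrow> 'c \<Rightarrow> 'c" where
  "vpaste D k' k \<tau>' \<tau> = vcomp D (hcomp D (id2 D k') \<tau>) (hcomp D \<tau>' (id2 D k))"

text \<open>Two squares with the same vertical edges are the ends of a cylinder on 2-cells \<open>\<alpha>\<close> and
  \<open>\<beta>\<close> between their horizontal edges; \<open>vcylinder\<close> exchanges the two directions.\<close>

definition hcylinder :: "'c two_cat \<Rightarrow> 'c \<Rightarrow> 'c \<Rightarrow> 'c \<Rightarrow> 'c \<Rightarrow> 'c \<Rightarrow> 'c \<Rightarrow> bool" where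
  "hcylinder D k k' \<alpha> \<beta> \<sigma> \<sigma>' \<longleftrightarrow> \<alpha> \<in> Cell2 D \<and> \<beta> \<in> Cell2 D \<and>
     square D k k' (src2 D \<alpha>) (src2 D \<beta>) \<sigma> \<and> square D k k' (tgt2 D \<alpha>) (tgt2 D \<beta>) \<sigma>' \<and>
     vcomp D \<sigma>' (hcomp D \<beta> (id2 D k)) = vcomp D (hcomp D (id2 D k') \<alpha>) \<sigma>"

definition vcylinder :: "'c two_cat \<Rightarrow> 'c \<Rightarrow> 'c \<Rightarrow> 'c \<Rightarrow> 'c \<Rightarrow> 'c \<Rightarrow> 'c \<Rightarrow> bool" where
  "vcylinder D u v \<kappa> \<kappa>' \<sigma> \<sigma>' \<longleftrightarrow> \<kappa> \<in> Cell2 D \<and> \<kappa>' \<in> Cell2 D \<and>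
     square D (src2 D \<kappa>) (src2 D \<kappa>') u v \<sigma> \<and> square D (tgt2 D \<kappa>) (tgt2 D \<kappa>') u v \<sigma>' \<and>
     vcomp D \<sigma>' (hcomp D (id2 D v) \<kappa>) = vcomp D (hcomp D \<kappa>' (id2 D u)) \<sigma>"

context
  fixes D :: "'c two_cat" assumes D: "two_category D"
begin

private lemmas cells_D = two_cat_ops[OF D] whisker[OF D]

lemma square_id: "k \<in> Cell1 D ==> square D k k (id1 D (src1 D k)) (id1 D (tgt1 D k)) (id2 D k)"
  by (simp add: square_def cells_D)

lemma square_hpaste: "square D k k' u v \<sigma> ==> square D k' k'' u' v' \<sigma>' ==>
    square D k k'' (comp1 D u' u) (comp1 D v' v) (hpaste D v' u \<sigma>' \<sigma>)"
  unfolding square_def hpaste_def by (elim conjE) (simp add: cells_D)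

lemma hpaste_id:
  "square D k k' u v \<sigma> ==> hpaste D (id1 D (tgt1 D v)) u (id2 D k') \<sigma> = \<sigma>"
  "square D k k' u v \<sigma> ==> hpaste D v (id1 D (src1 D u)) \<sigma> (id2 D k) = \<sigma>"
  unfolding square_def hpaste_def by (elim conjE, simp add: cells_D)+

lemma hpaste_assoc:
  assumes "square D k k' u v \<sigma>" "square D k' k'' u' v' \<sigma>'" "square D k'' k''' u'' v'' \<sigma>''"
  shows "hpaste D v'' (comp1 D u' u) \<sigma>'' (hpaste D v' u \<sigma>' \<sigma>) =
    hpaste D (comp1 D v'' v') u (hpaste D v'' u' \<sigma>'' \<sigma>') \<sigma>"
  using assms unfolding square_def hpaste_def by (elim conjE) (simp add: cells_D)

lemma hpaste_ids: "u \<in> Cell1 D ==> v \<in> Cell1 D ==> tgt1 D u = src1 D v ==>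
    hpaste D v u (id2 D v) (id2 D u) = id2 D (comp1 D v u)"
  by (simp add: hpaste_def cells_D)

lemma hcylinder_id: "square D k k' u v \<sigma> ==> hcylinder D k k' (id2 D u) (id2 D v) \<sigma> \<sigma>"
  unfolding hcylinder_def square_def by (elim conjE) (simp add: cells_D)

lemma hcylinder_vcomp:
  assumes "hcylinder D k k' \<alpha> \<beta> \<sigma> \<sigma>'" "hcylinder D k k' \<alpha>' \<beta>' \<sigma>' \<sigma>''"
    "tgt2 D \<alpha> = src2 D \<alpha>'" "tgt2 D \<beta> = src2 D \<beta>'"
  shows "hcylinder D k k' (vcomp D \<alpha>' \<alpha>) (vcomp D \<beta>' \<beta>) \<sigma> \<sigma>''"
proof -
  note c = assms[unfolded hcylinder_def square_def]
  have c1: "k \<in> Cell1 D" "k' \<in> Cell1 D" "\<alpha> \<in> Cell2 D" "\<beta> \<in> Cell2 D" "\<alpha>' \<in> Cell2 D" "\<beta>' \<in> Cell2 D"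
    "\<sigma> \<in> Cell2 D" "\<sigma>' \<in> Cell2 D" "\<sigma>'' \<in> Cell2 D"
    using c by auto
  have c2: "src1 D (src2 D \<alpha>) = src1 D k" "src1 D (src2 D \<beta>) = tgt1 D k"
    "tgt1 D (src2 D \<alpha>) = src1 D k'" "tgt1 D (src2 D \<beta>) = tgt1 D k'"
    "src1 D (src2 D \<alpha>') = src1 D k" "src1 D (src2 D \<beta>') = tgt1 D k"
    "tgt1 D (src2 D \<alpha>') = src1 D k'" "tgt1 D (src2 D \<beta>') = tgt1 D k'"
    "src2 D \<sigma> = comp1 D (src2 D \<beta>) k" "tgt2 D \<sigma> = comp1 D k' (src2 D \<alpha>)"
    "src2 D \<sigma>' = comp1 D (src2 D \<beta>') k" "tgt2 D \<sigma>' = comp1 D k' (src2 D \<alpha>')"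
    "src2 D \<sigma>'' = comp1 D (tgt2 D \<beta>') k" "tgt2 D \<sigma>'' = comp1 D k' (tgt2 D \<alpha>')"
    "tgt2 D \<alpha> = src2 D \<alpha>'" "tgt2 D \<beta> = src2 D \<beta>'"
    using c by auto
  note cc = c1 c2
  have n: "vcomp D \<sigma>' (hcomp D \<beta> (id2 D k)) = vcomp D (hcomp D (id2 D k') \<alpha>) \<sigma>"
    "vcomp D \<sigma>'' (hcomp D \<beta>' (id2 D k)) = vcomp D (hcomp D (id2 D k') \<alpha>') \<sigma>'"
    using c by auto
  have "vcomp D \<sigma>'' (hcomp D (vcomp D \<beta>' \<beta>) (id2 D k)) =
      vcomp D (vcomp D \<sigma>'' (hcomp D \<beta>' (id2 D k))) (hcomp D \<beta> (id2 D k))"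
    using cc by (simp add: cells_D)
  also have "\<dots> = vcomp D (hcomp D (id2 D k') \<alpha>') (vcomp D \<sigma>' (hcomp D \<beta> (id2 D k)))"
    unfolding n(2) using cc by (simp add: cells_D)
  also have "\<dots> = vcomp D (hcomp D (id2 D k') (vcomp D \<alpha>' \<alpha>)) \<sigma>"
    unfolding n(1) using cc by (simp add: cells_D)
  finally show ?thesis using cc by (simp add: hcylinder_def square_def cells_D)
qed

text \<open>Compatibility of cylinders with both compositions makes naturality of squares a property that spreads from generating 2-cells to all 2-cells.\<close>

lemma hcylinder_hcomp:
  assumes "hcylinder D k k' \<alpha> \<beta> \<sigma> \<tau>" "hcylinder D k' k'' \<alpha>' \<beta>' \<sigma>' \<tau>'"
  shows "hcylinder D k k'' (hcomp D \<alpha>' \<alpha>) (hcomp D \<beta>' \<beta>)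
    (hpaste D (src2 D \<beta>') (src2 D \<alpha>) \<sigma>' \<sigma>) (hpaste D (tgt2 D \<beta>') (tgt2 D \<alpha>) \<tau>' \<tau>)"
proof -
  note c = assms[unfolded hcylinder_def square_def]
  let ?V = "vcomp D" and ?H = "hcomp D" and ?i = "id2 D"
  have c1: "k \<in> Cell1 D" "k' \<in> Cell1 D" "k'' \<in> Cell1 D" "\<alpha> \<in> Cell2 D" "\<beta> \<in> Cell2 D" "\<sigma> \<in> Cell2 D"
    "\<tau> \<in> Cell2 D" "\<alpha>' \<in> Cell2 D" "\<beta>' \<in> Cell2 D" "\<sigma>' \<in> Cell2 D" "\<tau>' \<in> Cell2 D"
    using c by auto
  have c2: "src1 D (src2 D \<alpha>) = src1 D k" "src1 D (src2 D \<beta>) = tgt1 D k"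
    "tgt1 D (src2 D \<alpha>) = src1 D k'" "tgt1 D (src2 D \<beta>) = tgt1 D k'"
    "src1 D (src2 D \<alpha>') = src1 D k'" "src1 D (src2 D \<beta>') = tgt1 D k'"
    "tgt1 D (src2 D \<alpha>') = src1 D k''" "tgt1 D (src2 D \<beta>') = tgt1 D k''"
    "src2 D \<sigma> = comp1 D (src2 D \<beta>) k" "tgt2 D \<sigma> = comp1 D k' (src2 D \<alpha>)"
    "src2 D \<tau> = comp1 D (tgt2 D \<beta>) k" "tgt2 D \<tau> = comp1 D k' (tgt2 D \<alpha>)"
    "src2 D \<sigma>' = comp1 D (src2 D \<beta>') k'" "tgt2 D \<sigma>' = comp1 D k'' (src2 D \<alpha>')"
    "src2 D \<tau>' = comp1 D (tgt2 D \<beta>') k'" "tgt2 D \<tau>' = comp1 D k'' (tgt2 D \<alpha>')"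
    using c by auto
  note cc = c1 c2
  have n: "?V \<tau> (?H \<beta> (?i k)) = ?V (?H (?i k') \<alpha>) \<sigma>" "?V \<tau>' (?H \<beta>' (?i k')) = ?V (?H (?i k'') \<alpha>') \<sigma>'"
    using c by auto
  have b: "?H \<beta>' \<beta> = ?V (?H (?i (tgt2 D \<beta>')) \<beta>) (?H \<beta>' (?i (src2 D \<beta>)))"
    using interchange_cells[OF D, of "?i (src2 D \<beta>)" \<beta> \<beta>' "?i (tgt2 D \<beta>')"] cc by (simp add: cells_D)
  have a: "?H \<alpha>' \<alpha> = ?V (?H \<alpha>' (?i (tgt2 D \<alpha>))) (?H (?i (src2 D \<alpha>')) \<alpha>)"
    using interchange_cells[OF D, of \<alpha> "?i (tgt2 D \<alpha>)" "?i (src2 D \<alpha>')" \<alpha>'] cc by (simp add: cells_D)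
  have x1: "?V (?H (?i (tgt2 D \<beta>')) \<sigma>) (?H \<beta>' (?i (comp1 D (src2 D \<beta>) k))) =
      ?V (?H \<beta>' (?i (comp1 D k' (src2 D \<alpha>)))) (?H (?i (src2 D \<beta>')) \<sigma>)"
    using exchange[OF D, of \<sigma> \<beta>'] cc by (simp add: cells_D)
  have x2: "?V (?H (?i (comp1 D (tgt2 D \<beta>') k')) \<alpha>) (?H \<beta>' (?i (comp1 D k' (src2 D \<alpha>)))) =
      ?V (?H \<beta>' (?i (comp1 D k' (tgt2 D \<alpha>)))) (?H (?i (comp1 D (src2 D \<beta>') k')) \<alpha>)"
    using exchange[OF D, of \<alpha> "?H \<beta>' (?i k')"] cc by (simp add: cells_D)
  have x3: "?V (?H \<sigma>' (?i (tgt2 D \<alpha>))) (?H (?i (comp1 D (src2 D \<beta>') k')) \<alpha>) =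
      ?V (?H (?i (comp1 D k'' (src2 D \<alpha>'))) \<alpha>) (?H \<sigma>' (?i (src2 D \<alpha>)))"
    using exchange[OF D, of \<alpha> \<sigma>'] cc by (simp add: cells_D)
  have "?V (hpaste D (tgt2 D \<beta>') (tgt2 D \<alpha>) \<tau>' \<tau>) (?H (?H \<beta>' \<beta>) (?i k)) =
      ?V (?H \<tau>' (?i (tgt2 D \<alpha>))) (?V (?H (?i (tgt2 D \<beta>')) (?V \<tau> (?H \<beta> (?i k)))) (?H \<beta>' (?i (comp1 D (src2 D \<beta>) k))))"
    unfolding hpaste_def b using cc by (simp add: cells_D)
  also have "\<dots> = ?V (?H \<tau>' (?i (tgt2 D \<alpha>))) (?V (?H (?i (comp1 D (tgt2 D \<beta>') k')) \<alpha>)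
      (?V (?H (?i (tgt2 D \<beta>')) \<sigma>) (?H \<beta>' (?i (comp1 D (src2 D \<beta>) k)))))"
    unfolding n using cc by (simp add: cells_D)
  also have "\<dots> = ?V (?H \<tau>' (?i (tgt2 D \<alpha>))) (?V (?V (?H (?i (comp1 D (tgt2 D \<beta>') k')) \<alpha>)
      (?H \<beta>' (?i (comp1 D k' (src2 D \<alpha>))))) (?H (?i (src2 D \<beta>')) \<sigma>))"
    unfolding x1 using cc by (simp add: cells_D)
  also have "\<dots> = ?V (?H (?V \<tau>' (?H \<beta>' (?i k'))) (?i (tgt2 D \<alpha>)))
      (?V (?H (?i (comp1 D (src2 D \<beta>') k')) \<alpha>) (?H (?i (src2 D \<beta>')) \<sigma>))"
    unfolding x2 using cc by (simp add: cells_D)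
  also have "\<dots> = ?V (?H (?i k'') (?H \<alpha>' (?i (tgt2 D \<alpha>))))
      (?V (?V (?H \<sigma>' (?i (tgt2 D \<alpha>))) (?H (?i (comp1 D (src2 D \<beta>') k')) \<alpha>)) (?H (?i (src2 D \<beta>')) \<sigma>))"
    unfolding n using cc by (simp add: cells_D)
  also have "\<dots> = ?V (?H (?i k'') (?H \<alpha>' \<alpha>)) (hpaste D (src2 D \<beta>') (src2 D \<alpha>) \<sigma>' \<sigma>)"
    unfolding x3 a hpaste_def using cc by (simp add: cells_D)
  finally show ?thesis
    using cc unfolding hcylinder_def square_def hpaste_def by (simp add: cells_D)
qed

lemma vcylinder_hpaste:
  assumes "vcylinder D u v \<kappa> \<kappa>' \<sigma> \<tau>" "vcylinder D u' v' \<kappa>' \<kappa>'' \<sigma>' \<tau>'"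
  shows "vcylinder D (comp1 D u' u) (comp1 D v' v) \<kappa> \<kappa>''
    (hpaste D v' u \<sigma>' \<sigma>) (hpaste D v' u \<tau>' \<tau>)"
proof -
  note c = assms[unfolded vcylinder_def square_def]
  let ?V = "vcomp D" and ?H = "hcomp D" and ?i = "id2 D"
  have c1: "u \<in> Cell1 D" "v \<in> Cell1 D" "u' \<in> Cell1 D" "v' \<in> Cell1 D" "\<kappa> \<in> Cell2 D" "\<kappa>' \<in> Cell2 D"
    "\<kappa>'' \<in> Cell2 D" "\<sigma> \<in> Cell2 D" "\<tau> \<in> Cell2 D" "\<sigma>' \<in> Cell2 D" "\<tau>' \<in> Cell2 D"
    using c by auto
  have c2: "src1 D (src2 D \<kappa>) = src1 D u" "tgt1 D (src2 D \<kappa>) = src1 D v"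
    "src1 D (src2 D \<kappa>') = tgt1 D u" "tgt1 D (src2 D \<kappa>') = tgt1 D v"
    "src1 D (src2 D \<kappa>'') = tgt1 D u'" "tgt1 D (src2 D \<kappa>'') = tgt1 D v'"
    "src1 D u' = tgt1 D u" "src1 D v' = tgt1 D v"
    "src2 D \<sigma> = comp1 D v (src2 D \<kappa>)" "tgt2 D \<sigma> = comp1 D (src2 D \<kappa>') u"
    "src2 D \<tau> = comp1 D v (tgt2 D \<kappa>)" "tgt2 D \<tau> = comp1 D (tgt2 D \<kappa>') u"
    "src2 D \<sigma>' = comp1 D v' (src2 D \<kappa>')" "tgt2 D \<sigma>' = comp1 D (src2 D \<kappa>'') u'"
    "src2 D \<tau>' = comp1 D v' (tgt2 D \<kappa>')" "tgt2 D \<tau>' = comp1 D (tgt2 D \<kappa>'') u'"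
    using c by auto
  note cc = c1 c2
  have n: "?V \<tau> (?H (?i v) \<kappa>) = ?V (?H \<kappa>' (?i u)) \<sigma>" "?V \<tau>' (?H (?i v') \<kappa>') = ?V (?H \<kappa>'' (?i u')) \<sigma>'"
    using c by auto
  have "?V (hpaste D v' u \<tau>' \<tau>) (?H (?i (comp1 D v' v)) \<kappa>) =
      ?V (?H \<tau>' (?i u)) (?H (?i v') (?V \<tau> (?H (?i v) \<kappa>)))"
    unfolding hpaste_def using cc by (simp add: cells_D)
  also have "\<dots> = ?V (?H (?V \<tau>' (?H (?i v') \<kappa>')) (?i u)) (?H (?i v') \<sigma>)"
    unfolding n(1) using cc by (simp add: cells_D)
  also have "\<dots> = ?V (?H \<kappa>'' (?i (comp1 D u' u))) (hpaste D v' u \<sigma>' \<sigma>)"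
    unfolding n(2) hpaste_def using cc by (simp add: cells_D)
  finally show ?thesis
    using cc unfolding vcylinder_def square_def hpaste_def by (simp add: cells_D)
qed

text \<open>Four squares in a grid can be pasted in either order.\<close>

lemma vpaste_hpaste:
  assumes "square D k0 k0' u v b" "square D k0' k0'' u' v' b'"
    "square D k1 k1' v w a" "square D k1' k1'' v' w' a'"
  shows "vpaste D k1'' k0 (hpaste D w' v a' a) (hpaste D v' u b' b) =
    hpaste D w' u (vpaste D k1'' k0' a' b') (vpaste D k1' k0 a b)"
proof -
  note c = assms[unfolded square_def]
  let ?V = "vcomp D" and ?H = "hcomp D" and ?i = "id2 D"
  have x: "?V (?H (?i (comp1 D k1'' v')) b) (?H a' (?i (comp1 D v k0))) =
      ?V (?H a' (?i (comp1 D k0' u))) (?H (?i (comp1 D w' k1')) b)"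
    using exchange[OF D, of b a'] c by (simp add: cells_D)
  have "vpaste D k1'' k0 (hpaste D w' v a' a) (hpaste D v' u b' b) =
      ?V (?H (?i k1'') (?H b' (?i u))) (?V (?V (?H (?i (comp1 D k1'' v')) b) (?H a' (?i (comp1 D v k0))))
        (?H (?i w') (?H a (?i k0))))"
    unfolding vpaste_def hpaste_def using c by (simp add: cells_D)
  also have "\<dots> = hpaste D w' u (vpaste D k1'' k0' a' b') (vpaste D k1' k0 a b)"
    unfolding x vpaste_def hpaste_def using c by (simp add: cells_D)
  finally show ?thesis .
qed

end

section \<open>The associator\<close>

text \<open>The data of a lax transformation from \<open>F\<close> to \<open>G\<close>, given on the generators of \<open>A \<boxtimes> B\<close>:
  components \<open>k\<close>, and squares \<open>sl\<close> and \<open>sr\<close> at the 1-cells that come from \<open>A\<close> and from \<open>B\<close>. The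
  last assumption is naturality with respect to the interchange cells.\<close>

locale lax_extension =
  fixes A B D :: "nat two_cat" and F G :: "(nat, nat) two_fun" and k :: "nat \<Rightarrow> nat"
    and sl sr :: "nat \<Rightarrow> nat \<Rightarrow> nat"
  assumes A: "two_category A" and B: "two_category B"
    and F: "F \<in> Hom TwoCat (tens A B) D" and G: "G \<in> Hom TwoCat (tens A B) D"
    and sl: "f \<in> Cell1 A ==> y \<in> Cell0 B ==>
      square D (k (tens0 A B (src1 A f) y)) (k (tens0 A B (tgt1 A f) y))
        (Fun1 F (Fun1 (insl A B y) f)) (Fun1 G (Fun1 (insl A B y) f)) (sl f y)"
    and sr: "x \<in> Cell0 A ==> g \<in> Cell1 B ==>
      square D (k (tens0 A B x (src1 B g))) (k (tens0 A B x (tgt1 B g)))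
        (Fun1 F (Fun1 (insr A B x) g)) (Fun1 G (Fun1 (insr A B x) g)) (sr x g)"
    and sl_id: "x \<in> Cell0 A ==> y \<in> Cell0 B ==> sl (id1 A x) y = id2 D (k (tens0 A B x y))"
    and sr_id: "x \<in> Cell0 A ==> y \<in> Cell0 B ==> sr x (id1 B y) = id2 D (k (tens0 A B x y))"
    and sl_comp: "f \<in> Cell1 A ==> f' \<in> Cell1 A ==> tgt1 A f = src1 A f' ==> y \<in> Cell0 B ==>
      sl (comp1 A f' f) y =
      hpaste D (Fun1 G (Fun1 (insl A B y) f')) (Fun1 F (Fun1 (insl A B y) f)) (sl f' y) (sl f y)"
    and sr_comp: "x \<in> Cell0 A ==> g \<in> Cell1 B ==> g' \<in> Cell1 B ==> tgt1 B g = src1 B g' ==>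
      sr x (comp1 B g' g) =
      hpaste D (Fun1 G (Fun1 (insr A B x) g')) (Fun1 F (Fun1 (insr A B x) g)) (sr x g') (sr x g)"
    and sl_nat: "\<alpha> \<in> Cell2 A ==> y \<in> Cell0 B ==>
      hcylinder D (k (tens0 A B (src1 A (src2 A \<alpha>)) y)) (k (tens0 A B (tgt1 A (src2 A \<alpha>)) y))
        (Fun2 F (Fun2 (insl A B y) \<alpha>)) (Fun2 G (Fun2 (insl A B y) \<alpha>))
        (sl (src2 A \<alpha>) y) (sl (tgt2 A \<alpha>) y)"
    and sr_nat: "x \<in> Cell0 A ==> \<beta> \<in> Cell2 B ==>
      hcylinder D (k (tens0 A B x (src1 B (src2 B \<beta>)))) (k (tens0 A B x (tgt1 B (src2 B \<beta>))))
        (Fun2 F (Fun2 (insr A B x) \<beta>)) (Fun2 G (Fun2 (insr A B x) \<beta>))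
        (sr x (src2 B \<beta>)) (sr x (tgt2 B \<beta>))"
    and gam_nat: "f \<in> Cell1 A ==> g \<in> Cell1 B ==>
      hcylinder D (k (tens0 A B (src1 A f) (src1 B g))) (k (tens0 A B (tgt1 A f) (tgt1 B g)))
        (Fun2 F (gam A B f g)) (Fun2 G (gam A B f g))
        (hpaste D (Fun1 G (Fun1 (insl A B (tgt1 B g)) f)) (Fun1 F (Fun1 (insr A B (src1 A f)) g))
          (sl f (tgt1 B g)) (sr (src1 A f) g))
        (hpaste D (Fun1 G (Fun1 (insr A B (tgt1 A f)) g)) (Fun1 F (Fun1 (insl A B (src1 B g)) f))
          (sr (tgt1 A f) g) (sl f (src1 B g)))"
begin

lemma FG: "F \<in> Arr TwoCat" "TSrc F = tens A B" "TTgt F = D" "G \<in> Arr TwoCat" "TSrc G = tens A B" "TTgt G = D"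
  using F G by (auto simp: TwoCat_Hom_iff)

lemma D: "two_category D"
  using Arr_TwoCat_ends[OF FG(1)] FG by simp

lemmas simps = FG two_fun tens_ops[OF A B] in_tens_cells[OF A B] tens_two_cat[OF A B]
  two_cat_1[OF A] two_cat_1[OF B] ins_app[OF A B]

lemma k: assumes "x \<in> Cell0 A" "y \<in> Cell0 B"
  shows "k (tens0 A B x y) \<in> Cell1 D" "src1 D (k (tens0 A B x y)) = Fun0 F (tens0 A B x y)"
    "tgt1 D (k (tens0 A B x y)) = Fun0 G (tens0 A B x y)"
proof -
  note s = sl[of "id1 A x" y, unfolded square_def]
  have "src1 D (Fun1 H (Fun1 (insl A B y) (id1 A x))) = Fun0 H (tens0 A B x y)" if "H = F \<or> H = G" for H
    using that assms by (elim disjE) (simp_all add: FG two_fun ins_app[OF A B] two_cat_1[OF A] two_cat_1[OF tens_two_cat[OF A B]] two_cat_1[OF D]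
        in_tens_cells[OF A B])
  then show "k (tens0 A B x y) \<in> Cell1 D" "src1 D (k (tens0 A B x y)) = Fun0 F (tens0 A B x y)"
    "tgt1 D (k (tens0 A B x y)) = Fun0 G (tens0 A B x y)"
    using s assms two_cat_1[OF A] by metis+
qed

text \<open>The square at a composite of generators is the pasting of their squares. Invariance under the relations between 1-cells is associativity and unitality of pasting, and \<open>sl_comp\<close>, \<open>sr_comp\<close>.\<close>

fun sg :: "(nat, nat) gterm1 \<Rightarrow> nat" where
  "sg (I1 p) = id2 D (k (tens0 A B (fst p) (snd p)))"
| "sg (L1 f y) = sl f y"
| "sg (R1 x g) = sr x g"
| "sg (C1 t s) = hpaste D (Fun1 G (tens1 A B t)) (Fun1 F (tens1 A B s)) (sg t) (sg s)"

lemma tens1_I1: "p \<in> Cell0 A \<times> Cell0 B ==> tens1 A B (I1 p) = id1 (tens A B) (case_prod (tens0 A B) p)"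
  by (auto simp: simps)

lemma sg_square: "gwf1 A B t ==>
    square D (k (case_prod (tens0 A B) (gsrc1 A B t))) (k (case_prod (tens0 A B) (gtgt1 A B t)))
      (Fun1 F (tens1 A B t)) (Fun1 G (tens1 A B t)) (sg t)"
proof (induction t)
  case (I1 p)
  then have "fst p \<in> Cell0 A" "snd p \<in> Cell0 B" by auto
  then show ?case using square_id[OF D k(1), of "fst p" "snd p"] k[of "fst p" "snd p"] I1
    by (simp add: tens1_I1 split_beta simps(1-6) two_fun in_tens_cells[OF A B])
next
  case (L1 f y) then show ?case using sl by (simp add: tens_generators[OF A B])
next
  case (R1 x g) then show ?case using sr by (simp add: tens_generators[OF A B])
next
  case (C1 t s)
  then have "Fun1 H (tens1 A B (C1 t s)) = comp1 D (Fun1 H (tens1 A B t)) (Fun1 H (tens1 A B s))"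
    if "H = F \<or> H = G" for H
    using that by (auto simp: simps simp flip: tens_ops(4)[OF A B])
  then show ?case using square_hpaste[OF D] C1 by simp
qed

lemma sg_geq1: "geq1 A B s t ==> sg s = sg t"
proof (induction rule: geq1.induct)
  case (cong t t' s s')
  then have "tens1 A B t = tens1 A B t'" "tens1 A B s = tens1 A B s'"
    using geq1_ends[OF A B] tens_eq(1)[OF A B] by blast+
  then show ?case using cong by simp
next
  case (unit_l s)
  have "Fun1 G (tens1 A B (I1 (gtgt1 A B s))) = id1 D (tgt1 D (Fun1 G (tens1 A B s)))"
  proof -
    obtain x y where "gtgt1 A B s = (x, y)" "x \<in> Cell0 A" "y \<in> Cell0 B"
      using gwf1_ends[OF A B unit_l] by auto
    then show ?thesis using unit_l by (simp add: tens1_I1 FG two_fun tens_ops(1,2)[OF A B] in_tens_cells[OF A B])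
  qed
  then show ?case using hpaste_id(1)[OF D sg_square[OF unit_l]] gwf1_ends[OF A B unit_l]
    by (simp add: split_beta)
next
  case (unit_r s)
  have "Fun1 F (tens1 A B (I1 (gsrc1 A B s))) = id1 D (src1 D (Fun1 F (tens1 A B s)))"
  proof -
    obtain x y where "gsrc1 A B s = (x, y)" "x \<in> Cell0 A" "y \<in> Cell0 B"
      using gwf1_ends[OF A B unit_r] by auto
    then show ?thesis using unit_r by (simp add: tens1_I1 FG two_fun tens_ops(1,2)[OF A B] in_tens_cells[OF A B])
  qed
  then show ?case using hpaste_id(2)[OF D sg_square[OF unit_r]] gwf1_ends[OF A B unit_r]
    by (simp add: split_beta)
next
  case (assoc t s r)
  then have w: "gwf1 A B t" "gwf1 A B s" "gwf1 A B r" "gsrc1 A B t = gtgt1 A B s" "gsrc1 A B s = gtgt1 A B r"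
    by auto
  have "Fun1 F (tens1 A B (C1 s r)) = comp1 D (Fun1 F (tens1 A B s)) (Fun1 F (tens1 A B r))"
    "Fun1 G (tens1 A B (C1 t s)) = comp1 D (Fun1 G (tens1 A B t)) (Fun1 G (tens1 A B s))"
    using w by (auto simp: simps simp flip: tens_ops(4)[OF A B])
  then show ?case
    using hpaste_assoc[OF D sg_square[of r], of _ "Fun1 F (tens1 A B s)" "Fun1 G (tens1 A B s)" "sg s" _
        "Fun1 F (tens1 A B t)" "Fun1 G (tens1 A B t)" "sg t"] w sg_square[of s] sg_square[of t]
    by simp
next
  case (L_comp f x x' f' x'' y)
  then show ?case by (auto simp: in_Hom_cells sl_comp tens_generators[OF A B])
next
  case (R_comp x g y y' g' y'')
  then show ?case by (auto simp: in_Hom_cells sr_comp tens_generators[OF A B])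
qed (auto simp: sl_id sr_id)

definition sigma :: "nat \<Rightarrow> nat" where
  "sigma c = sg (rep1 (decode (gray A B) c))"

lemma sigma_tens1: "gwf1 A B t ==> sigma (tens1 A B t) = sg t"
  using sg_geq1[OF rep1[OF A B]] by (simp add: sigma_def tens_decode[OF A B])

lemma sigma_gen:
  "f \<in> Cell1 A ==> y \<in> Cell0 B ==> sigma (Fun1 (insl A B y) f) = sl f y"
  "x \<in> Cell0 A ==> g \<in> Cell1 B ==> sigma (Fun1 (insr A B x) g) = sr x g"
  by (simp_all add: sigma_tens1 flip: tens_generators[OF A B])

lemma sigma_square: "c \<in> Cell1 (tens A B) ==>
    square D (k (src1 (tens A B) c)) (k (tgt1 (tens A B) c)) (Fun1 F c) (Fun1 G c) (sigma c)"
  using sg_square by (auto simp: tens_cells[OF A B] sigma_tens1 tens_ops[OF A B])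

lemma sigma_comp:
  assumes "s \<in> Cell1 (tens A B)" "t \<in> Cell1 (tens A B)" "tgt1 (tens A B) s = src1 (tens A B) t"
  shows "sigma (comp1 (tens A B) t s) = hpaste D (Fun1 G t) (Fun1 F s) (sigma t) (sigma s)"
proof -
  obtain s' t' where s: "s = tens1 A B s'" "gwf1 A B s'" and t: "t = tens1 A B t'" "gwf1 A B t'"
    using assms by (auto simp: tens_cells[OF A B])
  have "gwf1 A B (C1 t' s')"
    using s t assms(3) gwf1_ends[OF A B t(2)] gwf1_ends[OF A B s(2)]
    by (auto simp: tens_ops[OF A B] dest!: arg_cong[of _ _ "decode (gray A B)"] simp: tens_decode[OF A B])
  then show ?thesis using s t by (simp add: sigma_tens1 tens_ops[OF A B] del: gwf1.simps)
qed

lemma sigma_id: "p \<in> Cell0 (tens A B) ==> sigma (id1 (tens A B) p) = id2 D (k p)"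
  by (auto simp: tens_cells[OF A B] tens_ops[OF A B] sigma_tens1)

text \<open>By induction on 2-cells: the generators are covered by the assumptions, composites by pasting cylinders.\<close>

lemma sigma_nat: "\<alpha> \<in> Cell2 (tens A B) ==>
    hcylinder D (k (src1 (tens A B) (src2 (tens A B) \<alpha>))) (k (tgt1 (tens A B) (src2 (tens A B) \<alpha>)))
      (Fun2 F \<alpha>) (Fun2 G \<alpha>) (sigma (src2 (tens A B) \<alpha>)) (sigma (tgt2 (tens A B) \<alpha>))"
proof (induction \<alpha> rule: tens_induct2[OF A B, consumes 1])
  case (1 s)
  note T = tens_two_cat[OF A B]
  show ?case using hcylinder_id[OF D sigma_square[OF 1]] 1 by (simp add: two_cat_v[OF T] simps(1-6) two_fun)
next
  case (2 \<alpha> y)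
  then show ?case using sl_nat[of \<alpha> y] by (simp add: two_fun ins_app[OF A B] sigma_gen two_cat_v[OF A] two_cat_1[OF A])
next
  case (3 x \<beta>)
  then show ?case using sr_nat[of x \<beta>] by (simp add: two_fun ins_app[OF A B] sigma_gen two_cat_v[OF B] two_cat_1[OF B])
next
  case (4 f g)
  interpret u: tens_pair A B by (rule tens_pair.intro[OF A B])
  note T = tens_two_cat[OF A B]
  show ?case using gam_nat[OF 4] 4
    by (simp add: u.gm sigma_comp sigma_gen two_fun ins_app[OF A B] two_cat_1[OF A] two_cat_1[OF B] two_cat_1[OF T])
next
  case (5 a b)
  note T = tens_two_cat[OF A B]
  have e: "src1 (tens A B) (src2 (tens A B) b) = src1 (tens A B) (src2 (tens A B) a)"
    "tgt1 (tens A B) (src2 (tens A B) b) = tgt1 (tens A B) (src2 (tens A B) a)"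
    using 5 two_cat_v[OF T, of a] by auto
  show ?case
    using hcylinder_vcomp[OF D 5(4), of "Fun2 F b" "Fun2 G b" "sigma (tgt2 (tens A B) b)"] 5(1-3,5) e
    by (simp add: two_cat_v[OF T] FG two_fun)
next
  case (6 a b)
  note T = tens_two_cat[OF A B]
  show ?case
    using hcylinder_hcomp[OF D 6(4), of _ "Fun2 F b" "Fun2 G b"] 6(1-3,5)
    by (simp add: two_cat_v[OF T] two_cat_h[OF T] two_cat_1[OF T] FG two_fun sigma_comp)
qed

end

text \<open>The associator is the bifunctor out of \<open>A \<boxtimes> B\<close> and \<open>C\<close> with \<open>slice\<close> inserting an object of \<open>C\<close> and
  \<open>fibre\<close> inserting an object of \<open>A \<boxtimes> B\<close>. Its interchange cells at a 1-cell \<open>h\<close> of \<open>C\<close> form the lax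
  transformation between slices that \<open>h\<close> induces.\<close>

definition slice :: "nat two_cat \<Rightarrow> nat two_cat \<Rightarrow> nat two_cat \<Rightarrow> nat \<Rightarrow> (nat, nat) two_fun" where
  "slice A B C z = tens_fun (Id TwoCat A) (insl B C z)"

definition fibre :: "nat two_cat \<Rightarrow> nat two_cat \<Rightarrow> nat two_cat \<Rightarrow> nat \<Rightarrow> (nat, nat) two_fun" where
  "fibre A B C p = (case decode (gray A B) p of G0 q \<Rightarrow>
     Comp TwoCat (insr A (tens B C) (fst q)) (insr B C (snd q)))"

definition assoc_gam :: "nat two_cat \<Rightarrow> nat two_cat \<Rightarrow> nat two_cat \<Rightarrow> nat \<Rightarrow> nat \<Rightarrow> nat" where
  "assoc_gam A B C t h = lax_extension.sigma A B (tens A (tens B C)) (slice A B C (src1 C h))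
     (slice A B C (tgt1 C h)) (\<lambda>p. Fun1 (fibre A B C p) h)
     (\<lambda>f y. gam A (tens B C) f (Fun1 (insr B C y) h))
     (\<lambda>x g. Fun2 (insr A (tens B C) x) (gam B C g h)) t"

definition assoc :: "nat two_cat \<Rightarrow> nat two_cat \<Rightarrow> nat two_cat \<Rightarrow> (nat, nat) two_fun" where
  "assoc A B C = gray_bifunctor.extension (tens A B) C (tens A (tens B C))
     (slice A B C) (fibre A B C) (assoc_gam A B C)"

context
  fixes A B C :: "nat two_cat"
  assumes A: "two_category A" and B: "two_category B" and C: "two_category C"
begin

private abbreviation "BC \<equiv> tens B C"
private abbreviation "ABC \<equiv> tens A (tens B C)"

private lemma BC: "two_category BC" by (rule tens_two_cat[OF B C])
private lemma ABC: "two_category ABC" by (rule tens_two_cat[OF A BC])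
private lemma AB: "two_category (tens A B)" by (rule tens_two_cat[OF A B])

interpretation u: tens_pair A BC by (rule tens_pair.intro[OF A BC])
interpretation v: tens_pair B C by (rule tens_pair.intro[OF B C])
interpretation w: tens_pair A B by (rule tens_pair.intro[OF A B])

private lemmas tc1 = two_cat_1[OF A] two_cat_1[OF B] two_cat_1[OF C] two_cat_1[OF AB]
private lemmas tc2 = two_cat_v[OF A] two_cat_v[OF B] two_cat_v[OF C] two_cat_v[OF BC]
private lemmas ins = ins_app[OF A BC] ins_app[OF B C] ins_app[OF A B]
private lemmas cells0 = in_tens_cells(1)[OF A BC] in_tens_cells(1)[OF B C] in_tens_cells(1)[OF A B]

lemma slice:
  assumes "z \<in> Cell0 C"
  shows "slice A B C z \<in> Arr TwoCat" "TSrc (slice A B C z) = tens A B" "TTgt (slice A B C z) = ABC"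
    "x \<in> Cell0 A ==> y \<in> Cell0 B ==> Fun0 (slice A B C z) (tens0 A B x y) = tens0 A BC x (tens0 B C y z)"
    "f \<in> Cell1 A ==> y \<in> Cell0 B ==>
      Fun1 (slice A B C z) (Fun1 (insl A B y) f) = Fun1 (insl A BC (tens0 B C y z)) f"
    "x \<in> Cell0 A ==> g \<in> Cell1 B ==>
      Fun1 (slice A B C z) (Fun1 (insr A B x) g) = Fun1 (insr A BC x) (Fun1 (insl B C z) g)"
    "\<alpha> \<in> Cell2 A ==> y \<in> Cell0 B ==>
      Fun2 (slice A B C z) (Fun2 (insl A B y) \<alpha>) = Fun2 (insl A BC (tens0 B C y z)) \<alpha>"
    "x \<in> Cell0 A ==> \<beta> \<in> Cell2 B ==>
      Fun2 (slice A B C z) (Fun2 (insr A B x) \<beta>) = Fun2 (insr A BC x) (Fun2 (insl B C z) \<beta>)"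
    "f \<in> Cell1 A ==> g \<in> Cell1 B ==>
      Fun2 (slice A B C z) (gam A B f g) = gam A BC f (Fun1 (insl B C z) g)"
  using tens_fun[of "Id TwoCat A" "insl B C z" A A B BC] A B C assms
  by (simp_all add: slice_def two_fun_id ins tens_fun_ends)

lemma fibre:
  assumes "x \<in> Cell0 A" "y \<in> Cell0 B"
  shows "fibre A B C (tens0 A B x y) \<in> Arr TwoCat" "TSrc (fibre A B C (tens0 A B x y)) = C"
    "TTgt (fibre A B C (tens0 A B x y)) = ABC"
    "z \<in> Cell0 C ==> Fun0 (fibre A B C (tens0 A B x y)) z = tens0 A BC x (tens0 B C y z)"
    "h \<in> Cell1 C ==> Fun1 (fibre A B C (tens0 A B x y)) h = Fun1 (insr A BC x) (Fun1 (insr B C y) h)"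
    "\<delta> \<in> Cell2 C ==> Fun2 (fibre A B C (tens0 A B x y)) \<delta> = Fun2 (insr A BC x) (Fun2 (insr B C y) \<delta>)"
  using assms by (simp_all add: fibre_def tens_decode[OF A B] two_fun_comp ins cells0)

lemma lax_extension_assoc:
  assumes h: "h \<in> Cell1 C"
  shows "lax_extension A B ABC (slice A B C (src1 C h)) (slice A B C (tgt1 C h))
     (\<lambda>p. Fun1 (fibre A B C p) h) (\<lambda>f y. gam A BC f (Fun1 (insr B C y) h))
     (\<lambda>x g. Fun2 (insr A BC x) (gam B C g h))"
proof (rule lax_extension.intro, goal_cases)
  case (5 f y)
  then show ?case unfolding square_def using h
    by (simp add: u.gm slice fibre tc1 ins two_fun cells0)
next
  case (6 x g)
  then show ?case unfolding square_def using h
    by (simp add: v.gm slice fibre tc1 ins two_fun cells0)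
next
  case (7 x y) then show ?case using h by (simp add: u.gm_id_l fibre ins two_fun)
next
  case (8 x y) then show ?case using h by (simp add: v.gm_id_l fibre ins two_fun)
next
  case (9 f f' y) then show ?case using h u.gm_comp_l[of f f' "Fun1 (insr B C y) h"]
    by (simp add: hpaste_def slice tc1 ins two_fun)
next
  case (10 x g g') then show ?case
    using h arg_cong[OF v.gm_comp_l[of g g' h], of "Fun2 (insr A BC x)"]
    by (simp add: hpaste_def slice tc1 ins two_fun v.gm two_cat_ops[OF BC])
next
  case (11 \<alpha> y)
  then show ?case unfolding hcylinder_def square_def
    using h u.gm_natural_l[of \<alpha> "Fun1 (insr B C y) h"]
    by (simp add: slice fibre tc1 two_cat_v[OF A] ins two_fun u.gm cells0)
next
  case (12 x \<beta>)
  then show ?case unfolding hcylinder_def square_def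
    using h arg_cong[OF v.gm_natural_l[of \<beta> h], of "Fun2 (insr A BC x)"]
    by (simp add: slice fibre tc1 two_cat_v[OF B] two_cat_v[OF BC] two_cat_h[OF BC] ins two_fun v.gm cells0)
next
  case (13 f g)
  let ?x = "src1 A f" and ?x' = "tgt1 A f" and ?y = "src1 B g" and ?y' = "tgt1 B g"
    and ?z = "src1 C h" and ?z' = "tgt1 C h"
  let ?\<gamma> = "gam B C g h" and ?Rh = "\<lambda>y. Fun1 (insr B C y) h" and ?Lg = "\<lambda>z. Fun1 (insl B C z) g"
  note S = slice fibre tc1 two_cat_1[OF BC] two_cat_ops[OF ABC]
     whisker[OF ABC] ins two_fun u.gm v.gm cells0
  \<comment> \<open>The cube spanned by \<open>f\<close>, \<open>g\<close> and \<open>h\<close> commutes because the interchange cells of \<open>f\<close> are natural with respect to the 2-cell \<open>\<gamma>\<^bsub>g,h\<^esub>\<close>.\<close>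
  have sq: "square ABC (Fun1 (insr A BC ?x) (?Rh ?y)) (Fun1 (insr A BC ?x') (?Rh ?y'))
      (comp1 ABC (Fun1 (insl A BC (tens0 B C ?y' ?z)) f) (Fun1 (insr A BC ?x) (?Lg ?z)))
      (comp1 ABC (Fun1 (insl A BC (tens0 B C ?y' ?z')) f) (Fun1 (insr A BC ?x) (?Lg ?z')))
      (hpaste ABC (Fun1 (insl A BC (tens0 B C ?y' ?z')) f) (Fun1 (insr A BC ?x) (?Lg ?z))
        (gam A BC f (?Rh ?y')) (Fun2 (insr A BC ?x) ?\<gamma>))"
    using 13 h by (intro square_hpaste[OF ABC]) (auto simp: square_def S)
  have sq': "square ABC (Fun1 (insr A BC ?x) (?Rh ?y)) (Fun1 (insr A BC ?x') (?Rh ?y'))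
      (comp1 ABC (Fun1 (insr A BC ?x') (?Lg ?z)) (Fun1 (insl A BC (tens0 B C ?y ?z)) f))
      (comp1 ABC (Fun1 (insr A BC ?x') (?Lg ?z')) (Fun1 (insl A BC (tens0 B C ?y ?z')) f))
      (hpaste ABC (Fun1 (insr A BC ?x') (?Lg ?z')) (Fun1 (insl A BC (tens0 B C ?y ?z)) f)
        (Fun2 (insr A BC ?x') ?\<gamma>) (gam A BC f (?Rh ?y)))"
    using 13 h by (intro square_hpaste[OF ABC]) (auto simp: square_def S)
  have n: "vcomp ABC (gam A BC f (comp1 BC (?Rh ?y') (?Lg ?z)))
        (hcomp ABC (id2 ABC (Fun1 (insl A BC (tens0 B C ?y' ?z')) f)) (Fun2 (insr A BC ?x) ?\<gamma>)) =
      vcomp ABC (hcomp ABC (Fun2 (insr A BC ?x') ?\<gamma>) (id2 ABC (Fun1 (insl A BC (tens0 B C ?y ?z)) f)))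
        (gam A BC f (comp1 BC (?Lg ?z') (?Rh ?y)))"
    using u.gm_natural_r[of f ?\<gamma>] 13 h by (simp add: v.gm tc1 two_cat_1[OF BC] ins two_fun)
  have c: "gam A BC f (comp1 BC (?Rh ?y') (?Lg ?z)) =
      vcomp ABC (hcomp ABC (id2 ABC (Fun1 (insr A BC ?x') (?Rh ?y'))) (gam A BC f (?Lg ?z)))
        (hcomp ABC (gam A BC f (?Rh ?y')) (id2 ABC (Fun1 (insr A BC ?x) (?Lg ?z))))"
    "gam A BC f (comp1 BC (?Lg ?z') (?Rh ?y)) =
      vcomp ABC (hcomp ABC (id2 ABC (Fun1 (insr A BC ?x') (?Lg ?z'))) (gam A BC f (?Rh ?y)))
        (hcomp ABC (gam A BC f (?Lg ?z')) (id2 ABC (Fun1 (insr A BC ?x) (?Rh ?y))))"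
    using 13 h by (intro u.gm_comp_r; simp add: tc1 ins two_fun)+
  have e: "vcomp ABC (hpaste ABC (Fun1 (insr A BC ?x') (?Lg ?z')) (Fun1 (insl A BC (tens0 B C ?y ?z)) f)
          (Fun2 (insr A BC ?x') ?\<gamma>) (gam A BC f (?Rh ?y)))
        (hcomp ABC (gam A BC f (?Lg ?z')) (id2 ABC (Fun1 (insr A BC ?x) (?Rh ?y)))) =
      vcomp ABC (hcomp ABC (id2 ABC (Fun1 (insr A BC ?x') (?Rh ?y'))) (gam A BC f (?Lg ?z)))
        (hpaste ABC (Fun1 (insl A BC (tens0 B C ?y' ?z')) f) (Fun1 (insr A BC ?x) (?Lg ?z))
          (gam A BC f (?Rh ?y')) (Fun2 (insr A BC ?x) ?\<gamma>))"
    using n[unfolded c] 13 h unfolding hpaste_def by (simp add: S)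
  show ?case unfolding hcylinder_def using sq sq' e 13 h by (simp add: S)
qed (use A B h in \<open>auto simp: TwoCat_Hom_iff slice tc1\<close>)

lemma assoc_gam:
  assumes h: "h \<in> Cell1 C"
  shows
    "f \<in> Cell1 A ==> y \<in> Cell0 B ==>
      assoc_gam A B C (Fun1 (insl A B y) f) h = gam A BC f (Fun1 (insr B C y) h)"
    "x \<in> Cell0 A ==> g \<in> Cell1 B ==>
      assoc_gam A B C (Fun1 (insr A B x) g) h = Fun2 (insr A BC x) (gam B C g h)"
    "t \<in> Cell1 (tens A B) ==>
      square ABC (Fun1 (fibre A B C (src1 (tens A B) t)) h) (Fun1 (fibre A B C (tgt1 (tens A B) t)) h)
        (Fun1 (slice A B C (src1 C h)) t) (Fun1 (slice A B C (tgt1 C h)) t) (assoc_gam A B C t h)"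
    "s \<in> Cell1 (tens A B) ==> t \<in> Cell1 (tens A B) ==> tgt1 (tens A B) s = src1 (tens A B) t ==>
      assoc_gam A B C (comp1 (tens A B) t s) h = hpaste ABC (Fun1 (slice A B C (tgt1 C h)) t)
        (Fun1 (slice A B C (src1 C h)) s) (assoc_gam A B C t h) (assoc_gam A B C s h)"
    "p \<in> Cell0 (tens A B) ==>
      assoc_gam A B C (id1 (tens A B) p) h = id2 ABC (Fun1 (fibre A B C p) h)"
    "\<alpha> \<in> Cell2 (tens A B) ==>
      hcylinder ABC (Fun1 (fibre A B C (src1 (tens A B) (src2 (tens A B) \<alpha>))) h)
        (Fun1 (fibre A B C (tgt1 (tens A B) (src2 (tens A B) \<alpha>))) h)
        (Fun2 (slice A B C (src1 C h)) \<alpha>) (Fun2 (slice A B C (tgt1 C h)) \<alpha>)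
        (assoc_gam A B C (src2 (tens A B) \<alpha>) h) (assoc_gam A B C (tgt2 (tens A B) \<alpha>) h)"
  unfolding assoc_gam_def
  using lax_extension.sigma_gen[OF lax_extension_assoc[OF h]]
    lax_extension.sigma_square[OF lax_extension_assoc[OF h]]
    lax_extension.sigma_comp[OF lax_extension_assoc[OF h]]
    lax_extension.sigma_id[OF lax_extension_assoc[OF h]]
    lax_extension.sigma_nat[OF lax_extension_assoc[OF h]]
  by blast+

lemma fibre_cell:
  assumes "p \<in> Cell0 (tens A B)"
  shows "fibre A B C p \<in> Arr TwoCat" "TSrc (fibre A B C p) = C" "TTgt (fibre A B C p) = ABC"
    "z \<in> Cell0 C ==> Fun0 (fibre A B C p) z = Fun0 (slice A B C z) p"
  using assms by (auto simp: tens_cells[OF A B] fibre slice)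

text \<open>The remaining conditions compare lax transformations on \<open>A \<boxtimes> B\<close>; each is proved by induction on 1-cells, since pasting commutes with both compositions.\<close>

lemma assoc_gam_natural_r:
  assumes "t \<in> Cell1 (tens A B)" and \<delta>: "\<delta> \<in> Cell2 C"
  shows "vcylinder ABC (Fun1 (slice A B C (src1 C (src2 C \<delta>))) t) (Fun1 (slice A B C (tgt1 C (src2 C \<delta>))) t)
    (Fun2 (fibre A B C (src1 (tens A B) t)) \<delta>) (Fun2 (fibre A B C (tgt1 (tens A B) t)) \<delta>)
    (assoc_gam A B C t (src2 C \<delta>)) (assoc_gam A B C t (tgt2 C \<delta>))"
  using assms(1)
proof (induction t rule: tens_induct1[OF A B, consumes 1])
  case (1 f y)
  then show ?case using u.gm_natural_r[of f "Fun2 (insr B C y) \<delta>"] \<delta>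
    by (simp add: vcylinder_def square_def assoc_gam slice fibre tc1 two_cat_v[OF C] ins two_fun u.gm cells0)
next
  case (2 x g)
  then show ?case using arg_cong[OF v.gm_natural_r[of g \<delta>], of "Fun2 (insr A BC x)"] \<delta>
    by (simp add: vcylinder_def square_def assoc_gam slice fibre tc1 two_cat_v[OF C] two_cat_v[OF BC]
        two_cat_h[OF BC] ins two_fun v.gm cells0)
next
  case (3 s t)
  then show ?case using vcylinder_hpaste[OF ABC 3(4), of "Fun1 (slice A B C (src1 C (src2 C \<delta>))) t"] \<delta>
    by (simp add: assoc_gam tc1 two_cat_v[OF C] slice two_fun)
qed

lemma assoc_gam_id_r:
  assumes "t \<in> Cell1 (tens A B)" and z: "z \<in> Cell0 C"
  shows "assoc_gam A B C t (id1 C z) = id2 ABC (Fun1 (slice A B C z) t)"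
  using assms(1)
proof (induction t rule: tens_induct1[OF A B, consumes 1])
  case (1 f y)
  then show ?case using u.gm_id_r[of f "tens0 B C y z"] z
    by (simp add: assoc_gam slice tc1 ins two_fun cells0)
next
  case (2 x g)
  then show ?case using z by (simp add: assoc_gam slice tc1 ins two_fun v.gm_id_r)
next
  case (3 s t)
  then show ?case using z
    by (simp add: assoc_gam tc1 slice two_fun hpaste_ids[OF ABC])
qed

lemma assoc_gam_comp_r:
  assumes "t \<in> Cell1 (tens A B)" and h: "h \<in> Cell1 C" "h' \<in> Cell1 C" "tgt1 C h = src1 C h'"
  shows "assoc_gam A B C t (comp1 C h' h) =
    vpaste ABC (Fun1 (fibre A B C (tgt1 (tens A B) t)) h') (Fun1 (fibre A B C (src1 (tens A B) t)) h)
      (assoc_gam A B C t h') (assoc_gam A B C t h)"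
  using assms(1)
proof (induction t rule: tens_induct1[OF A B, consumes 1])
  case (1 f y)
  then show ?case using u.gm_comp_r[of f "Fun1 (insr B C y) h" "Fun1 (insr B C y) h'"] h
    by (simp add: vpaste_def assoc_gam fibre tc1 ins two_fun cells0)
next
  case (2 x g)
  then show ?case using arg_cong[OF v.gm_comp_r[of g h h'], of "Fun2 (insr A BC x)"] h
    by (simp add: vpaste_def assoc_gam fibre tc1 ins two_fun cells0 v.gm two_cat_ops[OF BC])
next
  case (3 s t)
  note sq = assoc_gam(3)[OF h(1) 3(1)] assoc_gam(3)[OF h(1) 3(2)] assoc_gam(3)[OF h(2) 3(1)] assoc_gam(3)[OF h(2) 3(2)]
  show ?case
    using vpaste_hpaste[OF ABC sq(1) sq(2)[folded 3(3)], of "Fun1 (fibre A B C (src1 (tens A B) s)) h'"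
        "Fun1 (fibre A B C (tgt1 (tens A B) s)) h'" _ "assoc_gam A B C s h'"
        "Fun1 (fibre A B C (tgt1 (tens A B) t)) h'" _ "assoc_gam A B C t h'"] sq 3 h
    by (simp add: assoc_gam tc1)
qed

lemma gray_bifunctor_assoc:
  "gray_bifunctor (tens A B) C ABC (slice A B C) (fibre A B C) (assoc_gam A B C)"
proof (rule gray_bifunctor.intro, goal_cases)
  case (10 \<alpha> h) then show ?case using assoc_gam(6)[of h \<alpha>] by (simp add: hcylinder_def)
next
  case (11 t \<delta>) then show ?case using assoc_gam_natural_r[of t \<delta>] by (simp add: vcylinder_def)
next
  case (12 p h) then show ?case by (simp add: assoc_gam)
next
  case (13 t z) then show ?case by (simp add: assoc_gam_id_r)
next
  case (14 s t h) then show ?case by (simp add: assoc_gam hpaste_def)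
next
  case (15 t h h') then show ?case by (simp add: assoc_gam_comp_r vpaste_def)
qed (use C AB ABC assoc_gam(3) in \<open>auto simp: square_def TwoCat_Hom_iff slice fibre_cell\<close>)

interpretation a: gray_bifunctor "tens A B" C ABC "slice A B C" "fibre A B C" "assoc_gam A B C"
  by (rule gray_bifunctor_assoc)

lemma assoc_Arr: "assoc A B C \<in> Arr TwoCat" "TSrc (assoc A B C) = tens (tens A B) C" "TTgt (assoc A B C) = ABC"
  using a.extension by (simp_all add: assoc_def)

lemma assoc_app:
  "x \<in> Cell0 A ==> y \<in> Cell0 B ==> z \<in> Cell0 C ==>
    Fun0 (assoc A B C) (tens0 (tens A B) C (tens0 A B x y) z) = tens0 A BC x (tens0 B C y z)"
  "f \<in> Cell1 A ==> y \<in> Cell0 B ==> z \<in> Cell0 C ==>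
    Fun1 (assoc A B C) (Fun1 (insl (tens A B) C z) (Fun1 (insl A B y) f)) = Fun1 (insl A BC (tens0 B C y z)) f"
  "x \<in> Cell0 A ==> g \<in> Cell1 B ==> z \<in> Cell0 C ==>
    Fun1 (assoc A B C) (Fun1 (insl (tens A B) C z) (Fun1 (insr A B x) g)) = Fun1 (insr A BC x) (Fun1 (insl B C z) g)"
  "x \<in> Cell0 A ==> y \<in> Cell0 B ==> h \<in> Cell1 C ==>
    Fun1 (assoc A B C) (Fun1 (insr (tens A B) C (tens0 A B x y)) h) = Fun1 (insr A BC x) (Fun1 (insr B C y) h)"
  "\<alpha> \<in> Cell2 A ==> y \<in> Cell0 B ==> z \<in> Cell0 C ==>
    Fun2 (assoc A B C) (Fun2 (insl (tens A B) C z) (Fun2 (insl A B y) \<alpha>)) = Fun2 (insl A BC (tens0 B C y z)) \<alpha>"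
  "x \<in> Cell0 A ==> \<beta> \<in> Cell2 B ==> z \<in> Cell0 C ==>
    Fun2 (assoc A B C) (Fun2 (insl (tens A B) C z) (Fun2 (insr A B x) \<beta>)) = Fun2 (insr A BC x) (Fun2 (insl B C z) \<beta>)"
  "f \<in> Cell1 A ==> g \<in> Cell1 B ==> z \<in> Cell0 C ==>
    Fun2 (assoc A B C) (Fun2 (insl (tens A B) C z) (gam A B f g)) = gam A BC f (Fun1 (insl B C z) g)"
  "x \<in> Cell0 A ==> y \<in> Cell0 B ==> \<delta> \<in> Cell2 C ==>
    Fun2 (assoc A B C) (Fun2 (insr (tens A B) C (tens0 A B x y)) \<delta>) = Fun2 (insr A BC x) (Fun2 (insr B C y) \<delta>)"
  "f \<in> Cell1 A ==> y \<in> Cell0 B ==> h \<in> Cell1 C ==>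
    Fun2 (assoc A B C) (gam (tens A B) C (Fun1 (insl A B y) f) h) = gam A BC f (Fun1 (insr B C y) h)"
  "x \<in> Cell0 A ==> g \<in> Cell1 B ==> h \<in> Cell1 C ==>
    Fun2 (assoc A B C) (gam (tens A B) C (Fun1 (insr A B x) g) h) = Fun2 (insr A BC x) (gam B C g h)"
  unfolding assoc_def
  by (simp_all add: a.extension slice fibre assoc_gam cells0 ins two_fun w.gm)

end

section \<open>Equality of 2-functors out of iterated tensor products\<close>

lemmas tens_fun_app = tens_fun[OF _ _ _ HOL.refl _ HOL.refl]

lemma tens2_eqI:
  assumes A: "two_category A" and B: "two_category B"
    and F: "F \<in> Arr TwoCat" "G \<in> Arr TwoCat" "TSrc F = tens A B" "TSrc G = tens A B" "TTgt F = TTgt G"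
    and "\<And>x y. x \<in> Cell0 A ==> y \<in> Cell0 B ==> Fun0 F (tens0 A B x y) = Fun0 G (tens0 A B x y)"
    and "\<And>f y. f \<in> Cell1 A ==> y \<in> Cell0 B ==> Fun1 F (Fun1 (insl A B y) f) = Fun1 G (Fun1 (insl A B y) f)"
    and "\<And>x g. x \<in> Cell0 A ==> g \<in> Cell1 B ==> Fun1 F (Fun1 (insr A B x) g) = Fun1 G (Fun1 (insr A B x) g)"
    and "\<And>\<alpha> y. \<alpha> \<in> Cell2 A ==> y \<in> Cell0 B ==> Fun2 F (Fun2 (insl A B y) \<alpha>) = Fun2 G (Fun2 (insl A B y) \<alpha>)"
    and "\<And>x \<beta>. x \<in> Cell0 A ==> \<beta> \<in> Cell2 B ==> Fun2 F (Fun2 (insr A B x) \<beta>) = Fun2 G (Fun2 (insr A B x) \<beta>)"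
    and "\<And>f g. f \<in> Cell1 A ==> g \<in> Cell1 B ==> Fun2 F (gam A B f g) = Fun2 G (gam A B f g)"
  shows "F = G"
proof (rule tens_fun_eqI[OF A B F])
  show "Comp TwoCat F (insl A B y) = Comp TwoCat G (insl A B y)" if "y \<in> Cell0 B" for y
    using assms that by (intro two_fun_eqI) (auto simp: two_fun_comp ins_app[OF A B])
  show "Comp TwoCat F (insr A B x) = Comp TwoCat G (insr A B x)" if "x \<in> Cell0 A" for x
    using assms that by (intro two_fun_eqI) (auto simp: two_fun_comp ins_app[OF A B])
qed (use assms in auto)

text \<open>Agreement on the interchange cells \<open>\<gamma>\<^bsub>f,g\<^esub>\<close> is stable under composition in \<open>f\<close>.\<close>

lemma gam_agree_comp:
  assumes A: "two_category A" and B: "two_category B"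
    and F: "F \<in> Arr TwoCat" "G \<in> Arr TwoCat" "TSrc F = tens A B" "TSrc G = tens A B" "TTgt F = TTgt G"
    and l: "\<And>y. y \<in> Cell0 B ==> Comp TwoCat F (insl A B y) = Comp TwoCat G (insl A B y)"
    and f: "f \<in> Cell1 A" "f' \<in> Cell1 A" "tgt1 A f = src1 A f'" and g: "g \<in> Cell1 B"
    and e: "Fun2 F (gam A B f g) = Fun2 G (gam A B f g)" "Fun2 F (gam A B f' g) = Fun2 G (gam A B f' g)"
  shows "Fun2 F (gam A B (comp1 A f' f) g) = Fun2 G (gam A B (comp1 A f' f) g)"
proof -
  interpret u: tens_pair A B by (rule tens_pair.intro[OF A B])
  have L: "Fun1 F (Fun1 (insl A B y) f) = Fun1 G (Fun1 (insl A B y) f)"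
    if "y \<in> Cell0 B" "f \<in> Cell1 A" for y f
    using that arg_cong[OF l[OF that(1)], of "\<lambda>F. Fun1 F f"] by (simp add: two_fun_comp ins_app[OF A B])
  note T = tens_two_cat[OF A B]
  show ?thesis using f g e F
    by (simp add: u.gm_comp_l u.gm two_fun ins_app[OF A B] two_cat_1[OF A] two_cat_1[OF B] two_cat_ops[OF T] L)
qed

text \<open>The 1-cells of \<open>(A \<boxtimes> B) \<boxtimes> C\<close> are generated by those that move in one factor only, and by
  \<open>gam_agree_comp\<close> interchange cells need to be compared only between two of these.\<close>

lemma tens3_eqI:
  assumes A: "two_category A" and B: "two_category B" and C: "two_category C"
    and F: "F \<in> Arr TwoCat" "G \<in> Arr TwoCat" "TSrc F = tens (tens A B) C" "TSrc G = tens (tens A B) C"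
      "TTgt F = TTgt G"
    and "\<And>x y z. x \<in> Cell0 A ==> y \<in> Cell0 B ==> z \<in> Cell0 C ==>
      Fun0 F (tens0 (tens A B) C (tens0 A B x y) z) = Fun0 G (tens0 (tens A B) C (tens0 A B x y) z)"
    and "\<And>f y z. f \<in> Cell1 A ==> y \<in> Cell0 B ==> z \<in> Cell0 C ==>
      Fun1 F (Fun1 (insl (tens A B) C z) (Fun1 (insl A B y) f)) = Fun1 G (Fun1 (insl (tens A B) C z) (Fun1 (insl A B y) f))"
    and "\<And>x g z. x \<in> Cell0 A ==> g \<in> Cell1 B ==> z \<in> Cell0 C ==>
      Fun1 F (Fun1 (insl (tens A B) C z) (Fun1 (insr A B x) g)) = Fun1 G (Fun1 (insl (tens A B) C z) (Fun1 (insr A B x) g))"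
    and "\<And>x y h. x \<in> Cell0 A ==> y \<in> Cell0 B ==> h \<in> Cell1 C ==>
      Fun1 F (Fun1 (insr (tens A B) C (tens0 A B x y)) h) = Fun1 G (Fun1 (insr (tens A B) C (tens0 A B x y)) h)"
    and "\<And>\<alpha> y z. \<alpha> \<in> Cell2 A ==> y \<in> Cell0 B ==> z \<in> Cell0 C ==>
      Fun2 F (Fun2 (insl (tens A B) C z) (Fun2 (insl A B y) \<alpha>)) = Fun2 G (Fun2 (insl (tens A B) C z) (Fun2 (insl A B y) \<alpha>))"
    and "\<And>x \<beta> z. x \<in> Cell0 A ==> \<beta> \<in> Cell2 B ==> z \<in> Cell0 C ==>
      Fun2 F (Fun2 (insl (tens A B) C z) (Fun2 (insr A B x) \<beta>)) = Fun2 G (Fun2 (insl (tens A B) C z) (Fun2 (insr A B x) \<beta>))"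
    and "\<And>f g z. f \<in> Cell1 A ==> g \<in> Cell1 B ==> z \<in> Cell0 C ==>
      Fun2 F (Fun2 (insl (tens A B) C z) (gam A B f g)) = Fun2 G (Fun2 (insl (tens A B) C z) (gam A B f g))"
    and "\<And>x y \<delta>. x \<in> Cell0 A ==> y \<in> Cell0 B ==> \<delta> \<in> Cell2 C ==>
      Fun2 F (Fun2 (insr (tens A B) C (tens0 A B x y)) \<delta>) = Fun2 G (Fun2 (insr (tens A B) C (tens0 A B x y)) \<delta>)"
    and gl: "\<And>f y h. f \<in> Cell1 A ==> y \<in> Cell0 B ==> h \<in> Cell1 C ==>
      Fun2 F (gam (tens A B) C (Fun1 (insl A B y) f) h) = Fun2 G (gam (tens A B) C (Fun1 (insl A B y) f) h)"
    and gr: "\<And>x g h. x \<in> Cell0 A ==> g \<in> Cell1 B ==> h \<in> Cell1 C ==>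
      Fun2 F (gam (tens A B) C (Fun1 (insr A B x) g) h) = Fun2 G (gam (tens A B) C (Fun1 (insr A B x) g) h)"
  shows "F = G"
proof -
  note AB = tens_two_cat[OF A B]
  interpret w: tens_pair A B by (rule tens_pair.intro[OF A B])
  note S = two_fun_comp ins_app[OF A B] ins_app[OF AB C] two_fun in_tens_cells(1)[OF A B] w.gm
  have l: "Comp TwoCat F (insl (tens A B) C z) = Comp TwoCat G (insl (tens A B) C z)" if "z \<in> Cell0 C" for z
    by (rule tens2_eqI[OF A B]) (use assms that in \<open>auto simp: S\<close>)
  show ?thesis
  proof (rule tens_fun_eqI[OF AB C F l])
    show "Comp TwoCat F (insr (tens A B) C p) = Comp TwoCat G (insr (tens A B) C p)"
      if "p \<in> Cell0 (tens A B)" for p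
      using that assms by (intro two_fun_eqI) (auto simp: S tens_cells(1)[OF A B])
    show "Fun2 F (gam (tens A B) C t h) = Fun2 G (gam (tens A B) C t h)"
      if "t \<in> Cell1 (tens A B)" "h \<in> Cell1 C" for t h
      using that
    proof (induction t rule: tens_induct1[OF A B, consumes 1])
      case (3 s t) then show ?case using gam_agree_comp[OF AB C F l] by blast
    qed (use gl gr in auto)
  qed
qed

lemma tens4_eqI:
  assumes A: "two_category A" and B: "two_category B" and C: "two_category C" and E: "two_category E"
    and F: "F \<in> Arr TwoCat" "G \<in> Arr TwoCat" "TSrc F = tens (tens (tens A B) C) E"
      "TSrc G = tens (tens (tens A B) C) E" "TTgt F = TTgt G"
    and l: "\<And>w. w \<in> Cell0 E ==>
      Comp TwoCat F (insl (tens (tens A B) C) E w) = Comp TwoCat G (insl (tens (tens A B) C) E w)"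
    and r1: "\<And>x y z k. x \<in> Cell0 A ==> y \<in> Cell0 B ==> z \<in> Cell0 C ==> k \<in> Cell1 E ==>
      Fun1 F (Fun1 (insr (tens (tens A B) C) E (tens0 (tens A B) C (tens0 A B x y) z)) k) =
      Fun1 G (Fun1 (insr (tens (tens A B) C) E (tens0 (tens A B) C (tens0 A B x y) z)) k)"
    and r2: "\<And>x y z \<epsilon>. x \<in> Cell0 A ==> y \<in> Cell0 B ==> z \<in> Cell0 C ==> \<epsilon> \<in> Cell2 E ==>
      Fun2 F (Fun2 (insr (tens (tens A B) C) E (tens0 (tens A B) C (tens0 A B x y) z)) \<epsilon>) =
      Fun2 G (Fun2 (insr (tens (tens A B) C) E (tens0 (tens A B) C (tens0 A B x y) z)) \<epsilon>)"
    and g1: "\<And>f y z k. f \<in> Cell1 A ==> y \<in> Cell0 B ==> z \<in> Cell0 C ==> k \<in> Cell1 E ==>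
      Fun2 F (gam (tens (tens A B) C) E (Fun1 (insl (tens A B) C z) (Fun1 (insl A B y) f)) k) =
      Fun2 G (gam (tens (tens A B) C) E (Fun1 (insl (tens A B) C z) (Fun1 (insl A B y) f)) k)"
    and g2: "\<And>x g z k. x \<in> Cell0 A ==> g \<in> Cell1 B ==> z \<in> Cell0 C ==> k \<in> Cell1 E ==>
      Fun2 F (gam (tens (tens A B) C) E (Fun1 (insl (tens A B) C z) (Fun1 (insr A B x) g)) k) =
      Fun2 G (gam (tens (tens A B) C) E (Fun1 (insl (tens A B) C z) (Fun1 (insr A B x) g)) k)"
    and g3: "\<And>x y h k. x \<in> Cell0 A ==> y \<in> Cell0 B ==> h \<in> Cell1 C ==> k \<in> Cell1 E ==>
      Fun2 F (gam (tens (tens A B) C) E (Fun1 (insr (tens A B) C (tens0 A B x y)) h) k) =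
      Fun2 G (gam (tens (tens A B) C) E (Fun1 (insr (tens A B) C (tens0 A B x y)) h) k)"
  shows "F = G"
proof -
  note AB = tens_two_cat[OF A B]
  note ABC = tens_two_cat[OF AB C]
  note S = two_fun_comp ins_app[OF A B] ins_app[OF AB C] ins_app[OF ABC E] two_fun
    in_tens_cells(1)[OF A B] in_tens_cells(1)[OF AB C]
  show ?thesis
  proof (rule tens_fun_eqI[OF ABC E F l])
    show "Comp TwoCat F (insr (tens (tens A B) C) E p) = Comp TwoCat G (insr (tens (tens A B) C) E p)"
      if p: "p \<in> Cell0 (tens (tens A B) C)" for p
    proof -
      obtain x y z where *: "p = tens0 (tens A B) C (tens0 A B x y) z" "x \<in> Cell0 A" "y \<in> Cell0 B" "z \<in> Cell0 C"
        using p by (auto simp: tens_cells(1)[OF AB C] tens_cells(1)[OF A B])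
      have "Fun0 F (tens0 (tens (tens A B) C) E p w) = Fun0 G (tens0 (tens (tens A B) C) E p w)"
        if "w \<in> Cell0 E" for w
        using arg_cong[OF l[OF that], of "\<lambda>F. Fun0 F p"] p that by (simp add: S)
      then show ?thesis using * F r1 r2 p by (intro two_fun_eqI) (auto simp: S)
    qed
    have gl: "Fun2 F (gam (tens (tens A B) C) E (Fun1 (insl (tens A B) C z) s) k) =
        Fun2 G (gam (tens (tens A B) C) E (Fun1 (insl (tens A B) C z) s) k)"
      if "s \<in> Cell1 (tens A B)" "z \<in> Cell0 C" "k \<in> Cell1 E" for s z k
      using that
    proof (induction s rule: tens_induct1[OF A B, consumes 1])
      case (3 s t)
      then show ?case
        using gam_agree_comp[OF ABC E F l, of "Fun1 (insl (tens A B) C z) s" "Fun1 (insl (tens A B) C z) t" k]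
        by (simp add: S)
    qed (use g1 g2 in auto)
    show "Fun2 F (gam (tens (tens A B) C) E t k) = Fun2 G (gam (tens (tens A B) C) E t k)"
      if "t \<in> Cell1 (tens (tens A B) C)" "k \<in> Cell1 E" for t k
      using that
    proof (induction t rule: tens_induct1[OF AB C, consumes 1])
      case (3 s t) then show ?case using gam_agree_comp[OF ABC E F l] by blast
    next
      case (2 p h) then show ?case using g3 by (auto simp: tens_cells(1)[OF A B])
    qed (use gl in auto)
  qed
qed

section \<open>The monoidal structure on 2-categories\<close>

lemma tens_fun_Id:
  assumes "two_category A" "two_category B"
  shows "tens_fun (Id TwoCat A) (Id TwoCat B) = Id TwoCat (tens A B)"
proof -
  interpret u: tens_pair A B by (rule tens_pair.intro[OF assms])
  show ?thesis
    by (rule tens2_eqI[OF assms])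
      (use assms in \<open>simp_all add: tens_fun_app tens_fun_ends two_fun_id tens_two_cat in_tens_cells(1)
        ins_app two_fun u.gm\<close>)
qed

lemma tens_fun_Comp:
  assumes "F \<in> Arr TwoCat" "F' \<in> Arr TwoCat" "TTgt F = TSrc F'"
    "G \<in> Arr TwoCat" "G' \<in> Arr TwoCat" "TTgt G = TSrc G'"
  shows "tens_fun (Comp TwoCat F' F) (Comp TwoCat G' G) = Comp TwoCat (tens_fun F' G') (tens_fun F G)"
proof -
  note AB = Arr_TwoCat_ends(1)[OF assms(1)] Arr_TwoCat_ends(1)[OF assms(4)]
  note AB' = Arr_TwoCat_ends(1)[OF assms(2)] Arr_TwoCat_ends(1)[OF assms(5)]
  interpret u: tens_pair "TSrc F" "TSrc G" by (rule tens_pair.intro[OF AB])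
  show ?thesis
    by (rule tens2_eqI[OF AB])
      (use assms in \<open>simp_all add: tens_fun_app tens_fun_ends two_fun_comp in_tens_cells(1)[OF AB]
        ins_app[OF AB] ins_app[OF AB'] two_fun u.gm\<close>)
qed

lemma assoc_natural:
  assumes F: "F \<in> Arr TwoCat" "TSrc F = A" "TTgt F = A'" and G: "G \<in> Arr TwoCat" "TSrc G = B" "TTgt G = B'"
    and H: "H \<in> Arr TwoCat" "TSrc H = C" "TTgt H = C'"
  shows "Comp TwoCat (assoc A' B' C') (tens_fun (tens_fun F G) H) =
    Comp TwoCat (tens_fun F (tens_fun G H)) (assoc A B C)"
proof -
  have c: "two_category A" "two_category B" "two_category C" "two_category A'" "two_category B'" "two_category C'"
    using assms Arr_TwoCat_ends by auto
  note AB = tens_two_cat[OF c(1,2)] note BC = tens_two_cat[OF c(2,3)]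
  note AB' = tens_two_cat[OF c(4,5)] note BC' = tens_two_cat[OF c(5,6)]
  interpret ab: gray_bifunctor A B "tens A B" "insl A B" "insr A B" "gam A B"
    by (rule gray_bifunctor_tens[OF c(1,2)])
  interpret bc: gray_bifunctor B C "tens B C" "insl B C" "insr B C" "gam B C"
    by (rule gray_bifunctor_tens[OF c(2,3)])
  interpret abc: gray_bifunctor "tens A B" C "tens (tens A B) C" "insl (tens A B) C" "insr (tens A B) C" "gam (tens A B) C"
    by (rule gray_bifunctor_tens[OF AB c(3)])
  show ?thesis
    by (rule tens3_eqI[OF c(1-3)])
      (use assms c AB BC in \<open>simp_all add: two_fun_comp tens_fun_app tens_fun_ends assoc_Arr assoc_app two_fun
        ins_app[OF c(1,2)] ins_app[OF c(2,3)] ins_app[OF AB c(3)] ins_app[OF c(1) BC]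
        in_tens_cells(1) ab.gm bc.gm abc.gm\<close>)
qed

lemma pentagon:
  assumes A: "two_category A" and B: "two_category B" and C: "two_category C" and E: "two_category E"
  shows "Comp TwoCat (assoc A B (tens C E)) (assoc (tens A B) C E) =
    Comp TwoCat (tens_fun (Id TwoCat A) (assoc B C E))
      (Comp TwoCat (assoc A (tens B C) E) (tens_fun (assoc A B C) (Id TwoCat E)))"
proof -
  note AB = tens_two_cat[OF A B] and BC = tens_two_cat[OF B C] and CE = tens_two_cat[OF C E]
  note ABC = tens_two_cat[OF AB C] and BCE = tens_two_cat[OF B CE] and AbC = tens_two_cat[OF A BC]
    and BcE = tens_two_cat[OF BC E]
  interpret ab: tens_pair A B by (rule tens_pair.intro[OF A B])
  interpret bc: tens_pair B C by (rule tens_pair.intro[OF B C])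
  interpret ce: tens_pair C E by (rule tens_pair.intro[OF C E])
  interpret abc: tens_pair "tens A B" C by (rule tens_pair.intro[OF AB C])
  interpret abce: tens_pair "tens (tens A B) C" E by (rule tens_pair.intro[OF ABC E])
  note ab' = gray_bifunctor.gm[OF gray_bifunctor_tens[OF A BC]] gray_bifunctor.gm[OF gray_bifunctor_tens[OF B CE]]
    gray_bifunctor.gm[OF gray_bifunctor_tens[OF BC E]]
  note S = two_fun_comp tens_fun_app tens_fun_ends assoc_Arr assoc_app two_fun two_fun_id
        ins_app[OF A B] ins_app[OF B C] ins_app[OF C E] ins_app[OF AB C] ins_app[OF A BC] ins_app[OF ABC E]
        ins_app[OF AB CE] ins_app[OF B CE] ins_app[OF A BCE] ins_app[OF AbC E] ins_app[OF BC E] ins_app[OF A BcE]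
        in_tens_cells(1) ab.gm bc.gm ce.gm abc.gm abce.gm ab'
        A B C E AB BC CE ABC BCE AbC BcE
  show ?thesis
  proof (rule tens4_eqI[OF A B C E])
    fix w assume w: "w \<in> Cell0 E"
    show "Comp TwoCat (Comp TwoCat (assoc A B (tens C E)) (assoc (tens A B) C E)) (insl (tens (tens A B) C) E w) =
      Comp TwoCat (Comp TwoCat (tens_fun (Id TwoCat A) (assoc B C E))
      (Comp TwoCat (assoc A (tens B C) E) (tens_fun (assoc A B C) (Id TwoCat E)))) (insl (tens (tens A B) C) E w)"
      by (rule tens3_eqI[OF A B C]) (use w in \<open>simp_all add: S\<close>)
  qed (simp_all add: S)
qed

subsection \<open>Unitors\<close>

definition point :: nat where
  "point = encode (theta_cat []) (Th0 0)"

abbreviation unit_cat :: "nat two_cat" where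
  "unit_cat \<equiv> theta []"

lemma finite_cells_theta_cat: "finite (cells (theta_cat q))"
proof (rule finite_subset)
  let ?h = "theta_hom q" and ?n = "{..length q}"
  have le: "k \<le> length q" if "is \<in> ?h k" for k "is"
    using that by (simp add: theta_hom_def)
  have "Th1 k is \<in> case_prod Th1 ` Sigma ?n ?h" if "is \<in> ?h k" for k "is"
    by (rule image_eqI[of _ _ "(k, is)"]) (use that le in auto)
  moreover have "Th2 k is js \<in> (\<lambda>(k, is, js). Th2 k is js) ` (SIGMA k:?n. ?h k \<times> ?h k)"
    if "is \<in> ?h k" "js \<in> ?h k" for k "is" js
    by (rule image_eqI[of _ _ "(k, is, js)"]) (use that le in auto)
  ultimately show "cells (theta_cat q) \<subseteq> Th0 ` ?n \<union> case_prod Th1 ` Sigma ?n ?h \<union>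
      (\<lambda>(k, is, js). Th2 k is js) ` (SIGMA k:?n. ?h k \<times> ?h k)"
    unfolding cells_def theta_cat_def two_cat.simps by blast
qed (simp add: finite_theta_hom)

lemma countable_cells_theta_cat: "countable (cells (theta_cat q))"
  by (intro countable_finite finite_cells_theta_cat)

lemma two_category_theta: "two_category (theta q)"
  unfolding theta_def by (intro two_category_nat_copy two_category_theta_cat countable_cells_theta_cat)

lemma unit_cells:
  "Cell0 unit_cat = {point}" "Cell1 unit_cat = {id1 unit_cat point}"
  "Cell2 unit_cat = {id2 unit_cat (id1 unit_cat point)}"
proof -
  note c = nat_copy_ops[OF two_category_theta_cat countable_cells_theta_cat]
    nat_copy_cells[OF two_category_theta_cat countable_cells_theta_cat]
  have m: "Th0 0 \<in> cells (theta_cat [])" "Th1 0 [] \<in> cells (theta_cat [])"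
    by (auto simp: cells_def theta_cat_def theta_hom_def)
  have c0: "Cell0 (theta_cat []) = {Th0 0}" "Cell1 (theta_cat []) = {Th1 0 []}"
    "Cell2 (theta_cat []) = {Th2 0 [] []}" "id1 (theta_cat []) (Th0 0) = Th1 0 []"
    "id2 (theta_cat []) (Th1 0 []) = Th2 0 [] []"
    by (auto simp: theta_cat_def theta_hom_def)
  show "Cell0 unit_cat = {point}" "Cell1 unit_cat = {id1 unit_cat point}"
    "Cell2 unit_cat = {id2 unit_cat (id1 unit_cat point)}"
    unfolding theta_def point_def by (simp_all add: c m c0)
qed

lemmas unit_two_cat = two_category_theta[of "[]"]

definition const_fun :: "nat two_cat \<Rightarrow> nat \<Rightarrow> (nat, nat) two_fun" where
  "const_fun B y = mk_two_fun unit_cat B (\<lambda>_. y) (\<lambda>_. id1 B y) (\<lambda>_. id2 B (id1 B y))"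

lemma const_fun:
  assumes B: "two_category B" and y: "y \<in> Cell0 B"
  shows "const_fun B y \<in> Arr TwoCat" "TSrc (const_fun B y) = unit_cat" "TTgt (const_fun B y) = B"
    "Fun0 (const_fun B y) point = y" "Fun1 (const_fun B y) (id1 unit_cat point) = id1 B y"
    "Fun2 (const_fun B y) (id2 unit_cat (id1 unit_cat point)) = id2 B (id1 B y)"
proof -
  show "const_fun B y \<in> Arr TwoCat" unfolding const_fun_def
    by (intro mk_two_fun_Arr two_functorI unit_two_cat B)
      (use y in \<open>simp_all add: two_cat_ops[OF B]\<close>)
qed (simp_all add: const_fun_def unit_cells)

definition lunit :: "nat two_cat \<Rightarrow> (nat, nat) two_fun" where
  "lunit B = gray_bifunctor.extension unit_cat B B (\<lambda>y. const_fun B y) (\<lambda>_. Id TwoCat B) (\<lambda>_ g. id2 B g)"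

definition runit :: "nat two_cat \<Rightarrow> (nat, nat) two_fun" where
  "runit A = gray_bifunctor.extension A unit_cat A (\<lambda>_. Id TwoCat A) (\<lambda>x. const_fun A x) (\<lambda>f _. id2 A f)"

definition runit_inv :: "nat two_cat \<Rightarrow> (nat, nat) two_fun" where
  "runit_inv A = insl A unit_cat point"

lemmas unit_1 = two_cat_ops[OF unit_two_cat]

context
  fixes A :: "nat two_cat" assumes A: "two_category A"
begin

private lemmas unit_ops = two_fun_id const_fun[OF A] two_cat_ops[OF A] unit_1
  unit_cells TwoCat_Hom_iff

interpretation l: gray_bifunctor unit_cat A A "\<lambda>y. const_fun A y" "\<lambda>_. Id TwoCat A" "\<lambda>_ g. id2 A g"
  by (rule gray_bifunctor.intro) (use A unit_two_cat in \<open>auto simp: unit_ops\<close>)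

interpretation r: gray_bifunctor A unit_cat A "\<lambda>_. Id TwoCat A" "\<lambda>x. const_fun A x" "\<lambda>f _. id2 A f"
  by (rule gray_bifunctor.intro) (use A unit_two_cat in \<open>auto simp: unit_ops\<close>)

lemma lunit:
  "lunit A \<in> Arr TwoCat" "TSrc (lunit A) = tens unit_cat A" "TTgt (lunit A) = A"
  "y \<in> Cell0 A ==> Fun0 (lunit A) (tens0 unit_cat A point y) = y"
  "y \<in> Cell0 A ==> Fun1 (lunit A) (Fun1 (insl unit_cat A y) (id1 unit_cat point)) = id1 A y"
  "g \<in> Cell1 A ==> Fun1 (lunit A) (Fun1 (insr unit_cat A point) g) = g"
  "y \<in> Cell0 A ==>
    Fun2 (lunit A) (Fun2 (insl unit_cat A y) (id2 unit_cat (id1 unit_cat point))) = id2 A (id1 A y)"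
  "\<beta> \<in> Cell2 A ==> Fun2 (lunit A) (Fun2 (insr unit_cat A point) \<beta>) = \<beta>"
  "g \<in> Cell1 A ==> Fun2 (lunit A) (gam unit_cat A (id1 unit_cat point) g) = id2 A g"
  using l.extension by (simp_all add: lunit_def unit_ops)

lemma runit:
  "runit A \<in> Arr TwoCat" "TSrc (runit A) = tens A unit_cat" "TTgt (runit A) = A"
  "x \<in> Cell0 A ==> Fun0 (runit A) (tens0 A unit_cat x point) = x"
  "x \<in> Cell0 A ==> Fun1 (runit A) (Fun1 (insr A unit_cat x) (id1 unit_cat point)) = id1 A x"
  "f \<in> Cell1 A ==> Fun1 (runit A) (Fun1 (insl A unit_cat point) f) = f"
  "x \<in> Cell0 A ==>
    Fun2 (runit A) (Fun2 (insr A unit_cat x) (id2 unit_cat (id1 unit_cat point))) = id2 A (id1 A x)"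
  "\<alpha> \<in> Cell2 A ==> Fun2 (runit A) (Fun2 (insl A unit_cat point) \<alpha>) = \<alpha>"
  "f \<in> Cell1 A ==> Fun2 (runit A) (gam A unit_cat f (id1 unit_cat point)) = id2 A f"
  using r.extension by (simp_all add: runit_def unit_ops)

lemma runit_inv:
  "runit_inv A \<in> Arr TwoCat" "TSrc (runit_inv A) = A" "TTgt (runit_inv A) = tens A unit_cat"
  "x \<in> Cell0 A ==> Fun0 (runit_inv A) x = tens0 A unit_cat x point"
  by (simp_all add: runit_inv_def ins_app[OF A unit_two_cat] unit_cells)

lemma runit_inverse:
  "Comp TwoCat (runit A) (runit_inv A) = Id TwoCat A"
  "Comp TwoCat (runit_inv A) (runit A) = Id TwoCat (tens A unit_cat)"
proof -
  interpret u: tens_pair A unit_cat by (rule tens_pair.intro[OF A unit_two_cat])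
  note T = tens_two_cat[OF A unit_two_cat]
  note S' = two_fun_comp runit runit_inv unit_ops two_fun ins_app[OF A unit_two_cat] in_tens_cells(1)[OF A unit_two_cat]
    u.gm two_cat_ops[OF T] T A u.gm_id_r
  show "Comp TwoCat (runit A) (runit_inv A) = Id TwoCat A"
    by (rule two_fun_eqI) (simp_all add: S' runit_inv_def)
  show "Comp TwoCat (runit_inv A) (runit A) = Id TwoCat (tens A unit_cat)"
    by (rule tens2_eqI[OF A unit_two_cat]) (simp_all add: S', simp_all add: S' runit_inv_def)
qed

end

lemma lunit_natural:
  assumes F: "F \<in> Arr TwoCat" "TSrc F = A" "TTgt F = A'"
  shows "Comp TwoCat (lunit A') (tens_fun (Id TwoCat unit_cat) F) = Comp TwoCat F (lunit A)"
proof -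
  have A: "two_category A" and A': "two_category A'" using Arr_TwoCat_ends[OF F(1)] F by auto
  interpret u: tens_pair unit_cat A by (rule tens_pair.intro[OF unit_two_cat A])
  show ?thesis
    by (rule tens2_eqI[OF unit_two_cat A])
      (use F in \<open>simp_all add: two_fun_comp two_fun_id tens_fun_app tens_fun_ends lunit[OF A] lunit[OF A'] two_fun
        unit_cells unit_1 unit_two_cat ins_app[OF unit_two_cat A] in_tens_cells(1)[OF unit_two_cat A] u.gm
        two_cat_1[OF A] two_cat_1[OF A'] two_cat_v[OF A] two_cat_v[OF A'] two_cat_1[OF tens_two_cat[OF unit_two_cat A]] two_cat_v[OF tens_two_cat[OF unit_two_cat A]] two_cat_1[OF tens_two_cat[OF unit_two_cat A']] two_cat_v[OF tens_two_cat[OF unit_two_cat A']]\<close>)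
qed

lemma runit_natural:
  assumes F: "F \<in> Arr TwoCat" "TSrc F = A" "TTgt F = A'"
  shows "Comp TwoCat (runit A') (tens_fun F (Id TwoCat unit_cat)) = Comp TwoCat F (runit A)"
proof -
  have A: "two_category A" and A': "two_category A'" using Arr_TwoCat_ends[OF F(1)] F by auto
  interpret u: tens_pair A unit_cat by (rule tens_pair.intro[OF A unit_two_cat])
  show ?thesis
    by (rule tens2_eqI[OF A unit_two_cat])
      (use F in \<open>simp_all add: two_fun_comp two_fun_id tens_fun_app tens_fun_ends runit[OF A] runit[OF A'] two_fun
        unit_cells unit_1 unit_two_cat ins_app[OF A unit_two_cat] in_tens_cells(1)[OF A unit_two_cat] u.gm
        two_cat_1[OF A] two_cat_1[OF A'] two_cat_v[OF A] two_cat_v[OF A'] two_cat_1[OF tens_two_cat[OF A unit_two_cat]] two_cat_v[OF tens_two_cat[OF A unit_two_cat]] two_cat_1[OF tens_two_cat[OF A' unit_two_cat]] two_cat_v[OF tens_two_cat[OF A' unit_two_cat]]\<close>)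
qed

lemma lunit_unit: "lunit unit_cat = runit unit_cat"
proof -
  note U = unit_two_cat
  interpret u: tens_pair unit_cat unit_cat by (rule tens_pair.intro[OF U U])
  show ?thesis
    by (rule tens2_eqI[OF U U]) (use lunit[OF U] runit[OF U] in \<open>simp_all add: unit_cells unit_1\<close>)
qed

lemma lunit_tens:
  assumes B: "two_category B" and C: "two_category C"
  shows "Comp TwoCat (lunit (tens B C)) (assoc unit_cat B C) = tens_fun (lunit B) (Id TwoCat C)"
proof -
  note U = unit_two_cat
  note BC = tens_two_cat[OF B C] and UB = tens_two_cat[OF U B]
  interpret ab: tens_pair unit_cat B by (rule tens_pair.intro[OF U B])
  interpret bc: tens_pair B C by (rule tens_pair.intro[OF B C])
  interpret abc: tens_pair "tens unit_cat B" C by (rule tens_pair.intro[OF UB C])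
  show ?thesis
    by (rule tens3_eqI[OF U B C])
      (simp_all add: two_fun_comp tens_fun_app tens_fun_ends two_fun_id assoc_Arr assoc_app two_fun lunit
        ins_app[OF U B] ins_app[OF B C] ins_app[OF UB C] ins_app[OF U BC] unit_cells unit_1
        in_tens_cells(1) ab.gm bc.gm abc.gm two_cat_1[OF B] two_cat_1[OF C] bc.gm_id_l abc.gm_id_l U B C BC UB
        two_cat_1[OF UB] two_cat_v[OF UB] two_cat_1[OF BC] two_cat_v[OF BC] two_cat_1[OF tens_two_cat[OF UB C]] two_cat_v[OF tens_two_cat[OF UB C]] two_cat_1[OF tens_two_cat[OF U BC]] two_cat_v[OF tens_two_cat[OF U BC]])
qed

lemma runit_tens:
  assumes A: "two_category A" and B: "two_category B"
  shows "Comp TwoCat (tens_fun (Id TwoCat A) (runit B)) (assoc A B unit_cat) = runit (tens A B)"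
proof -
  note U = unit_two_cat
  note AB = tens_two_cat[OF A B] and BU = tens_two_cat[OF B U]
  interpret ab: tens_pair A B by (rule tens_pair.intro[OF A B])
  interpret bc: tens_pair B unit_cat by (rule tens_pair.intro[OF B U])
  interpret abc: tens_pair "tens A B" unit_cat by (rule tens_pair.intro[OF AB U])
  have i: "id1 (tens A B) (tens0 A B x y) = Fun1 (insr A B x) (id1 B y)"
    if "x \<in> Cell0 A" "y \<in> Cell0 B" for x y
    using that by (simp add: two_fun ins_app[OF A B])
  show ?thesis
    by (rule tens3_eqI[OF A B U])
      (simp_all add: two_fun_comp tens_fun_app tens_fun_ends two_fun_id assoc_Arr assoc_app two_fun runit
        ins_app[OF A B] ins_app[OF B U] ins_app[OF AB U] ins_app[OF A BU] unit_cells unit_1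
        in_tens_cells(1) ab.gm bc.gm abc.gm two_cat_1[OF B] two_cat_1[OF A] ab.gm_id_r U A B AB BU
        gray_bifunctor.gm_id_r[OF gray_bifunctor_tens[OF A BU]] two_cat_1[OF AB] two_cat_v[OF AB] two_cat_1[OF BU] two_cat_v[OF BU] two_cat_1[OF tens_two_cat[OF AB U]] two_cat_v[OF tens_two_cat[OF AB U]] two_cat_1[OF tens_two_cat[OF A BU]] two_cat_v[OF tens_two_cat[OF A BU]])
qed

lemma triangle:
  assumes A: "two_category A" and C: "two_category C"
  shows "Comp TwoCat (tens_fun (Id TwoCat A) (lunit C)) (assoc A unit_cat C) = tens_fun (runit A) (Id TwoCat C)"
proof -
  note U = unit_two_cat
  note AU = tens_two_cat[OF A U] and UC = tens_two_cat[OF U C]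
  interpret ac: tens_pair A C by (rule tens_pair.intro[OF A C])
  interpret ab: tens_pair A unit_cat by (rule tens_pair.intro[OF A U])
  interpret bc: tens_pair unit_cat C by (rule tens_pair.intro[OF U C])
  interpret abc: tens_pair "tens A unit_cat" C by (rule tens_pair.intro[OF AU C])
  show ?thesis
    by (rule tens3_eqI[OF A U C])
      (simp_all add: two_fun_comp tens_fun_app tens_fun_ends two_fun_id assoc_Arr assoc_app two_fun lunit runit
        ins_app[OF A U] ins_app[OF U C] ins_app[OF AU C] ins_app[OF A UC] ins_app[OF A C] unit_cells unit_1
        in_tens_cells(1) ab.gm bc.gm abc.gm ac.gm two_cat_1[OF A] two_cat_1[OF C] ac.gm_id_l ac.gm_id_r U A C AU UC
        gray_bifunctor.gm_id_r[OF gray_bifunctor_tens[OF A UC]] abc.gm_id_l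
        two_cat_1[OF AU] two_cat_v[OF AU] two_cat_1[OF UC] two_cat_v[OF UC] two_cat_1[OF tens_two_cat[OF AU C]] two_cat_v[OF tens_two_cat[OF AU C]] two_cat_1[OF tens_two_cat[OF A UC]] two_cat_v[OF tens_two_cat[OF A UC]] two_cat_1[OF tens_two_cat[OF A C]] two_cat_v[OF tens_two_cat[OF A C]])
qed

section \<open>Iterated tensor products in a monoidal category\<close>

text \<open>The compatibilities \<open>lu_T\<close>, \<open>ru_T\<close> and \<open>lu_I\<close> of the unit constraints are among the assumptions, since
  for the Gray tensor product they are checked on generators just as the triangle is.\<close>

locale monoidal = category C for C :: "('o, 'a) cat" +
  fixes T :: "'o \<Rightarrow> 'o \<Rightarrow> 'o" and Tf :: "'a \<Rightarrow> 'a \<Rightarrow> 'a" and I :: 'o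
    and a :: "'o \<Rightarrow> 'o \<Rightarrow> 'o \<Rightarrow> 'a" and lu ru ru' :: "'o \<Rightarrow> 'a"
  assumes I: "I \<in> Obj C"
    and T: "A \<in> Obj C ==> B \<in> Obj C ==> T A B \<in> Obj C"
    and Tf: "F \<in> Arr C ==> G \<in> Arr C ==> Tf F G \<in> Arr C"
      "F \<in> Arr C ==> G \<in> Arr C ==> Dom C (Tf F G) = T (Dom C F) (Dom C G)"
      "F \<in> Arr C ==> G \<in> Arr C ==> Cod C (Tf F G) = T (Cod C F) (Cod C G)"
    and Tf_Id: "A \<in> Obj C ==> B \<in> Obj C ==> Tf (Id C A) (Id C B) = Id C (T A B)"
    and Tf_Comp: "F \<in> Arr C ==> F' \<in> Arr C ==> Cod C F = Dom C F' ==> G \<in> Arr C ==> G' \<in> Arr C ==>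
      Cod C G = Dom C G' ==> Comp C (Tf F' G') (Tf F G) = Tf (Comp C F' F) (Comp C G' G)"
    and a: "A \<in> Obj C ==> B \<in> Obj C ==> E \<in> Obj C ==> a A B E \<in> Hom C (T (T A B) E) (T A (T B E))"
    and lu: "A \<in> Obj C ==> lu A \<in> Hom C (T I A) A"
    and ru: "A \<in> Obj C ==> ru A \<in> Hom C (T A I) A"
    and ru': "A \<in> Obj C ==> ru' A \<in> Hom C A (T A I)"
    and ru_inverse: "A \<in> Obj C ==> Comp C (ru A) (ru' A) = Id C A"
      "A \<in> Obj C ==> Comp C (ru' A) (ru A) = Id C (T A I)"
    and a_natural: "F \<in> Arr C ==> G \<in> Arr C ==> H \<in> Arr C ==>
      Comp C (a (Cod C F) (Cod C G) (Cod C H)) (Tf (Tf F G) H) =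
      Comp C (Tf F (Tf G H)) (a (Dom C F) (Dom C G) (Dom C H))"
    and lu_natural: "F \<in> Arr C ==> Comp C (lu (Cod C F)) (Tf (Id C I) F) = Comp C F (lu (Dom C F))"
    and ru_natural: "F \<in> Arr C ==> Comp C (ru (Cod C F)) (Tf F (Id C I)) = Comp C F (ru (Dom C F))"
    and pentagon: "A \<in> Obj C ==> B \<in> Obj C ==> D \<in> Obj C ==> E \<in> Obj C ==>
      Comp C (a A B (T D E)) (a (T A B) D E) =
      Comp C (Tf (Id C A) (a B D E)) (Comp C (a A (T B D) E) (Tf (a A B D) (Id C E)))"
    and lu_T: "A \<in> Obj C ==> B \<in> Obj C ==> Comp C (lu (T A B)) (a I A B) = Tf (lu A) (Id C B)"
    and ru_T: "A \<in> Obj C ==> B \<in> Obj C ==> Comp C (Tf (Id C A) (ru B)) (a A B I) = ru (T A B)"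
    and triangle: "A \<in> Obj C ==> B \<in> Obj C ==> Comp C (Tf (Id C A) (lu B)) (a A I B) = Tf (ru A) (Id C B)"
    and lu_I: "lu I = ru I"
begin

abbreviation comp (infixr "\<cdot>" 70) where "g \<cdot> f \<equiv> Comp C g f"

lemma ends: "f \<in> Arr C ==> Dom C f \<in> Obj C" "f \<in> Arr C ==> Cod C f \<in> Obj C"
  using dom_cod by auto

lemma Id_ty: "A \<in> Obj C ==> Id C A \<in> Arr C" "A \<in> Obj C ==> Dom C (Id C A) = A"
  "A \<in> Obj C ==> Cod C (Id C A) = A"
  using id_hom by (auto simp: Hom_iff)

lemma Comp_ty: "f \<in> Arr C ==> g \<in> Arr C ==> Cod C f = Dom C g ==> g \<cdot> f \<in> Arr C"
  "f \<in> Arr C ==> g \<in> Arr C ==> Cod C f = Dom C g ==> Dom C (g \<cdot> f) = Dom C f"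
  "f \<in> Arr C ==> g \<in> Arr C ==> Cod C f = Dom C g ==> Cod C (g \<cdot> f) = Cod C g"
  using comp_hom[of f "Dom C f" "Cod C f" g "Cod C g"] by (auto simp: Hom_iff)

lemma Comp_Id: "f \<in> Arr C ==> Dom C f = A ==> f \<cdot> Id C A = f"
  "f \<in> Arr C ==> Cod C f = A ==> Id C A \<cdot> f = f"
  using comp_id id_comp by auto

lemma Comp_assoc: "f \<in> Arr C ==> g \<in> Arr C ==> h \<in> Arr C ==> Cod C f = Dom C g ==> Cod C g = Dom C h ==>
    (h \<cdot> g) \<cdot> f = h \<cdot> g \<cdot> f"
  by (rule comp_assoc[symmetric]) (auto simp: Hom_iff)

lemma coh_ty:
  "A \<in> Obj C ==> B \<in> Obj C ==> E \<in> Obj C ==> a A B E \<in> Arr C"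
  "A \<in> Obj C ==> B \<in> Obj C ==> E \<in> Obj C ==> Dom C (a A B E) = T (T A B) E"
  "A \<in> Obj C ==> B \<in> Obj C ==> E \<in> Obj C ==> Cod C (a A B E) = T A (T B E)"
  "A \<in> Obj C ==> lu A \<in> Arr C" "A \<in> Obj C ==> Dom C (lu A) = T I A" "A \<in> Obj C ==> Cod C (lu A) = A"
  "A \<in> Obj C ==> ru A \<in> Arr C" "A \<in> Obj C ==> Dom C (ru A) = T A I" "A \<in> Obj C ==> Cod C (ru A) = A"
  "A \<in> Obj C ==> ru' A \<in> Arr C" "A \<in> Obj C ==> Dom C (ru' A) = A" "A \<in> Obj C ==> Cod C (ru' A) = T A I"
  using a lu ru ru' by (auto simp: Hom_iff)

lemmas ty = ends Id_ty Comp_ty coh_ty I T Tf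

lemma Tf_Comp': "F \<in> Arr C ==> F' \<in> Arr C ==> Cod C F = Dom C F' ==> G \<in> Arr C ==> G' \<in> Arr C ==>
    Cod C G = Dom C G' ==> e \<in> Arr C ==> Cod C e = T (Dom C F) (Dom C G) ==>
    Tf F' G' \<cdot> Tf F G \<cdot> e = Tf (F' \<cdot> F) (G' \<cdot> G) \<cdot> e"
  by (subst Comp_assoc[symmetric]) (simp_all add: ty Tf_Comp)

text \<open>Bracketed to the right and ending in the unit, iterated tensor products have structure maps defined by plain recursion on lists.\<close>

fun R :: "'o list \<Rightarrow> 'o" where
  "R [] = I"
| "R (A # As) = T A (R As)"

fun Rf :: "'a list \<Rightarrow> 'a" where
  "Rf [] = Id C I"
| "Rf (F # Fs) = Tf F (Rf Fs)"

fun append_arr :: "'o list \<Rightarrow> 'o list \<Rightarrow> 'a" where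
  "append_arr [] Bs = lu (R Bs)"
| "append_arr (A # As) Bs = Tf (Id C A) (append_arr As Bs) \<cdot> a A (R As) (R Bs)"

fun concat_arr :: "'o list list \<Rightarrow> 'a" where
  "concat_arr [] = Id C I"
| "concat_arr (As # Ass) = append_arr As (concat Ass) \<cdot> Tf (Id C (R As)) (concat_arr Ass)"

lemma R_Obj: "set As \<subseteq> Obj C ==> R As \<in> Obj C"
  by (induction As) (auto simp: ty)

lemma Rf_ty:
  "set Fs \<subseteq> Arr C ==> Rf Fs \<in> Arr C \<and> Dom C (Rf Fs) = R (map (Dom C) Fs) \<and> Cod C (Rf Fs) = R (map (Cod C) Fs)"
  by (induction Fs) (auto simp: ty)

lemma Rf_map_Id: "set As \<subseteq> Obj C ==> Rf (map (Id C) As) = Id C (R As)"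
  by (induction As) (auto simp: Tf_Id R_Obj)

lemma Rf_map_ty: "(\<And>x. x \<in> set xs ==> F x \<in> Arr C \<and> Dom C (F x) = X x \<and> Cod C (F x) = Y x) ==>
    Rf (map F xs) \<in> Arr C \<and> Dom C (Rf (map F xs)) = R (map X xs) \<and> Cod C (Rf (map F xs)) = R (map Y xs)"
  by (induction xs) (auto simp: ty)

lemma sub_concat: "set (concat Xss) \<subseteq> S ==> Xs \<in> set Xss ==> set Xs \<subseteq> S"
  by auto

lemma Rf_map_Comp:
  "(\<And>x. x \<in> set xs ==> F x \<in> Arr C \<and> G x \<in> Arr C \<and> Cod C (F x) = Dom C (G x)) ==>
    Rf (map (\<lambda>x. G x \<cdot> F x) xs) = Rf (map G xs) \<cdot> Rf (map F xs)"
proof (induction xs)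
  case Nil show ?case by (simp add: ty Comp_Id)
next
  case (Cons x xs)
  have "Rf (map F xs) \<in> Arr C \<and> Dom C (Rf (map F xs)) = R (map (\<lambda>x. Dom C (F x)) xs) \<and>
      Cod C (Rf (map F xs)) = R (map (\<lambda>x. Cod C (F x)) xs)"
    "Rf (map G xs) \<in> Arr C \<and> Dom C (Rf (map G xs)) = R (map (\<lambda>x. Cod C (F x)) xs) \<and>
      Cod C (Rf (map G xs)) = R (map (\<lambda>x. Cod C (G x)) xs)"
    using Cons.prems by (intro Rf_map_ty; auto)+
  then show ?case using Cons by (simp add: Tf_Comp)
qed

lemma append_arr_ty: "set As \<subseteq> Obj C ==> set Bs \<subseteq> Obj C ==>
    append_arr As Bs \<in> Arr C \<and> Dom C (append_arr As Bs) = T (R As) (R Bs) \<and> Cod C (append_arr As Bs) = R (As @ Bs)"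
  by (induction As) (auto simp: ty R_Obj)

lemma append_arr_natural: "set Fs \<subseteq> Arr C ==> set Gs \<subseteq> Arr C ==>
    append_arr (map (Cod C) Fs) (map (Cod C) Gs) \<cdot> Tf (Rf Fs) (Rf Gs) =
    Rf (Fs @ Gs) \<cdot> append_arr (map (Dom C) Fs) (map (Dom C) Gs)"
proof (induction Fs)
  case Nil then show ?case using lu_natural[of "Rf Gs"] Rf_ty[of Gs] by simp
next
  case (Cons F Fs)
  have o: "set (map (Cod C) Fs) \<subseteq> Obj C" "set (map (Cod C) Gs) \<subseteq> Obj C"
    "set (map (Dom C) Fs) \<subseteq> Obj C" "set (map (Dom C) Gs) \<subseteq> Obj C"
    using Cons.prems by (auto simp: ty)
  note t = Rf_ty[of Fs] Rf_ty[of Gs] Rf_ty[of "Fs @ Gs"] append_arr_ty[OF o(1,2)] append_arr_ty[OF o(3,4)]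
    o[THEN R_Obj]
  have F: "F \<in> Arr C" "set Fs \<subseteq> Arr C" using Cons.prems by auto
  have "append_arr (map (Cod C) (F # Fs)) (map (Cod C) Gs) \<cdot> Tf (Rf (F # Fs)) (Rf Gs) =
    Tf (Id C (Cod C F)) (append_arr (map (Cod C) Fs) (map (Cod C) Gs)) \<cdot>
    (a (Cod C F) (Cod C (Rf Fs)) (Cod C (Rf Gs)) \<cdot> Tf (Tf F (Rf Fs)) (Rf Gs))"
    using t F Cons.prems by (simp add: ty Comp_assoc)
  also have "\<dots> = Tf (F \<cdot> Id C (Dom C F)) (append_arr (map (Cod C) Fs) (map (Cod C) Gs) \<cdot> Tf (Rf Fs) (Rf Gs)) \<cdot>
      a (Dom C F) (Dom C (Rf Fs)) (Dom C (Rf Gs))"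
    using t F Cons.prems by (subst a_natural) (simp_all add: ty Comp_assoc Tf_Comp' Comp_Id)
  also have "\<dots> = Rf ((F # Fs) @ Gs) \<cdot> append_arr (map (Dom C) (F # Fs)) (map (Dom C) Gs)"
    unfolding Cons.IH[OF F(2) Cons.prems(2)]
    using t F Cons.prems by (simp add: ty Comp_assoc Tf_Comp')
  finally show ?case .
qed

text \<open>The induction step is the pentagon, the base case is \<open>lu_T\<close>.\<close>

lemma append_arr_append: "set As \<subseteq> Obj C ==> set Bs \<subseteq> Obj C ==> set Cs \<subseteq> Obj C ==>
    append_arr (As @ Bs) Cs \<cdot> Tf (append_arr As Bs) (Id C (R Cs)) =
    append_arr As (Bs @ Cs) \<cdot> Tf (Id C (R As)) (append_arr Bs Cs) \<cdot> a (R As) (R Bs) (R Cs)"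
proof (induction As)
  case Nil
  note t = append_arr_ty[of Bs Cs] R_Obj[of Bs] R_Obj[of Cs] R_Obj[of "Bs @ Cs"]
  have "append_arr ([] @ Bs) Cs \<cdot> Tf (append_arr [] Bs) (Id C (R Cs)) =
    (append_arr Bs Cs \<cdot> lu (T (R Bs) (R Cs))) \<cdot> a I (R Bs) (R Cs)"
    using Nil t by (simp add: ty Comp_assoc lu_T)
  also have "append_arr Bs Cs \<cdot> lu (T (R Bs) (R Cs)) = lu (R (Bs @ Cs)) \<cdot> Tf (Id C I) (append_arr Bs Cs)"
    using lu_natural[of "append_arr Bs Cs"] Nil t by simp
  finally show ?case using Nil t by (simp add: ty Comp_assoc)
next
  case (Cons A As)
  then have o: "A \<in> Obj C" "set As \<subseteq> Obj C" "set Bs \<subseteq> Obj C" "set Cs \<subseteq> Obj C" by auto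
  note t = append_arr_ty[OF o(2,3)] append_arr_ty[OF o(3,4)] append_arr_ty[of "As @ Bs" Cs]
    append_arr_ty[of As "Bs @ Cs"] R_Obj[OF o(2)] R_Obj[OF o(3)] R_Obj[OF o(4)] R_Obj[of "As @ Bs"] R_Obj[of "Bs @ Cs"]
  note IH = Cons.IH[OF o(2-4)]
  let ?i = "Id C A"
  have "append_arr ((A # As) @ Bs) Cs \<cdot> Tf (append_arr (A # As) Bs) (Id C (R Cs)) =
    Tf ?i (append_arr (As @ Bs) Cs) \<cdot>
      (a A (R (As @ Bs)) (R Cs) \<cdot> Tf (Tf ?i (append_arr As Bs)) (Id C (R Cs))) \<cdot> Tf (a A (R As) (R Bs)) (Id C (R Cs))"
    using t o by (simp add: ty Comp_assoc Tf_Comp Comp_Id)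
  also have "a A (R (As @ Bs)) (R Cs) \<cdot> Tf (Tf ?i (append_arr As Bs)) (Id C (R Cs)) =
      Tf ?i (Tf (append_arr As Bs) (Id C (R Cs))) \<cdot> a A (T (R As) (R Bs)) (R Cs)"
    using a_natural[of ?i "append_arr As Bs" "Id C (R Cs)"] t o by (simp add: ty)
  also have "Tf ?i (append_arr (As @ Bs) Cs) \<cdot> (\<dots>) \<cdot> Tf (a A (R As) (R Bs)) (Id C (R Cs)) =
      Tf ?i (append_arr (As @ Bs) Cs \<cdot> Tf (append_arr As Bs) (Id C (R Cs))) \<cdot> a A (T (R As) (R Bs)) (R Cs) \<cdot>
        Tf (a A (R As) (R Bs)) (Id C (R Cs))"
    using t o by (simp add: ty Comp_assoc Tf_Comp' Comp_Id)
  also have "\<dots> = Tf ?i (append_arr As (Bs @ Cs) \<cdot> Tf (Id C (R As)) (append_arr Bs Cs)) \<cdot>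
      (Tf ?i (a (R As) (R Bs) (R Cs)) \<cdot> a A (T (R As) (R Bs)) (R Cs) \<cdot> Tf (a A (R As) (R Bs)) (Id C (R Cs)))"
    unfolding IH using t o by (simp add: ty Comp_assoc Tf_Comp' Comp_Id)
  also have "\<dots> = Tf ?i (append_arr As (Bs @ Cs)) \<cdot>
      (Tf ?i (Tf (Id C (R As)) (append_arr Bs Cs)) \<cdot> a A (R As) (T (R Bs) (R Cs))) \<cdot> a (T A (R As)) (R Bs) (R Cs)"
    using t o by (simp add: ty Comp_assoc Tf_Comp' Comp_Id flip: pentagon)
  also have "Tf ?i (Tf (Id C (R As)) (append_arr Bs Cs)) \<cdot> a A (R As) (T (R Bs) (R Cs)) =
      a A (R As) (R (Bs @ Cs)) \<cdot> Tf (Id C (T A (R As))) (append_arr Bs Cs)"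
    using a_natural[of ?i "Id C (R As)" "append_arr Bs Cs"] t o by (simp add: ty Tf_Id)
  finally show ?case using t o by (simp add: ty Comp_assoc)
qed

lemma append_arr_Nil: "set As \<subseteq> Obj C ==> append_arr As [] = ru (R As)"
  by (induction As) (auto simp: lu_I ru_T R_Obj)

lemma concat_ty: "set (concat Ass) \<subseteq> Obj C ==> concat_arr Ass \<in> Arr C \<and>
    Dom C (concat_arr Ass) = R (map R Ass) \<and> Cod C (concat_arr Ass) = R (concat Ass)"
proof (induction Ass)
  case (Cons As Ass)
  then show ?case using append_arr_ty[of As "concat Ass"] R_Obj[of As] R_Obj[of "concat Ass"] by (auto simp: ty)
qed (simp add: ty)

lemma concat_arr_natural: "set (concat Fss) \<subseteq> Arr C ==>
    concat_arr (map (map (Cod C)) Fss) \<cdot> Rf (map Rf Fss) = Rf (concat Fss) \<cdot> concat_arr (map (map (Dom C)) Fss)"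
proof (induction Fss)
  case (Cons Fs Fss)
  then have F: "set Fs \<subseteq> Arr C" "set (concat Fss) \<subseteq> Arr C" by auto
  have o: "set (map (Cod C) Fs) \<subseteq> Obj C" "set (map (Dom C) Fs) \<subseteq> Obj C"
    "set (map (Cod C) (concat Fss)) \<subseteq> Obj C" "set (map (Dom C) (concat Fss)) \<subseteq> Obj C"
    "set (concat (map (map (Cod C)) Fss)) \<subseteq> Obj C" "set (concat (map (map (Dom C)) Fss)) \<subseteq> Obj C"
    using F by (auto simp: ty)
  note t = Rf_ty[OF F(1)] Rf_ty[OF F(2)] Rf_map_ty[of Fss Rf, OF Rf_ty[OF sub_concat[OF F(2)]]]
    append_arr_ty[OF o(1,3)] append_arr_ty[OF o(2,4)]
    concat_ty[OF o(5)] concat_ty[OF o(6)] o(1-4)[THEN R_Obj]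
    map_concat[of "Dom C" Fss, symmetric] map_concat[of "Cod C" Fss, symmetric]
  let ?cd = "map (map (Dom C))" and ?cc = "map (map (Cod C))"
  have "concat_arr (?cc (Fs # Fss)) \<cdot> Rf (map Rf (Fs # Fss)) =
    append_arr (map (Cod C) Fs) (map (Cod C) (concat Fss)) \<cdot> Tf (Rf Fs) (concat_arr (?cc Fss) \<cdot> Rf (map Rf Fss))"
    using t F by (simp add: ty Comp_assoc Tf_Comp Comp_Id comp_def)
  also have "\<dots> = (append_arr (map (Cod C) Fs) (map (Cod C) (concat Fss)) \<cdot> Tf (Rf Fs) (Rf (concat Fss))) \<cdot>
      Tf (Id C (R (map (Dom C) Fs))) (concat_arr (?cd Fss))"
    unfolding Cons.IH[OF F(2)] using t F by (simp add: ty Comp_assoc Tf_Comp Comp_Id comp_def)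
  also have "\<dots> = Rf (concat (Fs # Fss)) \<cdot> concat_arr (?cd (Fs # Fss))"
    unfolding append_arr_natural[OF F(1,2)] using t F Rf_ty[of "Fs @ concat Fss"]
    by (simp add: ty Comp_assoc comp_def)
  finally show ?case .
qed (simp add: ty Comp_Id)

lemma concat_arr_append: "set (concat Ass) \<subseteq> Obj C ==> set (concat Bss) \<subseteq> Obj C ==>
    concat_arr (Ass @ Bss) \<cdot> append_arr (map R Ass) (map R Bss) =
    append_arr (concat Ass) (concat Bss) \<cdot> Tf (concat_arr Ass) (concat_arr Bss)"
proof (induction Ass)
  case Nil then show ?case using lu_natural[of "concat_arr Bss"] concat_ty[of Bss] by simp
next
  case (Cons As Ass)
  then have o: "set As \<subseteq> Obj C" "set (concat Ass) \<subseteq> Obj C" "set (concat Bss) \<subseteq> Obj C" by auto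
  have "set (map R Ass) \<subseteq> Obj C" "set (map R Bss) \<subseteq> Obj C"
    using R_Obj[OF sub_concat[OF o(2)]] R_Obj[OF sub_concat[OF o(3)]] by auto
  note o = o this
  note t = append_arr_ty[OF o(1,2)] append_arr_ty[OF o(2,3)] append_arr_ty[of As "concat Ass @ concat Bss"]
    append_arr_ty[of "As @ concat Ass" "concat Bss"] append_arr_ty[OF o(4,5)] o[THEN R_Obj]
    concat_ty[OF o(2)] concat_ty[OF o(3)] concat_ty[of "Ass @ Bss"] R_Obj[of "concat Ass @ concat Bss"]
    R_Obj[of "As @ concat Ass"]
  let ?i = "Id C (R As)" and ?B = "concat_arr Bss"
  have "concat_arr ((As # Ass) @ Bss) \<cdot> append_arr (map R (As # Ass)) (map R Bss) =
    append_arr As (concat Ass @ concat Bss) \<cdot>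
      Tf ?i (concat_arr (Ass @ Bss) \<cdot> append_arr (map R Ass) (map R Bss)) \<cdot> a (R As) (R (map R Ass)) (R (map R Bss))"
    using t o by (simp add: ty Comp_assoc Tf_Comp' Comp_Id)
  also have "\<dots> = append_arr As (concat Ass @ concat Bss) \<cdot> Tf ?i (append_arr (concat Ass) (concat Bss)) \<cdot>
      (Tf ?i (Tf (concat_arr Ass) ?B) \<cdot> a (R As) (R (map R Ass)) (R (map R Bss)))"
    unfolding Cons.IH[OF o(2,3)] using t o by (simp add: ty Comp_assoc Tf_Comp' Comp_Id)
  also have "Tf ?i (Tf (concat_arr Ass) ?B) \<cdot> a (R As) (R (map R Ass)) (R (map R Bss)) =
      a (R As) (R (concat Ass)) (R (concat Bss)) \<cdot> Tf (Tf ?i (concat_arr Ass)) ?B"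
    using a_natural[of ?i "concat_arr Ass" ?B] t o by (simp add: ty)
  also have "append_arr As (concat Ass @ concat Bss) \<cdot> Tf ?i (append_arr (concat Ass) (concat Bss)) \<cdot> (\<dots>) =
      (append_arr As (concat Ass @ concat Bss) \<cdot> Tf ?i (append_arr (concat Ass) (concat Bss)) \<cdot>
        a (R As) (R (concat Ass)) (R (concat Bss))) \<cdot> Tf (Tf ?i (concat_arr Ass)) ?B"
    using t o by (simp add: ty Comp_assoc)
  also have "\<dots> = append_arr (concat (As # Ass)) (concat Bss) \<cdot> Tf (concat_arr (As # Ass)) (concat_arr Bss)"
    unfolding append_arr_append[OF o(1-3), symmetric] using t o by (simp add: ty Comp_assoc Tf_Comp Comp_Id)
  finally show ?case .
qed

text \<open>Associativity of flattening follows from its compatibility with appending, \<open>concat_arr_append\<close>, by induction on the outer list.\<close>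

lemma concat_arr_concat: "set (concat (concat Asss)) \<subseteq> Obj C ==>
    concat_arr (concat Asss) \<cdot> concat_arr (map (map R) Asss) =
    concat_arr (map concat Asss) \<cdot> Rf (map concat_arr Asss)"
proof (induction Asss)
  case (Cons Ass Asss)
  have o: "set (concat Ass) \<subseteq> Obj C" "set (concat (concat Asss)) \<subseteq> Obj C"
    using Cons.prems by auto
  have cc: "concat (map concat Asss) = concat (concat Asss)" by (induction Asss) auto
  have cr: "concat (map (map R) Asss) = map R (concat Asss)" by (simp add: map_concat)
  have o': "set (concat (map (map R) Asss)) \<subseteq> Obj C" "set (map R Ass) \<subseteq> Obj C"
    "set (map R (concat Asss)) \<subseteq> Obj C" "set (concat (map concat Asss)) \<subseteq> Obj C"
    unfolding cr cc using o(2) R_Obj[OF sub_concat[OF o(1)]] R_Obj[OF sub_concat[OF o(2)]] by (simp_all add: image_subset_iff)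
  have q: "set (concat Ass) \<subseteq> Obj C" if "Ass \<in> set Asss" for Ass using that o(2) by auto
  note t = concat_ty[OF o(1)] concat_ty[OF o(2)] concat_ty[OF o'(1)] concat_ty[OF o'(4)]
    Rf_map_ty[of Asss concat_arr, OF concat_ty[OF q]]
    append_arr_ty[OF o(1) o(2)] append_arr_ty[OF o'(2,3)] o[THEN R_Obj] o'[THEN R_Obj] cr
    concat_ty[of "Ass @ concat Asss"] cc
  have "concat_arr (concat (Ass # Asss)) \<cdot> concat_arr (map (map R) (Ass # Asss)) =
    (concat_arr (Ass @ concat Asss) \<cdot> append_arr (map R Ass) (map R (concat Asss))) \<cdot>
      Tf (Id C (R (map R Ass))) (concat_arr (map (map R) Asss))"
    using t o by (simp add: comp_def ty Comp_assoc)
  also have "\<dots> = append_arr (concat Ass) (concat (concat Asss)) \<cdot>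
      Tf (concat_arr Ass) (concat_arr (concat Asss) \<cdot> concat_arr (map (map R) Asss))"
    unfolding concat_arr_append[OF o] using t o by (simp add: comp_def ty Comp_assoc Tf_Comp Comp_Id)
  also have "\<dots> = concat_arr (map concat (Ass # Asss)) \<cdot> Rf (map concat_arr (Ass # Asss))"
    unfolding Cons.IH[OF o(2)] using t o by (simp add: comp_def ty Comp_assoc Tf_Comp Comp_Id)
  finally show ?case .
qed (simp add: ty Comp_Id)

lemma concat_arr_single: "set As \<subseteq> Obj C ==> concat_arr [As] = ru (R As)"
  using append_arr_Nil[of As] by (simp add: Tf_Id R_Obj I Comp_Id ty)

lemma concat_arr_singles: "set As \<subseteq> Obj C ==> concat_arr (map (\<lambda>A. [A]) As) = Rf (map ru As)"
proof (induction As)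
  case (Cons A As)
  have t: "Rf (map ru As) \<in> Arr C \<and> Dom C (Rf (map ru As)) = R (map (\<lambda>A. T A I) As) \<and>
      Cod C (Rf (map ru As)) = R (map (\<lambda>A. A) As)"
    using Cons.prems by (intro Rf_map_ty) (auto simp: ty)
  have "append_arr [A] As = Tf (ru A) (Id C (R As))"
    using Cons.prems by (simp add: triangle R_Obj)
  then show ?case using Cons t R_Obj[of As] by (simp add: ty Tf_Comp Comp_Id)
qed simp

subsection \<open>Omitting the final unit\<close>

text \<open>The bracketing used for the tensor product of 2-categories, in which a one-element list gives its
  element itself. The isomorphisms \<open>pad\<close> and \<open>unpad\<close> transport the structure maps and their laws from
  \<open>R\<close>, where no case distinctions on the length are necessary.\<close>

fun G :: "'o list \<Rightarrow> 'o" where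
  "G [] = I"
| "G [A] = A"
| "G (A # B # As) = T A (G (B # As))"

fun Gf :: "'a list \<Rightarrow> 'a" where
  "Gf [] = Id C I"
| "Gf [F] = F"
| "Gf (F # K # Fs) = Tf F (Gf (K # Fs))"

fun pad :: "'o list \<Rightarrow> 'a" where
  "pad [] = Id C I"
| "pad [A] = ru' A"
| "pad (A # B # As) = Tf (Id C A) (pad (B # As))"

fun unpad :: "'o list \<Rightarrow> 'a" where
  "unpad [] = Id C I"
| "unpad [A] = ru A"
| "unpad (A # B # As) = Tf (Id C A) (unpad (B # As))"

lemma G_Obj: "set As \<subseteq> Obj C ==> G As \<in> Obj C"
  by (induction As rule: G.induct) (auto simp: ty)

lemma Gf_ty: "set Fs \<subseteq> Arr C ==>
    Gf Fs \<in> Arr C \<and> Dom C (Gf Fs) = G (map (Dom C) Fs) \<and> Cod C (Gf Fs) = G (map (Cod C) Fs)"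
  by (induction Fs rule: Gf.induct) (auto simp: ty)

lemma pad_ty: "set As \<subseteq> Obj C ==>
    pad As \<in> Arr C \<and> Dom C (pad As) = G As \<and> Cod C (pad As) = R As"
  by (induction As rule: pad.induct) (auto simp: ty)

lemma unpad_ty: "set As \<subseteq> Obj C ==>
    unpad As \<in> Arr C \<and> Dom C (unpad As) = R As \<and> Cod C (unpad As) = G As"
  by (induction As rule: unpad.induct) (auto simp: ty)

lemma unpad_pad: "set As \<subseteq> Obj C ==> unpad As \<cdot> pad As = Id C (G As)"
  by (induction As rule: pad.induct)
    (use pad_ty unpad_ty G_Obj in \<open>auto simp: ty Comp_Id ru_inverse Tf_Comp Tf_Id simp del: R.simps\<close>)

lemma pad_unpad: "set As \<subseteq> Obj C ==> pad As \<cdot> unpad As = Id C (R As)"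
proof (induction As rule: pad.induct)
  case (3 A B As)
  then show ?case using pad_ty[of "B # As"] unpad_ty[of "B # As"] R_Obj[of "B # As"]
    by (simp add: ty Comp_Id Tf_Comp Tf_Id del: R.simps(2)) simp
qed (auto simp: ty Comp_Id ru_inverse)

lemma ru'_natural: "F \<in> Arr C ==> ru' (Cod C F) \<cdot> F = Tf F (Id C I) \<cdot> ru' (Dom C F)"
proof -
  assume F: "F \<in> Arr C"
  have "ru' (Cod C F) \<cdot> F = ru' (Cod C F) \<cdot> (F \<cdot> ru (Dom C F)) \<cdot> ru' (Dom C F)"
    using F by (simp add: ty Comp_assoc ru_inverse Comp_Id)
  also have "\<dots> = (ru' (Cod C F) \<cdot> ru (Cod C F)) \<cdot> Tf F (Id C I) \<cdot> ru' (Dom C F)"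
    unfolding ru_natural[OF F, symmetric] using F by (simp add: ty Comp_assoc)
  also have "\<dots> = Tf F (Id C I) \<cdot> ru' (Dom C F)"
    using F by (simp add: ty ru_inverse Comp_Id)
  finally show ?thesis .
qed

lemma pad_natural: "set Fs \<subseteq> Arr C ==> pad (map (Cod C) Fs) \<cdot> Gf Fs = Rf Fs \<cdot> pad (map (Dom C) Fs)"
proof (induction Fs rule: Gf.induct)
  case (3 F K Fs)
  have o: "set (map (Cod C) (K # Fs)) \<subseteq> Obj C" "set (map (Dom C) (K # Fs)) \<subseteq> Obj C"
    using 3 by (auto simp: ty)
  show ?case using 3 pad_ty[OF o(1)] pad_ty[OF o(2)] Gf_ty[of "K # Fs"] Rf_ty[of "K # Fs"]
    by (simp add: ty Tf_Comp Comp_Id del: Rf.simps(2) R.simps(2)) (simp add: ty Tf_Comp Comp_Id)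
qed (auto simp: ty Comp_Id ru'_natural)

lemma unpad_natural:
  assumes F: "set Fs \<subseteq> Arr C"
  shows "unpad (map (Cod C) Fs) \<cdot> Rf Fs = Gf Fs \<cdot> unpad (map (Dom C) Fs)"
proof -
  have o: "set (map (Cod C) Fs) \<subseteq> Obj C" "set (map (Dom C) Fs) \<subseteq> Obj C"
    using F by (auto simp: ty)
  note t = pad_ty[OF o(1)] pad_ty[OF o(2)] unpad_ty[OF o(1)] unpad_ty[OF o(2)] Gf_ty[OF F] Rf_ty[OF F] o[THEN R_Obj] o[THEN G_Obj]
  have "unpad (map (Cod C) Fs) \<cdot> Rf Fs =
    unpad (map (Cod C) Fs) \<cdot> (Rf Fs \<cdot> pad (map (Dom C) Fs)) \<cdot> unpad (map (Dom C) Fs)"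
    using t o by (simp add: ty Comp_assoc pad_unpad Comp_Id)
  also have "\<dots> = (unpad (map (Cod C) Fs) \<cdot> pad (map (Cod C) Fs)) \<cdot> Gf Fs \<cdot> unpad (map (Dom C) Fs)"
    unfolding pad_natural[OF F, symmetric] using t o by (simp add: ty Comp_assoc)
  also have "\<dots> = Gf Fs \<cdot> unpad (map (Dom C) Fs)"
    using t o by (simp add: ty unpad_pad Comp_Id)
  finally show ?thesis .
qed

definition flatten :: "'o list list \<Rightarrow> 'a" where
  "flatten Ass = unpad (concat Ass) \<cdot> concat_arr Ass \<cdot> Rf (map pad Ass) \<cdot> pad (map G Ass)"

lemma flatten_parts:
  assumes "set (concat Ass) \<subseteq> Obj C"
  shows "Rf (map pad Ass) \<in> Arr C \<and> Dom C (Rf (map pad Ass)) = R (map G Ass) \<and>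
      Cod C (Rf (map pad Ass)) = R (map R Ass)"
    "set (map G Ass) \<subseteq> Obj C"
    "pad (map G Ass) \<in> Arr C \<and> Dom C (pad (map G Ass)) = G (map G Ass) \<and> Cod C (pad (map G Ass)) = R (map G Ass)"
    "unpad (map G Ass) \<in> Arr C \<and> Dom C (unpad (map G Ass)) = R (map G Ass) \<and> Cod C (unpad (map G Ass)) = G (map G Ass)"
    "unpad (concat Ass) \<in> Arr C \<and> Dom C (unpad (concat Ass)) = R (concat Ass) \<and> Cod C (unpad (concat Ass)) = G (concat Ass)"
    "concat_arr Ass \<in> Arr C \<and> Dom C (concat_arr Ass) = R (map R Ass) \<and> Cod C (concat_arr Ass) = R (concat Ass)"
proof -
  note q = sub_concat[OF assms]
  show "Rf (map pad Ass) \<in> Arr C \<and> Dom C (Rf (map pad Ass)) = R (map G Ass) \<and>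
      Cod C (Rf (map pad Ass)) = R (map R Ass)"
    using pad_ty[OF q] by (rule Rf_map_ty)
  show "set (map G Ass) \<subseteq> Obj C" using G_Obj[OF q] by auto
  then show "pad (map G Ass) \<in> Arr C \<and> Dom C (pad (map G Ass)) = G (map G Ass) \<and> Cod C (pad (map G Ass)) = R (map G Ass)"
    "unpad (map G Ass) \<in> Arr C \<and> Dom C (unpad (map G Ass)) = R (map G Ass) \<and> Cod C (unpad (map G Ass)) = G (map G Ass)"
    by (rule pad_ty, rule unpad_ty)
qed (use unpad_ty[OF assms] concat_ty[OF assms] in auto)

lemma flatten_ty:
  assumes "set (concat Ass) \<subseteq> Obj C"
  shows "flatten Ass \<in> Arr C \<and> Dom C (flatten Ass) = G (map G Ass) \<and> Cod C (flatten Ass) = G (concat Ass)"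
  using flatten_parts[OF assms] by (simp add: flatten_def ty)

lemma flatten_natural:
  assumes F: "set (concat Fss) \<subseteq> Arr C"
  shows "flatten (map (map (Cod C)) Fss) \<cdot> Gf (map Gf Fss) = Gf (concat Fss) \<cdot> flatten (map (map (Dom C)) Fss)"
proof -
  let ?X = "map (map (Dom C)) Fss" and ?Y = "map (map (Cod C)) Fss"
  have o: "set (concat ?X) \<subseteq> Obj C" "set (concat ?Y) \<subseteq> Obj C"
    using F by (auto simp: ty)
  have q: "Fs \<in> set Fss ==> set Fs \<subseteq> Arr C" "Fs \<in> set Fss ==> set (map (Cod C) Fs) \<subseteq> Obj C"
     "Fs \<in> set Fss ==> set (map (Dom C) Fs) \<subseteq> Obj C" for Fs
    using F by (auto simp: ty)
  have g: "set (map Gf Fss) \<subseteq> Arr C" using Gf_ty[OF q(1)] by auto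
  have gm: "map (Dom C) (map Gf Fss) = map G ?X" "map (Cod C) (map Gf Fss) = map G ?Y"
    using Gf_ty[OF q(1)] by auto
  note t = flatten_parts[OF o(1)] flatten_parts[OF o(2)] Gf_ty[OF g, unfolded gm] Rf_ty[OF g, unfolded gm]
    Rf_map_ty[of Fss Rf, OF Rf_ty[OF q(1)]] Rf_ty[OF F] Gf_ty[OF F]
  have 1: "pad (map G ?Y) \<cdot> Gf (map Gf Fss) = Rf (map Gf Fss) \<cdot> pad (map G ?X)"
    using pad_natural[OF g] unfolding gm .
  have e: "pad (map (Cod C) Fs) \<cdot> Gf Fs = Rf Fs \<cdot> pad (map (Dom C) Fs)" if "Fs \<in> set Fss" for Fs
    using that F by (intro pad_natural) auto
  have "Rf (map pad ?Y) \<cdot> Rf (map Gf Fss) = Rf (map (\<lambda>Fs. pad (map (Cod C) Fs) \<cdot> Gf Fs) Fss)"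
    by (subst Rf_map_Comp) (use q pad_ty Gf_ty in \<open>auto simp: comp_def\<close>)
  also have "\<dots> = Rf (map (\<lambda>Fs. Rf Fs \<cdot> pad (map (Dom C) Fs)) Fss)"
    using e by (auto intro!: arg_cong[where f = Rf])
  also have "\<dots> = Rf (map Rf Fss) \<cdot> Rf (map pad ?X)"
    by (subst Rf_map_Comp) (use q pad_ty Rf_ty in \<open>auto simp: comp_def\<close>)
  finally have 2: "Rf (map pad ?Y) \<cdot> Rf (map Gf Fss) = Rf (map Rf Fss) \<cdot> Rf (map pad ?X)" .
  have 3: "concat_arr ?Y \<cdot> Rf (map Rf Fss) = Rf (concat Fss) \<cdot> concat_arr ?X"
    by (rule concat_arr_natural[OF F])
  have 4: "unpad (concat ?Y) \<cdot> Rf (concat Fss) = Gf (concat Fss) \<cdot> unpad (concat ?X)"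
    using unpad_natural[OF F] by (simp add: map_concat)
  have "flatten ?Y \<cdot> Gf (map Gf Fss) =
      unpad (concat ?Y) \<cdot> concat_arr ?Y \<cdot> Rf (map pad ?Y) \<cdot> (pad (map G ?Y) \<cdot> Gf (map Gf Fss))"
    unfolding flatten_def using t by (simp add: comp_def ty Comp_assoc)
  also have "\<dots> = unpad (concat ?Y) \<cdot> concat_arr ?Y \<cdot> (Rf (map pad ?Y) \<cdot> Rf (map Gf Fss)) \<cdot> pad (map G ?X)"
    unfolding 1 using t by (simp add: comp_def ty Comp_assoc)
  also have "\<dots> = unpad (concat ?Y) \<cdot> (concat_arr ?Y \<cdot> Rf (map Rf Fss)) \<cdot> Rf (map pad ?X) \<cdot> pad (map G ?X)"
    unfolding 2 using t by (simp add: comp_def ty Comp_assoc)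
  also have "\<dots> = (unpad (concat ?Y) \<cdot> Rf (concat Fss)) \<cdot> concat_arr ?X \<cdot> Rf (map pad ?X) \<cdot> pad (map G ?X)"
    unfolding 3 using t by (simp add: comp_def ty Comp_assoc map_concat)
  also have "\<dots> = Gf (concat Fss) \<cdot> flatten ?X"
    unfolding 4 flatten_def using t by (simp add: comp_def ty Comp_assoc map_concat)
  finally show ?thesis .
qed

lemma flatten_single:
  assumes "set As \<subseteq> Obj C"
  shows "flatten [As] = Id C (G As)"
proof -
  note t = pad_ty[OF assms] unpad_ty[OF assms] R_Obj[OF assms] G_Obj[OF assms]
  have n: "ru (R As) \<cdot> Tf (pad As) (Id C I) = pad As \<cdot> ru (G As)"
    using ru_natural[of "pad As"] t by simp
  have "flatten [As] = unpad As \<cdot> (ru (R As) \<cdot> Tf (pad As) (Id C I)) \<cdot> ru' (G As)"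
    using concat_arr_single[OF assms] t by (simp add: flatten_def ty Comp_assoc)
  also have "\<dots> = unpad As \<cdot> pad As \<cdot> ru (G As) \<cdot> ru' (G As)"
    unfolding n using t by (simp add: ty Comp_assoc)
  also have "\<dots> = Id C (G As)" using t assms by (simp add: ty ru_inverse Comp_Id unpad_pad)
  finally show ?thesis .
qed

lemma flatten_singles:
  assumes "set As \<subseteq> Obj C"
  shows "flatten (map (\<lambda>A. [A]) As) = Id C (G As)"
proof -
  note t = pad_ty[OF assms] unpad_ty[OF assms] R_Obj[OF assms] G_Obj[OF assms]
  have "Rf (map ru As) \<cdot> Rf (map ru' As) = Rf (map (\<lambda>A. ru A \<cdot> ru' A) As)"
    by (rule Rf_map_Comp[symmetric]) (use assms in \<open>auto simp: ty\<close>)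
  also have "map (\<lambda>A. ru A \<cdot> ru' A) As = map (Id C) As"
    using assms by (auto simp: ru_inverse)
  finally have 1: "Rf (map ru As) \<cdot> Rf (map ru' As) = Id C (R As)" by (simp add: Rf_map_Id assms)
  have r: "Rf (map ru As) \<in> Arr C \<and> Dom C (Rf (map ru As)) = R (map (\<lambda>A. T A I) As) \<and>
      Cod C (Rf (map ru As)) = R (map (\<lambda>A. A) As)"
    "Rf (map ru' As) \<in> Arr C \<and> Dom C (Rf (map ru' As)) = R (map (\<lambda>A. A) As) \<and>
      Cod C (Rf (map ru' As)) = R (map (\<lambda>A. T A I) As)"
    using assms by (intro Rf_map_ty; auto simp: ty)+
  have mg: "map G (map (\<lambda>A. [A]) As) = As" by (simp add: map_idI)
  have mp: "map pad (map (\<lambda>A. [A]) As) = map ru' As" by simp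
  have "flatten (map (\<lambda>A. [A]) As) = unpad As \<cdot> Rf (map ru As) \<cdot> Rf (map ru' As) \<cdot> pad As"
    unfolding flatten_def mg mp concat_arr_singles[OF assms] by simp
  also have "\<dots> = unpad As \<cdot> (Rf (map ru As) \<cdot> Rf (map ru' As)) \<cdot> pad As"
    using t r by (simp add: ty Comp_assoc)
  also have "\<dots> = Id C (G As)"
    unfolding 1 using t by (simp add: Comp_Id unpad_pad assms)
  finally show ?thesis .
qed

lemma flatten_flatten:
  assumes o: "set (concat (concat Asss)) \<subseteq> Obj C"
  shows "flatten (concat Asss) \<cdot> flatten (map (map G) Asss) = flatten (map concat Asss) \<cdot> Gf (map flatten Asss)"
proof -
  have cc: "concat (map concat Asss) = concat (concat Asss)" by (induction Asss) auto
  have cg: "concat (map (map G) Asss) = map G (concat Asss)" by (simp add: map_concat)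
  have cr: "concat (map (map R) Asss) = map R (concat Asss)" by (simp add: map_concat)
  have o1: "set (concat (map (map G) Asss)) \<subseteq> Obj C" unfolding cg using G_Obj[OF sub_concat[OF o]] by auto
  have o1': "set (concat (map (map R) Asss)) \<subseteq> Obj C" unfolding cr using R_Obj[OF sub_concat[OF o]] by auto
  have o2: "set (concat (map concat Asss)) \<subseteq> Obj C" unfolding cc by (rule o)
  have q: "set (concat Ass) \<subseteq> Obj C" if "Ass \<in> set Asss" for Ass using that o by auto
  have fl: "set (map flatten Asss) \<subseteq> Arr C" using flatten_ty[OF q] by auto
  have flm: "map (Dom C) (map flatten Asss) = map G (map (map G) Asss)"
    "map (Cod C) (map flatten Asss) = map G (map concat Asss)"
    using flatten_ty[OF q] by auto
  note t1 = flatten_parts[OF o] note t2 = flatten_parts[OF o1] note t3 = flatten_parts[OF o2]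
  let ?P = "\<lambda>Ass. Rf (map pad Ass)" and ?Q = "\<lambda>Ass. pad (map G Ass)"
  note P = flatten_parts(1)[OF q] note Q = flatten_parts(3)[OF q]
  note t4 = Rf_map_ty[of Asss ?P, OF P] Rf_map_ty[of Asss ?Q, OF Q] Rf_map_ty[of Asss concat_arr, OF concat_ty[OF q]]
    concat_ty[OF o1'] cr
  \<comment> \<open>Naturality of \<open>concat_arr\<close> with respect to the paddings of the innermost lists.\<close>
  have n: "Rf (map pad (concat Asss)) \<cdot> concat_arr (map (map G) Asss) = concat_arr (map (map R) Asss) \<cdot> Rf (map ?P Asss)"
  proof -
    have qq: "As \<in> set Ass ==> Ass \<in> set Asss ==> set As \<subseteq> Obj C" for As Ass using o by auto
    have F: "set (concat (map (map pad) Asss)) \<subseteq> Arr C" using pad_ty[OF qq] by auto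
    have e: "map (map (Cod C)) (map (map pad) Asss) = map (map R) Asss" "map (map (Dom C)) (map (map pad) Asss) = map (map G) Asss"
      "concat (map (map pad) Asss) = map pad (concat Asss)" "map Rf (map (map pad) Asss) = map ?P Asss"
      using pad_ty[OF qq] by (auto simp: map_concat)
    show ?thesis using concat_arr_natural[OF F] unfolding e by simp
  qed
  have "flatten (concat Asss) \<cdot> flatten (map (map G) Asss) =
    unpad (concat (concat Asss)) \<cdot> concat_arr (concat Asss) \<cdot> Rf (map pad (concat Asss)) \<cdot>
      (pad (map G (concat Asss)) \<cdot> unpad (map G (concat Asss))) \<cdot> concat_arr (map (map G) Asss) \<cdot>
      Rf (map ?Q Asss) \<cdot> pad (map G (map (map G) Asss))"
    unfolding flatten_def cg using t1 t2 t4 by (simp add: ty Comp_assoc cg comp_def)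
  also have "\<dots> = unpad (concat (concat Asss)) \<cdot> concat_arr (concat Asss) \<cdot>
      (Rf (map pad (concat Asss)) \<cdot> concat_arr (map (map G) Asss)) \<cdot> Rf (map ?Q Asss) \<cdot> pad (map G (map (map G) Asss))"
    using pad_unpad[OF flatten_parts(2)[OF o]] t1 t2 t4 by (simp add: ty Comp_assoc Comp_Id cg comp_def)
  also have "\<dots> = unpad (concat (concat Asss)) \<cdot> (concat_arr (concat Asss) \<cdot> concat_arr (map (map R) Asss)) \<cdot>
      Rf (map ?P Asss) \<cdot> Rf (map ?Q Asss) \<cdot> pad (map G (map (map G) Asss))"
    unfolding n using t1 t2 t4 by (simp add: ty Comp_assoc cg comp_def)
  also have "\<dots> = unpad (concat (concat Asss)) \<cdot> concat_arr (map concat Asss) \<cdot>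
      (Rf (map concat_arr Asss) \<cdot> Rf (map ?P Asss) \<cdot> Rf (map ?Q Asss)) \<cdot> pad (map G (map (map G) Asss))"
    unfolding concat_arr_concat[OF o] using t1 t2 t3 t4 by (simp add: ty Comp_assoc cg comp_def cc)
  also have "Rf (map concat_arr Asss) \<cdot> Rf (map ?P Asss) \<cdot> Rf (map ?Q Asss) =
      Rf (map (\<lambda>Ass. concat_arr Ass \<cdot> ?P Ass \<cdot> ?Q Ass) Asss)"
    by (subst Rf_map_Comp[symmetric], use P Q in force, subst Rf_map_Comp[symmetric])
      (use P Q concat_ty[OF q] in \<open>auto simp: ty\<close>)
  also have "map (\<lambda>Ass. concat_arr Ass \<cdot> ?P Ass \<cdot> ?Q Ass) Asss = map (\<lambda>Ass. pad (concat Ass) \<cdot> flatten Ass) Asss"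
  proof (rule map_cong[OF HOL.refl])
    fix Ass assume Ass: "Ass \<in> set Asss"
    have "pad (concat Ass) \<cdot> flatten Ass = (pad (concat Ass) \<cdot> unpad (concat Ass)) \<cdot> concat_arr Ass \<cdot> ?P Ass \<cdot> ?Q Ass"
      unfolding flatten_def using P[OF Ass] Q[OF Ass] concat_ty[OF q[OF Ass]] pad_ty[OF q[OF Ass]] unpad_ty[OF q[OF Ass]]
      by (simp add: ty Comp_assoc)
    then show "concat_arr Ass \<cdot> ?P Ass \<cdot> ?Q Ass = pad (concat Ass) \<cdot> flatten Ass"
      using pad_unpad[OF q[OF Ass]] P[OF Ass] Q[OF Ass] concat_ty[OF q[OF Ass]] by (simp add: ty Comp_Id)
  qed
  also have "Rf (map (\<lambda>Ass. pad (concat Ass) \<cdot> flatten Ass) Asss) = Rf (map pad (map concat Asss)) \<cdot> Rf (map flatten Asss)"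
    by (subst Rf_map_Comp) (use pad_ty[OF q] flatten_ty[OF q] in \<open>auto simp: comp_def\<close>)
  also have "unpad (concat (concat Asss)) \<cdot> concat_arr (map concat Asss) \<cdot> (\<dots>) \<cdot> pad (map G (map (map G) Asss)) =
      unpad (concat (concat Asss)) \<cdot> concat_arr (map concat Asss) \<cdot> Rf (map pad (map concat Asss)) \<cdot>
      (Rf (map flatten Asss) \<cdot> pad (map G (map (map G) Asss)))"
    using t1 t2 t3 t4 Rf_map_ty[of Asss flatten, OF flatten_ty[OF q]] by (simp add: comp_def ty Comp_assoc cc)
  also have "Rf (map flatten Asss) \<cdot> pad (map G (map (map G) Asss)) = pad (map G (map concat Asss)) \<cdot> Gf (map flatten Asss)"
    using pad_natural[OF fl, unfolded flm] by (rule HOL.sym)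
  also have "unpad (concat (concat Asss)) \<cdot> concat_arr (map concat Asss) \<cdot> Rf (map pad (map concat Asss)) \<cdot> (\<dots>) =
      flatten (map concat Asss) \<cdot> Gf (map flatten Asss)"
    unfolding flatten_def[of "map concat Asss"] using t3 Gf_ty[OF fl, unfolded flm] by (simp add: comp_def ty Comp_assoc cc)
  finally show ?thesis .
qed

end

section \<open>Presheaves on a countable category\<close>

lemma mk_psh_arr_sel [simp]:
  "Src (mk_psh_arr S X Y \<eta>) = X" "Tgt (mk_psh_arr S X Y \<eta>) = Y"
  "c \<in> Obj S ==> x \<in> At X c ==> Map (mk_psh_arr S X Y \<eta>) c x = \<eta> c x"
  by (simp_all add: mk_psh_arr_def)

lemma Psh_sel [simp]: "X \<in> Obj (Psh S) \<longleftrightarrow> presheaf S X" "Dom (Psh S) = Src" "Cod (Psh S) = Tgt"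
  by (simp_all add: Psh_def)

lemma in_Hom_Psh: "f \<in> Hom (Psh S) X Y \<longleftrightarrow> f \<in> Arr (Psh S) \<and> Src f = X \<and> Tgt f = Y"
  by (simp add: Hom_iff)

text \<open>Countability of \<open>S\<close> makes \<open>'u\<close> large enough to hold the hom-sets, as values of the representable
  presheaves, and the categories of elements, as shapes of colimits.\<close>

locale countable_category = category S
  for S :: "('o, 'a) cat" +
  fixes U :: "'u itself"
  assumes countable_Obj: "countable (Obj S)" and countable_Arr: "countable (Arr S)"
    and infinite_U: "infinite (UNIV :: 'u set)"
begin

abbreviation P :: "(('o, 'a, 'u) psh, ('o, 'a, 'u) psh_arr) cat" where "P \<equiv> Psh S"

lemma Arr_ends: "f \<in> Arr S ==> Dom S f \<in> Obj S" "f \<in> Arr S ==> Cod S f \<in> Obj S"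
  using dom_cod by auto

lemma S_Id: "c \<in> Obj S ==> Id S c \<in> Arr S" "c \<in> Obj S ==> Dom S (Id S c) = c" "c \<in> Obj S ==> Cod S (Id S c) = c"
  using id_hom by (auto simp: Hom_iff)

lemma S_Comp: "f \<in> Arr S ==> g \<in> Arr S ==> Cod S f = Dom S g ==> Comp S g f \<in> Arr S"
  "f \<in> Arr S ==> g \<in> Arr S ==> Cod S f = Dom S g ==> Dom S (Comp S g f) = Dom S f"
  "f \<in> Arr S ==> g \<in> Arr S ==> Cod S f = Dom S g ==> Cod S (Comp S g f) = Cod S g"
  using comp_hom[of f "Dom S f" "Cod S f" g "Cod S g"] by (auto simp: Hom_iff)

lemma S_assoc: "f \<in> Arr S ==> g \<in> Arr S ==> h \<in> Arr S ==> Cod S f = Dom S g ==> Cod S g = Dom S h ==>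
    Comp S (Comp S h g) f = Comp S h (Comp S g f)"
  by (rule comp_assoc[symmetric]) (auto simp: Hom_iff)

lemma presheaf_app:
  assumes "presheaf S X"
  shows "f \<in> Arr S ==> x \<in> At X (Cod S f) ==> Act X f x \<in> At X (Dom S f)"
    "c \<in> Obj S ==> x \<in> At X c ==> Act X (Id S c) x = x"
    "f \<in> Arr S ==> g \<in> Arr S ==> Cod S f = Dom S g ==> x \<in> At X (Cod S g) ==>
      Act X (Comp S g f) x = Act X f (Act X g x)"
  using assms by (auto simp: presheaf_def Hom_iff)

lemma psh_natI:
  assumes "\<And>c x. c \<in> Obj S ==> x \<in> At X c ==> \<eta> c x \<in> At Y c"
    and "\<And>f x. f \<in> Arr S ==> x \<in> At X (Cod S f) ==> \<eta> (Dom S f) (Act X f x) = Act Y f (\<eta> (Cod S f) x)"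
  shows "psh_nat S X Y \<eta>"
  using assms by (auto simp: psh_nat_def Hom_iff)

lemma mk_psh_arr_Arr:
  "presheaf S X ==> presheaf S Y ==> psh_nat S X Y \<eta> ==> mk_psh_arr S X Y \<eta> \<in> Arr P"
  unfolding Psh_def by simp blast

lemma P_ends: "f \<in> Arr P ==> presheaf S (Src f)" "f \<in> Arr P ==> presheaf S (Tgt f)"
  by (auto simp: Psh_def)

lemma P_Map:
  assumes "f \<in> Arr P"
  shows "Tgt f = Y ==> c \<in> Obj S ==> x \<in> At (Src f) c ==> Map f c x \<in> At Y c"
    "Src f = X ==> g \<in> Arr S ==> x \<in> At X (Cod S g) ==>
      Map f (Dom S g) (Act X g x) = Act (Tgt f) g (Map f (Cod S g) x)"
proof -
  obtain X' Y' \<eta> where f: "f = mk_psh_arr S X' Y' \<eta>" "presheaf S X'" "psh_nat S X' Y' \<eta>"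
    using assms by (auto simp: Psh_def)
  show "Tgt f = Y ==> c \<in> Obj S ==> x \<in> At (Src f) c ==> Map f c x \<in> At Y c"
    using f by (auto simp: psh_nat_def)
  show "Src f = X ==> g \<in> Arr S ==> x \<in> At X (Cod S g) ==>
      Map f (Dom S g) (Act X g x) = Act (Tgt f) g (Map f (Cod S g) x)"
    using f(1,3) presheaf_app[OF f(2)] by (auto simp: psh_nat_def Arr_ends Hom_iff)
qed

lemma P_eqI:
  assumes "f \<in> Arr P" "g \<in> Arr P" "Src f = Src g" "Tgt f = Tgt g"
    and "\<And>c x. c \<in> Obj S ==> x \<in> At (Src f) c ==> Map f c x = Map g c x"
  shows "f = g"
proof -
  have "h = mk_psh_arr S (Src h) (Tgt h) (Map h)" if h: "h \<in> Arr P" for h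
  proof -
    obtain X Y \<eta> where *: "h = mk_psh_arr S X Y \<eta>" using h by (auto simp: Psh_def)
    show ?thesis unfolding * by (auto simp: mk_psh_arr_def)
  qed
  moreover have "mk_psh_arr S (Src f) (Tgt f) (Map f) = mk_psh_arr S (Src g) (Tgt g) (Map g)"
    using assms(3-5) by (auto simp: mk_psh_arr_def intro!: restrict_ext)
  ultimately show ?thesis using assms(1,2) by metis
qed

lemma P_Id: "presheaf S X ==> Id P X \<in> Arr P" "Src (Id P X) = X" "Tgt (Id P X) = X"
  "c \<in> Obj S ==> x \<in> At X c ==> Map (Id P X) c x = x"
proof -
  assume "presheaf S X"
  then have "mk_psh_arr S X X (\<lambda>c x. x) \<in> Arr P" by (intro mk_psh_arr_Arr psh_natI) auto
  then show "Id P X \<in> Arr P" by (simp add: Psh_def)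
qed (simp_all add: Psh_def)

lemma P_Comp: "f \<in> Arr P ==> g \<in> Arr P ==> Tgt f = Src g ==> Comp P g f \<in> Arr P"
  "Src (Comp P g f) = Src f" "Tgt (Comp P g f) = Tgt g"
  "c \<in> Obj S ==> x \<in> At (Src f) c ==> Map (Comp P g f) c x = Map g c (Map f c x)"
proof -
  assume *: "f \<in> Arr P" "g \<in> Arr P" "Tgt f = Src g"
  then have "psh_nat S (Src f) (Tgt g) (\<lambda>c x. Map g c (Map f c x))"
    by (intro psh_natI) (auto simp: P_Map Arr_ends)
  then have "mk_psh_arr S (Src f) (Tgt g) (\<lambda>c x. Map g c (Map f c x)) \<in> Arr P"
    using * by (intro mk_psh_arr_Arr P_ends)
  then show "Comp P g f \<in> Arr P" by (simp add: Psh_def)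
qed (simp_all add: Psh_def)

lemma P_Comp_Id: "f \<in> Arr P ==> Src f = X ==> Comp P f (Id P X) = f" "f \<in> Arr P ==> Tgt f = X ==> Comp P (Id P X) f = f"
  by (auto intro!: P_eqI simp: P_Comp P_Id P_ends P_Map)

lemma P_assoc: "f \<in> Arr P ==> g \<in> Arr P ==> h \<in> Arr P ==> Tgt f = Src g ==> Tgt g = Src h ==>
    Comp P (Comp P h g) f = Comp P h (Comp P g f)"
  by (intro P_eqI) (auto simp: P_Comp P_Map)

lemma category_P: "category P"
  by (rule category.intro) (auto simp: in_Hom_Psh P_ends P_Id P_Comp P_Comp_Id P_assoc)

subsection \<open>Representable presheaves\<close>

abbreviation yo :: "'o \<Rightarrow> ('o, 'a, 'u) psh" where "yo \<equiv> yoneda S"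
abbreviation ya :: "'a \<Rightarrow> ('o, 'a, 'u) psh_arr" where "ya \<equiv> yoneda_arr S"

text \<open>The element of the representable presheaf \<open>yo c\<close> given by an arrow to \<open>c\<close>.\<close>

definition name :: "'o \<Rightarrow> 'o \<Rightarrow> 'a \<Rightarrow> 'u" where "name c d = psh_code (representable S c) d"

definition unname :: "'o \<Rightarrow> 'o \<Rightarrow> 'u \<Rightarrow> 'a" where "unname c d = psh_decode (representable S c) d"

lemma unname_name: "h \<in> Arr S ==> Dom S h = d ==> Cod S h = c ==> unname c d (name c d h) = h"
proof -
  assume h: "h \<in> Arr S" "Dom S h = d" "Cod S h = c"
  have "\<exists>e :: 'a \<Rightarrow> 'u. inj_on e (Hom S d c)"
  proof -
    have "countable (Hom S d c)" using countable_Arr by (rule countable_subset[rotated]) (auto simp: Hom_def)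
    then obtain e :: "'a \<Rightarrow> nat" where e: "inj_on e (Hom S d c)" by (auto simp: countable_def)
    obtain i :: "nat \<Rightarrow> 'u" where i: "inj i"
      using infinite_countable_subset[OF infinite_U] by blast
    have "inj_on (i \<circ> e) (Hom S d c)" using e i by (intro comp_inj_on) (auto intro: inj_on_subset)
    then show ?thesis by blast
  qed
  then have "inj_on (SOME e :: 'a \<Rightarrow> 'u. inj_on e (Hom S d c)) (Hom S d c)" by (rule someI_ex)
  then have "inj_on (psh_code (representable S c) d :: 'a \<Rightarrow> 'u) (At (representable S c) d)"
    by (simp add: psh_code_def representable_def)
  then show ?thesis using h
    by (simp add: unname_def name_def psh_decode_def representable_def Hom_iff)
qed

lemma At_yo: "At (yo c) d = name c d ` Hom S d c"
  by (simp add: yoneda_def psh_copy_def representable_def name_def)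

lemma name_At: "h \<in> Arr S ==> Dom S h = d ==> Cod S h = c ==> name c d h \<in> At (yo c) d"
  by (auto simp: At_yo Hom_iff)

lemma Act_yo: "f \<in> Arr S ==> h \<in> Arr S ==> Cod S f = Dom S h ==> Cod S h = c ==> Cod S f = d ==>
    Act (yo c) f (name c d h) = name c (Dom S f) (Comp S h f)"
  using unname_name[of h d c] by (simp add: yoneda_def psh_copy_def representable_def name_def unname_def)

lemma presheaf_yo: "c \<in> Obj S ==> presheaf S (yo c)"
  unfolding presheaf_def Hom_iff
  by (auto simp: At_yo Act_yo Hom_iff S_Comp S_assoc S_Id comp_id intro!: imageI)

text \<open>The Yoneda correspondence between elements of \<open>X\<close> at \<open>c\<close> and arrows from the representable presheaf.\<close>

definition yel :: "('o, 'a, 'u) psh \<Rightarrow> 'o \<Rightarrow> 'u \<Rightarrow> ('o, 'a, 'u) psh_arr" where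
  "yel X c x = mk_psh_arr S (yo c) X (\<lambda>d u. Act X (unname c d u) x)"

lemma yel:
  assumes "presheaf S X" "c \<in> Obj S" "x \<in> At X c"
  shows "yel X c x \<in> Arr P" "Src (yel X c x) = yo c" "Tgt (yel X c x) = X"
    "h \<in> Arr S ==> Dom S h = d ==> Cod S h = c ==> Map (yel X c x) d (name c d h) = Act X h x"
proof -
  have "psh_nat S (yo c) X (\<lambda>d u. Act X (unname c d u) x)"
    using assms by (intro psh_natI) (auto simp: At_yo Hom_iff unname_name Act_yo S_Comp presheaf_app)
  then show "yel X c x \<in> Arr P" unfolding yel_def using assms presheaf_yo by (intro mk_psh_arr_Arr)
  show "Src (yel X c x) = yo c" "Tgt (yel X c x) = X" by (simp_all add: yel_def)
  show "h \<in> Arr S ==> Dom S h = d ==> Cod S h = c ==> Map (yel X c x) d (name c d h) = Act X h x"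
    using assms by (auto simp: yel_def Arr_ends name_At unname_name)
qed

lemma yel_eq:
  assumes f: "f \<in> Arr P" "Src f = yo c" and c: "c \<in> Obj S"
  shows "f = yel (Tgt f) c (Map f c (name c c (Id S c)))"
proof -
  have m: "Map f c (name c c (Id S c)) \<in> At (Tgt f) c"
    using P_Map(1)[OF f(1) HOL.refl c, of "name c c (Id S c)"] f c by (simp add: name_At S_Id)
  have "Map f (Dom S h) (name c (Dom S h) h) = Act (Tgt f) h (Map f c (name c c (Id S c)))"
    if "h \<in> Arr S" "Cod S h = c" for h
    using P_Map(2)[OF f(1) f(2), of h "name c c (Id S c)"] that f c id_comp[of h] by (simp add: Act_yo name_At S_Id)
  then show ?thesis
    by (intro P_eqI) (use f c m P_ends in \<open>auto simp: yel At_yo Hom_iff\<close>)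
qed

lemma Comp_yel:
  assumes "f \<in> Arr P" "Src f = X" "c \<in> Obj S" "x \<in> At X c"
  shows "Comp P f (yel X c x) = yel (Tgt f) c (Map f c x)"
proof -
  have X: "presheaf S X" using assms P_ends by auto
  have "Map (Comp P f (yel X c x)) c (name c c (Id S c)) = Map f c x"
    using assms X by (simp add: P_Comp yel name_At S_Id presheaf_app)
  then show ?thesis using yel_eq[of "Comp P f (yel X c x)" c] assms X by (simp add: P_Comp yel)
qed

lemma Comp_yoneda_arr:
  assumes "presheaf S X" "f \<in> Arr S" "x \<in> At X (Cod S f)"
  shows "Comp P (yel X (Cod S f) x) (ya f) = yel X (Dom S f) (Act X f x)"
    and "ya f = yel (yo (Cod S f)) (Dom S f) (name (Cod S f) (Dom S f) f)"
proof -
  have e: "ya f = mk_psh_arr S (yo (Dom S f)) (yo (Cod S f))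
     (\<lambda>d u. name (Cod S f) d (Comp S f (unname (Dom S f) d u)))"
    by (simp add: yoneda_arr_def name_def unname_def)
  have "psh_nat S (yo (Dom S f)) (yo (Cod S f)) (\<lambda>d u. name (Cod S f) d (Comp S f (unname (Dom S f) d u)))"
    using assms by (intro psh_natI) (auto simp: At_yo Hom_iff unname_name Act_yo S_Comp S_assoc intro!: imageI)
  then have A: "ya f \<in> Arr P" unfolding e
    using assms by (intro mk_psh_arr_Arr presheaf_yo Arr_ends)
  show *: "ya f = yel (yo (Cod S f)) (Dom S f) (name (Cod S f) (Dom S f) f)"
    using yel_eq[OF A, of "Dom S f"] assms comp_id[of f]
    by (simp add: e Arr_ends name_At S_Id unname_name)
  show "Comp P (yel X (Cod S f) x) (ya f) = yel X (Dom S f) (Act X f x)"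
    unfolding * using assms by (subst Comp_yel) (auto simp: yel Arr_ends name_At)
qed

lemma yoneda_arr:
  assumes "f \<in> Arr S"
  shows "ya f \<in> Arr P" "Src (ya f) = yo (Dom S f)" "Tgt (ya f) = yo (Cod S f)"
    "h \<in> Arr S ==> Dom S h = d ==> Cod S h = c ==> Dom S f = c ==>
      Map (ya f) d (name c d h) = name (Cod S f) d (Comp S f h)"
proof -
  have *: "ya f = yel (yo (Cod S f)) (Dom S f) (name (Cod S f) (Dom S f) f)"
    using assms by (intro Comp_yoneda_arr(2)[of "yo (Cod S f)" f "name (Cod S f) (Cod S f) (Id S (Cod S f))"])
      (auto simp: presheaf_yo Arr_ends name_At S_Id)
  show "ya f \<in> Arr P" "Src (ya f) = yo (Dom S f)" "Tgt (ya f) = yo (Cod S f)"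
    using assms yel by (auto simp: * presheaf_yo Arr_ends name_At)
  show "h \<in> Arr S ==> Dom S h = d ==> Cod S h = c ==> Dom S f = c ==>
      Map (ya f) d (name c d h) = name (Cod S f) d (Comp S f h)"
    using assms by (auto simp: * yel presheaf_yo Arr_ends name_At Act_yo)
qed

lemma yel_Id: "c \<in> Obj S ==> yel (yo c) c (name c c (Id S c)) = Id P (yo c)"
  using yel_eq[of "Id P (yo c)" c] by (simp add: P_Id presheaf_yo name_At S_Id)

lemma yoneda_arr_Id: "c \<in> Obj S ==> ya (Id S c) = Id P (yo c)"
  using Comp_yoneda_arr(2)[of "yo c" "Id S c" "name c c (Id S c)"] by (simp add: presheaf_yo S_Id name_At yel_Id)

subsection \<open>Every presheaf is a colimit of representables\<close>

text \<open>Colimits of any shape that embeds into \<open>'u\<close> are covered by cocontinuity.\<close>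

lemma cocontinuous_shape:
  fixes J :: "('i, 'j) cat" and E :: "('p, 'b) cat" and D :: "('q, 'c) cat"
    and e :: "'i \<Rightarrow> 'u" and k :: "'j \<Rightarrow> 'u"
  assumes "cocontinuous TYPE('u) D E Fo Fa" and J: "category J" and F: "cat_functor J D Do Da"
    and colim: "is_colimit J D Do Da z l"
    and e: "inj_on e (Obj J)" "inj_on k (Arr J)"
  shows "is_colimit J E (Fo \<circ> Do) (Fa \<circ> Da) (Fo z) (Fa \<circ> l)"
proof -
  interpret J: category J by (rule J)
  define e' where "e' = inv_into (Obj J) e"
  define k' where "k' = inv_into (Arr J) k"
  have e': "x \<in> Obj J ==> e' (e x) = x" for x using e by (simp add: e'_def)
  have k': "x \<in> Arr J ==> k' (k x) = x" for x using e by (simp add: k'_def)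
  define K :: "('u, 'u) cat" where "K = \<lparr>Obj = e ` Obj J, Arr = k ` Arr J, Dom = (\<lambda>u. e (Dom J (k' u))),
    Cod = (\<lambda>u. e (Cod J (k' u))), Id = (\<lambda>u. k (Id J (e' u))), Comp = (\<lambda>v u. k (Comp J (k' v) (k' u)))\<rparr>"
  have K: "Obj K = e ` Obj J" "Arr K = k ` Arr J" "x \<in> Arr J ==> Dom K (k x) = e (Dom J x)"
    "x \<in> Arr J ==> Cod K (k x) = e (Cod J x)" "y \<in> Obj J ==> Id K (e y) = k (Id J y)"
    "x \<in> Arr J ==> x' \<in> Arr J ==> Comp K (k x') (k x) = k (Comp J x' x)" for x y x'
    by (auto simp: K_def e' k')
  have ends: "x \<in> Arr J ==> Dom J x \<in> Obj J" "x \<in> Arr J ==> Cod J x \<in> Obj J" for x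
    using J.dom_cod by auto
  have Id: "y \<in> Obj J ==> Id J y \<in> Arr J" "y \<in> Obj J ==> Dom J (Id J y) = y" "y \<in> Obj J ==> Cod J (Id J y) = y" for y
    using J.id_hom by (auto simp: Hom_iff)
  have Comp: "x \<in> Arr J ==> y \<in> Arr J ==> Cod J x = Dom J y ==> Comp J y x \<in> Arr J"
    "x \<in> Arr J ==> y \<in> Arr J ==> Cod J x = Dom J y ==> Dom J (Comp J y x) = Dom J x"
    "x \<in> Arr J ==> y \<in> Arr J ==> Cod J x = Dom J y ==> Cod J (Comp J y x) = Cod J y" for x y
    using J.comp_hom[of x "Dom J x" "Cod J x" y "Cod J y"] by (auto simp: Hom_iff)
  have eeq: "x \<in> Obj J ==> y \<in> Obj J ==> e x = e y \<longleftrightarrow> x = y" for x y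
    using e by (meson inj_on_eq_iff)
  have "category K"
    by (rule category.intro)
      (auto simp: Hom_iff K ends Id Comp eeq J.comp_id J.id_comp intro!: arg_cong[of _ _ k] J.comp_assoc)
  moreover have "cat_functor K D (Do \<circ> e') (Da \<circ> k')"
  proof (rule cat_functor.intro)
    fix x assume "x \<in> Obj K" then show "(Do \<circ> e') x \<in> Obj D" "(Da \<circ> k') (Id K x) = Id D ((Do \<circ> e') x)"
      using cat_functor.obj[OF F] cat_functor.id[OF F] by (auto simp: K e' k' Id)
  next
    fix f x y assume "f \<in> Hom K x y" then show "(Da \<circ> k') f \<in> Hom D ((Do \<circ> e') x) ((Do \<circ> e') y)"
      using cat_functor.hom[OF F, of "k' f" "Dom J (k' f)" "Cod J (k' f)"]
      by (auto simp: Hom_iff K e' k' ends)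
  next
    fix f x y g z assume "f \<in> Hom K x y" "g \<in> Hom K y z"
    then show "(Da \<circ> k') (Comp K g f) = Comp D ((Da \<circ> k') g) ((Da \<circ> k') f)"
      using cat_functor.comp[OF F, of "k' f" "Dom J (k' f)" "Cod J (k' f)" "k' g" "Cod J (k' g)"]
      by (auto simp: Hom_iff K e' k' ends Comp eeq)
  qed
  moreover have cocone: "is_cocone K H (Mo \<circ> e') (Ma \<circ> k') w m \<longleftrightarrow> is_cocone J H Mo Ma w (m \<circ> e)"
    for H :: "('r, 'd) cat" and Mo Ma w m
    by (auto simp: is_cocone_def K e' k' ends)
  have colimit: "is_colimit K H (Mo \<circ> e') (Ma \<circ> k') w (m \<circ> e') \<longleftrightarrow> is_colimit J H Mo Ma w m"
    for H :: "('r, 'd) cat" and Mo Ma w m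
  proof -
    have eq: "is_cocone J H Mo Ma w' m1 = is_cocone J H Mo Ma w' m2" if "\<And>j. j \<in> Obj J ==> m1 j = m2 j" for w' m1 m2
      using that by (auto simp: is_cocone_def ends)
    have 1: "is_cocone J H Mo Ma w' (m' \<circ> e' \<circ> e) = is_cocone J H Mo Ma w' m'" for w' m'
      by (rule eq) (simp add: e')
    have "(\<forall>w' m'. is_cocone J H Mo Ma w' (m' \<circ> e) \<longrightarrow> (\<exists>!h. h \<in> Hom H w w' \<and> (\<forall>j\<in>Obj J. Comp H h (m j) = m' (e j)))) \<longleftrightarrow>
      (\<forall>w' m'. is_cocone J H Mo Ma w' m' \<longrightarrow> (\<exists>!h. h \<in> Hom H w w' \<and> (\<forall>j\<in>Obj J. Comp H h (m j) = m' j)))"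
      (is "?l = ?r")
    proof
      assume l: ?l
      show ?r
      proof (intro allI impI)
        fix w' m' assume "is_cocone J H Mo Ma w' m'"
        then have "is_cocone J H Mo Ma w' (m' \<circ> e' \<circ> e)" unfolding 1 .
        from l[rule_format, OF this] show "\<exists>!h. h \<in> Hom H w w' \<and> (\<forall>j\<in>Obj J. Comp H h (m j) = m' j)"
          by (simp add: e' cong: ball_cong)
      qed
    next
      assume ?r then show ?l by (auto simp: comp_def)
    qed
    then show ?thesis unfolding is_colimit_def cocone 1 K by (simp add: e' o_assoc)
  qed
  ultimately have "is_colimit K E (Fo \<circ> (Do \<circ> e')) (Fa \<circ> (Da \<circ> k')) (Fo z) (Fa \<circ> (l \<circ> e'))"
    using assms(1) colim unfolding cocontinuous_def by (metis colimit)
  then show ?thesis using colimit[of E "Fo \<circ> Do" "Fa \<circ> Da" "Fo z" "Fa \<circ> l"] by (simp add: o_assoc)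
qed

lemma yoneda_arr_Comp:
  assumes "f \<in> Arr S" "g \<in> Arr S" "Cod S f = Dom S g"
  shows "ya (Comp S g f) = Comp P (ya g) (ya f)"
  using assms by (intro P_eqI) (auto simp: yoneda_arr S_Comp P_Comp At_yo Hom_iff S_assoc)

definition elements :: "('o, 'a, 'u) psh \<Rightarrow> ('o \<times> 'u, 'a \<times> 'u) cat" where
  "elements X = \<lparr>Obj = {(c, x). c \<in> Obj S \<and> x \<in> At X c}, Arr = {(f, x). f \<in> Arr S \<and> x \<in> At X (Cod S f)},
     Dom = (\<lambda>(f, x). (Dom S f, Act X f x)), Cod = (\<lambda>(f, x). (Cod S f, x)), Id = (\<lambda>(c, x). (Id S c, x)),
     Comp = (\<lambda>(g, y) (f, x). (Comp S g f, y))\<rparr>"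

lemma category_elements: "presheaf S X ==> category (elements X)"
  by (rule category.intro)
    (auto simp: elements_def Hom_iff Arr_ends presheaf_app S_Id S_Comp comp_id id_comp S_assoc)

lemma elements_functor: "presheaf S X ==> cat_functor (elements X) P (yo \<circ> fst) (ya \<circ> fst)"
  by (rule cat_functor.intro)
    (auto simp: elements_def Hom_iff presheaf_yo yoneda_arr yoneda_arr_Id yoneda_arr_Comp)

text \<open>A cocone under the diagram of elements of \<open>X\<close> assigns to each element of \<open>X\<close> an element of the vertex, naturally; this is an arrow out of \<open>X\<close>.\<close>

lemma elements_colimit:
  assumes X: "presheaf S X"
  shows "is_colimit (elements X) P (yo \<circ> fst) (ya \<circ> fst) X (\<lambda>(c, x). yel X c x)"
  unfolding is_colimit_def
proof (intro conjI allI impI)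
  show "is_cocone (elements X) P (yo \<circ> fst) (ya \<circ> fst) X (\<lambda>(c, x). yel X c x)"
    using X by (auto simp: is_cocone_def elements_def in_Hom_Psh yel Comp_yoneda_arr)
next
  fix W m assume m: "is_cocone (elements X) P (yo \<circ> fst) (ya \<circ> fst) W m"
  have mh: "m (c, x) \<in> Arr P" "Src (m (c, x)) = yo c" "Tgt (m (c, x)) = W" if "c \<in> Obj S" "x \<in> At X c" for c x
    using m that by (auto simp: is_cocone_def elements_def in_Hom_Psh)
  have mc: "Comp P (m (Cod S f, x)) (ya f) = m (Dom S f, Act X f x)" if "f \<in> Arr S" "x \<in> At X (Cod S f)" for f x
    using m that by (auto simp: is_cocone_def elements_def)
  have W: "presheaf S W" using m by (auto simp: is_cocone_def)
  let ?n = "\<lambda>c. name c c (Id S c)"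
  define h where "h = mk_psh_arr S X W (\<lambda>c x. Map (m (c, x)) c (?n c))"
  have nat: "psh_nat S X W (\<lambda>c x. Map (m (c, x)) c (?n c))"
  proof (rule psh_natI)
    fix c x assume "c \<in> Obj S" "x \<in> At X c"
    then show "Map (m (c, x)) c (?n c) \<in> At W c" using P_Map(1)[OF mh(1,3)] mh(2) by (simp add: name_At S_Id)
  next
    fix f x assume f: "f \<in> Arr S" "x \<in> At X (Cod S f)"
    have "Map (m (Dom S f, Act X f x)) (Dom S f) (?n (Dom S f)) =
        Map (m (Cod S f, x)) (Dom S f) (name (Cod S f) (Dom S f) f)"
      unfolding mc[OF f, symmetric] using f comp_id[of f]
      by (simp add: P_Comp yoneda_arr name_At S_Id Arr_ends)
    also have "\<dots> = Map (m (Cod S f, x)) (Dom S f) (Act (yo (Cod S f)) f (?n (Cod S f)))"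
      using f id_comp[of f] by (simp add: Act_yo S_Id Arr_ends)
    also have "\<dots> = Act W f (Map (m (Cod S f, x)) (Cod S f) (?n (Cod S f)))"
      using f mh by (subst P_Map(2)) (auto simp: Arr_ends name_At S_Id)
    finally show "Map (m (Dom S f, Act X f x)) (Dom S f) (?n (Dom S f)) =
      Act W f (Map (m (Cod S f, x)) (Cod S f) (?n (Cod S f)))" .
  qed
  have h: "h \<in> Arr P" "Src h = X" "Tgt h = W"
    using mk_psh_arr_Arr[OF X W nat] by (auto simp: h_def)
  have hm: "Comp P h (yel X c x) = m (c, x)" if "c \<in> Obj S" "x \<in> At X c" for c x
    using that h yel_eq[OF mh(1,2)[OF that] that(1)] mh(3)[OF that] by (subst Comp_yel) (auto simp: h_def)
  show "\<exists>!h. h \<in> Hom P X W \<and> (\<forall>j\<in>Obj (elements X). Comp P h (case j of (c, x) \<Rightarrow> yel X c x) = m j)"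
  proof (rule ex1I[of _ h])
    show "h \<in> Hom P X W \<and> (\<forall>j\<in>Obj (elements X). Comp P h (case j of (c, x) \<Rightarrow> yel X c x) = m j)"
      using h hm by (auto simp: in_Hom_Psh elements_def)
  next
    fix h' assume "h' \<in> Hom P X W \<and> (\<forall>j\<in>Obj (elements X). Comp P h' (case j of (c, x) \<Rightarrow> yel X c x) = m j)"
    then have h': "h' \<in> Arr P" "Src h' = X" "Tgt h' = W"
      "\<And>c x. c \<in> Obj S ==> x \<in> At X c ==> Comp P h' (yel X c x) = m (c, x)"
      by (auto simp: in_Hom_Psh elements_def)
    show "h' = h"
    proof (rule P_eqI)
      fix c x assume cx: "c \<in> Obj S" "x \<in> At (Src h') c"
      have "Map k c x = Map (Comp P k (yel X c x)) c (?n c)" if "k \<in> Arr P" "Src k = X" for k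
        using cx h' X by (simp add: P_Comp yel name_At S_Id presheaf_app)
      then show "Map h' c x = Map h c x" using h h' hm cx by simp
    qed (use h h' in auto)
  qed
qed

lemma cocontinuous_extend:
  assumes F: "cocontinuous TYPE('u) P E Fo Fa" and X: "presheaf S X" and W: "W \<in> Obj E"
    and m: "\<And>c x. c \<in> Obj S ==> x \<in> At X c ==> m c x \<in> Hom E (Fo (yo c)) W"
    and compat: "\<And>f x. f \<in> Arr S ==> x \<in> At X (Cod S f) ==>
      Comp E (m (Cod S f) x) (Fa (ya f)) = m (Dom S f) (Act X f x)"
  shows "\<exists>!h. h \<in> Hom E (Fo X) W \<and> (\<forall>c\<in>Obj S. \<forall>x\<in>At X c. Comp E h (Fa (yel X c x)) = m c x)"
proof -
  obtain eo :: "'o \<Rightarrow> nat" where eo: "inj_on eo (Obj S)" using countable_Obj by (auto simp: countable_def)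
  obtain ea :: "'a \<Rightarrow> nat" where ea: "inj_on ea (Arr S)" using countable_Arr by (auto simp: countable_def)
  obtain j :: "nat \<Rightarrow> 'u" where j: "inj j" using infinite_countable_subset[OF infinite_U] by blast
  obtain b :: "'u \<times> 'u \<Rightarrow> 'u" where b: "inj b"
    using card_of_Times_same_infinite[OF infinite_U] unfolding card_of_ordIso[symmetric]
    by (auto simp: bij_betw_def)
  \<comment> \<open>An element \<open>x\<close> at \<open>c\<close> is coded in \<open>'u\<close> by pairing \<open>x\<close> with the image of a number for \<open>c\<close>.\<close>
  have bj: "b (j m, x) = b (j n, y) \<longleftrightarrow> m = n \<and> x = y" for m n x y
    using b j by (auto simp: inj_eq)
  have "inj_on (\<lambda>(c, x). b (j (eo c), x)) (Obj (elements X))"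
    by (rule inj_onI) (auto simp: elements_def bj dest: inj_onD[OF eo])
  moreover have "inj_on (\<lambda>(f, x). b (j (ea f), x)) (Arr (elements X))"
    by (rule inj_onI) (auto simp: elements_def bj dest: inj_onD[OF ea])
  ultimately have "is_colimit (elements X) E (Fo \<circ> (yo \<circ> fst)) (Fa \<circ> (ya \<circ> fst)) (Fo X)
      (Fa \<circ> (\<lambda>(c, x). yel X c x))"
    by (rule cocontinuous_shape[OF F category_elements[OF X] elements_functor[OF X] elements_colimit[OF X]])
  moreover have "is_cocone (elements X) E (Fo \<circ> (yo \<circ> fst)) (Fa \<circ> (ya \<circ> fst)) W (\<lambda>(c, x). m c x)"
    using W m compat by (auto simp: is_cocone_def elements_def)
  ultimately have "\<exists>!h. h \<in> Hom E (Fo X) W \<and>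
      (\<forall>j\<in>Obj (elements X). Comp E h ((Fa \<circ> (\<lambda>(c, x). yel X c x)) j) = (\<lambda>(c, x). m c x) j)"
    unfolding is_colimit_def by blast
  then show ?thesis by (simp add: elements_def split_beta Ball_def imp_conjL)
qed

end

section \<open>Functors of several variables\<close>

text \<open>Variables are indexed by a set rather than by the positions of a list, so that one statement covers
  both \<open>\<otimes>\<^sub>a\<close> and the nested tensor products, whose variables are indexed by pairs.\<close>

locale multi_cocontinuous = countable_category S U
  for S :: "('o, 'a) cat" and U :: "'u itself" +
  fixes I :: "'i set" and Fo :: "('i \<Rightarrow> ('o, 'a, 'u) psh) \<Rightarrow> ('o, 'a, 'u) psh"
    and Fa :: "('i \<Rightarrow> ('o, 'a, 'u) psh_arr) \<Rightarrow> ('o, 'a, 'u) psh_arr"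
  assumes finite_I: "finite I"
    and Fo_cong: "(\<And>i. i \<in> I ==> X i = Y i) ==> Fo X = Fo Y"
    and Fa_cong: "(\<And>i. i \<in> I ==> f i = g i) ==> Fa f = Fa g"
    and Fa_Hom: "(\<And>i. i \<in> I ==> f i \<in> Arr P) ==> Fa f \<in> Hom P (Fo (\<lambda>i. Src (f i))) (Fo (\<lambda>i. Tgt (f i)))"
    and Fa_Id: "(\<And>i. i \<in> I ==> presheaf S (X i)) ==> Fa (\<lambda>i. Id P (X i)) = Id P (Fo X)"
    and Fa_Comp: "(\<And>i. i \<in> I ==> f i \<in> Arr P) ==> (\<And>i. i \<in> I ==> g i \<in> Arr P) ==>
      (\<And>i. i \<in> I ==> Tgt (f i) = Src (g i)) ==> Fa (\<lambda>i. Comp P (g i) (f i)) = Comp P (Fa g) (Fa f)"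
    and cocont: "i \<in> I ==> (\<And>i. i \<in> I ==> presheaf S (X i)) ==>
      cocontinuous TYPE('u) P P (\<lambda>Y. Fo (X(i := Y))) (\<lambda>f. Fa ((\<lambda>j. Id P (X j))(i := f)))"
begin

text \<open>The stages of the passage from representables to arbitrary presheaves: the variables in \<open>K\<close> are free,
  the others are still restricted to representables.\<close>

definition partial :: "('i \<Rightarrow> ('o, 'a, 'u) psh) \<Rightarrow> 'i set \<Rightarrow> ('i \<Rightarrow> ('o, 'a, 'u) psh_arr) \<Rightarrow> bool" where
  "partial X K x \<longleftrightarrow> (\<forall>i\<in>I. x i \<in> Arr P \<and> Tgt (x i) = X i \<and> (i \<notin> K \<longrightarrow> (\<exists>c\<in>Obj S. Src (x i) = yo c)))"

abbreviation slot :: "('i \<Rightarrow> ('o, 'a, 'u) psh_arr) \<Rightarrow> 'i \<Rightarrow> 'o \<Rightarrow> 'u \<Rightarrow> 'i \<Rightarrow> ('o, 'a, 'u) psh_arr" where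
  "slot x k c e \<equiv> (\<lambda>j. Id P (Src (x j)))(k := yel (Src (x k)) c e)"

lemma Fa_ty: "(\<And>i. i \<in> I ==> f i \<in> Arr P) ==> Fa f \<in> Arr P"
  "(\<And>i. i \<in> I ==> f i \<in> Arr P) ==> Src (Fa f) = Fo (\<lambda>i. Src (f i))"
  "(\<And>i. i \<in> I ==> f i \<in> Arr P) ==> Tgt (Fa f) = Fo (\<lambda>i. Tgt (f i))"
  using Fa_Hom by (auto simp: in_Hom_Psh)

text \<open>A cocone of arrows into \<open>W\<close>, natural with respect to all arrows between such partial families.\<close>

definition family :: "('i \<Rightarrow> ('o, 'a, 'u) psh) \<Rightarrow> ('o, 'a, 'u) psh \<Rightarrow> 'i set \<Rightarrow>
    (('i \<Rightarrow> ('o, 'a, 'u) psh_arr) \<Rightarrow> ('o, 'a, 'u) psh_arr) \<Rightarrow> bool" where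
  "family X W K m \<longleftrightarrow> (\<forall>x. partial X K x \<longrightarrow> m x \<in> Hom P (Fo (\<lambda>i. Src (x i))) W) \<and>
     (\<forall>x y. (\<forall>i\<in>I. x i = y i) \<longrightarrow> m x = m y) \<and>
     (\<forall>x f. partial X K x \<longrightarrow> (\<forall>i\<in>I. f i \<in> Arr P \<and> Tgt (f i) = Src (x i)) \<longrightarrow>
        partial X K (\<lambda>i. Comp P (x i) (f i)) \<longrightarrow> m (\<lambda>i. Comp P (x i) (f i)) = Comp P (m x) (Fa f))"

lemma slot_unique:
  assumes k: "k \<in> I" and x: "\<And>i. i \<in> I ==> x i \<in> Arr P" and W: "presheaf S W"
    and m: "\<And>c e. c \<in> Obj S ==> e \<in> At (Src (x k)) c ==> m c e \<in> Hom P (Fo (\<lambda>i. Src (slot x k c e i))) W"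
    and compat: "\<And>f e. f \<in> Arr S ==> e \<in> At (Src (x k)) (Cod S f) ==>
      Comp P (m (Cod S f) e) (Fa ((\<lambda>j. Id P (Src (x j)))(k := ya f))) = m (Dom S f) (Act (Src (x k)) f e)"
  shows "\<exists>!h. h \<in> Hom P (Fo (\<lambda>i. Src (x i))) W \<and>
    (\<forall>c\<in>Obj S. \<forall>e\<in>At (Src (x k)) c. Comp P h (Fa (slot x k c e)) = m c e)"
proof -
  have s: "(\<lambda>i. Src (slot x k c e i)) = (\<lambda>i. Src (x i))(k := yo c)" if "c \<in> Obj S" "e \<in> At (Src (x k)) c" for c e
    using that x[OF k] by (auto simp: P_Id yel P_ends)
  have id: "(\<lambda>i. Src (x i))(k := Src (x k)) = (\<lambda>i. Src (x i))" by auto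
  note e = cocontinuous_extend[OF cocont[OF k, of "\<lambda>i. Src (x i)"], of "Src (x k)" W m, unfolded id]
  show ?thesis
    by (rule e) (use x k W m s compat P_ends in \<open>auto simp: P_Id\<close>)
qed

text \<open>Variable \<open>k\<close> is freed by extending along the colimit of representables in it. The uniqueness in
  \<open>slot_unique\<close> makes the extended family natural in all variables at once.\<close>

lemma family_step:
  assumes X: "\<And>i. i \<in> I ==> presheaf S (X i)" and W: "presheaf S W" and k: "k \<in> I"
    and m: "family X W K m"
  shows "\<exists>m'. family X W (insert k K) m' \<and> (\<forall>x. partial X K x \<longrightarrow> m' x = m x)"
proof -
  let ?Q = "\<lambda>x h. h \<in> Hom P (Fo (\<lambda>i. Src (x i))) W \<and>
    (\<forall>c\<in>Obj S. \<forall>e\<in>At (Src (x k)) c. Comp P h (Fa (slot x k c e)) = m (x(k := Comp P (x k) (yel (Src (x k)) c e))))"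
  have mH: "\<And>x. partial X K x ==> m x \<in> Hom P (Fo (\<lambda>i. Src (x i))) W"
    and mcong: "\<And>x y. (\<And>i. i \<in> I ==> x i = y i) ==> m x = m y"
    and mcomp: "\<And>x f. partial X K x ==> (\<And>i. i \<in> I ==> f i \<in> Arr P \<and> Tgt (f i) = Src (x i)) ==>
        partial X K (\<lambda>i. Comp P (x i) (f i)) ==> m (\<lambda>i. Comp P (x i) (f i)) = Comp P (m x) (Fa f)"
    using m unfolding family_def by blast+
  have pu: "partial X K (x(k := Comp P (x k) (yel (Src (x k)) c e)))"
    if "partial X (insert k K) x" "c \<in> Obj S" "e \<in> At (Src (x k)) c" for x c e
    using that k by (auto simp: partial_def P_Comp yel P_ends)
  have ex: "\<exists>!h. ?Q x h" if x: "partial X (insert k K) x" for x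
  proof (rule slot_unique[OF k _ W])
    have xA: "x i \<in> Arr P" if "i \<in> I" for i using x that by (auto simp: partial_def)
    show "i \<in> I ==> x i \<in> Arr P" for i by (rule xA)
    show "m (x(k := Comp P (x k) (yel (Src (x k)) c e))) \<in> Hom P (Fo (\<lambda>i. Src (slot x k c e i))) W"
      if "c \<in> Obj S" "e \<in> At (Src (x k)) c" for c e
    proof -
      have "Fo (\<lambda>i. Src ((x(k := Comp P (x k) (yel (Src (x k)) c e))) i)) = Fo (\<lambda>i. Src (slot x k c e i))"
        using that xA[OF k] by (intro Fo_cong) (auto simp: P_Comp P_Id)
      then show ?thesis using mH[OF pu[OF x that]] by simp
    qed
    fix f e assume f: "f \<in> Arr S" "e \<in> At (Src (x k)) (Cod S f)"
    note A = P_ends(1)[OF xA[OF k]]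
    have "Comp P (m (x(k := Comp P (x k) (yel (Src (x k)) (Cod S f) e)))) (Fa ((\<lambda>j. Id P (Src (x j)))(k := ya f))) =
      m (\<lambda>i. Comp P ((x(k := Comp P (x k) (yel (Src (x k)) (Cod S f) e))) i) (((\<lambda>j. Id P (Src (x j)))(k := ya f)) i))"
      using f A x k xA
      by (intro mcomp[symmetric] pu)
        (auto simp: Arr_ends P_Id P_Comp P_ends yoneda_arr yel partial_def P_Comp_Id)
    also have "\<dots> = m (x(k := Comp P (x k) (yel (Src (x k)) (Dom S f) (Act (Src (x k)) f e))))"
      using f A xA k by (intro mcong) (auto simp: P_Comp_Id P_assoc yoneda_arr yel Arr_ends Comp_yoneda_arr(1)[OF A])
    finally show "Comp P (m (x(k := Comp P (x k) (yel (Src (x k)) (Cod S f) e)))) (Fa ((\<lambda>j. Id P (Src (x j)))(k := ya f))) =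
      m (x(k := Comp P (x k) (yel (Src (x k)) (Dom S f) (Act (Src (x k)) f e))))" .
  qed
  define N where "N x = (\<lambda>i. if i \<in> I then x i else undefined)" for x :: "'i \<Rightarrow> ('o, 'a, 'u) psh_arr"
  define m' where "m' x = (THE h. ?Q (N x) h)" for x
  have Qcong: "?Q x = ?Q y" if "\<And>i. i \<in> I ==> x i = y i" for x y
  proof -
    have "Fo (\<lambda>i. Src (x i)) = Fo (\<lambda>i. Src (y i))" using that by (intro Fo_cong) auto
    moreover have "Fa (slot x k c e) = Fa (slot y k c e)" for c e using that k by (intro Fa_cong) auto
    moreover have "m (x(k := Comp P (x k) (yel (Src (x k)) c e))) = m (y(k := Comp P (y k) (yel (Src (y k)) c e)))" for c e
      using that k by (intro mcong) auto
    moreover have "x k = y k" using that k by auto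
    ultimately show ?thesis by simp
  qed
  have m': "?Q x (m' x)" if x: "partial X (insert k K) x" for x
  proof -
    have "?Q (N x) = ?Q x" by (rule Qcong) (auto simp: N_def)
    then show ?thesis unfolding m'_def using theI'[OF ex[OF x]] by simp
  qed
  have ext: "m' x = m x" if x: "partial X K x" for x
  proof -
    have x': "partial X (insert k K) x" using x by (auto simp: partial_def)
    have xA: "x i \<in> Arr P" if "i \<in> I" for i using x that by (auto simp: partial_def)
    note A = P_ends(1)[OF xA[OF k]]
    have "?Q x (m x)"
    proof (intro conjI ballI mH[OF x])
      fix c e assume ce: "c \<in> Obj S" "e \<in> At (Src (x k)) c"
      have "Comp P (m x) (Fa (slot x k c e)) = m (\<lambda>i. Comp P (x i) (slot x k c e i))"
        using ce x xA k A
        by (intro mcomp[symmetric]) (auto simp: P_Id P_ends yel partial_def P_Comp P_Comp_Id)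
      also have "\<dots> = m (x(k := Comp P (x k) (yel (Src (x k)) c e)))"
        using xA by (intro mcong) (auto simp: P_Comp_Id)
      finally show "Comp P (m x) (Fa (slot x k c e)) = m (x(k := Comp P (x k) (yel (Src (x k)) c e)))" .
    qed
    then show ?thesis using ex[OF x'] m'[OF x'] by blast
  qed
  have "family X W (insert k K) m'"
    unfolding family_def
  proof (intro conjI allI impI)
    show "m' x \<in> Hom P (Fo (\<lambda>i. Src (x i))) W" if "partial X (insert k K) x" for x
      using m'[OF that] by blast
    show "m' x = m' y" if "\<forall>i\<in>I. x i = y i" for x y
    proof -
      have "N x = N y" using that by (auto simp: N_def)
      then show ?thesis by (simp only: m'_def)
    qed
    fix x f assume x: "partial X (insert k K) x" and f: "\<forall>i\<in>I. f i \<in> Arr P \<and> Tgt (f i) = Src (x i)"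
      and xf: "partial X (insert k K) (\<lambda>i. Comp P (x i) (f i))"
    have xA: "x i \<in> Arr P" if "i \<in> I" for i using x that by (auto simp: partial_def)
    have fA: "f i \<in> Arr P" "Tgt (f i) = Src (x i)" if "i \<in> I" for i using f that by auto
    have ends: "presheaf S (Src (x i))" "presheaf S (Src (f i))" if "i \<in> I" for i
      using that xA fA P_ends by auto
    have mx: "m' x \<in> Arr P" "Src (m' x) = Fo (\<lambda>i. Src (x i))" "Tgt (m' x) = W"
      using m'[OF x] by (auto simp: in_Hom_Psh)
    have Ff: "Fa f \<in> Arr P" "Src (Fa f) = Fo (\<lambda>i. Src (f i))" "Tgt (Fa f) = Fo (\<lambda>i. Src (x i))"
      using Fa_ty[of f] fA by (auto intro!: Fo_cong)
    have "?Q (\<lambda>i. Comp P (x i) (f i)) (Comp P (m' x) (Fa f))"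
    proof (intro conjI ballI)
      show "Comp P (m' x) (Fa f) \<in> Hom P (Fo (\<lambda>i. Src (Comp P (x i) (f i)))) W"
        using mx Ff by (simp add: in_Hom_Psh P_Comp)
      fix c e assume c: "c \<in> Obj S" and "e \<in> At (Src (Comp P (x k) (f k))) c"
      then have e: "e \<in> At (Src (f k)) c" by (simp add: P_Comp)
      have e': "Map (f k) c e \<in> At (Src (x k)) c" using P_Map(1)[OF fA[OF k] c e] .
      let ?s = "slot (\<lambda>i. Comp P (x i) (f i)) k c e" and ?t = "slot x k c (Map (f k) c e)"
        and ?f = "f(k := Id P (yo c))" and ?xk = "x(k := Comp P (x k) (yel (Src (x k)) c (Map (f k) c e)))"
      have sA: "?s i \<in> Arr P" "Src (?s i) = (if i = k then yo c else Src (f i))" "Tgt (?s i) = Src (f i)" if "i \<in> I" for i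
        using that e ends[OF that] by (auto simp: P_Comp P_Id yel c)
      have tA: "?t i \<in> Arr P" "Src (?t i) = (if i = k then yo c else Src (x i))" "Tgt (?t i) = Src (x i)" if "i \<in> I" for i
        using that e' ends[OF that] by (auto simp: P_Id yel c)
      have gA: "?f i \<in> Arr P" "Tgt (?f i) = (if i = k then yo c else Src (x i))" if "i \<in> I" for i
        using that fA by (auto simp: P_Id presheaf_yo c)
      have "Comp P (Comp P (m' x) (Fa f)) (Fa ?s) = Comp P (m' x) (Comp P (Fa f) (Fa ?s))"
        using mx Ff Fa_ty[of ?s] sA by (intro P_assoc) (auto intro!: Fo_cong)
      also have "Comp P (Fa f) (Fa ?s) = Fa (\<lambda>i. Comp P (f i) (?s i))"
        using fA sA by (intro Fa_Comp[symmetric]) auto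
      also have "\<dots> = Fa (\<lambda>i. Comp P (?t i) (?f i))"
        using fA ends e e' c
        by (intro Fa_cong) (auto simp: P_Comp P_Comp_Id Comp_yel yel)
      also have "\<dots> = Comp P (Fa ?t) (Fa ?f)"
        using tA gA by (intro Fa_Comp) auto
      also have "Comp P (m' x) \<dots> = Comp P (Comp P (m' x) (Fa ?t)) (Fa ?f)"
        using mx Fa_ty[of ?t] Fa_ty[of ?f] tA gA by (intro P_assoc[symmetric]) (auto intro!: Fo_cong)
      also have "Comp P (m' x) (Fa ?t) = m ?xk"
        using m'[OF x] c e' by blast
      also have "Comp P (m ?xk) (Fa ?f) = m (\<lambda>i. Comp P (?xk i) (?f i))"
      proof (rule mcomp[symmetric])
        show "partial X K ?xk" by (rule pu[OF x c e'])
        show "?f i \<in> Arr P \<and> Tgt (?f i) = Src (?xk i)" if "i \<in> I" for i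
          using that gA fA tA ends by (auto simp: P_Comp yel c e' P_Id)
        show "partial X K (\<lambda>i. Comp P (?xk i) (?f i))"
          using xf x ends e' fA xA c k by (auto simp: partial_def P_Comp yel P_Id presheaf_yo)
      qed
      also have "\<dots> = m ((\<lambda>i. Comp P (x i) (f i))(k := Comp P (Comp P (x k) (f k)) (yel (Src (Comp P (x k) (f k))) c e)))"
        using xA fA ends e e' c k P_Map(1)[OF xA[OF k] HOL.refl c e'] P_ends(2)[OF xA[OF k]]
        by (intro mcong) (auto simp: P_Comp P_Comp_Id yel P_assoc Comp_yel)
      finally show "Comp P (Comp P (m' x) (Fa f)) (Fa ?s) =
        m ((\<lambda>i. Comp P (x i) (f i))(k := Comp P (Comp P (x k) (f k)) (yel (Src (Comp P (x k) (f k))) c e)))" .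
    qed
    then show "m' (\<lambda>i. Comp P (x i) (f i)) = Comp P (m' x) (Fa f)"
      using ex[OF xf] m'[OF xf] by blast
  qed
  with ext show ?thesis by blast
qed

lemma family_all:
  assumes X: "\<And>i. i \<in> I ==> presheaf S (X i)" and W: "presheaf S W" and m: "family X W {} m"
  shows "\<exists>m'. family X W I m' \<and> (\<forall>x. partial X {} x \<longrightarrow> m' x = m x)"
proof -
  have "K \<subseteq> I ==> \<exists>m'. family X W K m' \<and> (\<forall>x. partial X {} x \<longrightarrow> m' x = m x)" if "finite K" for K
    using that
  proof (induction K rule: finite_induct)
    case empty then show ?case using m by blast
  next
    case (insert k K)
    then obtain m1 where m1: "family X W K m1" "\<forall>x. partial X {} x \<longrightarrow> m1 x = m x" by auto
    obtain m2 where m2: "family X W (insert k K) m2" "\<forall>x. partial X K x \<longrightarrow> m2 x = m1 x"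
      using family_step[OF X W _ m1(1), of k] insert by auto
    have "partial X {} x ==> partial X K x" for x by (auto simp: partial_def)
    then show ?case using m1 m2 by metis
  qed
  then show ?thesis using finite_I by auto
qed

text \<open>Arrows out of \<open>Fo X\<close> are compared by freeing the variables in the opposite direction: agreement on the elements of one variable at a time implies agreement.\<close>

lemma partial_epi:
  assumes X: "\<And>i. i \<in> I ==> presheaf S (X i)" and W: "presheaf S W"
    and h: "h \<in> Hom P (Fo X) W" "h' \<in> Hom P (Fo X) W"
    and eq: "\<And>x. partial X {} x ==> Comp P h (Fa x) = Comp P h' (Fa x)"
  shows "h = h'"
proof -
  have hA: "h \<in> Arr P" "Src h = Fo X" "Tgt h = W" "h' \<in> Arr P" "Src h' = Fo X" "Tgt h' = W"
    using h by (auto simp: in_Hom_Psh)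
  have "K \<subseteq> I ==> partial X K x ==> Comp P h (Fa x) = Comp P h' (Fa x)" if "finite K" for K x
    using that
  proof (induction K arbitrary: x rule: finite_induct)
    case empty then show ?case using eq by blast
  next
    case (insert k K)
    have k: "k \<in> I" using insert by auto
    have xA: "x i \<in> Arr P" "Tgt (x i) = X i" if "i \<in> I" for i using insert.prems that by (auto simp: partial_def)
    have Fx: "Fa x \<in> Arr P" "Src (Fa x) = Fo (\<lambda>i. Src (x i))" "Tgt (Fa x) = Fo X"
      using Fa_ty[of x] xA by (auto intro!: Fo_cong)
    note A = P_ends(1)[OF xA(1)[OF k]]
    let ?m = "\<lambda>c e. Comp P h (Fa (\<lambda>i. Comp P (x i) (slot x k c e i)))"
    have sA: "slot x k c e i \<in> Arr P" "Tgt (slot x k c e i) = Src (x i)"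
      if "i \<in> I" "c \<in> Obj S" "e \<in> At (Src (x k)) c" for i c e
      using that xA A P_ends by (auto simp: P_Id yel)
    have c: "Comp P (Comp P g (Fa x)) (Fa (slot x k c e)) = Comp P g (Fa (\<lambda>i. Comp P (x i) (slot x k c e i)))"
      if "c \<in> Obj S" "e \<in> At (Src (x k)) c" "g \<in> Arr P" "Src g = Fo X" for g c e
    proof -
      have "Comp P (Comp P g (Fa x)) (Fa (slot x k c e)) = Comp P g (Comp P (Fa x) (Fa (slot x k c e)))"
        using that Fx Fa_ty[of "slot x k c e"] sA by (intro P_assoc) (auto intro!: Fo_cong)
      then show ?thesis using Fa_Comp[of "slot x k c e" x] sA xA that by simp
    qed
    have q: "Comp P h (Fa (\<lambda>i. Comp P (x i) (slot x k c e i))) = Comp P h' (Fa (\<lambda>i. Comp P (x i) (slot x k c e i)))"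
      if "c \<in> Obj S" "e \<in> At (Src (x k)) c" for c e
    proof (rule insert.IH)
      show "partial X K (\<lambda>i. Comp P (x i) (slot x k c e i))"
        using insert.prems that A xA sA by (auto simp: partial_def P_Comp P_Id yel P_Comp_Id)
    qed (use insert in auto)
    have "\<exists>!g. g \<in> Hom P (Fo (\<lambda>i. Src (x i))) W \<and>
      (\<forall>c\<in>Obj S. \<forall>e\<in>At (Src (x k)) c. Comp P g (Fa (slot x k c e)) = Comp P (Comp P h (Fa x)) (Fa (slot x k c e)))"
    proof (rule slot_unique[OF k xA(1) W])
      show "Comp P (Comp P h (Fa x)) (Fa (slot x k c e)) \<in> Hom P (Fo (\<lambda>i. Src (slot x k c e i))) W"
        if "c \<in> Obj S" "e \<in> At (Src (x k)) c" for c e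
      proof -
        have "Fo (\<lambda>i. Tgt (slot x k c e i)) = Fo (\<lambda>i. Src (x i))"
          using sA that by (intro Fo_cong) auto
        then show ?thesis using hA Fx Fa_ty[of "slot x k c e"] sA that by (simp add: in_Hom_Psh P_Comp)
      qed
      fix f e assume f: "f \<in> Arr S" "e \<in> At (Src (x k)) (Cod S f)"
      let ?y = "(\<lambda>j. Id P (Src (x j)))(k := ya f)"
      have yA: "?y i \<in> Arr P" "Tgt (?y i) = Src (slot x k (Cod S f) e i)" if "i \<in> I" for i
        using that xA P_ends f A by (auto simp: P_Id yoneda_arr yel Arr_ends)
      have "Comp P (Fa (slot x k (Cod S f) e)) (Fa ?y) = Fa (\<lambda>i. Comp P (slot x k (Cod S f) e i) (?y i))"
        using yA sA f by (intro Fa_Comp[symmetric]) (auto simp: Arr_ends)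
      also have "\<dots> = Fa (slot x k (Dom S f) (Act (Src (x k)) f e))"
        using f xA A P_ends by (intro Fa_cong) (auto simp: P_Comp_Id P_Id Comp_yoneda_arr(1)[OF A])
      finally have 1: "Comp P (Fa (slot x k (Cod S f) e)) (Fa ?y) = Fa (slot x k (Dom S f) (Act (Src (x k)) f e))" .
      have "Fo (\<lambda>i. Tgt (slot x k (Cod S f) e i)) = Fo (\<lambda>i. Src (x i))"
        "Fo (\<lambda>i. Tgt (?y i)) = Fo (\<lambda>i. Src (slot x k (Cod S f) e i))"
        using sA yA f by (auto intro!: Fo_cong simp: Arr_ends)
      then have "Comp P (Comp P (Comp P h (Fa x)) (Fa (slot x k (Cod S f) e))) (Fa ?y) =
          Comp P (Comp P h (Fa x)) (Comp P (Fa (slot x k (Cod S f) e)) (Fa ?y))"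
        using hA Fx Fa_ty[of "slot x k (Cod S f) e"] Fa_ty[of ?y] sA yA f
        by (intro P_assoc) (auto simp: P_Comp Arr_ends)
      then show "Comp P (Comp P (Comp P h (Fa x)) (Fa (slot x k (Cod S f) e))) (Fa ?y) =
         Comp P (Comp P h (Fa x)) (Fa (slot x k (Dom S f) (Act (Src (x k)) f e)))"
        unfolding 1 .
    qed
    moreover have "Comp P g (Fa x) \<in> Hom P (Fo (\<lambda>i. Src (x i))) W" if "g = h \<or> g = h'" for g
      using that hA Fx by (auto simp: in_Hom_Psh P_Comp)
    moreover have "Comp P (Comp P h' (Fa x)) (Fa (slot x k c e)) = Comp P (Comp P h (Fa x)) (Fa (slot x k c e))"
      if "c \<in> Obj S" "e \<in> At (Src (x k)) c" for c e
      using q[OF that] c[OF that] hA by simp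
    ultimately show ?case by blast
  qed
  from this[OF finite_I, of "\<lambda>i. Id P (X i)"] have "Comp P h (Id P (Fo X)) = Comp P h' (Id P (Fo X))"
    using X by (simp add: partial_def P_Id Fa_Id)
  then show ?thesis using hA by (simp add: P_Comp_Id)
qed

lemma slot_functor:
  assumes i: "i \<in> I" and X: "\<And>i. i \<in> I ==> presheaf S (X i)"
  shows "cat_functor P P (\<lambda>Y. Fo (X(i := Y))) (\<lambda>f. Fa ((\<lambda>j. Id P (X j))(i := f)))"
proof (rule cat_functor.intro)
  let ?d = "\<lambda>f. (\<lambda>j. Id P (X j))(i := f)"
  have A: "?d f j \<in> Arr P" if "f \<in> Arr P" "j \<in> I" for f j using that X by (auto simp: P_Id)
  have e: "Fo (\<lambda>j. Src (?d f j)) = Fo (X(i := Src f))" "Fo (\<lambda>j. Tgt (?d f j)) = Fo (X(i := Tgt f))" for f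
    by (auto intro!: Fo_cong simp: P_Id)
  have I: "?d (Id P Y) = (\<lambda>j. Id P ((X(i := Y)) j))" for Y by auto
  show "Fa (?d f) \<in> Hom P (Fo (X(i := Y))) (Fo (X(i := Z)))" if "f \<in> Hom P Y Z" for f Y Z
    using that Fa_Hom[of "?d f", OF A[of f]] unfolding e by (auto simp: in_Hom_Psh)
  show Id: "Fa (?d (Id P Y)) = Id P (Fo (X(i := Y)))" if "Y \<in> Obj P" for Y
    using that X unfolding I by (intro Fa_Id) auto
  show "Fo (X(i := Y)) \<in> Obj P" if "Y \<in> Obj P" for Y
  proof -
    have "?d (Id P Y) j \<in> Arr P" if "j \<in> I" for j using that \<open>Y \<in> Obj P\<close> X by (auto simp: P_Id)
    then show ?thesis using P_ends(1)[OF Fa_ty(1)[of "?d (Id P Y)"]] Id[OF that] by (simp add: P_Id)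
  qed
  show "Fa (?d (Comp P g f)) = Comp P (Fa (?d g)) (Fa (?d f))" if "f \<in> Hom P Y Z" "g \<in> Hom P Z W" for f g Y Z W
  proof -
    have "Fa (?d (Comp P g f)) = Fa (\<lambda>j. Comp P (?d g j) (?d f j))"
      using X by (intro Fa_cong) (auto simp: P_Comp_Id P_Id)
    also have "\<dots> = Comp P (Fa (?d g)) (Fa (?d f))"
      using that X by (intro Fa_Comp) (auto simp: in_Hom_Psh P_Id)
    finally show ?thesis .
  qed
qed

text \<open>The universal property: arrows out of \<open>Fo X\<close> are compatible families indexed by tuples of
  elements of the presheaves \<open>X i\<close>.\<close>

theorem extend_family:
  assumes X: "\<And>i. i \<in> I ==> presheaf S (X i)" and W: "presheaf S W"
    and m: "\<And>c e. (\<And>i. i \<in> I ==> c i \<in> Obj S \<and> e i \<in> At (X i) (c i)) ==> m c e \<in> Hom P (Fo (\<lambda>i. yo (c i))) W"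
    and mcong: "\<And>c e c' e'. (\<And>i. i \<in> I ==> c i = c' i \<and> e i = e' i) ==> m c e = m c' e'"
    and compat: "\<And>f e. (\<And>i. i \<in> I ==> f i \<in> Arr S \<and> e i \<in> At (X i) (Cod S (f i))) ==>
      m (\<lambda>i. Dom S (f i)) (\<lambda>i. Act (X i) (f i) (e i)) =
      Comp P (m (\<lambda>i. Cod S (f i)) e) (Fa (\<lambda>i. ya (f i)))"
  shows "\<exists>!h. h \<in> Hom P (Fo X) W \<and>
    (\<forall>c e. (\<forall>i\<in>I. c i \<in> Obj S \<and> e i \<in> At (X i) (c i)) \<longrightarrow>
      Comp P h (Fa (\<lambda>i. yel (X i) (c i) (e i))) = m c e)"
proof -
  define ob where "ob Y = (SOME c. c \<in> Obj S \<and> yo c = Y)" for Y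
  define cc where "cc x i = ob (Src (x i))" for x :: "'i \<Rightarrow> ('o, 'a, 'u) psh_arr" and i
  define ee where "ee x i = Map (x i) (cc x i) (name (cc x i) (cc x i) (Id S (cc x i)))" for x i
  have ob: "ob Y \<in> Obj S" "yo (ob Y) = Y" if "\<exists>c\<in>Obj S. Y = yo c" for Y
    using someI_ex[of "\<lambda>c. c \<in> Obj S \<and> yo c = Y"] that by (auto simp: ob_def)
  have cc: "cc x i \<in> Obj S" "Src (x i) = yo (cc x i)" "x i \<in> Arr P" "Tgt (x i) = X i"
    "ee x i \<in> At (X i) (cc x i)" "x i = yel (X i) (cc x i) (ee x i)"
    if "partial X {} x" "i \<in> I" for x i
  proof -
    have p: "x i \<in> Arr P" "Tgt (x i) = X i" "\<exists>c\<in>Obj S. Src (x i) = yo c" using that by (auto simp: partial_def)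
    show c: "cc x i \<in> Obj S" "Src (x i) = yo (cc x i)" "x i \<in> Arr P" "Tgt (x i) = X i"
      using ob[OF p(3)] p by (auto simp: cc_def)
    show "ee x i \<in> At (X i) (cc x i)"
      unfolding ee_def using c by (intro P_Map(1)) (auto simp: name_At S_Id)
    show "x i = yel (X i) (cc x i) (ee x i)"
      using yel_eq[OF c(3,2,1)] c(4) by (simp add: ee_def)
  qed
  have fam: "family X W {} (\<lambda>x. m (cc x) (ee x))"
    unfolding family_def
  proof (intro conjI allI impI)
    fix x assume x: "partial X {} x"
    have "Fo (\<lambda>i. Src (x i)) = Fo (\<lambda>i. yo (cc x i))" using cc[OF x] by (intro Fo_cong) auto
    then show "m (cc x) (ee x) \<in> Hom P (Fo (\<lambda>i. Src (x i))) W"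
      using m[of "cc x" "ee x"] cc[OF x] by simp
  next
    fix x y :: "'i \<Rightarrow> ('o, 'a, 'u) psh_arr" assume "\<forall>i\<in>I. x i = y i"
    then show "m (cc x) (ee x) = m (cc y) (ee y)" by (intro mcong) (auto simp: cc_def ee_def)
  next
    fix x f assume x: "partial X {} x" and f: "\<forall>i\<in>I. f i \<in> Arr P \<and> Tgt (f i) = Src (x i)"
      and xf: "partial X {} (\<lambda>i. Comp P (x i) (f i))"
    let ?y = "\<lambda>i. Comp P (x i) (f i)"
    have ex: "\<exists>g. g \<in> Arr S \<and> Dom S g = cc ?y i \<and> Cod S g = cc x i \<and> f i = ya g \<and>
        ee ?y i = Act (X i) g (ee x i)" if i: "i \<in> I" for i
    proof -
      let ?c = "cc ?y i"
      note y = cc[OF xf i] and x' = cc[OF x i]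
      have fi: "f i \<in> Arr P" "Tgt (f i) = yo (cc x i)" "Src (f i) = yo ?c"
        using f i x' y by (auto simp: P_Comp)
      have "Map (f i) ?c (name ?c ?c (Id S ?c)) \<in> At (yo (cc x i)) ?c"
        using fi y by (intro P_Map(1)) (auto simp: name_At S_Id)
      then obtain g where g: "g \<in> Arr S" "Dom S g = ?c" "Cod S g = cc x i"
        "Map (f i) ?c (name ?c ?c (Id S ?c)) = name (cc x i) ?c g"
        by (auto simp: At_yo Hom_iff)
      have "f i = ya g"
        using yel_eq[OF fi(1,3) y(1)] g fi(2) Comp_yoneda_arr(2)[of "yo (Cod S g)" g "name (Cod S g) (Cod S g) (Id S (Cod S g))"] x'(1)
        by (simp add: presheaf_yo name_At S_Id)
      moreover have "ee ?y i = Act (X i) g (ee x i)"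
      proof -
        have "ee ?y i = Map (x i) ?c (name (cc x i) ?c g)"
          using g fi y(1) by (simp add: ee_def P_Comp name_At S_Id)
        also have "\<dots> = Map (yel (X i) (cc x i) (ee x i)) ?c (name (cc x i) ?c g)"
          by (rule arg_cong[OF x'(6), of "\<lambda>z. Map z ?c (name (cc x i) ?c g)"])
        also have "\<dots> = Act (X i) g (ee x i)"
          using g x' X[OF i] by (intro yel) auto
        finally show ?thesis .
      qed
      ultimately show ?thesis using g by blast
    qed
    have "\<exists>g. \<forall>i\<in>I. g i \<in> Arr S \<and> Dom S (g i) = cc ?y i \<and> Cod S (g i) = cc x i \<and>
        f i = ya (g i) \<and> ee ?y i = Act (X i) (g i) (ee x i)"
      by (intro bchoice ballI ex)
    then obtain g where g: "\<And>i. i \<in> I ==> g i \<in> Arr S \<and> Dom S (g i) = cc ?y i \<and> Cod S (g i) = cc x i \<and>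
        f i = ya (g i) \<and> ee ?y i = Act (X i) (g i) (ee x i)"
      by blast
    have "m (cc ?y) (ee ?y) = m (\<lambda>i. Dom S (g i)) (\<lambda>i. Act (X i) (g i) (ee x i))"
      using g by (intro mcong) auto
    also have "\<dots> = Comp P (m (\<lambda>i. Cod S (g i)) (ee x)) (Fa (\<lambda>i. ya (g i)))"
      using g cc[OF x] by (intro compat) auto
    also have "m (\<lambda>i. Cod S (g i)) (ee x) = m (cc x) (ee x)" using g by (intro mcong) auto
    also have "Fa (\<lambda>i. ya (g i)) = Fa f" using g by (intro Fa_cong) auto
    finally show "m (cc ?y) (ee ?y) = Comp P (m (cc x) (ee x)) (Fa f)" .
  qed
  obtain m' where m': "family X W I m'" "\<And>x. partial X {} x ==> m' x = m (cc x) (ee x)"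
    using family_all[OF X W fam] by blast
  define h where "h = m' (\<lambda>i. Id P (X i))"
  have pI: "partial X I (\<lambda>i. Id P (X i))" using X by (auto simp: partial_def P_Id)
  have h: "h \<in> Hom P (Fo X) W" using m'(1) pI unfolding family_def h_def by (auto simp: P_Id)
  have hx: "Comp P h (Fa x) = m (cc x) (ee x)" if x: "partial X {} x" for x
  proof -
    have e: "m' x = m' y" if "\<forall>i\<in>I. x i = y i" for x y using m'(1) that unfolding family_def by blast
    have "m' (\<lambda>i. Comp P (Id P (X i)) (x i)) = Comp P h (Fa x)"
      using m'(1) pI x unfolding family_def h_def by (auto simp: partial_def P_Id P_Comp)
    moreover have "m' (\<lambda>i. Comp P (Id P (X i)) (x i)) = m' x"
      using x by (intro e) (auto simp: partial_def P_Comp_Id)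
    ultimately show ?thesis using m'(2)[OF x] by simp
  qed
  have yp: "partial X {} (\<lambda>i. yel (X i) (c i) (e i))" if "\<And>i. i \<in> I ==> c i \<in> Obj S \<and> e i \<in> At (X i) (c i)" for c e
    using that X by (auto simp: partial_def yel)
  \<comment> \<open>\<open>yo\<close> need not be injective on objects, so the chosen object \<open>cc\<close> may differ from \<open>c\<close>; the two are
    related by an arrow that \<open>yo\<close> sends to an identity.\<close>
  have my: "m (cc (\<lambda>i. yel (X i) (c i) (e i))) (ee (\<lambda>i. yel (X i) (c i) (e i))) = m c e"
    if ce: "\<And>i. i \<in> I ==> c i \<in> Obj S \<and> e i \<in> At (X i) (c i)" for c e
  proof -
    let ?x = "\<lambda>i. yel (X i) (c i) (e i)"
    have ex: "\<exists>g. g \<in> Arr S \<and> Dom S g = cc ?x i \<and> Cod S g = c i \<and> ya g = Id P (yo (c i)) \<and>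
        ee ?x i = Act (X i) g (e i)" if i: "i \<in> I" for i
    proof -
      let ?c = "cc ?x i"
      note x = cc[OF yp[OF ce] i]
      have yy: "yo ?c = yo (c i)" using x(2) yel(2)[OF X[OF i]] ce[OF i] by auto
      have "name ?c ?c (Id S ?c) \<in> At (yo (c i)) ?c" using x yy name_At[of "Id S ?c" ?c ?c] by (simp add: S_Id)
      then obtain g where g: "g \<in> Arr S" "Dom S g = ?c" "Cod S g = c i" "name ?c ?c (Id S ?c) = name (c i) ?c g"
        by (auto simp: At_yo Hom_iff)
      have "ya g = yel (yo (c i)) ?c (name (c i) ?c g)"
        using Comp_yoneda_arr(2)[of "yo (Cod S g)" g "name (Cod S g) (Cod S g) (Id S (Cod S g))"] g ce[OF i]
        by (simp add: presheaf_yo name_At S_Id)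
      also have "\<dots> = Id P (yo (c i))" using yel_Id[OF x(1)] g(4) yy by simp
      finally have "ya g = Id P (yo (c i))" .
      moreover have "ee ?x i = Act (X i) g (e i)"
        unfolding ee_def g(4) using ce[OF i] X[OF i] g by (subst yel) auto
      ultimately show ?thesis using g by blast
    qed
    have "\<exists>g. \<forall>i\<in>I. g i \<in> Arr S \<and> Dom S (g i) = cc ?x i \<and> Cod S (g i) = c i \<and>
        ya (g i) = Id P (yo (c i)) \<and> ee ?x i = Act (X i) (g i) (e i)"
      by (intro bchoice ballI ex)
    then obtain g where g: "\<And>i. i \<in> I ==> g i \<in> Arr S \<and> Dom S (g i) = cc ?x i \<and> Cod S (g i) = c i \<and>
        ya (g i) = Id P (yo (c i)) \<and> ee ?x i = Act (X i) (g i) (e i)" by blast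
    have "m (cc ?x) (ee ?x) = m (\<lambda>i. Dom S (g i)) (\<lambda>i. Act (X i) (g i) (e i))"
      using g by (intro mcong) auto
    also have "\<dots> = Comp P (m (\<lambda>i. Cod S (g i)) e) (Fa (\<lambda>i. ya (g i)))"
      using g ce by (intro compat) auto
    also have "m (\<lambda>i. Cod S (g i)) e = m c e" using g by (intro mcong) auto
    also have "Fa (\<lambda>i. ya (g i)) = Fa (\<lambda>i. Id P (yo (c i)))" using g by (intro Fa_cong) auto
    also have "\<dots> = Id P (Fo (\<lambda>i. yo (c i)))" using ce by (intro Fa_Id presheaf_yo) auto
    also have "Comp P (m c e) \<dots> = m c e" using m[OF ce] by (intro P_Comp_Id) (auto simp: in_Hom_Psh)
    finally show ?thesis .
  qed
  show ?thesis
  proof (rule ex1I[of _ h])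
    show "h \<in> Hom P (Fo X) W \<and> (\<forall>c e. (\<forall>i\<in>I. c i \<in> Obj S \<and> e i \<in> At (X i) (c i)) \<longrightarrow>
      Comp P h (Fa (\<lambda>i. yel (X i) (c i) (e i))) = m c e)"
      using h hx yp my by auto
  next
    fix h' assume h': "h' \<in> Hom P (Fo X) W \<and> (\<forall>c e. (\<forall>i\<in>I. c i \<in> Obj S \<and> e i \<in> At (X i) (c i)) \<longrightarrow>
      Comp P h' (Fa (\<lambda>i. yel (X i) (c i) (e i))) = m c e)"
    show "h' = h"
    proof (rule partial_epi[OF X W _ h])
      show "h' \<in> Hom P (Fo X) W" using h' by blast
      fix x assume x: "partial X {} x"
      have "Fa x = Fa (\<lambda>i. yel (X i) (cc x i) (ee x i))" using cc(6)[OF x] by (intro Fa_cong) auto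
      then have "Comp P h' (Fa x) = m (cc x) (ee x)" using h' cc[OF x] by auto
      then show "Comp P h' (Fa x) = Comp P h (Fa x)" using hx[OF x] by simp
    qed
  qed
qed

end

section \<open>The category \<open>\<Theta>\<^sub>2\<close>\<close>

lemma Theta2_sel:
  "A \<in> Obj Theta2 \<longleftrightarrow> A \<in> range theta"
  "F \<in> Arr Theta2 \<longleftrightarrow> F \<in> Arr TwoCat \<and> TSrc F \<in> range theta \<and> TTgt F \<in> range theta"
  "Dom Theta2 = TSrc" "Cod Theta2 = TTgt" "Id Theta2 = Id TwoCat" "Comp Theta2 = Comp TwoCat"
  by (auto simp: Theta2_def full_subcat_def two_category_theta TwoCat_def)

lemma Theta2_two_category: "A \<in> Obj Theta2 ==> two_category A"
  by (auto simp: Theta2_sel two_category_theta)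

lemma category_Theta2: "category Theta2"
proof -
  interpret category TwoCat by (rule category_TwoCat)
  show ?thesis
    by (rule category.intro)
      (auto simp: Hom_iff Theta2_sel two_fun_id two_fun_comp two_category_theta comp_id[simplified] id_comp[simplified]
        intro!: comp_assoc[unfolded Hom_iff, simplified])
qed

lemma countable_Obj_Theta2: "countable (Obj Theta2)"
proof -
  have "Obj Theta2 = range theta" by (auto simp: Theta2_sel)
  then show ?thesis by simp
qed

lemma theta_finite: "finite (Cell0 (theta q))" "finite (Cell1 (theta q))" "finite (Cell2 (theta q))"
  using finite_cells_theta_cat[of q] unfolding theta_def
  by (auto simp: nat_copy_cells[OF two_category_theta_cat countable_cells_theta_cat] cells_def)

lemma countable_nat_functions: "finite C ==> countable (PiE C (\<lambda>_. UNIV :: nat set))" for C :: "nat set"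
  by (rule countableI'[of "\<lambda>f. map f (sorted_list_of_set C)"])
    (auto intro!: inj_onI simp: PiE_def intro: extensionalityI)

lemma countable_Arr_Theta2: "countable (Arr Theta2)"
proof -
  let ?H = "\<lambda>q r. {F \<in> Arr TwoCat. TSrc F = theta q \<and> TTgt F = theta r}"
  have "countable (?H q r)" for q r
  proof (rule countable_subset)
    let ?E = "\<lambda>C. PiE C (\<lambda>_. UNIV :: nat set)"
    show "?H q r \<subseteq> (\<lambda>(F0, F1, F2). \<lparr>TSrc = theta q, TTgt = theta r, Fun0 = F0, Fun1 = F1, Fun2 = F2\<rparr>) `
        (?E (Cell0 (theta q)) \<times> ?E (Cell1 (theta q)) \<times> ?E (Cell2 (theta q)))"
    proof
      fix F assume "F \<in> ?H q r"
      then have "F = \<lparr>TSrc = theta q, TTgt = theta r, Fun0 = Fun0 F, Fun1 = Fun1 F, Fun2 = Fun2 F\<rparr>"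
        "Fun0 F \<in> ?E (Cell0 (theta q))" "Fun1 F \<in> ?E (Cell1 (theta q))" "Fun2 F \<in> ?E (Cell2 (theta q))"
        by (auto simp: TwoCat_Arr_iff PiE_def)
      then show "F \<in> (\<lambda>(F0, F1, F2). \<lparr>TSrc = theta q, TTgt = theta r, Fun0 = F0, Fun1 = F1, Fun2 = F2\<rparr>) `
        (?E (Cell0 (theta q)) \<times> ?E (Cell1 (theta q)) \<times> ?E (Cell2 (theta q)))"
        by (intro image_eqI[of _ _ "(Fun0 F, Fun1 F, Fun2 F)"]) auto
    qed
    show "countable ((\<lambda>(F0, F1, F2). \<lparr>TSrc = theta q, TTgt = theta r, Fun0 = F0, Fun1 = F1, Fun2 = F2\<rparr>) `
        (?E (Cell0 (theta q)) \<times> ?E (Cell1 (theta q)) \<times> ?E (Cell2 (theta q))))"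
      by (intro countable_image countable_SIGMA countable_nat_functions theta_finite)
  qed
  moreover have "Arr Theta2 = (\<Union>q. \<Union>r. ?H q r)" by (auto simp: Theta2_sel)
  ultimately show ?thesis by simp
qed

section \<open>Iterated Gray tensor products\<close>

interpretation gray: monoidal TwoCat tens tens_fun unit_cat assoc lunit runit runit_inv
proof (intro monoidal.intro monoidal_axioms.intro, goal_cases)
  case 1 show ?case by (rule category_TwoCat)
next
  case (15 F G H)
  then show ?case using assoc_natural[of F _ _ G _ _ H] by simp
next
  case (16 F) then show ?case using lunit_natural[of F] by simp
next
  case (17 F) then show ?case using runit_natural[of F] by simp
next
  case (18 A B D E) then show ?case using pentagon[of A B D E] by simp
qed (auto simp: two_category_theta tens_two_cat tens_fun_ends tens_fun tens_fun_Id tens_fun_Comp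
    TwoCat_Hom_iff assoc_Arr lunit runit runit_inv runit_inverse lunit_tens runit_tens triangle lunit_unit)

lemma gray_list_eq: "gray_list As = gray.G As"
  by (induction As rule: gray_list.induct) (simp_all flip: tens_def)

lemma gray_list_fun_eq: "gray_list_fun Fs = gray.Gf Fs"
  by (induction Fs rule: gray_list_fun.induct) (simp_all flip: tens_fun_def)

abbreviation flat :: "nat two_cat list list \<Rightarrow> (nat, nat) two_fun" where "flat \<equiv> gray.flatten"

lemma gray_list_fun:
  assumes "set Fs \<subseteq> Arr TwoCat"
  shows "gray_list_fun Fs \<in> Arr TwoCat" "TSrc (gray_list_fun Fs) = gray_list (map TSrc Fs)"
    "TTgt (gray_list_fun Fs) = gray_list (map TTgt Fs)"
  using gray.Gf_ty[OF assms] by (auto simp: gray_list_eq gray_list_fun_eq)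

lemma flat:
  assumes "set (concat Ass) \<subseteq> Obj TwoCat"
  shows "flat Ass \<in> Arr TwoCat" "TSrc (flat Ass) = gray_list (map gray_list Ass)"
    "TTgt (flat Ass) = gray_list (concat Ass)"
proof -
  have "gray_list = gray.G" by (rule ext) (rule gray_list_eq)
  then show "flat Ass \<in> Arr TwoCat" "TSrc (flat Ass) = gray_list (map gray_list Ass)"
    "TTgt (flat Ass) = gray_list (concat Ass)" using gray.flatten_ty[OF assms] by auto
qed

lemma gray_list_fun_Id: "set As \<subseteq> Obj TwoCat ==> gray_list_fun (map (Id TwoCat) As) = Id TwoCat (gray_list As)"
  by (induction As rule: gray_list.induct) (auto simp: tens_fun_Id gray_list_eq gray_list_fun_eq gray.G_Obj[simplified])

lemma gray_list_fun_Comp: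
  assumes "\<And>z. z \<in> set zs ==> F z \<in> Arr TwoCat \<and> G z \<in> Arr TwoCat \<and> TTgt (F z) = TSrc (G z)"
  shows "gray_list_fun (map (\<lambda>z. Comp TwoCat (G z) (F z)) zs) =
    Comp TwoCat (gray_list_fun (map G zs)) (gray_list_fun (map F zs))"
proof -
  have "gray_list_fun (map (\<lambda>z. Comp TwoCat (G z) (F z)) (z # zs)) =
    Comp TwoCat (gray_list_fun (map G (z # zs))) (gray_list_fun (map F (z # zs)))"
    if "\<And>w. w \<in> set (z # zs) ==> F w \<in> Arr TwoCat \<and> G w \<in> Arr TwoCat \<and> TTgt (F w) = TSrc (G w)" for z zs
    using that
  proof (induction zs arbitrary: z)
    case (Cons w zs)
    have FG: "set (map F (w # zs)) \<subseteq> Arr TwoCat" "set (map G (w # zs)) \<subseteq> Arr TwoCat" using Cons.prems by auto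
    have e: "map TTgt (map F (w # zs)) = map TSrc (map G (w # zs))" using Cons.prems by auto
    have "gray_list_fun (map (\<lambda>z. Comp TwoCat (G z) (F z)) (z # w # zs)) =
      tens_fun (Comp TwoCat (G z) (F z)) (gray_list_fun (map (\<lambda>z. Comp TwoCat (G z) (F z)) (w # zs)))"
      by (simp add: tens_fun_def)
    also have "\<dots> = tens_fun (Comp TwoCat (G z) (F z))
        (Comp TwoCat (gray_list_fun (map G (w # zs))) (gray_list_fun (map F (w # zs))))"
      using Cons by simp
    also have "\<dots> = Comp TwoCat (tens_fun (G z) (gray_list_fun (map G (w # zs)))) (tens_fun (F z) (gray_list_fun (map F (w # zs))))"
    proof (rule tens_fun_Comp)
      show "TTgt (gray_list_fun (map F (w # zs))) = TSrc (gray_list_fun (map G (w # zs)))"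
        by (simp only: gray_list_fun[OF FG(1)] gray_list_fun[OF FG(2)] e)
    qed (use Cons.prems gray_list_fun(1)[OF FG(1)] gray_list_fun(1)[OF FG(2)] in auto)
    finally show ?case by (simp add: tens_fun_def)
  qed simp
  then show ?thesis using assms
    by (cases zs) (auto intro!: two_fun_eqI simp: two_fun_comp two_fun_id two_category_theta)
qed

lemma flat_natural:
  assumes "set (concat Fss) \<subseteq> Arr TwoCat"
  shows "Comp TwoCat (flat (map (map TTgt) Fss)) (gray_list_fun (map gray_list_fun Fss)) =
    Comp TwoCat (gray_list_fun (concat Fss)) (flat (map (map TSrc) Fss))"
proof -
  have "gray_list_fun = gray.Gf" by (rule ext) (rule gray_list_fun_eq)
  then show ?thesis using gray.flatten_natural[OF assms] by simp
qed

lemma flat_single: "set As \<subseteq> Obj TwoCat ==> flat [As] = Id TwoCat (gray_list As)"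
  using gray.flatten_single by (simp add: gray_list_eq)

lemma flat_singles: "set As \<subseteq> Obj TwoCat ==> flat (map (\<lambda>A. [A]) As) = Id TwoCat (gray_list As)"
  using gray.flatten_singles by (simp add: gray_list_eq)

lemma flat_flat:
  assumes "set (concat (concat Asss)) \<subseteq> Obj TwoCat"
  shows "Comp TwoCat (flat (concat Asss)) (flat (map (map gray_list) Asss)) =
    Comp TwoCat (flat (map concat Asss)) (gray_list_fun (map flat Asss))"
proof -
  have "gray_list_fun = gray.Gf" "gray_list = gray.G"
    by (rule ext, rule gray_list_fun_eq, rule ext, rule gray_list_eq)
  then show ?thesis using gray.flatten_flatten[OF assms] by simp
qed

section \<open>Elements of a tensor product of presheaves\<close>

locale gray_presheaves = gray_tensor_functors To Ta
  for To :: "'u theta_psh list \<Rightarrow> 'u theta_psh" and Ta :: "'u theta_psh_arr list \<Rightarrow> 'u theta_psh_arr" +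
  assumes infinite: "infinite (UNIV :: 'u set)"
begin

sublocale countable_category Theta2 "TYPE('u)"
  by (intro countable_category.intro category_Theta2 countable_category_axioms.intro
      countable_Obj_Theta2 countable_Arr_Theta2 infinite)

lemma To_presheaf: "(\<And>X. X \<in> set Xs ==> presheaf Theta2 X) ==> presheaf Theta2 (To Xs)"
  using cat_functor.obj[OF tensor_functor, of Xs "length Xs"] by (auto simp: pow_cat_def subset_eq)

lemma Ta_ty:
  assumes "\<And>f. f \<in> set fs ==> f \<in> Arr P"
  shows "Ta fs \<in> Arr P" "Src (Ta fs) = To (map Src fs)" "Tgt (Ta fs) = To (map Tgt fs)"
  using cat_functor.hom[OF tensor_functor, of fs "length fs" "map Src fs" "map Tgt fs"] assms
  by (auto simp: pow_cat_def Hom_iff)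

lemma Ta_map_ty:
  assumes "\<And>z. z \<in> set zs ==> f z \<in> Arr P \<and> Src (f z) = A z \<and> Tgt (f z) = B z"
  shows "Ta (map f zs) \<in> Arr P" "Src (Ta (map f zs)) = To (map A zs)" "Tgt (Ta (map f zs)) = To (map B zs)"
proof -
  have e: "map Src (map f zs) = map A zs" "map Tgt (map f zs) = map B zs" using assms by auto
  have a: "g \<in> Arr P" if "g \<in> set (map f zs)" for g using that assms by auto
  show "Ta (map f zs) \<in> Arr P" "Src (Ta (map f zs)) = To (map A zs)" "Tgt (Ta (map f zs)) = To (map B zs)"
    by (rule Ta_ty(1)[OF a]) (simp_all only: Ta_ty(2,3)[OF a] e)
qed

lemma Ta_Id: "(\<And>X. X \<in> set Xs ==> presheaf Theta2 X) ==> Ta (map (Id P) Xs) = Id P (To Xs)"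
  using cat_functor.id[OF tensor_functor, of Xs "length Xs"] by (auto simp: pow_cat_def subset_eq)

lemma Ta_map_Id:
  assumes "\<And>z. z \<in> set zs ==> presheaf Theta2 (X z)"
  shows "Ta (map (\<lambda>z. Id P (X z)) zs) = Id P (To (map X zs))"
proof -
  have "Ta (map (Id P) (map X zs)) = Id P (To (map X zs))" using assms by (intro Ta_Id) auto
  then show ?thesis by (simp add: comp_def)
qed

lemma Ta_Comp:
  assumes "\<And>z. z \<in> set zs ==> f z \<in> Arr P \<and> g z \<in> Arr P \<and> Tgt (f z) = Src (g z)"
  shows "Ta (map (\<lambda>z. Comp P (g z) (f z)) zs) = Comp P (Ta (map g zs)) (Ta (map f zs))"
proof -
  have "map2 (Comp P) (map g zs) (map f zs) = map (\<lambda>z. Comp P (g z) (f z)) zs"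
    by (simp add: map2_map_map)
  moreover have "map Tgt (map f zs) = map Src (map g zs)" using assms by auto
  ultimately show ?thesis
    using cat_functor.comp[OF tensor_functor, of "map f zs" "length zs" "map Src (map f zs)"
        "map Tgt (map f zs)" "map g zs" "map Tgt (map g zs)"] assms
    by (auto simp: pow_cat_def Hom_iff)
qed

text \<open>The isomorphisms between nerves of tensor products of objects of \<open>\<Theta>\<^sub>2\<close> and tensor products of
  representables are chosen anew at lists of length one, where the choice has to agree with the
  identification of \<open>\<otimes>\<^sub>1\<close> with the identity: this is what \<open>pure_single\<close> and hence the unit laws rely on.\<close>

definition comparison :: "(nat two_cat list \<Rightarrow> nat two_cat \<Rightarrow> (nat, nat) two_fun \<Rightarrow> 'u) \<Rightarrow> bool" where
  "comparison \<kappa> \<longleftrightarrow> (\<forall>\<theta>s. set \<theta>s \<subseteq> Obj Theta2 \<longrightarrow>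
     psh_iso Theta2 (nerve (gray_list \<theta>s)) (To (map (yoneda Theta2) \<theta>s)) (\<kappa> \<theta>s)) \<and>
   (\<forall>fs \<zeta> h. set fs \<subseteq> Arr Theta2 \<longrightarrow> \<zeta> \<in> Obj Theta2 \<longrightarrow>
     h \<in> Hom TwoCat \<zeta> (gray_list (map TSrc fs)) \<longrightarrow>
     Map (Ta (map ya fs)) \<zeta> (\<kappa> (map TSrc fs) \<zeta> h) =
     \<kappa> (map TTgt fs) \<zeta> (Comp TwoCat (gray_list_fun fs) h))"

definition kap :: "nat two_cat list \<Rightarrow> nat two_cat \<Rightarrow> (nat, nat) two_fun \<Rightarrow> 'u" where
  "kap \<theta>s \<zeta> h = (case \<theta>s of [\<theta>] \<Rightarrow> name \<theta> \<zeta> h | _ \<Rightarrow> (SOME \<kappa>. comparison \<kappa>) \<theta>s \<zeta> h)"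

lemma kap_1: "kap [\<theta>] \<zeta> h = name \<theta> \<zeta> h"
  by (simp add: kap_def)

lemma nerve_sel: "At (nerve A) \<theta> = {h \<in> Arr TwoCat. TSrc h = \<theta> \<and> TTgt h = A}"
  "Act (nerve A) f h = Comp TwoCat h f"
  by (auto simp: nerve_def TwoCat_Hom_iff)

lemma comparison_kap: "comparison kap"
proof -
  define \<kappa> where "\<kappa> = (SOME \<kappa>. comparison \<kappa>)"
  have \<kappa>: "comparison \<kappa>" unfolding \<kappa>_def
    using tensor_extends unfolding comparison_def by (rule someI_ex)
  have k: "kap \<theta>s = \<kappa> \<theta>s" if "length \<theta>s \<noteq> 1" for \<theta>s
    using that by (intro ext) (auto simp: kap_def \<kappa>_def split: list.splits)
  have 1: "psh_iso Theta2 (nerve (gray_list \<theta>s)) (To (map yo \<theta>s)) (kap \<theta>s)" if s: "set \<theta>s \<subseteq> Obj Theta2" for \<theta>s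
  proof (cases "length \<theta>s = 1")
    case True
    then obtain \<theta> where t: "\<theta>s = [\<theta>]" by (metis One_nat_def length_0_conv length_Suc_conv)
    have To: "To [yo \<theta>] = yo \<theta>" using tensor_1(1)[of "yo \<theta>"] presheaf_yo[of \<theta>] s t by simp
    have i: "inj_on (name \<theta> c) {h \<in> Arr TwoCat. TSrc h = c \<and> TTgt h = \<theta>}" if "c \<in> Obj Theta2" for c
      by (rule inj_on_inverseI[of _ "unname \<theta> c"]) (use that s t in \<open>auto intro!: unname_name simp: Theta2_sel\<close>)
    have A: "At (yo \<theta>) c = name \<theta> c ` {h \<in> Arr TwoCat. TSrc h = c \<and> TTgt h = \<theta>}" if "c \<in> Obj Theta2" for c
      using that s t by (auto simp: At_yo Hom_iff Theta2_sel)
    show ?thesis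
      unfolding psh_iso_def psh_iso_axioms_def psh_nat_def t
      using s t i To A by (auto simp: kap_1[abs_def] nerve_sel bij_betw_def Hom_iff kap_def Act_yo Theta2_sel)
  next
    case False then show ?thesis using \<kappa> s by (simp add: comparison_def k)
  qed
  have 2: "Map (Ta (map ya fs)) \<zeta> (kap (map TSrc fs) \<zeta> h) =
     kap (map TTgt fs) \<zeta> (Comp TwoCat (gray_list_fun fs) h)"
    if s: "set fs \<subseteq> Arr Theta2" "\<zeta> \<in> Obj Theta2" "h \<in> Hom TwoCat \<zeta> (gray_list (map TSrc fs))" for fs \<zeta> h
  proof (cases "length fs = 1")
    case True
    then obtain f where t: "fs = [f]" by (metis One_nat_def length_0_conv length_Suc_conv)
    have "Ta [ya f] = ya f" using tensor_1(2) yoneda_arr(1) s t by simp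
    then show ?thesis using s t yoneda_arr(4)[of f h \<zeta>]
      by (simp add: kap_def TwoCat_Hom_iff Theta2_sel)
  next
    case False
    then have "length (map TSrc fs) \<noteq> 1" "length (map TTgt fs) \<noteq> 1" by auto
    then show ?thesis using \<kappa> s by (simp add: comparison_def k)
  qed
  show ?thesis unfolding comparison_def using 1 2 by blast
qed

lemma kap:
  assumes s: "set \<theta>s \<subseteq> Obj Theta2" and z: "\<zeta> \<in> Obj Theta2"
  shows "h \<in> Hom TwoCat \<zeta> (gray_list \<theta>s) ==> kap \<theta>s \<zeta> h \<in> At (To (map yo \<theta>s)) \<zeta>"
    "v \<in> At (To (map yo \<theta>s)) \<zeta> ==> \<exists>h \<in> Hom TwoCat \<zeta> (gray_list \<theta>s). v = kap \<theta>s \<zeta> h"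
    "inj_on (kap \<theta>s \<zeta>) (Hom TwoCat \<zeta> (gray_list \<theta>s))"
    "h \<in> Hom TwoCat \<zeta> (gray_list \<theta>s) ==> g \<in> Arr Theta2 ==> TTgt g = \<zeta> ==>
      Act (To (map yo \<theta>s)) g (kap \<theta>s \<zeta> h) = kap \<theta>s (TSrc g) (Comp TwoCat h g)"
proof -
  have i: "psh_iso Theta2 (nerve (gray_list \<theta>s)) (To (map yo \<theta>s)) (kap \<theta>s)"
    using comparison_kap s unfolding comparison_def by blast
  have b: "bij_betw (kap \<theta>s \<zeta>) (Hom TwoCat \<zeta> (gray_list \<theta>s)) (At (To (map yo \<theta>s)) \<zeta>)"
    using psh_iso.bij[OF i z] by (simp add: nerve_def)
  then show "h \<in> Hom TwoCat \<zeta> (gray_list \<theta>s) ==> kap \<theta>s \<zeta> h \<in> At (To (map yo \<theta>s)) \<zeta>"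
    "v \<in> At (To (map yo \<theta>s)) \<zeta> ==> \<exists>h \<in> Hom TwoCat \<zeta> (gray_list \<theta>s). v = kap \<theta>s \<zeta> h"
    "inj_on (kap \<theta>s \<zeta>) (Hom TwoCat \<zeta> (gray_list \<theta>s))"
    by (auto simp: bij_betw_def)
  show "h \<in> Hom TwoCat \<zeta> (gray_list \<theta>s) ==> g \<in> Arr Theta2 ==> TTgt g = \<zeta> ==>
      Act (To (map yo \<theta>s)) g (kap \<theta>s \<zeta> h) = kap \<theta>s (TSrc g) (Comp TwoCat h g)"
    using psh_nat.natural[of Theta2 "nerve (gray_list \<theta>s)" "To (map yo \<theta>s)" "kap \<theta>s" g "TSrc g" \<zeta> h] i
    by (simp add: psh_iso_def nerve_sel TwoCat_Hom_iff Hom_iff Theta2_sel)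
qed

lemma kap_natural:
  assumes "set fs \<subseteq> Arr Theta2" "\<zeta> \<in> Obj Theta2" "h \<in> Hom TwoCat \<zeta> (gray_list (map TSrc fs))"
  shows "Map (Ta (map ya fs)) \<zeta> (kap (map TSrc fs) \<zeta> h) =
     kap (map TTgt fs) \<zeta> (Comp TwoCat (gray_list_fun fs) h)"
  using comparison_kap assms unfolding comparison_def by blast

definition unkap :: "nat two_cat list \<Rightarrow> nat two_cat \<Rightarrow> 'u \<Rightarrow> (nat, nat) two_fun" where
  "unkap \<theta>s \<zeta> = inv_into (Hom TwoCat \<zeta> (gray_list \<theta>s)) (kap \<theta>s \<zeta>)"

lemma unkap_kap: "set \<theta>s \<subseteq> Obj Theta2 ==> \<zeta> \<in> Obj Theta2 ==> h \<in> Hom TwoCat \<zeta> (gray_list \<theta>s) ==>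
    unkap \<theta>s \<zeta> (kap \<theta>s \<zeta> h) = h"
  unfolding unkap_def using kap(3) by (simp add: inv_into_f_f)

subsection \<open>Elements from elements of the factors\<close>

lemmas list_all2_maps = list_all2_map1 list_all2_map2 list_all2_same

definition elt :: "'u theta_psh \<Rightarrow> nat two_cat \<times> 'u \<Rightarrow> bool" where
  "elt X p \<longleftrightarrow> presheaf Theta2 X \<and> fst p \<in> Obj Theta2 \<and> snd p \<in> At X (fst p)"

text \<open>A presentation of an element of the tensor product: a list of elements of the factors, each paired
  with the object at which it lives, and a 2-functor into the tensor product of these objects.\<close>

definition presents :: "'u theta_psh list \<Rightarrow> (nat two_cat \<times> 'u) list \<Rightarrow> nat two_cat \<Rightarrow> (nat, nat) two_fun \<Rightarrow> bool" where
  "presents Xs ps \<zeta> h \<longleftrightarrow> list_all2 elt Xs ps \<and> \<zeta> \<in> Obj Theta2 \<and> h \<in> Hom TwoCat \<zeta> (gray_list (map fst ps))"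

text \<open>The \<open>Ta\<close>-image of the Yoneda arrows of the elements is applied to the element of a tensor product of
  representables that corresponds to \<open>h\<close>.\<close>

definition pure :: "'u theta_psh list \<Rightarrow> (nat two_cat \<times> 'u) list \<Rightarrow> nat two_cat \<Rightarrow> (nat, nat) two_fun \<Rightarrow> 'u" where
  "pure Xs ps \<zeta> h = Map (Ta (map2 (\<lambda>X p. yel X (fst p) (snd p)) Xs ps)) \<zeta> (kap (map fst ps) \<zeta> h)"

lemma elt_yel: "elt X p ==> yel X (fst p) (snd p) \<in> Arr P"
  "elt X p ==> Src (yel X (fst p) (snd p)) = yo (fst p)" "elt X p ==> Tgt (yel X (fst p) (snd p)) = X"
  using yel by (auto simp: elt_def)

lemma Theta2_TwoCat: "\<theta> \<in> Obj Theta2 ==> \<theta> \<in> Obj TwoCat" "f \<in> Arr Theta2 ==> f \<in> Arr TwoCat"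
  by (auto simp: Theta2_sel two_category_theta)

lemma elts_objs: "list_all2 elt Xs ps ==> set (map fst ps) \<subseteq> Obj Theta2"
  by (induction rule: list_all2_induct) (auto simp: elt_def)

lemma elts_Ta:
  assumes "list_all2 elt Xs ps"
  shows "Ta (map2 (\<lambda>X p. yel X (fst p) (snd p)) Xs ps) \<in> Arr P"
    "Src (Ta (map2 (\<lambda>X p. yel X (fst p) (snd p)) Xs ps)) = To (map yo (map fst ps))"
    "Tgt (Ta (map2 (\<lambda>X p. yel X (fst p) (snd p)) Xs ps)) = To Xs"
proof -
  let ?f = "map2 (\<lambda>X p. yel X (fst p) (snd p)) Xs ps"
  have "(\<forall>f\<in>set ?f. f \<in> Arr P) \<and> map Src ?f = map yo (map fst ps) \<and> map Tgt ?f = Xs"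
    using assms by (induction rule: list_all2_induct) (auto simp: elt_yel)
  then show "Ta ?f \<in> Arr P" "Src (Ta ?f) = To (map yo (map fst ps))" "Tgt (Ta ?f) = To Xs"
    using Ta_ty[of ?f] by auto
qed

lemma pure_At:
  assumes "list_all2 elt Xs ps" "\<zeta> \<in> Obj Theta2" "h \<in> Hom TwoCat \<zeta> (gray_list (map fst ps))"
  shows "pure Xs ps \<zeta> h \<in> At (To Xs) \<zeta>"
  unfolding pure_def using assms elts_Ta[OF assms(1)] kap(1)[OF elts_objs[OF assms(1)]]
  by (intro P_Map(1)) auto

lemma pure_Act:
  assumes "list_all2 elt Xs ps" "g \<in> Arr Theta2" "h \<in> Hom TwoCat (TTgt g) (gray_list (map fst ps))"
  shows "Act (To Xs) g (pure Xs ps (TTgt g) h) = pure Xs ps (TSrc g) (Comp TwoCat h g)"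
proof -
  have z: "TTgt g \<in> Obj Theta2" using assms(2) by (simp add: Theta2_sel)
  note t = elts_Ta[OF assms(1)] and o = elts_objs[OF assms(1)]
  show ?thesis
    unfolding pure_def
    using P_Map(2)[OF t(1,2) assms(2), of "kap (map fst ps) (TTgt g) h"] kap(1)[OF o z assms(3)]
      kap(4)[OF o z assms(3) assms(2)] t(3)
    by (simp add: Theta2_sel)
qed

text \<open>The relation between presentations: an arrow of \<open>\<Theta>\<^sub>2\<close> that acts on an element of a factor can be absorbed into the 2-functor, by naturality of the comparison isomorphisms.\<close>

lemma pure_pull:
  assumes z: "\<And>z. z \<in> set zs ==> f z \<in> Arr Theta2 \<and> elt (X z) (TTgt (f z), x z)"
    and "\<zeta> \<in> Obj Theta2" "h \<in> Hom TwoCat \<zeta> (gray_list (map TSrc (map f zs)))"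
  shows "pure (map X zs) (map (\<lambda>z. (TSrc (f z), Act (X z) (f z) (x z))) zs) \<zeta> h =
    pure (map X zs) (map (\<lambda>z. (TTgt (f z), x z)) zs) \<zeta> (Comp TwoCat (gray_list_fun (map f zs)) h)"
proof -
  have y: "Comp P (yel (X z) (TTgt (f z)) (x z)) (ya (f z)) = yel (X z) (TSrc (f z)) (Act (X z) (f z) (x z))"
    if "z \<in> set zs" for z
    using z[OF that] Comp_yoneda_arr(1)[of "X z" "f z" "x z"] by (simp add: elt_def Theta2_sel)
  have t: "yel (X z) (TTgt (f z)) (x z) \<in> Arr P" "Src (yel (X z) (TTgt (f z)) (x z)) = yo (TTgt (f z))"
    "ya (f z) \<in> Arr P" "Src (ya (f z)) = yo (TSrc (f z))"
    "Tgt (ya (f z)) = yo (TTgt (f z))"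
    if "z \<in> set zs" for z
    using z[OF that] elt_yel[of "X z" "(TTgt (f z), x z)"] yoneda_arr(1-3)[of "f z"] by (auto simp: Theta2_sel)
  have "Ta (map (\<lambda>z. yel (X z) (TSrc (f z)) (Act (X z) (f z) (x z))) zs) =
      Ta (map (\<lambda>z. Comp P (yel (X z) (TTgt (f z)) (x z)) (ya (f z))) zs)"
    using y by (intro arg_cong[of _ _ Ta]) simp
  also have "\<dots> = Comp P (Ta (map (\<lambda>z. yel (X z) (TTgt (f z)) (x z)) zs)) (Ta (map (\<lambda>z. ya (f z)) zs))"
    using t by (intro Ta_Comp) auto
  finally have e: "Ta (map (\<lambda>z. yel (X z) (TSrc (f z)) (Act (X z) (f z) (x z))) zs) =
      Comp P (Ta (map (\<lambda>z. yel (X z) (TTgt (f z)) (x z)) zs)) (Ta (map (\<lambda>z. ya (f z)) zs))" .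
  have s: "set (map f zs) \<subseteq> Arr Theta2" using z by auto
  have o: "set (map TSrc (map f zs)) \<subseteq> Obj Theta2" using s by (auto simp: Theta2_sel)
  have y: "Ta (map (\<lambda>z. ya (f z)) zs) \<in> Arr P"
    "Src (Ta (map (\<lambda>z. ya (f z)) zs)) = To (map yo (map TSrc (map f zs)))"
    "Tgt (Ta (map (\<lambda>z. ya (f z)) zs)) = To (map (\<lambda>z. yo (TTgt (f z))) zs)"
    using Ta_map_ty[of zs "\<lambda>z. ya (f z)" "\<lambda>z. yo (TSrc (f z))" "\<lambda>z. yo (TTgt (f z))"] t
    by (auto simp: comp_def)
  have w: "Ta (map (\<lambda>z. yel (X z) (TTgt (f z)) (x z)) zs) \<in> Arr P"
    "Src (Ta (map (\<lambda>z. yel (X z) (TTgt (f z)) (x z)) zs)) = To (map (\<lambda>z. yo (TTgt (f z))) zs)"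
    using Ta_map_ty[of zs "\<lambda>z. yel (X z) (TTgt (f z)) (x z)" "\<lambda>z. yo (TTgt (f z))"
        "\<lambda>z. Tgt (yel (X z) (TTgt (f z)) (x z))"] t
    by auto
  show ?thesis
    using kap_natural[OF s assms(2,3)] assms(2) e kap(1)[OF o assms(2,3)] y w
    by (simp add: pure_def map2_map_map comp_def P_Comp)
qed

lemma pure_map:
  assumes z: "\<And>z. z \<in> set zs ==> g z \<in> Arr P \<and> elt (Src (g z)) (p z)"
    and "\<zeta> \<in> Obj Theta2" "h \<in> Hom TwoCat \<zeta> (gray_list (map fst (map p zs)))"
  shows "Map (Ta (map g zs)) \<zeta> (pure (map (\<lambda>z. Src (g z)) zs) (map p zs) \<zeta> h) =
    pure (map (\<lambda>z. Tgt (g z)) zs) (map (\<lambda>z. (fst (p z), Map (g z) (fst (p z)) (snd (p z)))) zs) \<zeta> h"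
proof -
  have l: "list_all2 elt (map (\<lambda>z. Src (g z)) zs) (map p zs)"
    using z by (auto simp: list_all2_maps)
  note t = elts_Ta[OF l]
  have y: "Comp P (g z) (yel (Src (g z)) (fst (p z)) (snd (p z))) =
      yel (Tgt (g z)) (fst (p z)) (Map (g z) (fst (p z)) (snd (p z)))" if "z \<in> set zs" for z
    using z[OF that] by (intro Comp_yel) (auto simp: elt_def)
  have "Ta (map (\<lambda>z. yel (Tgt (g z)) (fst (p z)) (Map (g z) (fst (p z)) (snd (p z)))) zs) =
     Ta (map (\<lambda>z. Comp P (g z) (yel (Src (g z)) (fst (p z)) (snd (p z)))) zs)"
    using y by (intro arg_cong[of _ _ Ta]) simp
  also have "\<dots> = Comp P (Ta (map g zs)) (Ta (map (\<lambda>z. yel (Src (g z)) (fst (p z)) (snd (p z))) zs))"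
    using z elt_yel by (intro Ta_Comp) auto
  finally show ?thesis
    using kap(1)[OF elts_objs[OF l] assms(2,3)] t assms(2)
    by (simp add: pure_def map2_map_map comp_def P_Comp)
qed

lemma pure_single:
  assumes "elt X (\<theta>, x)" "\<zeta> \<in> Obj Theta2" "h \<in> Hom TwoCat \<zeta> \<theta>"
  shows "pure [X] [(\<theta>, x)] \<zeta> h = Act X h x"
proof -
  have "Ta [yel X \<theta> x] = yel X \<theta> x" using tensor_1(2)[of "yel X \<theta> x"] elt_yel(1)[OF assms(1)] by simp
  then show ?thesis using assms yel(4)[of X \<theta> x h \<zeta>]
    by (simp add: pure_def kap_1 elt_def TwoCat_Hom_iff Theta2_sel)
qed

subsection \<open>Maps out of a tensor product\<close>

lemma map_upt_update: "i < n ==> map (X(i := Y)) [0..<n] = (map X [0..<n])[i := Y]"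
  by (rule nth_equalityI) (auto simp: nth_list_update)

lemma multi_cocontinuous_To:
  "multi_cocontinuous Theta2 {..<n} (\<lambda>X. To (map X [0..<n])) (\<lambda>f. Ta (map f [0..<n]))"
proof (intro multi_cocontinuous.intro multi_cocontinuous_axioms.intro, goal_cases)
  case 1 show ?case by (rule countable_category_axioms)
next
  case (3 X Y) then show ?case by (intro arg_cong[of _ _ To]) auto
next
  case (4 f g) then show ?case by (intro arg_cong[of _ _ Ta]) auto
next
  case (5 f)
  then show ?case using Ta_map_ty[of "[0..<n]" f "\<lambda>i. Src (f i)" "\<lambda>i. Tgt (f i)"] by (simp add: in_Hom_Psh)
next
  case (6 X) then show ?case by (intro Ta_map_Id) auto
next
  case (7 f g) then show ?case by (intro Ta_Comp) auto
next
  case (8 i X)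
  have e: "map (\<lambda>j. Id P (X j)) [0..<n] = map (Id P) (map X [0..<n])" by simp
  have "set (map X [0..<n]) \<subseteq> Obj P" "i < length (map X [0..<n])" using 8 by auto
  from tensor_cocontinuous[OF this] 8 show ?case by (simp add: map_upt_update e del: map_map)
qed simp

text \<open>The universal property in terms of presentations. A function \<open>m\<close> that is natural in \<open>\<zeta>\<close> and respects
  the relation of \<open>pure_pull\<close> gives, for fixed elements of the factors, an arrow out of the tensor
  product of the corresponding representables, and together these form a compatible family.\<close>

lemma To_extend:
  assumes X: "\<And>X. X \<in> set Xs ==> presheaf Theta2 X" and W: "presheaf Theta2 W"
    and mA: "\<And>ps \<zeta> h. presents Xs ps \<zeta> h ==> m ps \<zeta> h \<in> At W \<zeta>"
    and mN: "\<And>ps g h. presents Xs ps (TTgt g) h ==> g \<in> Arr Theta2 ==>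
      m ps (TSrc g) (Comp TwoCat h g) = Act W g (m ps (TTgt g) h)"
    and mC: "\<And>f e \<zeta> h. (\<And>i. i < length Xs ==> f i \<in> Arr Theta2 \<and> elt (Xs ! i) (TTgt (f i), e i)) ==> \<zeta> \<in> Obj Theta2 ==>
      h \<in> Hom TwoCat \<zeta> (gray_list (map TSrc (map f [0..<length Xs]))) ==>
      m (map (\<lambda>i. (TSrc (f i), Act (Xs ! i) (f i) (e i))) [0..<length Xs]) \<zeta> h =
      m (map (\<lambda>i. (TTgt (f i), e i)) [0..<length Xs]) \<zeta> (Comp TwoCat (gray_list_fun (map f [0..<length Xs])) h)"
  shows "\<exists>!\<eta>. \<eta> \<in> Hom P (To Xs) W \<and>
    (\<forall>ps \<zeta> h. presents Xs ps \<zeta> h \<longrightarrow> Map \<eta> \<zeta> (pure Xs ps \<zeta> h) = m ps \<zeta> h)"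
proof -
  note mA' = mA[unfolded presents_def, OF conjI[OF _ conjI]]
  have mN': "m ps (TSrc g) (Comp TwoCat h g) = Act W g (m ps (TTgt g) h)"
    if "list_all2 elt Xs ps" "g \<in> Arr Theta2" "h \<in> Hom TwoCat (TTgt g) (gray_list (map fst ps))" for ps g h
    using mN that by (simp add: presents_def Theta2_sel)
  define n where "n = length Xs"
  let ?E = "\<lambda>c e. Ta (map (\<lambda>i. yel (Xs ! i) (c i) (e i)) [0..<n])" and ?Y = "\<lambda>c. To (map (\<lambda>i. yo (c i)) [0..<n])"
  interpret F: multi_cocontinuous Theta2 "TYPE('u)" "{..<n}" "\<lambda>X. To (map X [0..<n])" "\<lambda>f. Ta (map f [0..<n])"
    by (rule multi_cocontinuous_To)
  have Xs: "map ((!) Xs) [0..<n] = Xs" by (simp add: n_def map_nth)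
  let ?ps = "\<lambda>c e. map (\<lambda>i. (c i, e i)) [0..<n]"
  \<comment> \<open>An element of a tensor product of representables is named by exactly one 2-functor, to which \<open>m\<close> applies.\<close>
  define M where "M c e = mk_psh_arr Theta2 (?Y c) W
     (\<lambda>\<zeta> v. m (?ps c e) \<zeta> (unkap (map c [0..<n]) \<zeta> v))" for c e
  let ?ok = "\<lambda>c e. \<forall>i\<in>{..<n}. c i \<in> Obj Theta2 \<and> e i \<in> At (Xs ! i) (c i)"
  have ok: "list_all2 elt Xs (?ps c e)" "set (map c [0..<n]) \<subseteq> Obj Theta2" if "?ok c e" for c e
    using that X by (auto simp: list_all2_conv_all_nth n_def elt_def)
  have f: "map fst (?ps c e) = map c [0..<n]" for c e by simp
  have M_nat: "psh_nat Theta2 (?Y c) W (\<lambda>\<zeta> v. m (?ps c e) \<zeta> (unkap (map c [0..<n]) \<zeta> v))"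
    if ce: "?ok c e" for c e
  proof (rule psh_natI)
    note o = ok[OF ce]
    have y: "map (\<lambda>i. yo (c i)) [0..<n] = map yo (map c [0..<n])" by simp
    show "m (?ps c e) \<zeta> (unkap (map c [0..<n]) \<zeta> v) \<in> At W \<zeta>"
      if v: "\<zeta> \<in> Obj Theta2" "v \<in> At (?Y c) \<zeta>" for \<zeta> v
    proof -
      obtain h where "h \<in> Hom TwoCat \<zeta> (gray_list (map c [0..<n]))" "v = kap (map c [0..<n]) \<zeta> h"
        using kap(2)[OF o(2) v(1)] v(2) unfolding y by blast
      then show ?thesis using mA'[OF o(1) v(1)] unkap_kap[OF o(2) v(1)] unfolding f by simp
    qed
    show "m (?ps c e) (Dom Theta2 g) (unkap (map c [0..<n]) (Dom Theta2 g) (Act (?Y c) g v)) =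
        Act W g (m (?ps c e) (Cod Theta2 g) (unkap (map c [0..<n]) (Cod Theta2 g) v))"
      if g: "g \<in> Arr Theta2" "v \<in> At (?Y c) (Cod Theta2 g)" for g v
    proof -
      have z: "TTgt g \<in> Obj Theta2" "TSrc g \<in> Obj Theta2" using g(1) by (auto simp: Theta2_sel)
      obtain h where h: "h \<in> Hom TwoCat (TTgt g) (gray_list (map c [0..<n]))" "v = kap (map c [0..<n]) (TTgt g) h"
        using kap(2)[OF o(2) z(1)] g(2) unfolding y by (auto simp: Theta2_sel)
      have "Comp TwoCat h g \<in> Hom TwoCat (TSrc g) (gray_list (map c [0..<n]))"
        using h(1) g(1) by (auto simp: TwoCat_Hom_iff two_fun_comp Theta2_sel)
      then show ?thesis
        using mN'[OF o(1) g(1)] h kap(4)[OF o(2) z(1) h(1) g(1) HOL.refl] unfolding f y Theta2_sel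
        by (simp add: unkap_kap[OF o(2) z(1)] unkap_kap[OF o(2) z(2)] del: map_map)
    qed
  qed
  have Y: "presheaf Theta2 (?Y c)" if "?ok c e" for c e
    using that presheaf_yo by (intro To_presheaf) auto
  have MH: "M c e \<in> Hom P (?Y c) W" if "?ok c e" for c e
    unfolding M_def in_Hom_Psh using mk_psh_arr_Arr[OF Y W M_nat] that by auto
  have Mq: "Map (M c e) \<zeta> (kap (map c [0..<n]) \<zeta> h) = m (?ps c e) \<zeta> h"
    if "?ok c e" "\<zeta> \<in> Obj Theta2" "h \<in> Hom TwoCat \<zeta> (gray_list (map c [0..<n]))" for c e \<zeta> h
    using that kap(1)[OF ok(2)[OF that(1)] that(2,3)] unkap_kap[OF ok(2)[OF that(1)] that(2,3)]
    by (simp add: M_def comp_def)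
  have "\<exists>!h. h \<in> Hom P (To (map ((!) Xs) [0..<n])) W \<and>
    (\<forall>c e. ?ok c e \<longrightarrow> Comp P h (?E c e) = M c e)"
  proof (rule F.extend_family)
    show "presheaf Theta2 (Xs ! i)" if "i \<in> {..<n}" for i using that X by (simp add: n_def)
    show "M c e \<in> Hom P (?Y c) W"
      if "\<And>i. i \<in> {..<n} ==> c i \<in> Obj Theta2 \<and> e i \<in> At (Xs ! i) (c i)" for c e
      using that by (intro MH) auto
    show "M c e = M c' e'" if "\<And>i. i \<in> {..<n} ==> c i = c' i \<and> e i = e' i" for c e c' e'
    proof -
      have "?ps c e = ?ps c' e'" "map c [0..<n] = map c' [0..<n]" "map (\<lambda>i. yo (c i)) [0..<n] = map (\<lambda>i. yo (c' i)) [0..<n]"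
        using that by auto
      then show ?thesis unfolding M_def by (simp only:)
    qed
    fix g :: "nat \<Rightarrow> (nat, nat) two_fun" and e
    assume g: "\<And>i. i \<in> {..<n} ==> g i \<in> Arr Theta2 \<and> e i \<in> At (Xs ! i) (Cod Theta2 (g i))"
    let ?e = "\<lambda>i. Act (Xs ! i) (g i) (e i)" and ?s = "\<lambda>i. TSrc (g i)" and ?t = "\<lambda>i. TTgt (g i)"
    have pX: "presheaf Theta2 (Xs ! i)" if "i < n" for i using X that by (simp add: n_def)
    have ok1: "?ok ?s ?e"
      using g presheaf_app(1)[OF pX] by (auto simp: Theta2_sel)
    have ok2: "?ok ?t e" using g by (auto simp: Theta2_sel)
    let ?y = "map (\<lambda>i. ya (g i)) [0..<n]"
    have gs: "set (map g [0..<n]) \<subseteq> Arr Theta2" using g by auto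
    have gs': "set (map TSrc (map g [0..<n])) \<subseteq> Obj Theta2" using gs by (auto simp: Theta2_sel)
    have gsT: "set (map g [0..<n]) \<subseteq> Arr TwoCat" using gs by (auto simp: Theta2_sel)
    have yA: "Ta ?y \<in> Arr P" "Src (Ta ?y) = To (map (\<lambda>i. yo (TSrc (g i))) [0..<n])"
      "Tgt (Ta ?y) = To (map (\<lambda>i. yo (TTgt (g i))) [0..<n])"
      using Ta_map_ty[of "[0..<n]" "\<lambda>i. ya (g i)" "\<lambda>i. yo (TSrc (g i))" "\<lambda>i. yo (TTgt (g i))"]
        g yoneda_arr by (auto simp: Theta2_sel)
    note M1 = MH[OF ok1] and M2 = MH[OF ok2]
    show "M (\<lambda>i. Dom Theta2 (g i)) ?e = Comp P (M (\<lambda>i. Cod Theta2 (g i)) e) (Ta ?y)"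
      unfolding Theta2_sel
    proof (rule P_eqI)
      fix \<zeta> v assume z: "\<zeta> \<in> Obj Theta2" and "v \<in> At (Src (M ?s ?e)) \<zeta>"
      then have "v \<in> At (To (map yo (map TSrc (map g [0..<n])))) \<zeta>" using M1 by (simp add: in_Hom_Psh comp_def)
      then obtain h where h: "h \<in> Hom TwoCat \<zeta> (gray_list (map TSrc (map g [0..<n])))"
        "v = kap (map TSrc (map g [0..<n])) \<zeta> h"
        using kap(2)[OF gs' z] by blast
      have gh: "Comp TwoCat (gray_list_fun (map g [0..<n])) h \<in> Hom TwoCat \<zeta> (gray_list (map ?t [0..<n]))"
        using h gray_list_fun[OF gsT] by (auto simp: TwoCat_Hom_iff two_fun_comp comp_def)
      have v: "v \<in> At (Src (Ta ?y)) \<zeta>"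
        using M1 \<open>v \<in> At (Src (M ?s ?e)) \<zeta>\<close> yA by (simp add: in_Hom_Psh)
      have "Map (Comp P (M ?t e) (Ta ?y)) \<zeta> v =
          Map (M ?t e) \<zeta> (kap (map ?t [0..<n]) \<zeta> (Comp TwoCat (gray_list_fun (map g [0..<n])) h))"
        using kap_natural[OF gs z h(1)] P_Comp(4)[OF z v] h(2) by (simp add: comp_def)
      also have "\<dots> = m (?ps ?t e) \<zeta> (Comp TwoCat (gray_list_fun (map g [0..<n])) h)"
        by (rule Mq[OF ok2 z gh])
      also have "\<dots> = m (?ps ?s ?e) \<zeta> h"
        using mC[of g e \<zeta> h] g pX z h(1) by (auto simp: n_def[symmetric] elt_def Theta2_sel)
      also have "\<dots> = Map (M ?s ?e) \<zeta> v"
        using Mq[OF ok1 z, of h] h by (simp add: comp_def)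
      finally show "Map (M ?s ?e) \<zeta> v = Map (Comp P (M ?t e) (Ta ?y)) \<zeta> v" by simp
    qed (use M1 M2 yA in \<open>auto simp: in_Hom_Psh P_Comp\<close>)
  qed (use W in auto)
  then have ex: "\<exists>!h. h \<in> Hom P (To Xs) W \<and>
    (\<forall>c e. ?ok c e \<longrightarrow> Comp P h (?E c e) = M c e)"
    unfolding Xs .
  have eq: "(\<forall>c e. ?ok c e \<longrightarrow> Comp P \<eta> (?E c e) = M c e) \<longleftrightarrow>
    (\<forall>ps \<zeta> h. presents Xs ps \<zeta> h \<longrightarrow> Map \<eta> \<zeta> (pure Xs ps \<zeta> h) = m ps \<zeta> h)" if \<eta>: "\<eta> \<in> Hom P (To Xs) W" for \<eta>
  proof -
    have m2: "map2 (\<lambda>X p. yel X (fst p) (snd p)) Xs (?ps c e) = map (\<lambda>i. yel (Xs ! i) (c i) (e i)) [0..<n]" for c e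
      by (rule nth_equalityI) (auto simp: n_def)
    have one: "Comp P \<eta> (?E c e) = M c e \<longleftrightarrow>
      (\<forall>\<zeta> h. \<zeta> \<in> Obj Theta2 \<longrightarrow> h \<in> Hom TwoCat \<zeta> (gray_list (map fst (?ps c e))) \<longrightarrow>
        Map \<eta> \<zeta> (pure Xs (?ps c e) \<zeta> h) = m (?ps c e) \<zeta> h)" (is "?l \<longleftrightarrow> ?r") if ce: "?ok c e" for c e
    proof -
      note t = elts_Ta[OF ok(1)[OF ce], unfolded m2 f]
      have M: "M c e \<in> Arr P" "Src (M c e) = To (map yo (map c [0..<n]))" "Tgt (M c e) = W"
        using MH[OF ce] by (auto simp: in_Hom_Psh comp_def)
      have Q: "pure Xs (?ps c e) \<zeta> h = Map (?E c e) \<zeta> (kap (map c [0..<n]) \<zeta> h)" for \<zeta> h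
        unfolding pure_def m2 f ..
      have C: "Map (Comp P \<eta> (?E c e)) \<zeta> (kap (map c [0..<n]) \<zeta> h) =
          Map \<eta> \<zeta> (pure Xs (?ps c e) \<zeta> h)"
        if "\<zeta> \<in> Obj Theta2" "h \<in> Hom TwoCat \<zeta> (gray_list (map c [0..<n]))" for \<zeta> h
        unfolding Q using kap(1)[OF ok(2)[OF ce] that] that t by (intro P_Comp(4)) auto
      show ?thesis
      proof
        assume l: ?l
        show ?r unfolding f using C[unfolded l] Mq[OF ce] by simp
      next
        assume r: ?r
        show ?l
        proof (rule P_eqI)
          fix \<zeta> v assume z: "\<zeta> \<in> Obj Theta2"
            and "v \<in> At (Src (Comp P \<eta> (?E c e))) \<zeta>"
          then have "v \<in> At (To (map yo (map c [0..<n]))) \<zeta>" using t by (simp add: P_Comp)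
          then obtain h where h: "h \<in> Hom TwoCat \<zeta> (gray_list (map c [0..<n]))" "v = kap (map c [0..<n]) \<zeta> h"
            using kap(2)[OF ok(2)[OF ce] z] by blast
          then show "Map (Comp P \<eta> (?E c e)) \<zeta> v = Map (M c e) \<zeta> v"
            using C[OF z h(1)] Mq[OF ce z h(1)] r[unfolded f, rule_format, OF z h(1)] by simp
        qed (use t M \<eta> in \<open>auto simp: P_Comp in_Hom_Psh\<close>)
      qed
    qed
    show ?thesis
    proof
      assume l: "\<forall>c e. ?ok c e \<longrightarrow> Comp P \<eta> (?E c e) = M c e"
      show "\<forall>ps \<zeta> h. presents Xs ps \<zeta> h \<longrightarrow> Map \<eta> \<zeta> (pure Xs ps \<zeta> h) = m ps \<zeta> h"
      proof (intro allI impI)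
        fix ps \<zeta> h assume "presents Xs ps \<zeta> h"
        then have ps: "list_all2 elt Xs ps" "\<zeta> \<in> Obj Theta2" "h \<in> Hom TwoCat \<zeta> (gray_list (map fst ps))"
          by (auto simp: presents_def)
        let ?c = "\<lambda>i. fst (ps ! i)" and ?e = "\<lambda>i. snd (ps ! i)"
        have e: "?ps ?c ?e = ps" using ps(1) by (intro nth_equalityI) (auto simp: n_def list_all2_conv_all_nth)
        have k: "?ok ?c ?e" using ps(1) by (auto simp: n_def list_all2_conv_all_nth elt_def)
        from iffD1[OF one[OF k] l[rule_format, OF bspec[OF k]]] ps(2,3)
        show "Map \<eta> \<zeta> (pure Xs ps \<zeta> h) = m ps \<zeta> h" unfolding e by simp
      qed
    next
      assume r: "\<forall>ps \<zeta> h. presents Xs ps \<zeta> h \<longrightarrow> Map \<eta> \<zeta> (pure Xs ps \<zeta> h) = m ps \<zeta> h"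
      show "\<forall>c e. ?ok c e \<longrightarrow> Comp P \<eta> (?E c e) = M c e"
      proof (intro allI impI)
        fix c e assume k: "?ok c e"
        show "Comp P \<eta> (?E c e) = M c e"
          by (rule iffD2[OF one[OF k]], intro allI impI, rule r[rule_format]) (use ok(1)[OF k] in \<open>simp add: presents_def\<close>)
      qed
    qed
  qed
  show ?thesis using ex by (simp only: eq cong: conj_cong)
qed

text \<open>The elements with a presentation form a subpresheaf \<open>V\<close>. By \<open>To_extend\<close> there is an arrow to \<open>V\<close> that
  fixes them; followed by the inclusion it fixes all presented elements, as does the identity, so by
  uniqueness it is the identity and \<open>V\<close> is everything.\<close>

lemma pure_surj:
  assumes X: "\<And>X. X \<in> set Xs ==> presheaf Theta2 X" and z: "\<zeta> \<in> Obj Theta2" and v: "v \<in> At (To Xs) \<zeta>"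
  shows "\<exists>ps h. presents Xs ps \<zeta> h \<and> v = pure Xs ps \<zeta> h"
proof -
  define V :: "'u theta_psh" where "V = \<lparr>At = (\<lambda>\<zeta>. {pure Xs ps \<zeta> h | ps h. presents Xs ps \<zeta> h}), Act = Act (To Xs)\<rparr>"
  have T: "presheaf Theta2 (To Xs)" using X by (rule To_presheaf)
  have sub: "At V \<zeta> \<subseteq> At (To Xs) \<zeta>" if "\<zeta> \<in> Obj Theta2" for \<zeta>
    using pure_At by (auto simp: V_def presents_def)
  have aV: "Act V = Act (To Xs)" by (simp add: V_def)
  have hg: "Comp TwoCat h g \<in> Hom TwoCat (TSrc g) A" if "g \<in> Arr Theta2" "h \<in> Hom TwoCat (TTgt g) A" for g h A
    using that by (auto simp: TwoCat_Hom_iff two_fun_comp Theta2_sel)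
  have act: "Act V g v \<in> At V (TSrc g)" if "g \<in> Arr Theta2" "v \<in> At V (TTgt g)" for g v
    using that pure_Act hg by (fastforce simp: V_def presents_def Theta2_sel)
  have V: "presheaf Theta2 V"
    unfolding presheaf_def Hom_iff
  proof (intro conjI allI impI; (elim conjE)?)
    fix f c d x assume "f \<in> Arr Theta2" "Dom Theta2 f = c" "Cod Theta2 f = d" "x \<in> At V d"
    then show "Act V f x \<in> At V c" using act by (auto simp: Theta2_sel)
  next
    fix c x assume "c \<in> Obj Theta2" "x \<in> At V c"
    then show "Act V (Id Theta2 c) x = x" using presheaf_app(2)[OF T, of c x] sub[of c] aV by (simp add: subset_eq)
  next
    fix f c d g e x assume "f \<in> Arr Theta2" "Dom Theta2 f = c" "Cod Theta2 f = d"
      "g \<in> Arr Theta2" "Dom Theta2 g = d" "Cod Theta2 g = e" "x \<in> At V e"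
    then show "Act V (Comp Theta2 g f) x = Act V f (Act V g x)"
      using presheaf_app(3)[OF T, of f g x] sub[of e] Arr_ends[of g] aV by (auto simp: subset_eq)
  qed
  have m1: "\<exists>!\<eta>. \<eta> \<in> Hom P (To Xs) (To Xs) \<and>
    (\<forall>ps \<zeta> h. presents Xs ps \<zeta> h \<longrightarrow> Map \<eta> \<zeta> (pure Xs ps \<zeta> h) = pure Xs ps \<zeta> h)"
    and m2: "\<exists>!\<eta>. \<eta> \<in> Hom P (To Xs) V \<and>
    (\<forall>ps \<zeta> h. presents Xs ps \<zeta> h \<longrightarrow> Map \<eta> \<zeta> (pure Xs ps \<zeta> h) = pure Xs ps \<zeta> h)"
  proof -
    have C: "pure Xs (map (\<lambda>i. (TSrc (f i), Act (Xs ! i) (f i) (e i))) [0..<length Xs]) \<zeta> h =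
      pure Xs (map (\<lambda>i. (TTgt (f i), e i)) [0..<length Xs]) \<zeta> (Comp TwoCat (gray_list_fun (map f [0..<length Xs])) h)"
      if "\<And>i. i < length Xs ==> f i \<in> Arr Theta2 \<and> elt (Xs ! i) (TTgt (f i), e i)" "\<zeta> \<in> Obj Theta2"
      "h \<in> Hom TwoCat \<zeta> (gray_list (map TSrc (map f [0..<length Xs])))" for f e \<zeta> h
      using pure_pull[of "[0..<length Xs]" f "(!) Xs" e \<zeta> h] that by (simp add: map_nth)
    show "\<exists>!\<eta>. \<eta> \<in> Hom P (To Xs) (To Xs) \<and>
      (\<forall>ps \<zeta> h. presents Xs ps \<zeta> h \<longrightarrow> Map \<eta> \<zeta> (pure Xs ps \<zeta> h) = pure Xs ps \<zeta> h)"
      by (rule To_extend[OF X T _ _ C]) (use pure_At pure_Act in \<open>auto simp: presents_def\<close>)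
    show "\<exists>!\<eta>. \<eta> \<in> Hom P (To Xs) V \<and>
      (\<forall>ps \<zeta> h. presents Xs ps \<zeta> h \<longrightarrow> Map \<eta> \<zeta> (pure Xs ps \<zeta> h) = pure Xs ps \<zeta> h)"
      by (rule To_extend[OF X V _ _ C]) (use pure_Act in \<open>auto simp: V_def presents_def\<close>)
  qed
  obtain \<eta> where \<eta>: "\<eta> \<in> Arr P" "Src \<eta> = To Xs" "Tgt \<eta> = V"
    "\<And>ps \<zeta> h. presents Xs ps \<zeta> h ==> Map \<eta> \<zeta> (pure Xs ps \<zeta> h) = pure Xs ps \<zeta> h"
    using m2 by (auto simp: in_Hom_Psh)
  define \<iota> where "\<iota> = mk_psh_arr Theta2 V (To Xs) (\<lambda>_ x. x)"
  have \<iota>: "\<iota> \<in> Arr P" "Src \<iota> = V" "Tgt \<iota> = To Xs"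
    using mk_psh_arr_Arr[OF V T, of "\<lambda>_ x. x"] psh_natI[of V "\<lambda>_ x. x" "To Xs"] sub by (auto simp: \<iota>_def V_def)
  have \<iota>pure: "Map \<iota> \<zeta> x = x" if "\<zeta> \<in> Obj Theta2" "x \<in> At V \<zeta>" for \<zeta> x using that by (simp add: \<iota>_def)
  have "Comp P \<iota> \<eta> = Id P (To Xs)"
  proof -
    obtain e where u: "\<forall>y. y \<in> Hom P (To Xs) (To Xs) \<and> (\<forall>ps \<zeta> h. presents Xs ps \<zeta> h \<longrightarrow> Map y \<zeta> (pure Xs ps \<zeta> h) = pure Xs ps \<zeta> h) \<longrightarrow> y = e"
      using m1 by (elim ex1E) blast
    have "Comp P \<iota> \<eta> = e"
    proof (rule u[rule_format], intro conjI allI impI)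
      show "Comp P \<iota> \<eta> \<in> Hom P (To Xs) (To Xs)" using \<iota> \<eta> by (simp add: in_Hom_Psh P_Comp)
      fix ps \<zeta> h assume *: "presents Xs ps \<zeta> h"
      then have "\<zeta> \<in> Obj Theta2" "pure Xs ps \<zeta> h \<in> At (To Xs) \<zeta>" using pure_At by (auto simp: presents_def)
      moreover from * have "pure Xs ps \<zeta> h \<in> At V \<zeta>" by (auto simp: V_def)
      ultimately show "Map (Comp P \<iota> \<eta>) \<zeta> (pure Xs ps \<zeta> h) = pure Xs ps \<zeta> h"
        using * \<eta> \<iota>pure by (simp add: P_Comp)
    qed
    moreover have "Id P (To Xs) = e"
      by (rule u[rule_format], intro conjI allI impI) (use T pure_At in \<open>auto simp: in_Hom_Psh P_Id presents_def\<close>)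
    ultimately show ?thesis by simp
  qed
  then have "v = Map \<iota> \<zeta> (Map \<eta> \<zeta> v)"
    using v z T \<eta> by (metis P_Comp(4) P_Id(4))
  moreover have "Map \<eta> \<zeta> v \<in> At V \<zeta>" using v z \<eta> by (intro P_Map(1)) auto
  ultimately have "v \<in> At V \<zeta>" using \<iota>pure z by simp
  then show ?thesis by (auto simp: V_def)
qed

end

section \<open>The multiplication\<close>

lemma cocontinuous_compose:
  fixes U :: "'u itself"
  assumes F: "cat_functor C D Fo Fa" "cocontinuous U C D Fo Fa" and G: "cocontinuous U D E Go Ga"
  shows "cocontinuous U C E (\<lambda>x. Go (Fo x)) (\<lambda>f. Ga (Fa f))"
  unfolding cocontinuous_def
proof (intro allI impI)
  fix J :: "('u, 'u) cat" and Do Da z l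
  assume J: "category J" and D: "cat_functor J C Do Da" and l: "is_colimit J C Do Da z l"
  have "cat_functor J D (Fo \<circ> Do) (Fa \<circ> Da)"
    by (rule cat_functor.intro)
      (auto intro: cat_functor.obj[OF F(1)] cat_functor.obj[OF D] cat_functor.hom[OF F(1)] cat_functor.hom[OF D]
        simp: cat_functor.id[OF F(1)] cat_functor.id[OF D] cat_functor.obj[OF D]
          cat_functor.comp[OF D] cat_functor.comp[OF F(1) cat_functor.hom[OF D] cat_functor.hom[OF D]])
  moreover have "is_colimit J D (Fo \<circ> Do) (Fa \<circ> Da) (Fo z) (Fa \<circ> l)"
    using F(2)[unfolded cocontinuous_def, rule_format, OF J D l] .
  ultimately have "is_colimit J E (Go \<circ> (Fo \<circ> Do)) (Ga \<circ> (Fa \<circ> Da)) (Go (Fo z)) (Ga \<circ> (Fa \<circ> l))"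
    using G[unfolded cocontinuous_def] J by blast
  then show "is_colimit J E ((\<lambda>x. Go (Fo x)) \<circ> Do) ((\<lambda>f. Ga (Fa f)) \<circ> Da) (Go (Fo z)) ((\<lambda>f. Ga (Fa f)) \<circ> l)"
    by (simp add: comp_def)
qed

text \<open>A list of lists whose entries are indexed by their positions; the variables of a nested tensor product are such positions.\<close>

definition grid :: "nat list \<Rightarrow> (nat \<times> nat \<Rightarrow> 'a) \<Rightarrow> 'a list list" where
  "grid ls x = map (\<lambda>j. map (\<lambda>l. x (j, l)) [0..<ls ! j]) [0..<length ls]"

definition grid_index :: "nat list \<Rightarrow> (nat \<times> nat) set" where
  "grid_index ls = {(j, l). j < length ls \<and> l < ls ! j}"

lemma grid_map: "map (map g) (grid ls x) = grid ls (\<lambda>z. g (x z))"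
  by (simp add: grid_def)

lemma grid_nth: "grid (map length xss) (\<lambda>(j, l). xss ! j ! l) = xss"
  by (auto simp: grid_def intro!: nth_equalityI)

lemma grid_cong: "(\<And>z. z \<in> grid_index ls ==> x z = y z) ==> grid ls x = grid ls y"
  by (auto simp: grid_def grid_index_def)

lemma set_grid: "set (concat (grid ls x)) = x ` grid_index ls"
  by (force simp: grid_def grid_index_def)

lemma concat_grid: "concat (grid ls x) = map x (concat (grid ls (\<lambda>i. i)))"
  by (simp add: grid_def map_concat comp_def)

lemma list_all2_grid: "list_all2 (list_all2 R) (grid ls x) (grid ls y) \<longleftrightarrow> (\<forall>i\<in>grid_index ls. R (x i) (y i))"
  by (auto simp: list_all2_conv_all_nth grid_def grid_index_def)

lemma list_all2_concat: "list_all2 (list_all2 R) xss yss ==> list_all2 R (concat xss) (concat yss)"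
  by (rule concat_transfer[THEN rel_funD])

lemma finite_grid_index: "finite (grid_index ls)"
proof -
  have "grid_index ls = (\<Union>j<length ls. Pair j ` {..<ls ! j})" by (auto simp: grid_index_def)
  then show ?thesis by simp
qed

lemma grid_inverse: obtains x where "xss = grid (map length xss) x"
  using grid_nth[of xss] by metis

context gray_presheaves begin

text \<open>Varying one entry varies one factor of one of the inner tensor products, so the functor of one variable is a composite of two cocontinuous ones.\<close>

lemma multi_cocontinuous_To_To:
  "multi_cocontinuous Theta2 (grid_index ls) (\<lambda>X. To (map To (grid ls X))) (\<lambda>f. Ta (map Ta (grid ls f)))"
proof (intro multi_cocontinuous.intro multi_cocontinuous_axioms.intro, goal_cases)
  case 1 show ?case by (rule countable_category_axioms)
next
  case 2 show ?case by (rule finite_grid_index)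
next
  case (3 X Y) then show ?case using grid_cong[of ls X Y] by simp
next
  case (4 f g) then show ?case using grid_cong[of ls f g] by simp
next
  case (5 f)
  have f: "f (j, l) \<in> Arr P" if "j < length ls" "l < ls ! j" for j l using 5 that by (simp add: grid_index_def)
  have in_ty: "Ta (map (\<lambda>l. f (j, l)) [0..<ls ! j]) \<in> Arr P \<and>
    Src (Ta (map (\<lambda>l. f (j, l)) [0..<ls ! j])) = To (map (\<lambda>l. Src (f (j, l))) [0..<ls ! j]) \<and>
    Tgt (Ta (map (\<lambda>l. f (j, l)) [0..<ls ! j])) = To (map (\<lambda>l. Tgt (f (j, l))) [0..<ls ! j])" if "j < length ls" for j
    using Ta_map_ty[of "[0..<ls ! j]" "\<lambda>l. f (j, l)" "\<lambda>l. Src (f (j, l))" "\<lambda>l. Tgt (f (j, l))"] f that by simp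
  then show ?case
    using Ta_map_ty[of "[0..<length ls]" "\<lambda>j. Ta (map (\<lambda>l. f (j, l)) [0..<ls ! j])"
        "\<lambda>j. To (map (\<lambda>l. Src (f (j, l))) [0..<ls ! j])" "\<lambda>j. To (map (\<lambda>l. Tgt (f (j, l))) [0..<ls ! j])"]
    by (simp add: in_Hom_Psh grid_def comp_def)
next
  case (6 X)
  then have X: "presheaf Theta2 (X (j, l))" if "j < length ls" "l < ls ! j" for j l using that by (simp add: grid_index_def)
  have "Ta (map Ta (grid ls (\<lambda>i. Id P (X i)))) = Ta (map (\<lambda>j. Id P (To (map (\<lambda>l. X (j, l)) [0..<ls ! j]))) [0..<length ls])"
    unfolding grid_def map_map comp_def using X by (intro arg_cong[of _ _ Ta] map_cong HOL.refl Ta_map_Id) auto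
  also have "\<dots> = Id P (To (map (\<lambda>j. To (map (\<lambda>l. X (j, l)) [0..<ls ! j])) [0..<length ls]))"
    using X by (intro Ta_map_Id To_presheaf) auto
  finally show ?case by (simp add: grid_def comp_def)
next
  case (7 f g)
  have fg: "f (j, l) \<in> Arr P \<and> g (j, l) \<in> Arr P \<and> Tgt (f (j, l)) = Src (g (j, l))" if "j < length ls" "l < ls ! j" for j l
    using 7 that by (simp add: grid_index_def)
  let ?f = "\<lambda>j. Ta (map (\<lambda>l. f (j, l)) [0..<ls ! j])" and ?g = "\<lambda>j. Ta (map (\<lambda>l. g (j, l)) [0..<ls ! j])"
  have ty: "?f j \<in> Arr P \<and> ?g j \<in> Arr P \<and> Tgt (?f j) = Src (?g j)" if "j < length ls" for j
    using Ta_map_ty[of "[0..<ls ! j]" "\<lambda>l. f (j, l)" "\<lambda>l. Src (f (j, l))" "\<lambda>l. Src (g (j, l))"]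
      Ta_map_ty[of "[0..<ls ! j]" "\<lambda>l. g (j, l)" "\<lambda>l. Src (g (j, l))" "\<lambda>l. Tgt (g (j, l))"] fg that by simp
  have "Ta (map Ta (grid ls (\<lambda>i. Comp P (g i) (f i)))) = Ta (map (\<lambda>j. Comp P (?g j) (?f j)) [0..<length ls])"
    unfolding grid_def map_map comp_def using fg by (intro arg_cong[of _ _ Ta] map_cong HOL.refl Ta_Comp) auto
  also have "\<dots> = Comp P (Ta (map ?g [0..<length ls])) (Ta (map ?f [0..<length ls]))"
    using ty by (intro Ta_Comp) auto
  finally show ?case by (simp add: grid_def comp_def)
next
  case (8 i X)
  obtain j l where i: "i = (j, l)" "j < length ls" "l < ls ! j" using 8(1) by (auto simp: grid_index_def)
  have X: "presheaf Theta2 (X (j, l))" if "j < length ls" "l < ls ! j" for j l using 8(2) that by (simp add: grid_index_def)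
  interpret inner: multi_cocontinuous Theta2 "TYPE('u)" "{..<ls ! j}" "\<lambda>X. To (map X [0..<ls ! j])" "\<lambda>f. Ta (map f [0..<ls ! j])"
    by (rule multi_cocontinuous_To)
  interpret outer: multi_cocontinuous Theta2 "TYPE('u)" "{..<length ls}" "\<lambda>X. To (map X [0..<length ls])" "\<lambda>f. Ta (map f [0..<length ls])"
    by (rule multi_cocontinuous_To)
  let ?X = "\<lambda>l. X (j, l)" and ?Z = "\<lambda>j. To (map (\<lambda>l. X (j, l)) [0..<ls ! j])"
  let ?Fo = "\<lambda>Y. To (map (?X(l := Y)) [0..<ls ! j])" and ?Fa = "\<lambda>f. Ta (map ((\<lambda>l. Id P (?X l))(l := f)) [0..<ls ! j])"
  let ?Go = "\<lambda>Y. To (map (?Z(j := Y)) [0..<length ls])" and ?Ga = "\<lambda>f. Ta (map ((\<lambda>j. Id P (?Z j))(j := f)) [0..<length ls])"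
  have "cocontinuous TYPE('u) P P (\<lambda>Y. ?Go (?Fo Y)) (\<lambda>f. ?Ga (?Fa f))"
    by (rule cocontinuous_compose[OF inner.slot_functor inner.cocont outer.cocont]) (use i X in \<open>auto intro!: To_presheaf\<close>)
  moreover have "?Go (?Fo Y) = To (map To (grid ls (X(i := Y))))" for Y
    unfolding grid_def map_map i by (intro arg_cong[of _ _ To] map_cong) (auto intro!: arg_cong[of _ _ To])
  moreover have "?Ga (?Fa f) = Ta (map Ta (grid ls ((\<lambda>j. Id P (X j))(i := f))))" for f
    unfolding grid_def map_map i
  proof (intro arg_cong[of _ _ Ta] map_cong HOL.refl)
    fix j' assume j': "j' \<in> set [0..<length ls]"
    show "((\<lambda>j. Id P (?Z j))(j := ?Fa f)) j' =
      (Ta \<circ> (\<lambda>ja. map (\<lambda>la. ((\<lambda>j. Id P (X j))((j, l) := f)) (ja, la)) [0..<ls ! ja])) j'"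
    proof (cases "j' = j")
      case True
      then show ?thesis by (auto intro!: arg_cong[of _ _ Ta])
    next
      case False
      then show ?thesis using Ta_map_Id[of "[0..<ls ! j']" "\<lambda>l. X (j', l)"] X j' by simp
    qed
  qed
  ultimately show ?case by simp
qed

subsection \<open>The multiplication on representables\<close>

abbreviation Comp2 (infixr \<open>\<cdot>\<close> 75) where "G \<cdot> F \<equiv> Comp TwoCat G F"

lemma yo_presheaf: "set \<theta>s \<subseteq> Obj Theta2 ==> X \<in> set (map yo \<theta>s) ==> presheaf Theta2 X"
  using presheaf_yo by auto

lemma To_yo_presheaf: "set \<theta>s \<subseteq> Obj Theta2 ==> presheaf Theta2 (To (map yo \<theta>s))"
  by (intro To_presheaf yo_presheaf) auto

lemma yoneda_arr_ty: "f \<in> Arr Theta2 ==>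
    ya f \<in> Arr P \<and> Src (ya f) = yo (TSrc f) \<and> Tgt (ya f) = yo (TTgt f)"
  using yoneda_arr(1-3)[of f] by (simp add: Theta2_sel)

lemma unkap:
  assumes "set \<theta>s \<subseteq> Obj Theta2" "elt (To (map yo \<theta>s)) p"
  shows "unkap \<theta>s (fst p) (snd p) \<in> Hom TwoCat (fst p) (gray_list \<theta>s)"
    "kap \<theta>s (fst p) (unkap \<theta>s (fst p) (snd p)) = snd p"
proof -
  obtain h where "h \<in> Hom TwoCat (fst p) (gray_list \<theta>s)" "snd p = kap \<theta>s (fst p) h"
    using kap(2)[OF assms(1), of "fst p" "snd p"] assms(2) by (auto simp: elt_def)
  then show "unkap \<theta>s (fst p) (snd p) \<in> Hom TwoCat (fst p) (gray_list \<theta>s)"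
    "kap \<theta>s (fst p) (unkap \<theta>s (fst p) (snd p)) = snd p"
    using unkap_kap[OF assms(1), of "fst p" h] assms(2) by (auto simp: elt_def)
qed

text \<open>The operation on 2-functors behind the multiplication: \<open>h\<close> lands in the tensor product of the sources of the \<open>k z\<close>, and the composite lands in the flattened tensor product.\<close>

abbreviation graft :: "('z \<Rightarrow> nat two_cat list) \<Rightarrow> ('z \<Rightarrow> (nat, nat) two_fun) \<Rightarrow> 'z list \<Rightarrow> (nat, nat) two_fun \<Rightarrow> (nat, nat) two_fun" where
  "graft \<theta>s k zs h \<equiv> flat (map \<theta>s zs) \<cdot> gray_list_fun (map k zs) \<cdot> h"

lemma flat_glf:
  assumes z: "\<And>z. z \<in> set zs ==> set (\<theta>s z) \<subseteq> Obj Theta2 \<and> \<eta> z \<in> Obj Theta2 \<and> k z \<in> Hom TwoCat (\<eta> z) (gray_list (\<theta>s z))"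
    and h: "h \<in> Hom TwoCat \<zeta> (gray_list (map \<eta> zs))"
  shows "gray_list_fun (map k zs) \<cdot> h \<in> Hom TwoCat \<zeta> (gray_list (map (\<lambda>z. gray_list (\<theta>s z)) zs))"
    "graft \<theta>s k zs h \<in> Hom TwoCat \<zeta> (gray_list (concat (map \<theta>s zs)))"
proof -
  have k: "set (map k zs) \<subseteq> Arr TwoCat" using z by (auto simp: TwoCat_Hom_iff)
  have e: "map TSrc (map k zs) = map \<eta> zs" "map TTgt (map k zs) = map (\<lambda>z. gray_list (\<theta>s z)) zs"
    using z by (auto simp: TwoCat_Hom_iff)
  have t: "set (concat (map \<theta>s zs)) \<subseteq> Obj TwoCat" using z Theta2_TwoCat(1) by fastforce
  note g = gray_list_fun[OF k, unfolded e] and f = flat[OF t, unfolded map_map comp_def]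
  show 1: "gray_list_fun (map k zs) \<cdot> h \<in> Hom TwoCat \<zeta> (gray_list (map (\<lambda>z. gray_list (\<theta>s z)) zs))"
    using g h by (simp add: TwoCat_Hom_iff two_fun_comp)
  show "graft \<theta>s k zs h \<in> Hom TwoCat \<zeta> (gray_list (concat (map \<theta>s zs)))"
    using 1 f by (simp add: TwoCat_Hom_iff two_fun_comp)
qed

lemma Comp2_assoc: "f \<in> Arr TwoCat ==> g \<in> Arr TwoCat ==> h \<in> Arr TwoCat ==> TTgt f = TSrc g ==> TTgt g = TSrc h ==>
    (h \<cdot> g) \<cdot> f = h \<cdot> g \<cdot> f"
  using category.comp_assoc[OF category_TwoCat, of f "TSrc f" "TTgt f" g "TTgt g" h "TTgt h"]
  by (simp add: TwoCat_Hom_iff)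

text \<open>The multiplication for representables. An element of an inner tensor product is then the same as a
  2-functor, which \<open>unkap\<close> recovers.\<close>

definition is_mult_yo :: "nat two_cat list list \<Rightarrow> 'u theta_psh_arr \<Rightarrow> bool" where
  "is_mult_yo \<theta>ss \<eta> \<longleftrightarrow> \<eta> \<in> Hom P (To (map (\<lambda>\<theta>s. To (map yo \<theta>s)) \<theta>ss)) (To (map yo (concat \<theta>ss))) \<and>
    (\<forall>ps \<zeta> h. presents (map (\<lambda>\<theta>s. To (map yo \<theta>s)) \<theta>ss) ps \<zeta> h \<longrightarrow>
      Map \<eta> \<zeta> (pure (map (\<lambda>\<theta>s. To (map yo \<theta>s)) \<theta>ss) ps \<zeta> h) =
      kap (concat \<theta>ss) \<zeta> (flat \<theta>ss \<cdot> gray_list_fun (map2 (\<lambda>\<theta>s p. unkap \<theta>s (fst p) (snd p)) \<theta>ss ps) \<cdot> h))"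

lemma mult_yo_ex:
  assumes \<theta>: "set (concat \<theta>ss) \<subseteq> Obj Theta2"
  shows "\<exists>\<eta>. is_mult_yo \<theta>ss \<eta>"
  unfolding is_mult_yo_def
proof (rule ex1_implies_ex, rule To_extend)
  let ?n = "length \<theta>ss" and ?Ys = "map (\<lambda>\<theta>s. To (map yo \<theta>s)) \<theta>ss"
  let ?k = "\<lambda>ps i. unkap (\<theta>ss ! i) (fst (ps ! i)) (snd (ps ! i))"
  have \<theta>i: "set (\<theta>ss ! i) \<subseteq> Obj Theta2" if "i < ?n" for i using \<theta> nth_mem[OF that] by (auto simp del: nth_mem)
  have m2: "map2 (\<lambda>\<theta>s p. unkap \<theta>s (fst p) (snd p)) \<theta>ss ps = map (?k ps) [0..<?n]" if "length ps = ?n" for ps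
    using that by (intro nth_equalityI) auto
  have mn: "map ((!) \<theta>ss) [0..<?n] = \<theta>ss" by (rule map_nth)
  have FH: "gray_list_fun (map (?k ps) [0..<?n]) \<cdot> h \<in> Hom TwoCat \<zeta> (gray_list (map gray_list \<theta>ss))"
    "flat \<theta>ss \<cdot> gray_list_fun (map (?k ps) [0..<?n]) \<cdot> h \<in> Hom TwoCat \<zeta> (gray_list (concat \<theta>ss))"
    "length ps = ?n"
    if ps: "list_all2 elt ?Ys ps" and h: "h \<in> Hom TwoCat \<zeta> (gray_list (map fst ps))" for ps h \<zeta>
  proof -
    show l: "length ps = ?n" using list_all2_lengthD[OF ps] by simp
    have p: "elt (To (map yo (\<theta>ss ! i))) (ps ! i)" if "i < ?n" for i using ps that by (simp add: list_all2_conv_all_nth)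
    have e: "map fst ps = map (\<lambda>i. fst (ps ! i)) [0..<?n]" using l by (intro nth_equalityI) auto
    have z: "set (\<theta>ss ! i) \<subseteq> Obj Theta2 \<and> fst (ps ! i) \<in> Obj Theta2 \<and> ?k ps i \<in> Hom TwoCat (fst (ps ! i)) (gray_list (\<theta>ss ! i))"
      if "i \<in> set [0..<?n]" for i
      using that \<theta>i[of i] p[of i] unkap(1)[of "\<theta>ss ! i" "ps ! i"] by (simp add: elt_def)
    note r = flat_glf[of "[0..<?n]" "(!) \<theta>ss" "\<lambda>i. fst (ps ! i)" "?k ps", OF z h[unfolded e]]
    have "map (\<lambda>i. gray_list (\<theta>ss ! i)) [0..<?n] = map gray_list \<theta>ss" by (intro nth_equalityI) auto
    then show "gray_list_fun (map (?k ps) [0..<?n]) \<cdot> h \<in> Hom TwoCat \<zeta> (gray_list (map gray_list \<theta>ss))"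
      "flat \<theta>ss \<cdot> gray_list_fun (map (?k ps) [0..<?n]) \<cdot> h \<in> Hom TwoCat \<zeta> (gray_list (concat \<theta>ss))"
      using r by (simp_all add: mn)
  qed
  show "presheaf Theta2 X" if "X \<in> set ?Ys" for X
    using that \<theta> by (auto intro!: To_yo_presheaf)
  show "presheaf Theta2 (To (map yo (concat \<theta>ss)))" by (rule To_yo_presheaf[OF \<theta>])
  let ?m = "\<lambda>ps \<zeta> h. kap (concat \<theta>ss) \<zeta> (flat \<theta>ss \<cdot> gray_list_fun (map2 (\<lambda>\<theta>s p. unkap \<theta>s (fst p) (snd p)) \<theta>ss ps) \<cdot> h)"
  show "?m ps \<zeta> h \<in> At (To (map yo (concat \<theta>ss))) \<zeta>"
    if "presents ?Ys ps \<zeta> h" for ps \<zeta> h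
  proof -
    from that have ps: "list_all2 elt ?Ys ps" "\<zeta> \<in> Obj Theta2" "h \<in> Hom TwoCat \<zeta> (gray_list (map fst ps))"
      by (auto simp: presents_def)
    show ?thesis using kap(1)[OF \<theta> ps(2)] FH[OF ps(1,3)] by (simp only: m2)
  qed
  show "?m ps (TSrc g) (h \<cdot> g) = Act (To (map yo (concat \<theta>ss))) g (?m ps (TTgt g) h)"
    if psh: "presents ?Ys ps (TTgt g) h" and g: "g \<in> Arr Theta2" for ps g h
  proof -
    from psh have ps: "list_all2 elt ?Ys ps" and h: "h \<in> Hom TwoCat (TTgt g) (gray_list (map fst ps))"
      by (auto simp: presents_def)
    note F = FH[OF ps h]
    have z: "TTgt g \<in> Obj Theta2" "g \<in> Arr TwoCat" using g by (auto simp: Theta2_sel)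
    have G: "gray_list_fun (map (?k ps) [0..<?n]) \<in> Arr TwoCat" "TSrc (gray_list_fun (map (?k ps) [0..<?n])) = gray_list (map fst ps)"
      "TTgt (gray_list_fun (map (?k ps) [0..<?n])) = gray_list (map gray_list \<theta>ss)"
    proof -
      have p: "?k ps i \<in> Hom TwoCat (fst (ps ! i)) (gray_list (\<theta>ss ! i))" if "i < ?n" for i
        using that unkap(1)[OF \<theta>i[OF that], of "ps ! i"] ps by (simp add: list_all2_conv_all_nth)
      have k: "set (map (?k ps) [0..<?n]) \<subseteq> Arr TwoCat" using p by (auto simp: TwoCat_Hom_iff)
      have "map TSrc (map (?k ps) [0..<?n]) = map fst ps" "map TTgt (map (?k ps) [0..<?n]) = map gray_list \<theta>ss"
        using p F(3) by (auto simp: TwoCat_Hom_iff intro!: nth_equalityI)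
      with gray_list_fun[OF k] show "gray_list_fun (map (?k ps) [0..<?n]) \<in> Arr TwoCat"
        "TSrc (gray_list_fun (map (?k ps) [0..<?n])) = gray_list (map fst ps)"
        "TTgt (gray_list_fun (map (?k ps) [0..<?n])) = gray_list (map gray_list \<theta>ss)" by simp_all
    qed
    have \<theta>': "set (concat \<theta>ss) \<subseteq> Obj TwoCat" using \<theta> Theta2_TwoCat(1) by blast
    note f = flat[OF \<theta>']
    have "flat \<theta>ss \<cdot> gray_list_fun (map (?k ps) [0..<?n]) \<cdot> h \<cdot> g = (flat \<theta>ss \<cdot> gray_list_fun (map (?k ps) [0..<?n]) \<cdot> h) \<cdot> g"
      using f G h z(2) F by (simp add: Comp2_assoc TwoCat_Hom_iff two_fun_comp)
    then show ?thesis unfolding m2[OF F(3)] using kap(4)[OF \<theta> z(1) F(2) g HOL.refl] by simp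
  qed
  show "?m (map (\<lambda>i. (TSrc (f i), Act (?Ys ! i) (f i) (e i))) [0..<length ?Ys]) \<zeta> h =
    ?m (map (\<lambda>i. (TTgt (f i), e i)) [0..<length ?Ys]) \<zeta> (gray_list_fun (map f [0..<length ?Ys]) \<cdot> h)"
    if fe: "\<And>i. i < length ?Ys ==> f i \<in> Arr Theta2 \<and> elt (?Ys ! i) (TTgt (f i), e i)" and z: "\<zeta> \<in> Obj Theta2"
      and h: "h \<in> Hom TwoCat \<zeta> (gray_list (map TSrc (map f [0..<length ?Ys])))" for f e \<zeta> h
  proof -
    let ?u = "\<lambda>i. unkap (\<theta>ss ! i) (TTgt (f i)) (e i)"
    have u: "?u i \<in> Hom TwoCat (TTgt (f i)) (gray_list (\<theta>ss ! i))" "kap (\<theta>ss ! i) (TTgt (f i)) (?u i) = e i"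
      "f i \<in> Arr Theta2" "f i \<in> Arr TwoCat" "TTgt (f i) \<in> Obj Theta2" "TSrc (f i) \<in> Obj Theta2" if "i < ?n" for i
      using unkap[OF \<theta>i[OF that], of "(TTgt (f i), e i)"] fe[of i] that by (auto simp: Theta2_sel)
    have v: "unkap (\<theta>ss ! i) (TSrc (f i)) (Act (To (map yo (\<theta>ss ! i))) (f i) (e i)) = ?u i \<cdot> f i" if "i < ?n" for i
    proof -
      have "?u i \<cdot> f i \<in> Hom TwoCat (TSrc (f i)) (gray_list (\<theta>ss ! i))"
        using u[OF that] by (simp add: TwoCat_Hom_iff two_fun_comp)
      then show ?thesis
        using kap(4)[OF \<theta>i[OF that] u(5)[OF that] u(1)[OF that] u(3)[OF that] HOL.refl] u(2)[OF that]
          unkap_kap[OF \<theta>i[OF that] u(6)[OF that]] by simp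
    qed
    have 1: "map2 (\<lambda>\<theta>s p. unkap \<theta>s (fst p) (snd p)) \<theta>ss (map (\<lambda>i. (TSrc (f i), Act (?Ys ! i) (f i) (e i))) [0..<length ?Ys]) =
       map (\<lambda>i. ?u i \<cdot> f i) [0..<?n]"
      using v by (intro nth_equalityI) auto
    have 2: "map2 (\<lambda>\<theta>s p. unkap \<theta>s (fst p) (snd p)) \<theta>ss (map (\<lambda>i. (TTgt (f i), e i)) [0..<length ?Ys]) = map ?u [0..<?n]"
      by (intro nth_equalityI) auto
    have uA: "set (map ?u [0..<?n]) \<subseteq> Arr TwoCat" and fA: "set (map f [0..<?n]) \<subseteq> Arr TwoCat"
      using u by (auto simp: TwoCat_Hom_iff)
    have s: "map TSrc (map ?u [0..<?n]) = map TTgt (map f [0..<?n])" using u by (auto simp: TwoCat_Hom_iff)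
    have "gray_list_fun (map (\<lambda>i. ?u i \<cdot> f i) [0..<?n]) = gray_list_fun (map ?u [0..<?n]) \<cdot> gray_list_fun (map f [0..<?n])"
      using u by (intro gray_list_fun_Comp) (auto simp: TwoCat_Hom_iff)
    moreover have "(gray_list_fun (map ?u [0..<?n]) \<cdot> gray_list_fun (map f [0..<?n])) \<cdot> h =
      gray_list_fun (map ?u [0..<?n]) \<cdot> gray_list_fun (map f [0..<?n]) \<cdot> h"
      using h by (intro Comp2_assoc) (simp_all only: gray_list_fun[OF uA] gray_list_fun[OF fA] s TwoCat_Hom_iff length_map)
    ultimately show ?thesis unfolding 1 2 by simp
  qed
qed

definition mult_yo :: "nat two_cat list list \<Rightarrow> 'u theta_psh_arr" where
  "mult_yo \<theta>ss = (SOME \<eta>. is_mult_yo \<theta>ss \<eta>)"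

lemma is_mult_yo: "set (concat \<theta>ss) \<subseteq> Obj Theta2 ==> is_mult_yo \<theta>ss (mult_yo \<theta>ss)"
  unfolding mult_yo_def by (rule someI_ex) (rule mult_yo_ex)

lemma mult_yo:
  assumes "set (concat \<theta>ss) \<subseteq> Obj Theta2"
  shows "mult_yo \<theta>ss \<in> Arr P" "Src (mult_yo \<theta>ss) = To (map (\<lambda>\<theta>s. To (map yo \<theta>s)) \<theta>ss)"
    "Tgt (mult_yo \<theta>ss) = To (map yo (concat \<theta>ss))"
  using is_mult_yo[OF assms] by (auto simp: is_mult_yo_def in_Hom_Psh)

lemma mult_yo_app:
  assumes z: "\<And>z. z \<in> set zs ==> set (\<theta>s z) \<subseteq> Obj Theta2 \<and> \<eta> z \<in> Obj Theta2 \<and> k z \<in> Hom TwoCat (\<eta> z) (gray_list (\<theta>s z))"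
    and h: "\<zeta> \<in> Obj Theta2" "h \<in> Hom TwoCat \<zeta> (gray_list (map \<eta> zs))"
  shows "Map (mult_yo (map \<theta>s zs)) \<zeta>
      (pure (map (\<lambda>z. To (map yo (\<theta>s z))) zs) (map (\<lambda>z. (\<eta> z, kap (\<theta>s z) (\<eta> z) (k z))) zs) \<zeta> h) =
    kap (concat (map \<theta>s zs)) \<zeta> (graft \<theta>s k zs h)"
proof -
  have \<theta>: "set (concat (map \<theta>s zs)) \<subseteq> Obj Theta2" using z by auto
  let ?ps = "map (\<lambda>z. (\<eta> z, kap (\<theta>s z) (\<eta> z) (k z))) zs"
  have m: "map (\<lambda>\<theta>s. To (map yo \<theta>s)) (map \<theta>s zs) = map (\<lambda>z. To (map yo (\<theta>s z))) zs" "map fst ?ps = map \<eta> zs" by simp_all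
  have p: "list_all2 elt (map (\<lambda>z. To (map yo (\<theta>s z))) zs) ?ps"
    using z kap(1) by (auto simp: list_all2_maps elt_def intro!: To_yo_presheaf)
  have k: "map2 (\<lambda>\<theta>s p. unkap \<theta>s (fst p) (snd p)) (map \<theta>s zs) ?ps = map k zs"
    using z unkap_kap by (auto simp: map2_map_map)
  from is_mult_yo[OF \<theta>, unfolded is_mult_yo_def m, THEN conjunct2, rule_format, of ?ps \<zeta> h] p h
  show ?thesis unfolding k m presents_def by blast
qed

text \<open>\<open>pure_surj\<close> for factors indexed by a list; without repetitions, the elements are a function of the index.\<close>

lemma pure_exhaust:
  assumes zs: "distinct zs" "\<And>z. z \<in> set zs ==> presheaf Theta2 (X z)" and v: "\<zeta> \<in> Obj Theta2" "v \<in> At (To (map X zs)) \<zeta>"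
  shows "\<exists>\<theta> x h. (\<forall>z\<in>set zs. elt (X z) (\<theta> z, x z)) \<and> h \<in> Hom TwoCat \<zeta> (gray_list (map \<theta> zs)) \<and>
    v = pure (map X zs) (map (\<lambda>z. (\<theta> z, x z)) zs) \<zeta> h"
proof -
  obtain ps h where ps: "list_all2 elt (map X zs) ps" "h \<in> Hom TwoCat \<zeta> (gray_list (map fst ps))" "v = pure (map X zs) ps \<zeta> h"
    using pure_surj[of "map X zs" \<zeta> v] zs v by (auto simp: presents_def)
  have l: "length zs = length ps" using list_all2_lengthD[OF ps(1)] by simp
  define p where "p z = the (map_of (zip zs ps) z)" for z
  have p: "p (zs ! i) = ps ! i" if "i < length zs" for i
    using that l zs(1) by (simp add: p_def map_of_zip_nth)
  have m: "map p zs = ps" using p l by (intro nth_equalityI) auto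
  show ?thesis
  proof (intro exI conjI ballI)
    show "elt (X z) (fst (p z), snd (p z))" if "z \<in> set zs" for z
      using ps(1) that unfolding m[symmetric] by (auto simp: list_all2_maps)
  qed (use ps(2,3) in \<open>auto simp flip: m simp: comp_def\<close>)
qed

text \<open>On presentations this is the naturality of flattening.\<close>

lemma mult_yo_natural:
  assumes f: "set (concat fss) \<subseteq> Arr Theta2"
  shows "Comp P (Ta (map ya (concat fss))) (mult_yo (map (map TSrc) fss)) =
    Comp P (mult_yo (map (map TTgt) fss)) (Ta (map (\<lambda>fs. Ta (map ya fs)) fss))"
proof (rule P_eqI)
  let ?Y = "Ta (map ya (concat fss))" and ?YY = "Ta (map (\<lambda>fs. Ta (map ya fs)) fss)"
    and ?S = "mult_yo (map (map TSrc) fss)" and ?T = "mult_yo (map (map TTgt) fss)"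
  let ?n = "length fss"
  let ?s = "\<lambda>i. map TSrc (fss ! i)" and ?t = "\<lambda>i. map TTgt (fss ! i)"
  have fi: "set (fss ! i) \<subseteq> Arr Theta2" if "i < ?n" for i using f nth_mem[OF that] by (auto simp del: nth_mem)
  have st: "set (?s i) \<subseteq> Obj Theta2" "set (?t i) \<subseteq> Obj Theta2" if "i < ?n" for i
    using fi[OF that] by (auto simp: Theta2_sel)
  have s: "set (concat (map (map TSrc) fss)) \<subseteq> Obj Theta2" and t: "set (concat (map (map TTgt) fss)) \<subseteq> Obj Theta2"
    using f by (auto simp: Theta2_sel)
  have fT: "set (concat fss) \<subseteq> Arr TwoCat" using f by (auto simp: Theta2_sel)
  have F: "map (\<lambda>i. fss ! i) [0..<?n] = fss" by (simp add: map_nth)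
  have M: "map ?s [0..<?n] = map (map TSrc) fss" "map ?t [0..<?n] = map (map TTgt) fss"
    by (auto intro!: nth_equalityI)
  have A: "?Y \<in> Arr P"
    "Src ?Y = To (map yo (concat (map (map TSrc) fss)))"
    "Tgt ?Y = To (map yo (concat (map (map TTgt) fss)))"
    using Ta_map_ty[of "concat fss" "ya" "\<lambda>f. yo (TSrc f)" "\<lambda>f. yo (TTgt f)", OF yoneda_arr_ty] f
    by (auto simp: map_concat comp_def subset_eq)
  have B: "Ta (map ya (fss ! i)) \<in> Arr P \<and>
    Src (Ta (map ya (fss ! i))) = To (map yo (?s i)) \<and>
    Tgt (Ta (map ya (fss ! i))) = To (map yo (?t i))" if "i < ?n" for i
    using Ta_map_ty[of "fss ! i" "ya" "\<lambda>f. yo (TSrc f)" "\<lambda>f. yo (TTgt f)", OF yoneda_arr_ty] fi[OF that]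
    by (auto simp: subset_eq comp_def)
  have e: "map (\<lambda>fs. Ta (map ya fs)) fss = map (\<lambda>i. Ta (map ya (fss ! i))) [0..<?n]"
    by (intro nth_equalityI) auto
  have C: "?YY \<in> Arr P"
    "Src ?YY = To (map (\<lambda>i. To (map yo (?s i))) [0..<?n])"
    "Tgt ?YY = To (map (\<lambda>i. To (map yo (?t i))) [0..<?n])"
    unfolding e
    using Ta_map_ty[of "[0..<?n]" "\<lambda>i. Ta (map ya (fss ! i))" "\<lambda>i. To (map yo (?s i))" "\<lambda>i. To (map yo (?t i))"] B
    by auto
  have ms: "map (\<lambda>\<theta>s. To (map yo \<theta>s)) (map (map TSrc) fss) = map (\<lambda>i. To (map yo (?s i))) [0..<?n]"
    "map (\<lambda>\<theta>s. To (map yo \<theta>s)) (map (map TTgt) fss) = map (\<lambda>i. To (map yo (?t i))) [0..<?n]"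
    by (auto intro!: nth_equalityI)
  note S = mult_yo[OF s, unfolded ms] and T = mult_yo[OF t, unfolded ms]
  show "Comp P ?Y ?S \<in> Arr P"
    "Comp P ?T ?YY \<in> Arr P"
    using A C S T by (auto intro!: P_Comp(1) simp del: map_map)
  show "Src (Comp P ?Y ?S) =
      Src (Comp P ?T ?YY)"
    by (simp only: P_Comp C S)
  show "Tgt (Comp P ?Y ?S) =
      Tgt (Comp P ?T ?YY)"
    by (simp only: P_Comp A T)
  fix \<zeta> v assume z: "\<zeta> \<in> Obj Theta2"
    and "v \<in> At (Src (Comp P ?Y ?S)) \<zeta>"
  then have v: "v \<in> At (To (map (\<lambda>i. To (map yo (?s i))) [0..<?n])) \<zeta>" by (simp only: P_Comp S)
  have Y: "presheaf Theta2 (To (map yo (?s i)))" if "i \<in> set [0..<?n]" for i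
    using that st by (intro To_yo_presheaf) auto
  obtain \<eta> x h where x': "\<forall>i\<in>set [0..<?n]. elt (To (map yo (?s i))) (\<eta> i, x i)"
    and h: "h \<in> Hom TwoCat \<zeta> (gray_list (map \<eta> [0..<?n]))"
    and vx: "v = pure (map (\<lambda>i. To (map yo (?s i))) [0..<?n]) (map (\<lambda>i. (\<eta> i, x i)) [0..<?n]) \<zeta> h"
    using pure_exhaust[OF distinct_upt Y z v] by blast
  note x = bspec[OF x']
  let ?k = "\<lambda>i. unkap (?s i) (\<eta> i) (x i)"
  have k: "set (?s i) \<subseteq> Obj Theta2 \<and> \<eta> i \<in> Obj Theta2 \<and> ?k i \<in> Hom TwoCat (\<eta> i) (gray_list (?s i))"
    and kx: "kap (?s i) (\<eta> i) (?k i) = x i" if "i \<in> set [0..<?n]" for i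
    using unkap[of "?s i" "(\<eta> i, x i)"] x[OF that] st that by (auto simp: elt_def)
  have fiT: "set (fss ! i) \<subseteq> Arr TwoCat" if "i < ?n" for i using fi[OF that] by (auto simp: Theta2_sel)
  have k': "set (?t i) \<subseteq> Obj Theta2 \<and> \<eta> i \<in> Obj Theta2 \<and>
      gray_list_fun (fss ! i) \<cdot> ?k i \<in> Hom TwoCat (\<eta> i) (gray_list (?t i))" if "i \<in> set [0..<?n]" for i
    using k[OF that] st[of i] gray_list_fun[OF fiT[of i]] that by (simp add: TwoCat_Hom_iff two_fun_comp)
  have v': "v = pure (map (\<lambda>i. To (map yo (?s i))) [0..<?n]) (map (\<lambda>i. (\<eta> i, kap (?s i) (\<eta> i) (?k i))) [0..<?n]) \<zeta> h"
    unfolding vx using kx by (intro arg_cong2[of _ _ _ _ "\<lambda>a b. pure a b \<zeta> h"] map_cong) auto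
  let ?h = "graft ?s ?k [0..<?n] h"
  have hA: "gray_list_fun (map ?k [0..<?n]) \<cdot> h \<in> Hom TwoCat \<zeta> (gray_list (map (\<lambda>i. gray_list (?s i)) [0..<?n]))"
    "?h \<in> Hom TwoCat \<zeta> (gray_list (concat (map ?s [0..<?n])))"
    by (rule flat_glf[OF k h]; assumption)+
  have vS: "v \<in> At (Src ?S) \<zeta>" using v by (simp only: S)
  have vC: "v \<in> At (Src ?YY) \<zeta>" using v by (simp only: C)
  have ks: "set (map ?k [0..<?n]) \<subseteq> Arr TwoCat" using k by (auto simp: TwoCat_Hom_iff)
  have "Map (Comp P ?Y ?S) \<zeta> v =
      Map ?Y \<zeta> (Map (mult_yo (map ?s [0..<?n])) \<zeta> v)"
    unfolding M by (rule P_Comp(4)[OF z vS])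
  also have "\<dots> = Map ?Y \<zeta> (kap (concat (map ?s [0..<?n])) \<zeta> ?h)"
    unfolding v' by (subst mult_yo_app[OF k z h]) simp_all
  also have "\<dots> = kap (concat (map ?t [0..<?n])) \<zeta> (gray_list_fun (concat fss) \<cdot> ?h)"
    using kap_natural[OF f z, of ?h] hA(2) unfolding M map_concat by simp
  also have "gray_list_fun (concat fss) \<cdot> ?h =
      graft ?t (\<lambda>i. gray_list_fun (fss ! i) \<cdot> ?k i) [0..<?n] h"
  proof -
    have a: "gray_list_fun (map (\<lambda>i. gray_list_fun (fss ! i) \<cdot> ?k i) [0..<?n]) =
        gray_list_fun (map (\<lambda>i. gray_list_fun (fss ! i)) [0..<?n]) \<cdot> gray_list_fun (map ?k [0..<?n])"
      using k gray_list_fun[OF fiT] by (intro gray_list_fun_Comp) (auto simp: TwoCat_Hom_iff)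
    have b: "map (\<lambda>i. gray_list_fun (fss ! i)) [0..<?n] = map gray_list_fun fss" by (intro nth_equalityI) auto
    have gA: "set (map gray_list_fun fss) \<subseteq> Arr TwoCat" using gray_list_fun(1) fT by auto
    have c: "map TTgt (map ?k [0..<?n]) = map TSrc (map gray_list_fun fss)"
      "map TTgt (map gray_list_fun fss) = map gray_list (map (map TTgt) fss)"
      "map TSrc (map gray_list_fun fss) = map gray_list (map (map TSrc) fss)"
      "map TSrc (map ?k [0..<?n]) = map \<eta> [0..<?n]"
      using k gray_list_fun[OF fiT] by (auto simp: TwoCat_Hom_iff in_set_conv_nth intro!: nth_equalityI)
    have sT: "set (concat (map (map TSrc) fss)) \<subseteq> Obj TwoCat" and tT: "set (concat (map (map TTgt) fss)) \<subseteq> Obj TwoCat"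
      using s t Theta2_TwoCat(1) by blast+
    note ty = gray_list_fun[OF ks] gray_list_fun[OF gA] gray_list_fun[OF fT] flat[OF sT] flat[OF tT] map_concat
    have hT: "h \<in> Arr TwoCat" "TTgt h = gray_list (map \<eta> [0..<?n])" using h by (auto simp: TwoCat_Hom_iff)
    have sg: "map (\<lambda>i. gray_list (?s i)) [0..<?n] = map gray_list (map (map TSrc) fss)" by (auto intro!: nth_equalityI)
    have gkh: "gray_list_fun (map ?k [0..<?n]) \<cdot> h \<in> Arr TwoCat"
      "TTgt (gray_list_fun (map ?k [0..<?n]) \<cdot> h) = gray_list (map gray_list (map (map TSrc) fss))"
      using hA(1) unfolding sg by (auto simp: TwoCat_Hom_iff)
    have "gray_list_fun (concat fss) \<cdot> ?h =
        (gray_list_fun (concat fss) \<cdot> flat (map (map TSrc) fss)) \<cdot> gray_list_fun (map ?k [0..<?n]) \<cdot> h"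
      unfolding M by (rule Comp2_assoc[symmetric]) (simp_all only: ty gkh)
    also have "\<dots> = (flat (map (map TTgt) fss) \<cdot> gray_list_fun (map gray_list_fun fss)) \<cdot> gray_list_fun (map ?k [0..<?n]) \<cdot> h"
      by (simp only: flat_natural[OF fT])
    also have "\<dots> = flat (map (map TTgt) fss) \<cdot> gray_list_fun (map gray_list_fun fss) \<cdot> gray_list_fun (map ?k [0..<?n]) \<cdot> h"
      by (rule Comp2_assoc) (simp_all only: ty gkh c)
    also have "gray_list_fun (map gray_list_fun fss) \<cdot> gray_list_fun (map ?k [0..<?n]) \<cdot> h =
        (gray_list_fun (map gray_list_fun fss) \<cdot> gray_list_fun (map ?k [0..<?n])) \<cdot> h"
      by (rule Comp2_assoc[symmetric]) (simp_all only: ty hT c)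
    finally show ?thesis unfolding M a b .
  qed
  also have "kap (concat (map ?t [0..<?n])) \<zeta>
      (graft ?t (\<lambda>i. gray_list_fun (fss ! i) \<cdot> ?k i) [0..<?n] h) =
    Map (mult_yo (map ?t [0..<?n])) \<zeta> (pure (map (\<lambda>i. To (map yo (?t i))) [0..<?n])
      (map (\<lambda>i. (\<eta> i, kap (?t i) (\<eta> i) (gray_list_fun (fss ! i) \<cdot> ?k i))) [0..<?n]) \<zeta> h)"
    by (rule mult_yo_app[OF k' z h, symmetric])
  also have "pure (map (\<lambda>i. To (map yo (?t i))) [0..<?n])
      (map (\<lambda>i. (\<eta> i, kap (?t i) (\<eta> i) (gray_list_fun (fss ! i) \<cdot> ?k i))) [0..<?n]) \<zeta> h =
    Map (Ta (map (\<lambda>i. Ta (map ya (fss ! i))) [0..<?n])) \<zeta> v"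
  proof -
    let ?g = "\<lambda>i. Ta (map ya (fss ! i))"
    have g: "?g i \<in> Arr P \<and> elt (Src (?g i)) (\<eta> i, kap (?s i) (\<eta> i) (?k i))" if "i \<in> set [0..<?n]" for i
      using B[of i] x[OF that] kx[OF that] that by simp
    have "Map (?g i) (\<eta> i) (kap (?s i) (\<eta> i) (?k i)) = kap (?t i) (\<eta> i) (gray_list_fun (fss ! i) \<cdot> ?k i)"
      if "i \<in> set [0..<?n]" for i
      using kap_natural[OF fi, of i "\<eta> i" "?k i"] k[OF that] that by simp
    then have "pure (map (\<lambda>i. To (map yo (?t i))) [0..<?n])
        (map (\<lambda>i. (\<eta> i, kap (?t i) (\<eta> i) (gray_list_fun (fss ! i) \<cdot> ?k i))) [0..<?n]) \<zeta> h =
      pure (map (\<lambda>i. Tgt (?g i)) [0..<?n]) (map (\<lambda>i. (\<eta> i, Map (?g i) (\<eta> i) (kap (?s i) (\<eta> i) (?k i)))) [0..<?n]) \<zeta> h"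
      using B by (intro arg_cong2[of _ _ _ _ "\<lambda>a b. pure a b \<zeta> h"] map_cong) auto
    also have "\<dots> = Map (Ta (map ?g [0..<?n])) \<zeta>
        (pure (map (\<lambda>i. Src (?g i)) [0..<?n]) (map (\<lambda>i. (\<eta> i, kap (?s i) (\<eta> i) (?k i))) [0..<?n]) \<zeta> h)"
      using pure_map[of "[0..<?n]" ?g "\<lambda>i. (\<eta> i, kap (?s i) (\<eta> i) (?k i))" \<zeta> h, OF g z] h by (simp add: comp_def)
    also have "pure (map (\<lambda>i. Src (?g i)) [0..<?n]) (map (\<lambda>i. (\<eta> i, kap (?s i) (\<eta> i) (?k i))) [0..<?n]) \<zeta> h = v"
      unfolding v' using B by (intro arg_cong2[of _ _ _ _ "\<lambda>a b. pure a b \<zeta> h"] map_cong) auto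
    finally show ?thesis .
  qed
  also have "Map (mult_yo (map ?t [0..<?n])) \<zeta> (Map (Ta (map (\<lambda>i. Ta (map ya (fss ! i))) [0..<?n])) \<zeta> v) =
      Map (Comp P ?T ?YY) \<zeta> v"
    unfolding M e[symmetric] by (rule P_Comp(4)[OF z vC, symmetric])
  finally show "Map (Comp P ?Y ?S) \<zeta> v =
    Map (Comp P ?T ?YY) \<zeta> v" .
qed

subsection \<open>The multiplication on arbitrary presheaves\<close>

definition yels :: "'u theta_psh list \<Rightarrow> (nat two_cat \<times> 'u) list \<Rightarrow> 'u theta_psh_arr" where
  "yels Xs ps = Ta (map2 (\<lambda>X p. yel X (fst p) (snd p)) Xs ps)"

lemma yels:
  assumes "list_all2 elt Xs ps"
  shows "yels Xs ps \<in> Arr P" "Src (yels Xs ps) = To (map yo (map fst ps))" "Tgt (yels Xs ps) = To Xs"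
  using elts_Ta[OF assms] by (simp_all add: yels_def)

lemma pure_yels: "pure Xs ps \<zeta> h = Map (yels Xs ps) \<zeta> (kap (map fst ps) \<zeta> h)"
  by (simp add: pure_def yels_def)

text \<open>The multiplication is determined by its restrictions along tuples of elements of all the presheaves,
  where naturality prescribes it in terms of representables.\<close>

definition is_mult :: "'u theta_psh list list \<Rightarrow> 'u theta_psh_arr \<Rightarrow> bool" where
  "is_mult Xss \<eta> \<longleftrightarrow> \<eta> \<in> Hom P (To (map To Xss)) (To (concat Xss)) \<and>
    (\<forall>pss. list_all2 (list_all2 elt) Xss pss \<longrightarrow>
      Comp P \<eta> (Ta (map2 yels Xss pss)) = Comp P (yels (concat Xss) (concat pss)) (mult_yo (map (map fst) pss)))"

lemma mult_ex:
  assumes X: "\<forall>X\<in>set (concat Xss). presheaf Theta2 X"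
  shows "\<exists>\<eta>. is_mult Xss \<eta>"
proof -
  define ls where "ls = map length Xss"
  obtain X' where X': "Xss = grid ls X'" unfolding ls_def by (rule grid_inverse)
  interpret F: multi_cocontinuous Theta2 "TYPE('u)" "grid_index ls" "\<lambda>X. To (map To (grid ls X))" "\<lambda>f. Ta (map Ta (grid ls f))"
    by (rule multi_cocontinuous_To_To)
  have pX: "presheaf Theta2 (X' i)" if "i \<in> grid_index ls" for i
    using X that unfolding X' set_grid by blast
  let ?W = "To (concat Xss)"
  have W: "presheaf Theta2 ?W" using X by (intro To_presheaf) blast
  let ?ok = "\<lambda>c e. \<forall>i\<in>grid_index ls. c i \<in> Obj Theta2 \<and> e i \<in> At (X' i) (c i)"
  let ?ps = "\<lambda>c e. grid ls (\<lambda>i. (c i, e i))"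
  define M where "M c e = Comp P (yels (concat Xss) (concat (?ps c e))) (mult_yo (grid ls c))"
    for c :: "nat \<times> nat \<Rightarrow> nat two_cat" and e
  have el: "list_all2 elt (concat Xss) (concat (?ps c e))" "map fst (concat (?ps c e)) = concat (grid ls c)"
    "set (concat (grid ls c)) \<subseteq> Obj Theta2" if "?ok c e" for c e
  proof -
    show "list_all2 elt (concat Xss) (concat (?ps c e))"
      unfolding X' by (intro list_all2_concat) (use that pX in \<open>auto simp: list_all2_grid elt_def\<close>)
    show "map fst (concat (?ps c e)) = concat (grid ls c)" by (simp add: map_concat grid_map)
    show "set (concat (grid ls c)) \<subseteq> Obj Theta2" using that unfolding set_grid by auto
  qed
  have MA: "M c e \<in> Arr P" "Src (M c e) = To (map To (grid ls (\<lambda>i. yo (c i))))" "Tgt (M c e) = ?W" if "?ok c e" for c e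
    using yels[OF el(1)[OF that]] mult_yo[OF el(3)[OF that]] el(2)[OF that]
    by (simp_all add: M_def P_Comp comp_def flip: grid_map)
  have "\<exists>!h. h \<in> Hom P (To (map To (grid ls X'))) ?W \<and>
    (\<forall>c e. ?ok c e \<longrightarrow> Comp P h (Ta (map Ta (grid ls (\<lambda>i. yel (X' i) (c i) (e i))))) = M c e)"
  proof (rule F.extend_family)
    show "M c e \<in> Hom P (To (map To (grid ls (\<lambda>i. yo (c i))))) ?W"
      if "\<And>i. i \<in> grid_index ls ==> c i \<in> Obj Theta2 \<and> e i \<in> At (X' i) (c i)" for c e
      using MA[of c e] that by (simp add: in_Hom_Psh)
    show "M c e = M c' e'" if "\<And>i. i \<in> grid_index ls ==> c i = c' i \<and> e i = e' i" for c e c' e'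
      using grid_cong[of ls c c'] grid_cong[of ls "\<lambda>i. (c i, e i)" "\<lambda>i. (c' i, e' i)"] that by (simp add: M_def)
    show "M (\<lambda>i. Dom Theta2 (f i)) (\<lambda>i. Act (X' i) (f i) (e i)) =
      Comp P (M (\<lambda>i. Cod Theta2 (f i)) e) (Ta (map Ta (grid ls (\<lambda>i. ya (f i)))))"
      if fe: "\<And>i. i \<in> grid_index ls ==> f i \<in> Arr Theta2 \<and> e i \<in> At (X' i) (Cod Theta2 (f i))" for f e
    proof -
      let ?s = "\<lambda>i. TSrc (f i)" and ?t = "\<lambda>i. TTgt (f i)"
      let ?y = "Ta (map ya (concat (grid ls f)))" and ?yy = "Ta (map Ta (grid ls (\<lambda>i. ya (f i))))"
        and ?x = "yels (concat Xss) (concat (grid ls (\<lambda>i. (?t i, e i))))"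
      let ?is = "concat (grid ls (\<lambda>i. i))" and ?e = "\<lambda>i. Act (X' i) (f i) (e i)"
      have ix: "i \<in> grid_index ls" if "i \<in> set ?is" for i using that unfolding set_grid by simp
      have f: "set (concat (grid ls f)) \<subseteq> Arr Theta2" unfolding set_grid using fe by auto
      have o: "set (concat (grid ls ?s)) \<subseteq> Obj Theta2" "set (concat (grid ls ?t)) \<subseteq> Obj Theta2"
        unfolding set_grid using fe by (auto simp: Theta2_sel)
      have y: "yel (X' i) (TTgt (f i)) (e i) \<in> Arr P \<and> Src (yel (X' i) (TTgt (f i)) (e i)) = yo (TTgt (f i)) \<and>
          Tgt (yel (X' i) (TTgt (f i)) (e i)) = X' i"
        "ya (f i) \<in> Arr P \<and> Src (ya (f i)) = yo (TSrc (f i)) \<and>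
          Tgt (ya (f i)) = yo (TTgt (f i))"
        "Comp P (yel (X' i) (TTgt (f i)) (e i)) (ya (f i)) = yel (X' i) (TSrc (f i)) (?e i)"
        if "i \<in> set ?is" for i
        using fe[OF ix[OF that]] pX[OF ix[OF that]] yel(1-3)[of "X' i" "TTgt (f i)" "e i"] yoneda_arr_ty[of "f i"]
          Comp_yoneda_arr(1)[of "X' i" "f i" "e i"] by (auto simp: Theta2_sel)
      have Y: "yels (concat Xss) (concat (grid ls (\<lambda>i. (c i, x i)))) = Ta (map (\<lambda>i. yel (X' i) (c i) (x i)) ?is)" for c x
        unfolding X' concat_grid[of ls X'] concat_grid[of ls "\<lambda>i. (c i, x i)"] yels_def by (simp add: map2_map_map)
      have "Ta (map (\<lambda>i. yel (X' i) (TSrc (f i)) (?e i)) ?is) =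
          Ta (map (\<lambda>i. Comp P (yel (X' i) (TTgt (f i)) (e i)) (ya (f i))) ?is)"
        using y(3) by (intro arg_cong[of _ _ Ta] map_cong HOL.refl) simp
      also have "\<dots> = Comp P (Ta (map (\<lambda>i. yel (X' i) (TTgt (f i)) (e i)) ?is)) (Ta (map (\<lambda>i. ya (f i)) ?is))"
        using y(1,2) by (intro Ta_Comp) auto
      finally have 1: "yels (concat Xss) (concat (grid ls (\<lambda>i. (TSrc (f i), ?e i)))) =
          Comp P ?x ?y"
        unfolding Y by (simp add: concat_grid[of ls f] comp_def)
      have g: "map (map TSrc) (grid ls f) = grid ls ?s" "map (map TTgt) (grid ls f) = grid ls ?t"
        "map (\<lambda>fs. Ta (map ya fs)) (grid ls f) = map Ta (grid ls (\<lambda>i. ya (f i)))"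
        by (simp_all add: grid_def comp_def)
      note N = mult_yo_natural[OF f, unfolded g]
      have cf: "set (concat (grid ls f)) \<subseteq> Arr Theta2" by (rule f)
      note A = Ta_map_ty[of "concat (grid ls f)" "ya" "\<lambda>f. yo (TSrc f)" "\<lambda>f. yo (TTgt f)", OF yoneda_arr_ty[OF subsetD[OF cf]]]
      have A': "map (\<lambda>f. yo (TTgt f)) (concat (grid ls f)) = map yo (concat (grid ls ?t))"
        "map (\<lambda>f. yo (TSrc f)) (concat (grid ls f)) = map yo (concat (grid ls ?s))"
        by (simp_all add: map_concat grid_map)
      have ok1: "?ok ?t e" using fe by (auto simp: Theta2_sel)
      note E = yels[OF el(1)[OF ok1], unfolded el(2)[OF ok1]]
      have B: "?yy \<in> Arr P"
        "Tgt ?yy = To (map To (grid ls (\<lambda>i. yo (TTgt (f i)))))"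
        using F.Fa_ty[of "\<lambda>i. ya (f i)"] yoneda_arr_ty fe F.Fo_cong[of "\<lambda>i. Tgt (ya (f i))" "\<lambda>i. yo (TTgt (f i))"] by auto
      have m: "map (\<lambda>\<theta>s. To (map yo \<theta>s)) (grid ls ?t) = map To (grid ls (\<lambda>i. yo (TTgt (f i))))"
        by (simp add: grid_def comp_def)
      show ?thesis
        unfolding M_def Theta2_sel 1
        using P_assoc[of "mult_yo (grid ls ?s)" "?y"
            "?x"]
          P_assoc[of "?yy" "mult_yo (grid ls ?t)"
            "?x"]
          N mult_yo[OF o(1)] mult_yo[OF o(2), unfolded m] E A[unfolded A'] B
        by simp
    qed
  qed (use pX W in auto)
  then obtain \<eta> where \<eta>: "\<eta> \<in> Hom P (To (map To Xss)) ?W"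
    "\<And>c e. ?ok c e ==> Comp P \<eta> (Ta (map Ta (grid ls (\<lambda>i. yel (X' i) (c i) (e i))))) = M c e"
    unfolding X' by blast
  have "is_mult Xss \<eta>"
    unfolding is_mult_def
  proof (intro conjI allI impI \<eta>(1))
    fix pss assume pss: "list_all2 (list_all2 elt) Xss pss"
    have ls: "ls = map length pss"
      using pss by (auto simp: ls_def list_all2_conv_all_nth intro!: nth_equalityI)
    obtain p where p: "pss = grid ls p" unfolding ls by (rule grid_inverse)
    have P: "elt (X' i) (p i)" if "i \<in> grid_index ls" for i
      using pss that unfolding p X' by (auto simp: list_all2_conv_all_nth grid_def grid_index_def)
    then have ok: "?ok (\<lambda>i. fst (p i)) (\<lambda>i. snd (p i))" by (auto simp: elt_def)
    have "map2 yels Xss pss = map Ta (grid ls (\<lambda>i. yel (X' i) (fst (p i)) (snd (p i))))"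
      unfolding p X' by (auto simp: grid_def yels_def map2_map_map intro!: arg_cong[of _ _ Ta] nth_equalityI)
    then show "Comp P \<eta> (Ta (map2 yels Xss pss)) =
      Comp P (yels (concat Xss) (concat pss)) (mult_yo (map (map fst) pss))"
      using \<eta>(2)[OF ok] by (simp add: M_def p grid_map)
  qed
  then show ?thesis ..
qed

definition mult :: "'u theta_psh list list \<Rightarrow> 'u theta_psh_arr" where
  "mult Xss = (SOME \<eta>. is_mult Xss \<eta>)"

lemma mult:
  assumes "\<forall>X\<in>set (concat Xss). presheaf Theta2 X"
  shows "is_mult Xss (mult Xss)" "mult Xss \<in> Arr P" "Src (mult Xss) = To (map To Xss)" "Tgt (mult Xss) = To (concat Xss)"
proof -
  show m: "is_mult Xss (mult Xss)" unfolding mult_def using mult_ex[OF assms] by (rule someI_ex)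
  then show "mult Xss \<in> Arr P" "Src (mult Xss) = To (map To Xss)" "Tgt (mult Xss) = To (concat Xss)"
    by (auto simp: is_mult_def in_Hom_Psh)
qed

text \<open>The formula through which every law is verified: the elements of the factors are concatenated and the 2-functors are grafted.\<close>

lemma Map_mult:
  assumes z: "\<And>z. z \<in> set zs ==> presents (Xs z) (ps z) (\<eta> z) (k z)"
    and h: "\<zeta> \<in> Obj Theta2" "h \<in> Hom TwoCat \<zeta> (gray_list (map \<eta> zs))"
  shows "Map (mult (map Xs zs)) \<zeta> (pure (map (\<lambda>z. To (Xs z)) zs) (map (\<lambda>z. (\<eta> z, pure (Xs z) (ps z) (\<eta> z) (k z))) zs) \<zeta> h) =
    pure (concat (map Xs zs)) (concat (map ps zs)) \<zeta>
      (graft (\<lambda>z. map fst (ps z)) k zs h)"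
proof -
  have l: "list_all2 elt (Xs z) (ps z)" "\<eta> z \<in> Obj Theta2" "k z \<in> Hom TwoCat (\<eta> z) (gray_list (map fst (ps z)))"
    if "z \<in> set zs" for z using z[OF that] by (auto simp: presents_def)
  have pX: "presheaf Theta2 X" if X: "X \<in> set (concat (map Xs zs))" for X
  proof -
    obtain z where "z \<in> set zs" "X \<in> set (Xs z)" using X by auto
    then show ?thesis using l(1)[of z] by (auto simp: list_all2_conv_all_nth in_set_conv_nth elt_def)
  qed
  have m: "is_mult (map Xs zs) (mult (map Xs zs))" by (intro mult(1) ballI pX)
  have ll: "list_all2 (list_all2 elt) (map Xs zs) (map ps zs)"
    using l by (simp add: list_all2_maps)
  then have lc: "list_all2 elt (concat (map Xs zs)) (concat (map ps zs))" by (rule list_all2_concat)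
  let ?\<theta> = "\<lambda>z. map fst (ps z)"
  let ?y = "\<lambda>z. yels (Xs z) (ps z)"
  have k: "set (?\<theta> z) \<subseteq> Obj Theta2 \<and> \<eta> z \<in> Obj Theta2 \<and> k z \<in> Hom TwoCat (\<eta> z) (gray_list (?\<theta> z))" if "z \<in> set zs" for z
    using l[OF that] elts_objs[OF l(1)[OF that]] by blast
  have y: "?y z \<in> Arr P \<and> Src (?y z) = To (map yo (?\<theta> z)) \<and> Tgt (?y z) = To (Xs z)" if "z \<in> set zs" for z
    using yels[OF l(1)[OF that]] by simp
  note Y = Ta_map_ty[OF y]
  have e: "pure (map (\<lambda>z. To (Xs z)) zs) (map (\<lambda>z. (\<eta> z, pure (Xs z) (ps z) (\<eta> z) (k z))) zs) \<zeta> h =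
    Map (Ta (map ?y zs)) \<zeta> (pure (map (\<lambda>z. To (map yo (?\<theta> z))) zs) (map (\<lambda>z. (\<eta> z, kap (?\<theta> z) (\<eta> z) (k z))) zs) \<zeta> h)"
  proof -
    have g: "?y z \<in> Arr P \<and> elt (Src (?y z)) (\<eta> z, kap (?\<theta> z) (\<eta> z) (k z))" if "z \<in> set zs" for z
      using y[OF that] k[OF that] kap(1)[of "?\<theta> z" "\<eta> z" "k z"] To_yo_presheaf[of "?\<theta> z"] by (simp add: elt_def)
    have "map (\<lambda>z. Src (?y z)) zs = map (\<lambda>z. To (map yo (?\<theta> z))) zs" "map (\<lambda>z. Tgt (?y z)) zs = map (\<lambda>z. To (Xs z)) zs"
      using y by auto
    then show ?thesis
      using pure_map[of zs ?y "\<lambda>z. (\<eta> z, kap (?\<theta> z) (\<eta> z) (k z))" \<zeta> h, OF g h(1)] h(2)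
      by (simp add: comp_def pure_yels del: map_eq_conv)
  qed
  let ?v = "pure (map (\<lambda>z. To (map yo (?\<theta> z))) zs) (map (\<lambda>z. (\<eta> z, kap (?\<theta> z) (\<eta> z) (k z))) zs) \<zeta> h"
  have vl: "list_all2 elt (map (\<lambda>z. To (map yo (?\<theta> z))) zs) (map (\<lambda>z. (\<eta> z, kap (?\<theta> z) (\<eta> z) (k z))) zs)"
    using k kap(1) To_yo_presheaf by (auto simp: list_all2_maps elt_def simp del: set_map map_map)
  have v: "?v \<in> At (To (map (\<lambda>z. To (map yo (?\<theta> z))) zs)) \<zeta>"
    using pure_At[OF vl h(1)] h(2) by (simp add: comp_def)
  have \<theta>: "set (concat (map ?\<theta> zs)) \<subseteq> Obj Theta2" using k by fastforce
  have vY: "?v \<in> At (Src (Ta (map ?y zs))) \<zeta>" using v by (simp only: Y)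
  have vM: "?v \<in> At (Src (mult_yo (map ?\<theta> zs))) \<zeta>"
    using v by (simp add: mult_yo[OF \<theta>] comp_def)
  have m2: "map2 yels (map Xs zs) (map ps zs) = map ?y zs" by (simp add: map2_map_map)
  have mf: "map (map fst) (map ps zs) = map ?\<theta> zs" by simp
  have "Map (mult (map Xs zs)) \<zeta> (Map (Ta (map ?y zs)) \<zeta> ?v) = Map (Comp P (mult (map Xs zs)) (Ta (map ?y zs))) \<zeta> ?v"
    by (rule P_Comp(4)[OF h(1) vY, symmetric])
  also have "Comp P (mult (map Xs zs)) (Ta (map ?y zs)) =
      Comp P (yels (concat (map Xs zs)) (concat (map ps zs))) (mult_yo (map ?\<theta> zs))"
    using m[unfolded is_mult_def, THEN conjunct2, rule_format, OF ll] unfolding m2 mf .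
  also have "Map \<dots> \<zeta> ?v = Map (yels (concat (map Xs zs)) (concat (map ps zs))) \<zeta> (Map (mult_yo (map ?\<theta> zs)) \<zeta> ?v)"
    by (rule P_Comp(4)[OF h(1) vM])
  also have "Map (mult_yo (map ?\<theta> zs)) \<zeta> ?v = kap (concat (map ?\<theta> zs)) \<zeta> (graft ?\<theta> k zs h)"
    by (rule mult_yo_app[OF k h])
  finally show ?thesis unfolding e by (simp add: pure_yels[of "concat (map Xs zs)"] map_concat comp_def)
qed

end

text \<open>Positions in row \<open>i\<close> remember \<open>i\<close>, so that data chosen row by row can be made functions of the position alone.\<close>

definition row :: "nat list \<Rightarrow> nat \<Rightarrow> (nat \<times> nat) list" where
  "row ls i = map (Pair i) [0..<ls ! i]"

lemma row: "distinct (row ls i)" "z \<in> set (row ls i) ==> fst z = i"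
  by (auto simp: row_def distinct_map inj_on_def)

lemma grid_row: "grid ls x = map (\<lambda>i. map x (row ls i)) [0..<length ls]"
  by (simp add: grid_def row_def comp_def)

context gray_presheaves begin

text \<open>Presentations of the elements of a nested tensor product, with rows \<open>Z i\<close> for \<open>i\<close> in \<open>js\<close>.\<close>

abbreviation is_row :: "('z \<Rightarrow> 'u theta_psh) \<Rightarrow> ('i \<Rightarrow> 'z list) \<Rightarrow> ('z \<Rightarrow> nat two_cat) \<Rightarrow> ('z \<Rightarrow> 'u) \<Rightarrow>
    ('i \<Rightarrow> nat two_cat) \<Rightarrow> ('i \<Rightarrow> (nat, nat) two_fun) \<Rightarrow> 'i \<Rightarrow> bool" where
  "is_row X Z \<theta> x \<eta> k i \<equiv> presents (map X (Z i)) (map (\<lambda>z. (\<theta> z, x z)) (Z i)) (\<eta> i) (k i)"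

abbreviation row_elt :: "('z \<Rightarrow> 'u theta_psh) \<Rightarrow> ('i \<Rightarrow> 'z list) \<Rightarrow> ('z \<Rightarrow> nat two_cat) \<Rightarrow> ('z \<Rightarrow> 'u) \<Rightarrow>
    ('i \<Rightarrow> nat two_cat) \<Rightarrow> ('i \<Rightarrow> (nat, nat) two_fun) \<Rightarrow> 'i \<Rightarrow> 'u" where
  "row_elt X Z \<theta> x \<eta> k i \<equiv> pure (map X (Z i)) (map (\<lambda>z. (\<theta> z, x z)) (Z i)) (\<eta> i) (k i)"

abbreviation rows_elt :: "'i list \<Rightarrow> ('z \<Rightarrow> 'u theta_psh) \<Rightarrow> ('i \<Rightarrow> 'z list) \<Rightarrow> ('z \<Rightarrow> nat two_cat) \<Rightarrow> ('z \<Rightarrow> 'u) \<Rightarrow>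
    ('i \<Rightarrow> nat two_cat) \<Rightarrow> ('i \<Rightarrow> (nat, nat) two_fun) \<Rightarrow> nat two_cat \<Rightarrow> (nat, nat) two_fun \<Rightarrow> 'u" where
  "rows_elt js X Z \<theta> x \<eta> k \<zeta> h \<equiv> pure (map (\<lambda>i. To (map X (Z i))) js) (map (\<lambda>i. (\<eta> i, row_elt X Z \<theta> x \<eta> k i)) js) \<zeta> h"

text \<open>\<open>pure_surj\<close>, applied to the outer tensor product and then to each inner one.\<close>

lemma rows_exhaust:
  assumes js: "distinct js" and Z: "\<And>i. i \<in> set js ==> distinct (Z i)" "\<And>i z. i \<in> set js ==> z \<in> set (Z i) ==> r z = i"
    and X: "\<And>i z. i \<in> set js ==> z \<in> set (Z i) ==> presheaf Theta2 (X z)"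
    and v: "\<zeta> \<in> Obj Theta2" "v \<in> At (To (map (\<lambda>i. To (map X (Z i))) js)) \<zeta>"
  obtains \<theta> x \<eta> k h where
    "\<And>i. i \<in> set js ==> is_row X Z \<theta> x \<eta> k i"
    "h \<in> Hom TwoCat \<zeta> (gray_list (map \<eta> js))"
    "v = rows_elt js X Z \<theta> x \<eta> k \<zeta> h"
proof -
  have T: "presheaf Theta2 (To (map X (Z i)))" if "i \<in> set js" for i using X that by (intro To_presheaf) auto
  obtain \<eta> y h where y': "\<forall>i\<in>set js. elt (To (map X (Z i))) (\<eta> i, y i)"
    and h: "h \<in> Hom TwoCat \<zeta> (gray_list (map \<eta> js))"
    and vy: "v = pure (map (\<lambda>i. To (map X (Z i))) js) (map (\<lambda>i. (\<eta> i, y i)) js) \<zeta> h"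
    using pure_exhaust[OF js T v] by blast
  note y = bspec[OF y']
  have "\<exists>\<theta> x k. (\<forall>z\<in>set (Z i). elt (X z) (\<theta> z, x z)) \<and> k \<in> Hom TwoCat (\<eta> i) (gray_list (map \<theta> (Z i))) \<and>
      y i = pure (map X (Z i)) (map (\<lambda>z. (\<theta> z, x z)) (Z i)) (\<eta> i) k" if i: "i \<in> set js" for i
  proof -
    have "\<eta> i \<in> Obj Theta2" "y i \<in> At (To (map X (Z i))) (\<eta> i)" using y[OF i] by (auto simp: elt_def)
    from pure_exhaust[OF Z(1)[OF i] X[OF i] this] show ?thesis by blast
  qed
  then have "\<forall>i\<in>set js. \<exists>\<theta> x k. (\<forall>z\<in>set (Z i). elt (X z) (\<theta> z, x z)) \<and>
      k \<in> Hom TwoCat (\<eta> i) (gray_list (map \<theta> (Z i))) \<and>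
      y i = pure (map X (Z i)) (map (\<lambda>z. (\<theta> z, x z)) (Z i)) (\<eta> i) k" by blast
  from bchoice[OF this] obtain \<theta> where
    "\<forall>i\<in>set js. \<exists>x k. (\<forall>z\<in>set (Z i). elt (X z) (\<theta> i z, x z)) \<and>
      k \<in> Hom TwoCat (\<eta> i) (gray_list (map (\<theta> i) (Z i))) \<and>
      y i = pure (map X (Z i)) (map (\<lambda>z. (\<theta> i z, x z)) (Z i)) (\<eta> i) k" ..
  from bchoice[OF this] obtain x where
    "\<forall>i\<in>set js. \<exists>k. (\<forall>z\<in>set (Z i). elt (X z) (\<theta> i z, x i z)) \<and>
      k \<in> Hom TwoCat (\<eta> i) (gray_list (map (\<theta> i) (Z i))) \<and>
      y i = pure (map X (Z i)) (map (\<lambda>z. (\<theta> i z, x i z)) (Z i)) (\<eta> i) k" ..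
  from bchoice[OF this] obtain k where **: "\<forall>i\<in>set js. (\<forall>z\<in>set (Z i). elt (X z) (\<theta> i z, x i z)) \<and>
      k i \<in> Hom TwoCat (\<eta> i) (gray_list (map (\<theta> i) (Z i))) \<and>
      y i = pure (map X (Z i)) (map (\<lambda>z. (\<theta> i z, x i z)) (Z i)) (\<eta> i) (k i)" ..
  note * = bspec[OF **]
  have m: "map (\<lambda>z. (\<theta> (r z) z, x (r z) z)) (Z i) = map (\<lambda>z. (\<theta> i z, x i z)) (Z i)"
    "map (\<lambda>z. \<theta> (r z) z) (Z i) = map (\<theta> i) (Z i)" if "i \<in> set js" for i
    using Z(2)[OF that] by auto
  show ?thesis
  proof (rule that[of "\<lambda>z. \<theta> (r z) z" "\<lambda>z. x (r z) z" \<eta> k h])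
    show "presents (map X (Z i)) (map (\<lambda>z. (\<theta> (r z) z, x (r z) z)) (Z i)) (\<eta> i) (k i)" if i: "i \<in> set js" for i
      unfolding presents_def m[OF i] using *[OF i] y[OF i]
      by (auto simp: list_all2_maps comp_def elt_def)
    show "v = pure (map (\<lambda>i. To (map X (Z i))) js)
        (map (\<lambda>i. (\<eta> i, pure (map X (Z i)) (map (\<lambda>z. (\<theta> (r z) z, x (r z) z)) (Z i)) (\<eta> i) (k i))) js) \<zeta> h"
    proof -
      have "y i = pure (map X (Z i)) (map (\<lambda>z. (\<theta> (r z) z, x (r z) z)) (Z i)) (\<eta> i) (k i)" if i: "i \<in> set js" for i
        unfolding m(1)[OF i] using *[OF i] by blast
      then show ?thesis unfolding vy by (intro arg_cong2[of _ _ _ _ "\<lambda>a b. pure a b \<zeta> h"] map_cong HOL.refl prod.expand conjI) auto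
    qed
  qed (rule h)
qed

lemma row_D:
  assumes "presents (map X zs) (map (\<lambda>z. (\<theta> z, x z)) zs) \<eta> k"
  shows "z \<in> set zs ==> elt (X z) (\<theta> z, x z)" "\<eta> \<in> Obj Theta2" "k \<in> Hom TwoCat \<eta> (gray_list (map \<theta> zs))"
  using assms by (auto simp: presents_def list_all2_maps comp_def)

lemma Map_mult_rows:
  assumes z: "\<And>i. i \<in> set js ==> is_row X Z \<theta> x \<eta> k i"
    and h: "\<zeta> \<in> Obj Theta2" "h \<in> Hom TwoCat \<zeta> (gray_list (map \<eta> js))"
  shows "Map (mult (map (\<lambda>i. map X (Z i)) js)) \<zeta> (rows_elt js X Z \<theta> x \<eta> k \<zeta> h) =
    pure (map X (concat (map Z js))) (map (\<lambda>z. (\<theta> z, x z)) (concat (map Z js))) \<zeta>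
      (graft (\<lambda>i. map \<theta> (Z i)) k js h)"
  using Map_mult[of js "\<lambda>i. map X (Z i)" "\<lambda>i. map (\<lambda>z. (\<theta> z, x z)) (Z i)" \<eta> k \<zeta> h, OF z h]
  by (simp add: map_concat comp_def)

lemma rows_Hom:
  assumes z: "\<And>i. i \<in> set js ==> is_row X Z \<theta> x \<eta> k i"
    and h: "h \<in> Hom TwoCat \<zeta> (gray_list (map \<eta> js))"
  shows "graft (\<lambda>i. map \<theta> (Z i)) k js h \<in> Hom TwoCat \<zeta> (gray_list (map \<theta> (concat (map Z js))))"
proof -
  have "set (map \<theta> (Z i)) \<subseteq> Obj Theta2 \<and> \<eta> i \<in> Obj Theta2 \<and> k i \<in> Hom TwoCat (\<eta> i) (gray_list (map \<theta> (Z i)))"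
    if "i \<in> set js" for i
    using row_D[OF z[OF that]] by (auto simp: elt_def)
  from flat_glf(2)[of js "\<lambda>i. map \<theta> (Z i)" \<eta> k h \<zeta>, OF this h] show ?thesis by (simp add: map_concat comp_def)
qed

lemma mult_eqI:
  assumes f: "f \<in> Arr P" "Src f = To (map (\<lambda>i. To (map X (Z i))) js)" and g: "g \<in> Arr P" "Src g = Src f" "Tgt g = Tgt f"
    and js: "distinct js" and Z: "\<And>i. i \<in> set js ==> distinct (Z i)" "\<And>i z. i \<in> set js ==> z \<in> set (Z i) ==> r z = i"
    and X: "\<And>i z. i \<in> set js ==> z \<in> set (Z i) ==> presheaf Theta2 (X z)"
    and eq: "\<And>\<theta> x \<eta> k h \<zeta>. (\<And>i. i \<in> set js ==> is_row X Z \<theta> x \<eta> k i) ==>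
      \<zeta> \<in> Obj Theta2 ==> h \<in> Hom TwoCat \<zeta> (gray_list (map \<eta> js)) ==>
      Map f \<zeta> (rows_elt js X Z \<theta> x \<eta> k \<zeta> h) =
      Map g \<zeta> (rows_elt js X Z \<theta> x \<eta> k \<zeta> h)"
  shows "f = g"
proof (rule P_eqI)
  fix \<zeta> v assume z: "\<zeta> \<in> Obj Theta2" and "v \<in> At (Src f) \<zeta>"
  then have v: "v \<in> At (To (map (\<lambda>i. To (map X (Z i))) js)) \<zeta>" by (simp add: f)
  show "Map f \<zeta> v = Map g \<zeta> v"
  proof (rule rows_exhaust[OF js Z X z v])
    fix \<theta> x \<eta> k h
    assume "\<And>i. i \<in> set js ==> is_row X Z \<theta> x \<eta> k i"
      "h \<in> Hom TwoCat \<zeta> (gray_list (map \<eta> js))"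
      "v = rows_elt js X Z \<theta> x \<eta> k \<zeta> h"
    with eq[of \<theta> x \<eta> k \<zeta> h] z show ?thesis by simp
  qed
qed (use f g in auto)

lemma rows_At:
  assumes z: "\<And>i. i \<in> set js ==> is_row X Z \<theta> x \<eta> k i"
    and h: "\<zeta> \<in> Obj Theta2" "h \<in> Hom TwoCat \<zeta> (gray_list (map \<eta> js))"
  shows "i \<in> set js ==> elt (To (map X (Z i))) (\<eta> i, row_elt X Z \<theta> x \<eta> k i)"
    "rows_elt js X Z \<theta> x \<eta> k \<zeta> h
      \<in> At (To (map (\<lambda>i. To (map X (Z i))) js)) \<zeta>"
proof -
  show *: "elt (To (map X (Z i))) (\<eta> i, row_elt X Z \<theta> x \<eta> k i)" if "i \<in> set js" for i
    using z[OF that] row_D[OF z[OF that]] pure_At by (auto simp: elt_def presents_def intro!: To_presheaf)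
  show "rows_elt js X Z \<theta> x \<eta> k \<zeta> h
      \<in> At (To (map (\<lambda>i. To (map X (Z i))) js)) \<zeta>"
    using h * by (intro pure_At) (auto simp: list_all2_maps comp_def)
qed

subsection \<open>The laws\<close>

lemma mult_natural:
  assumes f: "\<And>g. g \<in> set (concat fss) ==> g \<in> Arr P"
  shows "Comp P (mult (map (map Tgt) fss)) (Ta (map Ta fss)) = Comp P (Ta (concat fss)) (mult (map (map Src) fss))"
proof -
  obtain f where fss: "fss = map (\<lambda>i. map f (row (map length fss) i)) [0..<length (map length fss)]"
    using grid_inverse[of fss] unfolding grid_row by blast
  define js where "js = [0..<length (map length fss)]"
  define Z where "Z = row (map length fss)"
  let ?zs = "concat (map Z js)"
  let ?s = "\<lambda>z. Src (f z)" and ?t = "\<lambda>z. Tgt (f z)" and ?g = "\<lambda>i. Ta (map f (Z i))" and ?G = "Ta (map f ?zs)"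
  let ?MS = "mult (map (\<lambda>i. map ?s (Z i)) js)" and ?MT = "mult (map (\<lambda>i. map ?t (Z i)) js)" and ?FF = "Ta (map ?g js)"
  have fs: "fss = map (\<lambda>i. map f (Z i)) js" unfolding js_def Z_def by (rule fss)
  have c: "concat fss = map f ?zs" unfolding fs by (simp add: map_concat comp_def)
  have fA: "f z \<in> Arr P" if "i \<in> set js" "z \<in> set (Z i)" for i z using f that unfolding fs by auto
  have fA': "f z \<in> Arr P" if "z \<in> set ?zs" for z
    using f[unfolded c] that by (metis image_eqI list.set_map)
  have F: "?g i \<in> Arr P \<and> Src (?g i) = To (map ?s (Z i)) \<and>
    Tgt (?g i) = To (map ?t (Z i))" if "i \<in> set js" for i
    using Ta_map_ty[of "Z i" f ?s ?t] fA[OF that] by blast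
  note FF = Ta_map_ty[of js "\<lambda>i. ?g i", OF F]
  have G: "?G \<in> Arr P" "Src ?G = To (map ?s ?zs)"
    "Tgt ?G = To (map ?t ?zs)"
    using Ta_map_ty[of ?zs f ?s ?t] fA' by blast+
  have mc: "concat (map (\<lambda>i. map g (Z i)) js) = map g ?zs" for g :: "_ \<Rightarrow> 'u theta_psh" by (simp add: map_concat comp_def)
  have S: "\<forall>X\<in>set (concat (map (\<lambda>i. map ?s (Z i)) js)). presheaf Theta2 X"
    and T: "\<forall>X\<in>set (concat (map (\<lambda>i. map ?t (Z i)) js)). presheaf Theta2 X"
    unfolding mc using P_ends[OF fA'] by auto
  note MS = mult(2-)[OF S, unfolded mc map_map comp_def] and MT = mult(2-)[OF T, unfolded mc map_map comp_def]
  have "Comp P ?MT ?FF =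
    Comp P ?G ?MS"
  proof (rule mult_eqI[where Z = Z and js = js and X = ?s and r = fst])
    fix \<theta> x \<eta> k h \<zeta>
    assume e: "\<And>i. i \<in> set js ==> is_row ?s Z \<theta> x \<eta> k i"
      and h: "\<zeta> \<in> Obj Theta2" "h \<in> Hom TwoCat \<zeta> (gray_list (map \<eta> js))"
    let ?v = "rows_elt js ?s Z \<theta> x \<eta> k \<zeta> h"
    let ?y = "\<lambda>z. Map (f z) (\<theta> z) (x z)"
    note l = row_D[OF e]
    note A = rows_At[OF e h]
    have e': "is_row ?t Z \<theta> ?y \<eta> k i" if "i \<in> set js" for i
      using l[OF that] fA[OF that] P_ends P_Map(1)
      by (auto simp: presents_def elt_def list_all2_maps comp_def)
    have lz: "elt (Src (f z)) (\<theta> z, x z)" if "z \<in> set ?zs" for z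
    proof -
      from that have "\<exists>i\<in>set js. z \<in> set (Z i)" by simp
      then show ?thesis using l(1) by blast
    qed
    have in_row: "Map (?g i) (\<eta> i) (row_elt ?s Z \<theta> x \<eta> k i) =
      row_elt ?t Z \<theta> ?y \<eta> k i" if i: "i \<in> set js" for i
      using pure_map[of "Z i" f "\<lambda>z. (\<theta> z, x z)" "\<eta> i" "k i"] fA[OF i] l[OF i] by (simp add: comp_def)
    have "Map (Comp P ?MT ?FF) \<zeta> ?v =
      Map ?MT \<zeta> (Map ?FF \<zeta> ?v)"
      by (rule P_Comp(4)[OF h(1)]) (use A(2) in \<open>simp only: FF\<close>)
    also have "Map ?FF \<zeta> ?v =
       pure (map (\<lambda>i. Tgt (?g i)) js)
        (map (\<lambda>i. (\<eta> i, Map (?g i) (\<eta> i) (row_elt ?s Z \<theta> x \<eta> k i))) js) \<zeta> h"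
    proof -
      have "?v = pure (map (\<lambda>i. Src (?g i)) js)
          (map (\<lambda>i. (\<eta> i, row_elt ?s Z \<theta> x \<eta> k i)) js) \<zeta> h"
        using F by (intro arg_cong2[of _ _ _ _ "\<lambda>a b. pure a b \<zeta> h"] map_cong) auto
      then show ?thesis
        using pure_map[of js "\<lambda>i. ?g i"
            "\<lambda>i. (\<eta> i, row_elt ?s Z \<theta> x \<eta> k i)" \<zeta> h] F A(1) h
        by (simp add: comp_def)
    qed
    also have "\<dots> = rows_elt js ?t Z \<theta> ?y \<eta> k \<zeta> h"
      using F in_row by (intro arg_cong2[of _ _ _ _ "\<lambda>a b. pure a b \<zeta> h"] map_cong) auto
    also have "Map ?MT \<zeta> \<dots> =
        pure (map ?t ?zs) (map (\<lambda>z. (\<theta> z, ?y z)) ?zs) \<zeta>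
      (graft (\<lambda>i. map \<theta> (Z i)) k js h)"
      by (rule Map_mult_rows[OF e' h])
    also have "\<dots> = Map ?G \<zeta> (pure (map ?s ?zs) (map (\<lambda>z. (\<theta> z, x z)) ?zs) \<zeta>
      (graft (\<lambda>i. map \<theta> (Z i)) k js h))"
      using pure_map[of ?zs f "\<lambda>z. (\<theta> z, x z)" \<zeta> "graft (\<lambda>i. map \<theta> (Z i)) k js h"]
        fA' lz h(1) rows_Hom[OF e h(2)] by (simp add: comp_def)
    also have "\<dots> = Map ?G \<zeta> (Map ?MS \<zeta> ?v)"
      by (simp only: Map_mult_rows[OF e h])
    also have "\<dots> = Map (Comp P ?G ?MS) \<zeta> ?v"
      by (rule P_Comp(4)[OF h(1), symmetric]) (use A(2) in \<open>simp only: MS\<close>)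
    finally show "Map (Comp P ?MT ?FF) \<zeta> ?v =
      Map (Comp P ?G ?MS) \<zeta> ?v" .
  qed (use FF G MS MT fA P_ends row in \<open>auto simp: P_Comp js_def Z_def simp del: map_map\<close>)
  moreover have "map (map Tgt) fss = map (\<lambda>i. map ?t (Z i)) js" "map (map Src) fss = map (\<lambda>i. map ?s (Z i)) js"
    "map Ta fss = map (\<lambda>i. ?g i) js"
    unfolding fs by (simp_all add: comp_def)
  ultimately show ?thesis by (simp only: c)
qed

text \<open>An element \<open>v\<close> of \<open>To Xs\<close> presents itself, through the identity 2-functor, as an element of the unary
  tensor product; the multiplication grafts any presentation of \<open>v\<close> onto this identity.\<close>

lemma mult_left_unit:
  assumes X: "\<And>X. X \<in> set Xs ==> presheaf Theta2 X"
  shows "mult [Xs] = Id P (To Xs)"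
proof (rule P_eqI)
  have T: "presheaf Theta2 (To Xs)" by (rule To_presheaf[OF X])
  have t1: "To [To Xs] = To Xs" using tensor_1(1)[of "To Xs"] T by simp
  have "\<forall>X\<in>set (concat [Xs]). presheaf Theta2 X" using X by simp
  note m = mult[OF this]
  show "mult [Xs] \<in> Arr P" "Src (mult [Xs]) = Src (Id P (To Xs))" "Tgt (mult [Xs]) = Tgt (Id P (To Xs))" "Id P (To Xs) \<in> Arr P"
    using m T by (simp_all add: P_Id t1)
  fix \<zeta> v assume z: "\<zeta> \<in> Obj Theta2" and "v \<in> At (Src (mult [Xs])) \<zeta>"
  then have v: "v \<in> At (To Xs) \<zeta>" by (simp add: m t1)
  obtain ps h where ps: "list_all2 elt Xs ps" "h \<in> Hom TwoCat \<zeta> (gray_list (map fst ps))" "v = pure Xs ps \<zeta> h"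
    using pure_surj[OF X z v] by (auto simp: presents_def)
  have I: "Id TwoCat \<zeta> \<in> Hom TwoCat \<zeta> \<zeta>" using z Theta2_two_category by (simp add: TwoCat_Hom_iff two_fun_id)
  \<comment> \<open>\<open>pure_single\<close> at the identity of \<open>\<zeta>\<close>.\<close>
  have s: "pure [To Xs] [(\<zeta>, v)] \<zeta> (Id TwoCat \<zeta>) = v"
    using pure_single[OF _ z I, of "To Xs" v] T v z presheaf_app(2)[OF T z v] by (simp add: elt_def Theta2_sel)
  have \<theta>: "set (map fst ps) \<subseteq> Obj TwoCat" using elts_objs[OF ps(1)] Theta2_TwoCat(1) by blast
  have hT: "h \<in> Arr TwoCat" "TSrc h = \<zeta>" "TTgt h = gray_list (map fst ps)" using ps(2) by (auto simp: TwoCat_Hom_iff)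
  have id: "h \<cdot> Id TwoCat \<zeta> = h" "Id TwoCat (gray_list (map fst ps)) \<cdot> h = h"
    using category.comp_id[OF category_TwoCat hT(1)] category.id_comp[OF category_TwoCat hT(1)] hT by (simp_all add: TwoCat_def)
  have "Map (mult [Xs]) \<zeta> v = pure Xs ps \<zeta> (flat [map fst ps] \<cdot> h \<cdot> Id TwoCat \<zeta>)"
    using Map_mult[of "[()]" "\<lambda>_. Xs" "\<lambda>_. ps" "\<lambda>_. \<zeta>" "\<lambda>_. h" \<zeta> "Id TwoCat \<zeta>"] ps z I s by (simp add: presents_def)
  also have "\<dots> = v" unfolding flat_single[OF \<theta>] id ps(3) ..
  finally show "Map (mult [Xs]) \<zeta> v = Map (Id P (To Xs)) \<zeta> v" using z v by (simp add: P_Id)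
qed

text \<open>Here the identities are grafted onto a presentation: each element of a factor presents itself.\<close>

lemma mult_right_unit:
  assumes X: "\<And>X. X \<in> set Xs ==> presheaf Theta2 X"
  shows "mult (map (\<lambda>X. [X]) Xs) = Id P (To Xs)"
proof (rule P_eqI)
  let ?n = "length Xs"
  have T: "presheaf Theta2 (To Xs)" by (rule To_presheaf[OF X])
  have t1: "map (\<lambda>X. To [X]) Xs = Xs" using tensor_1(1) X by (simp add: map_idI)
  have "\<forall>X\<in>set (concat (map (\<lambda>X. [X]) Xs)). presheaf Theta2 X" using X by simp
  note m = mult[OF this]
  show "mult (map (\<lambda>X. [X]) Xs) \<in> Arr P" "Src (mult (map (\<lambda>X. [X]) Xs)) = Src (Id P (To Xs))"
    "Tgt (mult (map (\<lambda>X. [X]) Xs)) = Tgt (Id P (To Xs))" "Id P (To Xs) \<in> Arr P"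
    using m T t1 by (simp_all add: P_Id comp_def)
  fix \<zeta> v assume z: "\<zeta> \<in> Obj Theta2" and "v \<in> At (Src (mult (map (\<lambda>X. [X]) Xs))) \<zeta>"
  then have v: "v \<in> At (To Xs) \<zeta>" using t1 by (simp add: m comp_def)
  obtain ps h where ps: "list_all2 elt Xs ps" "h \<in> Hom TwoCat \<zeta> (gray_list (map fst ps))" "v = pure Xs ps \<zeta> h"
    using pure_surj[OF X z v] by (auto simp: presents_def)
  let ?X = "\<lambda>i. Xs ! i" and ?p = "\<lambda>i. ps ! i"
  have l: "length ps = ?n" using list_all2_lengthD[OF ps(1)] by simp
  have M: "map ?X [0..<?n] = Xs" "map ?p [0..<?n] = ps" using l map_nth[of Xs] map_nth[of ps] by simp_all
  have e: "elt (?X i) (?p i)" if "i < ?n" for i using ps(1) that by (simp add: list_all2_conv_all_nth)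
  let ?I = "\<lambda>i. Id TwoCat (fst (?p i))"
  have I: "?I i \<in> Hom TwoCat (fst (?p i)) (fst (?p i))" if "i < ?n" for i
    using e[OF that] Theta2_two_category by (simp add: elt_def TwoCat_Hom_iff two_fun_id)
  have s: "pure [?X i] [?p i] (fst (?p i)) (?I i) = snd (?p i)" if "i < ?n" for i
  proof -
    have "elt (?X i) (fst (?p i), snd (?p i))" using e[OF that] by simp
    from pure_single[OF this _ I[OF that]] e[OF that] show ?thesis
      using presheaf_app(2)[of "?X i" "fst (?p i)" "snd (?p i)"] by (simp add: elt_def Theta2_sel)
  qed
  have t: "To [?X i] = ?X i" if "i < ?n" for i using tensor_1(1)[of "?X i"] e[OF that] by (simp add: elt_def)
  have \<theta>: "set (map fst ps) \<subseteq> Obj TwoCat" using elts_objs[OF ps(1)] Theta2_TwoCat(1) by blast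
  have hT: "h \<in> Arr TwoCat" "TSrc h = \<zeta>" "TTgt h = gray_list (map fst ps)" using ps(2) by (auto simp: TwoCat_Hom_iff)
  have id: "Id TwoCat (gray_list (map fst ps)) \<cdot> h = h"
    using category.id_comp[OF category_TwoCat hT(1)] hT by (simp add: TwoCat_def)
  have mf: "map (\<lambda>i. fst (?p i)) [0..<?n] = map fst ps" using arg_cong[OF M(2), of "map fst"] by (simp add: comp_def)
  have g: "map ?I [0..<?n] = map (Id TwoCat) (map fst ps)" unfolding mf[symmetric] by simp
  have f: "map (\<lambda>i. map fst [?p i]) [0..<?n] = map (\<lambda>A. [A]) (map fst ps)" unfolding mf[symmetric] by simp
  have c: "concat (map (\<lambda>i. [y i]) [0..<?n]) = map y [0..<?n]" for y :: "nat \<Rightarrow> 'z" by (induction ?n) auto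
  have vE: "v = pure (map (\<lambda>i. To [?X i]) [0..<?n]) (map (\<lambda>i. (fst (?p i), pure [?X i] [?p i] (fst (?p i)) (?I i))) [0..<?n]) \<zeta> h"
  proof -
    have "map (\<lambda>i. To [?X i]) [0..<?n] = map ?X [0..<?n]"
      "map (\<lambda>i. (fst (?p i), pure [?X i] [?p i] (fst (?p i)) (?I i))) [0..<?n] = map ?p [0..<?n]"
      using t s by auto
    then show ?thesis unfolding ps(3) by (simp only: M)
  qed
  have hh: "h \<in> Hom TwoCat \<zeta> (gray_list (map (\<lambda>i. fst (?p i)) [0..<?n]))" unfolding mf by (rule ps(2))
  have el: "presents [?X i] [?p i] (fst (?p i)) (?I i)" if "i \<in> set [0..<?n]" for i
    using e I that by (simp add: presents_def elt_def)
  have mX: "map (\<lambda>X. [X]) Xs = map (\<lambda>i. [?X i]) [0..<?n]" by (intro nth_equalityI) auto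
  have "Map (mult (map (\<lambda>X. [X]) Xs)) \<zeta> v =
      pure Xs ps \<zeta> (flat (map (\<lambda>A. [A]) (map fst ps)) \<cdot> gray_list_fun (map (Id TwoCat) (map fst ps)) \<cdot> h)"
    unfolding mX by (subst vE, subst Map_mult[OF el z hh]) (simp_all only: c M f g)
  also have "\<dots> = v" unfolding flat_singles[OF \<theta>] gray_list_fun_Id[OF \<theta>] id ps(3) ..
  finally show "Map (mult (map (\<lambda>X. [X]) Xs)) \<zeta> v = Map (Id P (To Xs)) \<zeta> v" using z v by (simp add: P_Id)
qed

lemma gray_list_fun_map:
  assumes "\<And>i. i \<in> set js ==> F i \<in> Hom TwoCat (A i) (B i)"
  shows "gray_list_fun (map F js) \<in> Hom TwoCat (gray_list (map A js)) (gray_list (map B js))"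
proof -
  have a: "set (map F js) \<subseteq> Arr TwoCat" "map TSrc (map F js) = map A js" "map TTgt (map F js) = map B js"
    using assms by (auto simp: TwoCat_Hom_iff)
  show ?thesis using gray_list_fun[OF a(1)] unfolding a(2,3) by (simp add: TwoCat_Hom_iff)
qed

lemma Comp2_Hom: "F \<in> Hom TwoCat A B ==> G \<in> Hom TwoCat B C ==> G \<cdot> F \<in> Hom TwoCat A C"
  by (simp add: TwoCat_Hom_iff two_fun_comp)

lemma Comp2_Hom_assoc: "F \<in> Hom TwoCat A B ==> G \<in> Hom TwoCat B C ==> H \<in> Hom TwoCat C D ==> (H \<cdot> G) \<cdot> F = H \<cdot> G \<cdot> F"
  by (simp add: TwoCat_Hom_iff Comp2_assoc)

text \<open>Grafting twice: outer-first and inner-first agree by naturality of flattening, which moves the \<open>l z\<close> past the flattening of rows, and by \<open>flat_flat\<close>.\<close>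

lemma flat_assoc:
  assumes l: "\<And>i z. i \<in> set js ==> z \<in> set (Z i) ==> set (\<Theta> z) \<subseteq> Obj TwoCat \<and> l z \<in> Hom TwoCat (\<theta> z) (gray_list (\<Theta> z))"
    and k: "\<And>i. i \<in> set js ==> k i \<in> Hom TwoCat (\<eta> i) (gray_list (map \<theta> (Z i)))"
    and h: "h \<in> Hom TwoCat \<zeta> (gray_list (map \<eta> js))"
  shows "flat (map \<Theta> (concat (map Z js))) \<cdot> gray_list_fun (map l (concat (map Z js))) \<cdot>
      graft (\<lambda>i. map \<theta> (Z i)) k js h =
    flat (map (\<lambda>i. concat (map \<Theta> (Z i))) js) \<cdot>
      gray_list_fun (map (\<lambda>i. flat (map \<Theta> (Z i)) \<cdot> gray_list_fun (map l (Z i)) \<cdot> k i) js) \<cdot> h"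
proof -
  let ?zs = "concat (map Z js)"
  let ?A = "\<lambda>i. map \<Theta> (Z i)"
  let ?As = "map ?A js" and ?Fs = "map (\<lambda>i. map l (Z i)) js"
  have lz: "set (\<Theta> z) \<subseteq> Obj TwoCat \<and> l z \<in> Hom TwoCat (\<theta> z) (gray_list (\<Theta> z))" if "z \<in> set ?zs" for z
  proof -
    from that have "\<exists>i\<in>set js. z \<in> set (Z i)" by simp
    then show ?thesis using l by blast
  qed
  have o: "set (concat ?As) \<subseteq> {As. set As \<subseteq> Obj TwoCat}" using l by auto
  have oc: "set (concat (concat ?As)) \<subseteq> Obj TwoCat" using l by fastforce
  have oi: "set (concat (?A i)) \<subseteq> Obj TwoCat" if "i \<in> set js" for i using l[OF that] by auto
  have FA: "set (concat ?Fs) \<subseteq> Arr TwoCat" using l by (auto simp: TwoCat_Hom_iff)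
  have cA: "concat ?As = map \<Theta> ?zs" "concat ?Fs = map l ?zs" by (simp_all add: map_concat comp_def)
  have g: "map (map gray_list) ?As = map (map TTgt) ?Fs" "map (map TSrc) ?Fs = map (\<lambda>i. map \<theta> (Z i)) js"
    using l by (auto simp: TwoCat_Hom_iff)
  have th: "concat (map (\<lambda>i. map \<theta> (Z i)) js) = map \<theta> ?zs" by (simp add: map_concat comp_def)
  have gg: "map gray_list (map (map TSrc) ?Fs) = map (\<lambda>i. gray_list (map \<theta> (Z i))) js" unfolding g by simp
  have \<theta>o: "set (concat (map (map TSrc) ?Fs)) \<subseteq> Obj TwoCat" and Go: "set (concat (map (map TTgt) ?Fs)) \<subseteq> Obj TwoCat"
    using FA Arr_TwoCat_ends by fastforce+
  have K: "gray_list_fun (map k js) \<in> Hom TwoCat (gray_list (map \<eta> js)) (gray_list (map (\<lambda>i. gray_list (map \<theta> (Z i))) js))"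
    by (rule gray_list_fun_map) (rule k)
  have flatHom: "flat Ass \<in> Hom TwoCat (gray_list (map gray_list Ass)) (gray_list (concat Ass))"
    if "set (concat Ass) \<subseteq> Obj TwoCat" for Ass
    using flat[OF that] by (simp add: TwoCat_Hom_iff)
  have f\<theta>: "flat (map (\<lambda>i. map \<theta> (Z i)) js) \<in> Hom TwoCat (gray_list (map (\<lambda>i. gray_list (map \<theta> (Z i))) js)) (gray_list (map \<theta> ?zs))"
    using flatHom[OF \<theta>o] unfolding gg unfolding g th .
  have L: "gray_list_fun (map l ?zs) \<in> Hom TwoCat (gray_list (map \<theta> ?zs)) (gray_list (map (\<lambda>z. gray_list (\<Theta> z)) ?zs))"
    by (rule gray_list_fun_map) (use lz in blast)
  have F: "flat (map \<Theta> ?zs) \<in> Hom TwoCat (gray_list (map (\<lambda>z. gray_list (\<Theta> z)) ?zs)) (gray_list (concat (map \<Theta> ?zs)))"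
    using flatHom[of "map \<Theta> ?zs"] oc unfolding cA by (simp add: comp_def)
  have li: "gray_list_fun (map l (Z i)) \<in> Hom TwoCat (gray_list (map \<theta> (Z i))) (gray_list (map (\<lambda>z. gray_list (\<Theta> z)) (Z i)))"
    if "i \<in> set js" for i by (rule gray_list_fun_map) (use l[OF that] in blast)
  have fi: "flat (?A i) \<in> Hom TwoCat (gray_list (map (\<lambda>z. gray_list (\<Theta> z)) (Z i))) (gray_list (concat (?A i)))"
    if "i \<in> set js" for i using flatHom[OF oi[OF that]] by (simp add: comp_def)
  let ?G1 = "gray_list_fun (map (\<lambda>i. gray_list_fun (map l (Z i))) js)" and ?G2 = "gray_list_fun (map (\<lambda>i. flat (?A i)) js)"
  have G1: "?G1 \<in> Hom TwoCat (gray_list (map (\<lambda>i. gray_list (map \<theta> (Z i))) js))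
      (gray_list (map (\<lambda>i. gray_list (map (\<lambda>z. gray_list (\<Theta> z)) (Z i))) js))"
    by (rule gray_list_fun_map) (rule li)
  have G2: "?G2 \<in> Hom TwoCat (gray_list (map (\<lambda>i. gray_list (map (\<lambda>z. gray_list (\<Theta> z)) (Z i))) js))
      (gray_list (map (\<lambda>i. gray_list (concat (?A i))) js))"
    by (rule gray_list_fun_map) (rule fi)
  have fc: "flat (map (\<lambda>i. concat (?A i)) js) \<in> Hom TwoCat (gray_list (map (\<lambda>i. gray_list (concat (?A i))) js)) (gray_list (concat (map \<Theta> ?zs)))"
  proof -
    have "concat (map (\<lambda>i. concat (?A i)) js) = concat (map \<Theta> ?zs)" by (induction js) simp_all
    moreover from this have "set (concat (map (\<lambda>i. concat (?A i)) js)) \<subseteq> Obj TwoCat" using oc unfolding cA by simp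
    ultimately show ?thesis using flatHom[of "map (\<lambda>i. concat (?A i)) js"] by (simp add: comp_def)
  qed
  let ?FG = "flat (map (map gray_list) ?As)"
  have fG: "?FG \<in> Hom TwoCat (gray_list (map (\<lambda>i. gray_list (map (\<lambda>z. gray_list (\<Theta> z)) (Z i))) js)) (gray_list (map (\<lambda>z. gray_list (\<Theta> z)) ?zs))"
    using flatHom[OF Go] unfolding g(1)[symmetric] by (simp add: map_concat comp_def)
  note Kh = Comp2_Hom[OF h K]
  have nat: "gray_list_fun (map l ?zs) \<cdot> flat (map (\<lambda>i. map \<theta> (Z i)) js) = ?FG \<cdot> ?G1"
    using flat_natural[OF FA] unfolding g(1)[symmetric] g(2) cA by (simp add: comp_def)
  have ff: "flat (map \<Theta> ?zs) \<cdot> ?FG = flat (map (\<lambda>i. concat (?A i)) js) \<cdot> ?G2"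
    using flat_flat[OF oc] unfolding cA by (simp add: comp_def)
  have "gray_list_fun (map l ?zs) \<cdot> graft (\<lambda>i. map \<theta> (Z i)) k js h =
      ?FG \<cdot> ?G1 \<cdot> gray_list_fun (map k js) \<cdot> h"
    using Comp2_Hom_assoc[OF Kh f\<theta> L] Comp2_Hom_assoc[OF Kh G1 fG] nat by simp
  then have "flat (map \<Theta> ?zs) \<cdot> gray_list_fun (map l ?zs) \<cdot> graft (\<lambda>i. map \<theta> (Z i)) k js h =
      flat (map \<Theta> ?zs) \<cdot> ?FG \<cdot> ?G1 \<cdot> gray_list_fun (map k js) \<cdot> h" by simp
  also have "\<dots> = flat (map (\<lambda>i. concat (?A i)) js) \<cdot> ?G2 \<cdot> ?G1 \<cdot> gray_list_fun (map k js) \<cdot> h"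
    using Comp2_Hom_assoc[OF Comp2_Hom[OF Kh G1] fG F] Comp2_Hom_assoc[OF Comp2_Hom[OF Kh G1] G2 fc] ff by simp
  also have "?G2 \<cdot> ?G1 \<cdot> gray_list_fun (map k js) \<cdot> h = (?G2 \<cdot> ?G1 \<cdot> gray_list_fun (map k js)) \<cdot> h"
    using Comp2_Hom_assoc[OF Kh G1 G2] Comp2_Hom_assoc[OF h K G1] Comp2_Hom_assoc[OF h Comp2_Hom[OF K G1] G2] by simp
  also have "?G2 \<cdot> ?G1 \<cdot> gray_list_fun (map k js) =
      gray_list_fun (map (\<lambda>i. flat (?A i) \<cdot> gray_list_fun (map l (Z i)) \<cdot> k i) js)"
  proof -
    have "gray_list_fun (map (\<lambda>i. gray_list_fun (map l (Z i)) \<cdot> k i) js) = ?G1 \<cdot> gray_list_fun (map k js)"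
      using li k by (intro gray_list_fun_Comp) (simp add: TwoCat_Hom_iff)
    moreover have "gray_list_fun (map (\<lambda>i. flat (?A i) \<cdot> gray_list_fun (map l (Z i)) \<cdot> k i) js) =
        ?G2 \<cdot> gray_list_fun (map (\<lambda>i. gray_list_fun (map l (Z i)) \<cdot> k i) js)"
      using fi Comp2_Hom[OF k li] by (intro gray_list_fun_Comp) (simp add: TwoCat_Hom_iff)
    ultimately show ?thesis by simp
  qed
  finally show ?thesis .
qed

text \<open>Each entry of a nested element has in turn a presentation, so both composites can be evaluated by \<open>Map_mult\<close>.\<close>

lemma mult_assoc:
  assumes X: "\<forall>X\<in>set (concat (concat Xsss)). presheaf Theta2 X"
  shows "Comp P (mult (concat Xsss)) (mult (map (map To) Xsss)) = Comp P (mult (map concat Xsss)) (Ta (map mult Xsss))"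
proof -
  obtain XX where Xf: "Xsss = map (\<lambda>i. map XX (row (map length Xsss) i)) [0..<length (map length Xsss)]"
    using grid_inverse[of Xsss] unfolding grid_row by blast
  define js where "js = [0..<length (map length Xsss)]"
  define Z where "Z = row (map length Xsss)"
  let ?zs = "concat (map Z js)"
  let ?C = "\<lambda>i. concat (map XX (Z i))" and ?T = "\<lambda>z. To (XX z)" and ?m = "\<lambda>i. mult (map XX (Z i))"
  let ?M1 = "mult (map XX ?zs)" and ?M2 = "mult (map ?C js)" and ?M3 = "mult (map (\<lambda>i. map ?T (Z i)) js)" and ?M4 = "Ta (map ?m js)"
  have Xs: "Xsss = map (\<lambda>i. map XX (Z i)) js" unfolding js_def Z_def by (rule Xf)
  have c: "concat Xsss = map XX ?zs" "map concat Xsss = map (\<lambda>i. ?C i) js"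
    "map mult Xsss = map (\<lambda>i. ?m i) js" "map (map To) Xsss = map (\<lambda>i. map ?T (Z i)) js"
    unfolding Xs by (simp_all add: map_concat comp_def)
  have cc: "concat (map (\<lambda>i. ?C i) js) = concat (map XX ?zs)" by (induction js) simp_all
  have ccT: "concat (map (\<lambda>i. map ?T (Z i)) js) = map ?T ?zs" by (simp add: map_concat comp_def)
  have pX: "\<forall>X\<in>set (XX z). presheaf Theta2 X" if "i \<in> set js" "z \<in> set (Z i)" for i z
    using X that unfolding c(1) by (cases z) auto
  have pT: "presheaf Theta2 (To (XX z))" if "i \<in> set js" "z \<in> set (Z i)" for i z
    using pX[OF that] by (intro To_presheaf) blast
  have "\<forall>X\<in>set (concat (map XX ?zs)). presheaf Theta2 X" using X unfolding c(1) .
  note M1 = mult(2-)[OF this, unfolded map_map comp_def]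
  have "\<forall>X\<in>set (concat (map (\<lambda>i. ?C i) js)). presheaf Theta2 X" using X unfolding cc c(1) .
  note M2 = mult(2-)[OF this, unfolded cc map_map comp_def]
  have "\<forall>X\<in>set (concat (map (\<lambda>i. map ?T (Z i)) js)). presheaf Theta2 X" using pT by auto
  note M3 = mult(2-)[OF this, unfolded ccT map_map comp_def]
  have Mi: "?m i \<in> Arr P \<and> Src (?m i) = To (map ?T (Z i)) \<and>
      Tgt (?m i) = To (?C i)" if "i \<in> set js" for i
  proof -
    have "\<forall>X\<in>set (?C i). presheaf Theta2 X" using pX[OF that] by auto
    from mult(2-)[OF this] show ?thesis by (simp add: comp_def)
  qed
  note M4 = Ta_map_ty[of js "\<lambda>i. ?m i", OF Mi]
  have "Comp P ?M1 ?M3 =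
    Comp P ?M2 ?M4"
  proof (rule mult_eqI[where Z = Z and js = js and X = ?T and r = fst])
    fix \<theta> x \<eta> k h \<zeta>
    assume e: "\<And>i. i \<in> set js ==> is_row ?T Z \<theta> x \<eta> k i"
      and h: "\<zeta> \<in> Obj Theta2" "h \<in> Hom TwoCat \<zeta> (gray_list (map \<eta> js))"
    let ?v = "rows_elt js ?T Z \<theta> x \<eta> k \<zeta> h"
    note lr = row_D[OF e] and A = rows_At[OF e h]
    have "\<forall>z\<in>set ?zs. \<exists>ps l. presents (XX z) ps (\<theta> z) l \<and> x z = pure (XX z) ps (\<theta> z) l"
    proof
      fix z assume "z \<in> set ?zs"
      then obtain i where i: "i \<in> set js" "z \<in> set (Z i)" by auto
      have "\<theta> z \<in> Obj Theta2" "x z \<in> At (To (XX z)) (\<theta> z)" using lr(1)[OF i] by (auto simp: elt_def)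
      then show "\<exists>ps l. presents (XX z) ps (\<theta> z) l \<and> x z = pure (XX z) ps (\<theta> z) l"
        using pure_surj[of "XX z" "\<theta> z" "x z"] pX[OF i] unfolding presents_def by blast
    qed
    from bchoice[OF this] obtain ps where "\<forall>z\<in>set ?zs. \<exists>l. presents (XX z) (ps z) (\<theta> z) l \<and> x z = pure (XX z) (ps z) (\<theta> z) l" ..
    from bchoice[OF this] obtain l where l': "\<forall>z\<in>set ?zs. presents (XX z) (ps z) (\<theta> z) (l z) \<and> x z = pure (XX z) (ps z) (\<theta> z) (l z)" ..
    let ?P = "\<lambda>i. concat (map ps (Z i))" and ?q = "\<lambda>z. pure (XX z) (ps z) (\<theta> z) (l z)" and ?e = "\<lambda>z. presents (XX z) (ps z) (\<theta> z) (l z)"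
    have l: "?e z" "x z = ?q z" if "z \<in> set ?zs" for z
      using l' that by blast+
    have iz: "z \<in> set ?zs" if "i \<in> set js" "z \<in> set (Z i)" for i z using that by auto
    let ?h = "graft (\<lambda>i. map \<theta> (Z i)) k js h"
    let ?\<Theta> = "\<lambda>z. map fst (ps z)"
    note hH = rows_Hom[OF e h(2)]
    let ?k = "\<lambda>i. graft ?\<Theta> l (Z i) (k i)"
    have e3: "presents (?C i) (?P i) (\<eta> i) (?k i)" if i: "i \<in> set js" for i
    proof -
      have ll: "?e z" if "z \<in> set (Z i)" for z using l(1) iz[OF i that] .
      have *: "set (?\<Theta> z) \<subseteq> Obj Theta2 \<and> \<theta> z \<in> Obj Theta2 \<and> l z \<in> Hom TwoCat (\<theta> z) (gray_list (?\<Theta> z))"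
        if "z \<in> set (Z i)" for z
        using ll[OF that] elts_objs[of "XX z" "ps z"] unfolding presents_def by blast
      have "list_all2 (list_all2 elt) (map XX (Z i)) (map ps (Z i))"
        using ll by (simp add: presents_def list_all2_maps)
      then show ?thesis
        using list_all2_concat flat_glf(2)[of "Z i" ?\<Theta> \<theta> l "k i" "\<eta> i", OF * lr(3)[OF i]] lr(2)[OF i]
        by (simp add: presents_def map_concat comp_def)
    qed
    have "Map (Comp P ?M1 ?M3) \<zeta> ?v =
      Map ?M1 \<zeta> (Map ?M3 \<zeta> ?v)"
      by (rule P_Comp(4)[OF h(1)]) (use A(2) in \<open>simp only: M3\<close>)
    also have "Map ?M3 \<zeta> ?v =
      pure (map ?T ?zs) (map (\<lambda>z. (\<theta> z, x z)) ?zs) \<zeta> ?h"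
      by (rule Map_mult_rows[OF e h])
    also have "\<dots> = pure (map ?T ?zs) (map (\<lambda>z. (\<theta> z, ?q z)) ?zs) \<zeta> ?h"
      using l(2) by (intro arg_cong2[of _ _ _ _ "\<lambda>a b. pure a b \<zeta> ?h"] map_cong HOL.refl) simp
    also have "Map ?M1 \<zeta> \<dots> = pure (concat (map XX ?zs)) (concat (map ps ?zs)) \<zeta>
        (graft ?\<Theta> l ?zs ?h)"
      by (rule Map_mult[OF l(1) h(1) hH])
    also have "graft ?\<Theta> l ?zs ?h =
      flat (map (\<lambda>i. concat (map ?\<Theta> (Z i))) js) \<cdot>
      gray_list_fun (map (\<lambda>i. graft ?\<Theta> l (Z i) (k i)) js) \<cdot> h"
    proof (rule flat_assoc[OF _ lr(3) h(2)])
      fix i z assume "i \<in> set js" "z \<in> set (Z i)"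
      then have e2: "?e z" using l(1) iz by blast
      then show "set (?\<Theta> z) \<subseteq> Obj TwoCat \<and> l z \<in> Hom TwoCat (\<theta> z) (gray_list (?\<Theta> z))"
        using elts_objs[of "XX z" "ps z"] Theta2_TwoCat(1) unfolding presents_def by blast
    qed
    also have "pure (concat (map XX ?zs)) (concat (map ps ?zs)) \<zeta> \<dots> =
      Map ?M2 \<zeta> (pure (map (\<lambda>i. To (?C i)) js)
        (map (\<lambda>i. (\<eta> i, pure (?C i) (?P i) (\<eta> i)
          (graft ?\<Theta> l (Z i) (k i)))) js) \<zeta> h)"
    proof -
      have "concat (map ps ?zs) = concat (map (\<lambda>i. ?P i) js)" by (induction js) simp_all
      note a = this
      have b: "map (\<lambda>i. map fst (?P i)) js = map (\<lambda>i. concat (map ?\<Theta> (Z i))) js"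
        by (simp add: map_concat comp_def)
      show ?thesis using Map_mult[OF e3 h] unfolding cc b a[symmetric] by (rule HOL.sym)
    qed
    also have "pure (map (\<lambda>i. To (?C i)) js)
        (map (\<lambda>i. (\<eta> i, pure (?C i) (?P i) (\<eta> i)
          (graft ?\<Theta> l (Z i) (k i)))) js) \<zeta> h =
      Map ?M4 \<zeta> ?v"
    proof -
      let ?p = "\<lambda>i. (\<eta> i, row_elt ?T Z \<theta> x \<eta> k i)"
      have "Map (?m i) (\<eta> i) (snd (?p i)) =
        pure (?C i) (?P i) (\<eta> i) (?k i)" if i: "i \<in> set js" for i
      proof -
        have ll: "?e z" "x z = ?q z" if "z \<in> set (Z i)" for z
          using l iz[OF i that] by blast+
        have "snd (?p i) = pure (map ?T (Z i)) (map (\<lambda>z. (\<theta> z, ?q z)) (Z i)) (\<eta> i) (k i)"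
          unfolding snd_conv using ll(2) by (intro arg_cong2[of _ _ _ _ "\<lambda>a b. pure a b (\<eta> i) (k i)"] map_cong HOL.refl) simp
        then show ?thesis using Map_mult[OF ll(1) lr(2,3)[OF i]] by simp
      qed
      then have "pure (map (\<lambda>i. To (?C i)) js)
          (map (\<lambda>i. (\<eta> i, pure (?C i) (?P i) (\<eta> i) (?k i))) js) \<zeta> h =
        pure (map (\<lambda>i. Tgt (?m i)) js)
          (map (\<lambda>i. (\<eta> i, Map (?m i) (\<eta> i) (snd (?p i)))) js) \<zeta> h"
        using Mi by (intro arg_cong2[of _ _ _ _ "\<lambda>a b. pure a b \<zeta> h"] map_cong HOL.refl) auto
      also have "\<dots> = Map ?M4 \<zeta> (pure (map (\<lambda>i. Src (?m i)) js) (map ?p js) \<zeta> h)"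
        using pure_map[of js "\<lambda>i. ?m i" ?p \<zeta> h] Mi A(1) h by (simp add: comp_def)
      also have "pure (map (\<lambda>i. Src (?m i)) js) (map ?p js) \<zeta> h = ?v"
        using Mi by (intro arg_cong2[of _ _ _ _ "\<lambda>a b. pure a b \<zeta> h"] map_cong HOL.refl) auto
      finally show ?thesis .
    qed
    also have "Map ?M2 \<zeta> \<dots> =
      Map (Comp P ?M2 ?M4) \<zeta> ?v"
      by (rule P_Comp(4)[OF h(1), symmetric]) (use A(2) in \<open>simp only: M4\<close>)
    finally show "Map (Comp P ?M1 ?M3) \<zeta> ?v =
      Map (Comp P ?M2 ?M4) \<zeta> ?v" .
  qed (use M1 M2 M3 M4 pT row in \<open>auto simp: P_Comp js_def Z_def simp del: map_map\<close>)
  then show ?thesis unfolding c .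
qed

theorem normal_lax_monoidal_mult: "normal_lax_monoidal P To Ta (Id P) mult"
proof (intro normal_lax_monoidal.intro normal_lax_monoidal_axioms.intro lax_monoidal.intro lax_monoidal_axioms.intro, goal_cases)
  case 1 show ?case by (rule category_P)
next
  case (2 n) show ?case by (rule tensor_functor)
next
  case (3 X) then show ?case using tensor_1(1) by (simp add: in_Hom_Psh P_Id)
next
  case (4 f) then show ?case using tensor_1(2) by (simp add: P_Comp_Id)
next
  case (5 Xss)
  then have "\<forall>X\<in>set (concat Xss). presheaf Theta2 X" by auto
  from mult(2-)[OF this] show ?case by (simp add: in_Hom_Psh)
next
  case (6 fss) then show ?case using mult_natural[of fss] by auto
next
  case (7 Xs)
  then have X: "\<And>X. X \<in> set Xs ==> presheaf Theta2 X" by auto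
  show ?case using P_Comp_Id(1)[of "Id P (To Xs)" "To Xs"] To_presheaf[OF X] by (simp add: mult_left_unit[OF X] P_Id)
next
  case (8 Xs)
  then have X: "\<And>X. X \<in> set Xs ==> presheaf Theta2 X" by auto
  show ?case
    using P_Comp_Id(1)[of "Id P (To Xs)" "To Xs"] To_presheaf[OF X] by (simp add: mult_right_unit[OF X] Ta_Id[OF X] P_Id)
next
  case (9 Xsss)
  then have "\<forall>X\<in>set (concat (concat Xsss)). X \<in> Obj P" by (simp only: subset_eq)
  then have "\<forall>X\<in>set (concat (concat Xsss)). presheaf Theta2 X" by (simp only: Psh_sel)
  then show ?case by (rule mult_assoc)
next
  case (10 X)
  then show ?case using P_Comp_Id(1)[of "Id P X" X] tensor_1(1)[of X]
    by (auto simp: is_iso_def P_Id in_Hom_Psh intro!: bexI[of _ "Id P X"])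
qed

end

theorem proposition7p2:
  fixes To :: "'u theta_psh list \<Rightarrow> 'u theta_psh"
    and Ta :: "'u theta_psh_arr list \<Rightarrow> 'u theta_psh_arr"
  assumes "infinite (UNIV :: 'u set)"
    and "gray_tensor_functors To Ta"
  shows "\<exists>\<iota> \<mu>. normal_lax_monoidal (Psh Theta2) To Ta \<iota> \<mu>"
proof -
  interpret gray_presheaves To Ta
    by (rule gray_presheaves.intro[OF assms(2)]) (rule gray_presheaves_axioms.intro[OF assms(1)])
  show ?thesis using normal_lax_monoidal_mult by blast
qed

end
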